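(* Let $T\subset\mathbb{R}^3$ be a tetrahedron with Alfeld split $T^A$ and let $r\ge4$. Then $$U_r^1(T^A)=\{u\in H^1(T;\mathbb S): u\in\mathcal P_r(T^A;\mathbb S),\ (\mathrm{curl}\,u)'\in W_{r-1}^1(T^A)\otimes\mathbb V,\ u\text{ is }C^1\text{ at the vertices of }T\text{ and }\mathrm{inc}\,u\text{ is }C^0\text{ at the vertices of }T\},$$ and $$\mathring U_r^1(T^A)=\{u\in\mathring H^1(T;\mathbb S): u\in\mathcal P_r(T^A;\mathbb S),\ (\mathrm{curl}\,u)'\in\mathring W_{r-1}^1(T^A)\otimes\mathbb V,\ \text{all first order derivatives of }u\text{ vanish at the vertices of }T,\text{ and }\mathrm{inc}\,u\text{ vanishes at the vertices of }T\}.$$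
   Context: Alfeld split: $T=[x_0,x_1,x_2,x_3]$ is a nondegenerate tetrahedron, $z$ a point in its interior, $T_i$ the tetrahedron whose vertices are $z$ and the $x_j$, $j\ne i$, and $T^A=\{T_0,T_1,T_2,T_3\}$. $\mathcal{P}_r(K)$: polynomials of degree $\le r$ on $K$. $n$: outward unit normal on $\partial T$. A function smooth on each $T_i$ is "$C^k$ at a vertex $x_i$ of $T$" if for all derivatives of order $\le k$ the limiting values at $x_i$ from all $T_j\ni x_i$ coincide; a quantity "vanishes at $x_i$" (or equals $0$ there) if all these limiting values are $0$. $\mathbb V=\mathbb R^3$; $\mathbb S$: symmetric $3\times 3$ matrices. For a space $X$ of vector functions, $X\otimes\mathbb V$ is the space of $3\times3$ matrix fields whose rows lie in $X$. $\mathrm{curl}$ acts on matrix fields row by row, $(\cdot)'$ is transpose, $\mathrm{sym}\,M=\frac12(M+M')$, $\mathrm{inc}\,u=\mathrm{curl}\,(\mathrm{curl}\,u)'$ for symmetric matrix fields $u$. $H^1(T;\mathbb S)$ ($\mathring H^1(T;\mathbb S)$): symmetric matrix fields with entries in $H^1(T)$ (with zero trace on $\partial T$). $\mathcal P_r(T^A;\mathbb S)$: symmetric matrix fields whose entries are polynomials of degree $\le r$ on each $T_i$. $W_r^0=\{\omega\in H^1(T):\omega|_K\in\mathcal P_r(K)\ \forall K\in T^A\}$, $\mathring W_r^0$ its subspace vanishing on $\partial T$; $W_r^1=\{\omega\in H(\mathrm{curl},T):\omega|_K\in[\mathcal P_r(K)]^3\ \forall K\in T^A\}$, $\mathring W_r^1=\{\omega\in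 W_r^1:\omega\times n=0\text{ on }\partial T\}$; $L_r^1=[W_r^0]^3$, $\mathring L_r^1=[\mathring W_r^0]^3$; $S_r^1=\{\omega\in L_r^1:\mathrm{curl}\,\omega\in L_{r-1}^1\}$, $\mathring S_r^1=\{\omega\in\mathring L_r^1:\mathrm{curl}\,\omega\in\mathring L_{r-1}^1\}$; $Z_r^1=\{\omega\in S_r^1:\mathrm{curl}\,\omega\text{ is }C^1\text{ at the vertices of }T\}$, $\mathring Z_r^1=\{\omega\in\mathring S_r^1:\mathrm{grad}\,\mathrm{curl}\,\omega=0\text{ at the vertices of }T\}$. Finally $U_r^1(T^A)=\{\mathrm{sym}(u):u\in Z_r^1\otimes\mathbb V\}$ and $\mathring U_r^1(T^A)=\{\mathrm{sym}(u):u\in\mathring Z_r^1\otimes\mathbb V\}$. *)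

theory Defs
  imports "HOL-Analysis.Analysis"
begin

text \<open>
  Elements of the Lebesgue and Sobolev spaces are represented by functions on the whole of
  \<open>real^3\<close>, of which only the almost-everywhere class on \<open>T\<close> matters: each space below is a set
  of functions that is closed under modification on null sets (and outside \<open>T\<close>). Equality of
  two such sets is therefore equality of the corresponding spaces of classes. The closed set
  \<open>T\<close> stands for the domain \<open>interior T\<close>.
\<close>

section \<open>Smooth functions and limiting values\<close>

definition partial :: "3 \<Rightarrow> (real^3 \<Rightarrow> 'b::real_normed_vector) \<Rightarrow> real^3 \<Rightarrow> 'b" where
  "partial i g = (\<lambda>x. frechet_derivative g (at x) (axis i 1))"

definition partials :: "3 list \<Rightarrow> (real^3 \<Rightarrow> 'b::real_normed_vector) \<Rightarrow> real^3 \<Rightarrow> 'b" where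
  "partials is g = foldr partial is g"

definition smooth_on :: "(real^3) set \<Rightarrow> (real^3 \<Rightarrow> 'b::real_normed_vector) \<Rightarrow> bool" where
  "smooth_on S g \<longleftrightarrow> (\<forall>is. \<forall>x\<in>S. partials is g differentiable (at x))"

text \<open>
  \<open>l\<close> is the limiting value at \<open>x\<close>, from within \<open>K\<close>, of the derivative of \<open>f\<close> with multi-index
  \<open>is\<close>. The function \<open>g\<close> is the smooth representative of the class of \<open>f\<close> on \<open>K\<close>, unique on
  \<open>interior K\<close>.
\<close>
definition limiting_value ::
  "(real^3) set \<Rightarrow> 3 list \<Rightarrow> (real^3 \<Rightarrow> 'b::real_normed_vector) \<Rightarrow> real^3 \<Rightarrow> 'b \<Rightarrow> bool" where
  "limiting_value K is f x l \<longleftrightarrow>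
     (\<exists>g. smooth_on (interior K) g \<and> (AE y in lebesgue_on K. f y = g y) \<and>
          (partials is g \<longlongrightarrow> l) (at x within interior K))"


section \<open>Sobolev spaces\<close>

definition test_fun :: "(real^3) set \<Rightarrow> (real^3 \<Rightarrow> 'b::real_normed_vector) \<Rightarrow> bool" where
  "test_fun S \<phi> \<longleftrightarrow> smooth_on UNIV \<phi> \<and> compact (closure {x. \<phi> x \<noteq> 0}) \<and>
     closure {x. \<phi> x \<noteq> 0} \<subseteq> S"

definition L2 :: "(real^3) set \<Rightarrow> (real^3 \<Rightarrow> 'b::euclidean_space) set" where
  "L2 T = {f. f \<in> borel_measurable (lebesgue_on T) \<and>
              integrable (lebesgue_on T) (\<lambda>x. (norm (f x))\<^sup>2)}"

definition has_wpartial ::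
  "(real^3) set \<Rightarrow> 3 \<Rightarrow> (real^3 \<Rightarrow> real) \<Rightarrow> (real^3 \<Rightarrow> real) \<Rightarrow> bool" where
  "has_wpartial T i f g \<longleftrightarrow> f \<in> L2 T \<and> g \<in> L2 T \<and>
     (\<forall>\<phi>. test_fun (interior T) \<phi> \<longrightarrow>
        (\<integral>x. f x * partial i \<phi> x \<partial>lebesgue_on T) = - (\<integral>x. g x * \<phi> x \<partial>lebesgue_on T))"

text \<open>A representative; meaningful only if an \<open>L2\<close> weak derivative exists (similarly below).\<close>
definition wpartial :: "(real^3) set \<Rightarrow> 3 \<Rightarrow> (real^3 \<Rightarrow> real) \<Rightarrow> real^3 \<Rightarrow> real" where
  "wpartial T i f = (SOME g. has_wpartial T i f g)"

definition H1 :: "(real^3) set \<Rightarrow> (real^3 \<Rightarrow> real) set" where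
  "H1 T = {f. \<forall>i. \<exists>g. has_wpartial T i f g}"

text \<open>
  The functions in \<open>H1\<close> with zero trace, as the closure of the test functions in the \<open>H1\<close> norm.
\<close>
definition H1_0 :: "(real^3) set \<Rightarrow> (real^3 \<Rightarrow> real) set" where
  "H1_0 T = {f \<in> H1 T. \<exists>\<phi> :: nat \<Rightarrow> real^3 \<Rightarrow> real.
     (\<forall>n. test_fun (interior T) (\<phi> n)) \<and>
     (\<lambda>n. \<integral>x. (\<phi> n x - f x)\<^sup>2 \<partial>lebesgue_on T) \<longlonglongrightarrow> 0 \<and>
     (\<forall>i. (\<lambda>n. \<integral>x. (partial i (\<phi> n) x - wpartial T i f x)\<^sup>2 \<partial>lebesgue_on T) \<longlonglongrightarrow> 0)}"

definition curl :: "(real^3 \<Rightarrow> real^3) \<Rightarrow> real^3 \<Rightarrow> real^3" where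
  "curl \<phi> x = vector [partial 2 \<phi> x $ 3 - partial 3 \<phi> x $ 2,
                      partial 3 \<phi> x $ 1 - partial 1 \<phi> x $ 3,
                      partial 1 \<phi> x $ 2 - partial 2 \<phi> x $ 1]"

definition has_wcurl ::
  "(real^3) set \<Rightarrow> (real^3 \<Rightarrow> real^3) \<Rightarrow> (real^3 \<Rightarrow> real^3) \<Rightarrow> bool" where
  "has_wcurl T w c \<longleftrightarrow> w \<in> L2 T \<and> c \<in> L2 T \<and>
     (\<forall>\<phi>. test_fun (interior T) \<phi> \<longrightarrow>
        (\<integral>x. w x \<bullet> curl \<phi> x \<partial>lebesgue_on T) = (\<integral>x. c x \<bullet> \<phi> x \<partial>lebesgue_on T))"

definition Hcurl :: "(real^3) set \<Rightarrow> (real^3 \<Rightarrow> real^3) set" where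
  "Hcurl T = {w. \<exists>c. has_wcurl T w c}"

definition wcurl :: "(real^3) set \<Rightarrow> (real^3 \<Rightarrow> real^3) \<Rightarrow> real^3 \<Rightarrow> real^3" where
  "wcurl T w = (SOME c. has_wcurl T w c)"


section \<open>Matrix fields\<close>

definition tensorV :: "(real^3 \<Rightarrow> real^3) set \<Rightarrow> (real^3 \<Rightarrow> real^3^3) set" where
  "tensorV X = {u. \<forall>i. (\<lambda>x. u x $ i) \<in> X}"

definition symm :: "real^3^3 \<Rightarrow> real^3^3" where
  "symm M = (1/2) *\<^sub>R (M + transpose M)"

definition mcurl :: "(real^3) set \<Rightarrow> (real^3 \<Rightarrow> real^3^3) \<Rightarrow> real^3 \<Rightarrow> real^3^3" where
  "mcurl T u = (\<lambda>x. \<chi> i. wcurl T (\<lambda>y. u y $ i) x)"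

definition inc :: "(real^3) set \<Rightarrow> (real^3 \<Rightarrow> real^3^3) \<Rightarrow> real^3 \<Rightarrow> real^3^3" where
  "inc T u = mcurl T (\<lambda>x. transpose (mcurl T u x))"

definition symm_fields ::
  "(real^3) set \<Rightarrow> (real^3 \<Rightarrow> real) set \<Rightarrow> (real^3 \<Rightarrow> real^3^3) set" where
  "symm_fields T X = {u. (AE x in lebesgue_on T. transpose (u x) = u x) \<and>
                         (\<forall>i j. (\<lambda>x. u x $ i $ j) \<in> X)}"


section \<open>The Alfeld split\<close>

text \<open>The vertices are indexed by the four-element type \<open>4\<close>.\<close>

definition tet :: "(4 \<Rightarrow> real^3) \<Rightarrow> (real^3) set" where
  "tet X = convex hull (range X)"

definition nondegenerate :: "(4 \<Rightarrow> real^3) \<Rightarrow> bool" where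
  "nondegenerate X \<longleftrightarrow> inj X \<and> \<not> affine_dependent (range X)"

definition subtet :: "(4 \<Rightarrow> real^3) \<Rightarrow> real^3 \<Rightarrow> 4 \<Rightarrow> (real^3) set" where
  "subtet X z i = convex hull (insert z (X ` (UNIV - {i})))"

definition alfeld :: "(4 \<Rightarrow> real^3) \<Rightarrow> real^3 \<Rightarrow> (real^3) set set" where
  "alfeld X z = range (subtet X z)"

definition face :: "(4 \<Rightarrow> real^3) \<Rightarrow> 4 \<Rightarrow> (real^3) set" where
  "face X i = convex hull (X ` (UNIV - {i}))"

definition outward_normal :: "(4 \<Rightarrow> real^3) \<Rightarrow> 4 \<Rightarrow> real^3" where
  "outward_normal X i = (THE \<nu>. norm \<nu> = 1 \<and>
     (\<forall>x\<in>face X i. \<forall>y\<in>face X i. \<nu> \<bullet> (x - y) = 0) \<and>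
     (\<forall>y\<in>face X i. \<nu> \<bullet> (X i - y) < 0))"

definition Ck_at ::
  "nat \<Rightarrow> (4 \<Rightarrow> real^3) \<Rightarrow> real^3 \<Rightarrow> (real^3 \<Rightarrow> 'b::real_normed_vector) \<Rightarrow> real^3 \<Rightarrow> bool" where
  "Ck_at k X z f x \<longleftrightarrow>
     (\<forall>is. length is \<le> k \<longrightarrow>
        (\<exists>l. \<forall>K\<in>alfeld X z. x \<in> K \<longrightarrow> limiting_value K is f x l))"

definition vanishes_at ::
  "(4 \<Rightarrow> real^3) \<Rightarrow> real^3 \<Rightarrow> (real^3 \<Rightarrow> 'b::real_normed_vector) \<Rightarrow> real^3 \<Rightarrow> bool" where
  "vanishes_at X z f x \<longleftrightarrow> (\<forall>K\<in>alfeld X z. x \<in> K \<longrightarrow> limiting_value K [] f x 0)"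

definition grad_vanishes_at ::
  "(4 \<Rightarrow> real^3) \<Rightarrow> real^3 \<Rightarrow> (real^3 \<Rightarrow> 'b::real_normed_vector) \<Rightarrow> real^3 \<Rightarrow> bool" where
  "grad_vanishes_at X z f x \<longleftrightarrow>
     (\<forall>i. \<forall>K\<in>alfeld X z. x \<in> K \<longrightarrow> limiting_value K [i] f x 0)"


section \<open>Piecewise polynomial spaces\<close>

definition poly_fun :: "nat \<Rightarrow> (real^3 \<Rightarrow> real) \<Rightarrow> bool" where
  "poly_fun r p \<longleftrightarrow> (\<exists>c :: (3 \<Rightarrow> nat) \<Rightarrow> real.
     p = (\<lambda>x. \<Sum>\<alpha> | sum \<alpha> UNIV \<le> r. c \<alpha> * (\<Prod>i\<in>UNIV. (x $ i) ^ \<alpha> i)))"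

definition P :: "nat \<Rightarrow> (real^3) set \<Rightarrow> (real^3 \<Rightarrow> real) set" where
  "P r K = {f. \<exists>p. poly_fun r p \<and> (AE x in lebesgue_on K. f x = p x)}"

definition PA :: "nat \<Rightarrow> (4 \<Rightarrow> real^3) \<Rightarrow> real^3 \<Rightarrow> (real^3 \<Rightarrow> real) set" where
  "PA r X z = {f. \<forall>K\<in>alfeld X z. f \<in> P r K}"

definition W0 :: "nat \<Rightarrow> (4 \<Rightarrow> real^3) \<Rightarrow> real^3 \<Rightarrow> (real^3 \<Rightarrow> real) set" where
  "W0 r X z = H1 (tet X) \<inter> PA r X z"

definition W0_0 :: "nat \<Rightarrow> (4 \<Rightarrow> real^3) \<Rightarrow> real^3 \<Rightarrow> (real^3 \<Rightarrow> real) set" where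
  "W0_0 r X z = {w \<in> W0 r X z. \<forall>x\<in>frontier (tet X). vanishes_at X z w x}"

definition W1 :: "nat \<Rightarrow> (4 \<Rightarrow> real^3) \<Rightarrow> real^3 \<Rightarrow> (real^3 \<Rightarrow> real^3) set" where
  "W1 r X z = {w \<in> Hcurl (tet X). \<forall>i. (\<lambda>x. w x $ i) \<in> PA r X z}"

text \<open>
  The face opposite to \<open>X i\<close> is a face of \<open>subtet X z i\<close> only, so the boundary values of \<open>w\<close>
  on that face are the limiting values from \<open>subtet X z i\<close>.
\<close>
definition W1_0 :: "nat \<Rightarrow> (4 \<Rightarrow> real^3) \<Rightarrow> real^3 \<Rightarrow> (real^3 \<Rightarrow> real^3) set" where
  "W1_0 r X z = {w \<in> W1 r X z. \<forall>i. \<forall>x\<in>face X i.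
     limiting_value (subtet X z i) [] (\<lambda>y. cross3 (w y) (outward_normal X i)) x 0}"

definition L1 :: "nat \<Rightarrow> (4 \<Rightarrow> real^3) \<Rightarrow> real^3 \<Rightarrow> (real^3 \<Rightarrow> real^3) set" where
  "L1 r X z = {w. \<forall>i. (\<lambda>x. w x $ i) \<in> W0 r X z}"

definition L1_0 :: "nat \<Rightarrow> (4 \<Rightarrow> real^3) \<Rightarrow> real^3 \<Rightarrow> (real^3 \<Rightarrow> real^3) set" where
  "L1_0 r X z = {w. \<forall>i. (\<lambda>x. w x $ i) \<in> W0_0 r X z}"

definition S1 :: "nat \<Rightarrow> (4 \<Rightarrow> real^3) \<Rightarrow> real^3 \<Rightarrow> (real^3 \<Rightarrow> real^3) set" where
  "S1 r X z = {w \<in> L1 r X z. wcurl (tet X) w \<in> L1 (r - 1) X z}"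

definition S1_0 :: "nat \<Rightarrow> (4 \<Rightarrow> real^3) \<Rightarrow> real^3 \<Rightarrow> (real^3 \<Rightarrow> real^3) set" where
  "S1_0 r X z = {w \<in> L1_0 r X z. wcurl (tet X) w \<in> L1_0 (r - 1) X z}"

definition Z1 :: "nat \<Rightarrow> (4 \<Rightarrow> real^3) \<Rightarrow> real^3 \<Rightarrow> (real^3 \<Rightarrow> real^3) set" where
  "Z1 r X z = {w \<in> S1 r X z. \<forall>x\<in>range X. Ck_at 1 X z (wcurl (tet X) w) x}"

definition Z1_0 :: "nat \<Rightarrow> (4 \<Rightarrow> real^3) \<Rightarrow> real^3 \<Rightarrow> (real^3 \<Rightarrow> real^3) set" where
  "Z1_0 r X z = {w \<in> S1_0 r X z. \<forall>x\<in>range X. grad_vanishes_at X z (wcurl (tet X) w) x}"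

definition U1 :: "nat \<Rightarrow> (4 \<Rightarrow> real^3) \<Rightarrow> real^3 \<Rightarrow> (real^3 \<Rightarrow> real^3^3) set" where
  "U1 r X z = {u. \<exists>v\<in>tensorV (Z1 r X z). AE x in lebesgue_on (tet X). u x = symm (v x)}"

definition U1_0 :: "nat \<Rightarrow> (4 \<Rightarrow> real^3) \<Rightarrow> real^3 \<Rightarrow> (real^3 \<Rightarrow> real^3^3) set" where
  "U1_0 r X z = {u. \<exists>v\<in>tensorV (Z1_0 r X z). AE x in lebesgue_on (tet X). u x = symm (v x)}"

end

theory Submission
  imports Defs
begin

text \<open>
  A field \<open>u = sym P\<close> differs from \<open>P\<close> by a skew field \<open>mskw \<psi>\<close>, and \<open>curl (mskw \<psi>)\<close> is
  \<open>(div \<psi>) I - (grad \<psi>)'\<close> up to sign. Hence \<open>curl P\<close> is an algebraic function of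
  \<open>S = (curl u)' + grad \<psi>\<close>, and the continuity of \<open>curl P\<close> is the continuity of \<open>S\<close>. Since
  \<open>curl S = inc u\<close>, the tangential continuity of \<open>(curl u)'\<close> and the values of \<open>inc u\<close> at the
  vertices are inherited from \<open>S\<close>.

  Conversely, given \<open>u\<close>, the jumps of each row \<open>\<rho>\<close> of \<open>(curl u)'\<close> are normal to the faces, and a
  continuous piecewise polynomial \<open>\<psi>\<close> is needed for which \<open>\<rho> + grad \<psi>\<close> is continuous. Let \<open>L m\<close> be the
  affine function equal to \<open>1\<close> at \<open>z\<close> and to \<open>0\<close> on the face opposite to \<open>X m\<close>, so that the interior
  faces lie on the planes \<open>L m = L l\<close>. The coefficients of the normal jumps are interpolated by one
  polynomial \<open>Q x s\<close> of four variables at \<open>s = L m x\<close>, and \<open>\<psi>\<close> is the integral of \<open>Q x s\<close> over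
  \<open>0 \<le> s \<le> L m x\<close>. At a vertex, a continuous piecewise polynomial \<open>S\<close> whose curl is continuous there
  has a continuous gradient, because its gradient jumps across three planes are multiples of the linearly
  independent matrices \<open>\<nu> \<nu>'\<close>.
\<close>

section \<open>Smooth functions\<close>

text \<open>The interpolation in \<open>(x, s)\<close> carries more than the lift of the jumps. The
  hyperplanes \<open>s = L m x\<close> are in general position in four dimensions, so data
  prescribed on intersections of some of them, and compatible where these meet, come from a single
  polynomial. Applied to a continuous piecewise polynomial, this gives one polynomial that equals
  every piece at \<open>s = L m x\<close>. With \<open>s\<close> replaced by the Lipschitz function
  \<open>mu\<close> it yields integration by parts; with \<open>s\<close> replaced by a smooth
  function supported inside T it yields approximation by test functions, hence zero trace. The
  obstacle to the lift is compatibility where three face planes share a line: there the three jumps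
  of a row add up to zero and two of the normals are independent, so the three coefficients
  coincide. In the other direction, jumps of weakly differentiable fields are read off from test
  functions concentrated at a point of a face and carried to the whole plane as polynomial
  identities. The exterior counts as a fifth piece carrying zero, so an index set \<open>N\<close>,
  equal to \<open>range Some\<close> or to \<open>UNIV\<close>, covers both equalities at
  once.\<close>

lemma partial_at:
  assumes "(f has_derivative f') (at x)"
  shows "partial i f x = f' (axis i 1)"
  using frechet_derivative_at[OF assms] by (simp add: partial_def)

lemma partial_add:
  assumes "f differentiable at x" "g differentiable at x"
  shows "partial i (\<lambda>x. f x + g x) x = partial i f x + partial i g x"
  using assms unfolding frechet_derivative_works
  by (intro partial_at[OF has_derivative_add, THEN trans]) (auto simp: partial_def)

lemma partial_diff:
  assumes "f differentiable at x" "g differentiable at x"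
  shows "partial i (\<lambda>x. f x - g x) x = partial i f x - partial i g x"
  using assms unfolding frechet_derivative_works
  by (intro partial_at[OF has_derivative_diff, THEN trans]) (auto simp: partial_def)

lemma partial_linear:
  assumes "bounded_linear F" "f differentiable at x"
  shows "partial i (\<lambda>x. F (f x)) x = F (partial i f x)"
  using assms unfolding frechet_derivative_works
  by (intro partial_at[OF bounded_linear.has_derivative, THEN trans]) (auto simp: partial_def)

lemma partial_mult:
  fixes f g :: "real^3 \<Rightarrow> real"
  assumes "f differentiable at x" "g differentiable at x"
  shows "partial i (\<lambda>x. f x * g x) x = f x * partial i g x + partial i f x * g x"
  using assms unfolding frechet_derivative_works
  by (intro partial_at[OF has_derivative_mult, THEN trans]) (auto simp: partial_def)

lemma partial_sum:
  assumes "\<And>k. k \<in> I \<Longrightarrow> f k differentiable at x"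
  shows "partial i (\<lambda>x. \<Sum>k\<in>I. f k x) x = (\<Sum>k\<in>I. partial i (f k) x)"
  using assms unfolding frechet_derivative_works
  by (intro partial_at[OF has_derivative_sum, THEN trans]) (auto simp: partial_def)

lemma partial_const [simp]: "partial i (\<lambda>x. c) = (\<lambda>x. 0)"
  by (auto simp: partial_def)

lemma partial_chain:
  fixes f :: "real^3 \<Rightarrow> real"
  assumes "f differentiable at x" "(h has_real_derivative h') (at (f x))"
  shows "partial i (\<lambda>x. h (f x)) x = h' * partial i f x"
proof -
  have "((\<lambda>x. h (f x)) has_derivative (\<lambda>v. h' * frechet_derivative f (at x) v)) (at x)"
    using has_derivative_compose[OF assms(1)[unfolded frechet_derivative_works]
      assms(2)[unfolded has_field_derivative_def]] by simp
  from partial_at[OF this] show ?thesis by (simp add: partial_def)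
qed

lemma partial_nth:
  fixes f :: "real^3 \<Rightarrow> 'b::real_normed_vector^'n"
  assumes "f differentiable at x"
  shows "partial i (\<lambda>x. f x $ k) x = partial i f x $ k"
  by (rule partial_linear[OF bounded_linear_vec_nth assms])

lemma partial_coord: "partial i (\<lambda>x. x $ j) = (\<lambda>x. if i = j then 1 else 0)"
  by (rule ext, subst partial_at[OF bounded_linear_imp_has_derivative[OF bounded_linear_vec_nth]])
     (auto simp: axis_def)

lemma partials_Nil [simp]: "partials [] g = g"
  by (simp add: partials_def)

lemma partials_Cons [simp]: "partials (i # is) g = partial i (partials is g)"
  by (simp add: partials_def)

lemma partials_snoc: "partials (is @ [i]) g = partials is (partial i g)"
  by (simp add: partials_def)

abbreviation smooth :: "(real^3 \<Rightarrow> 'b::real_normed_vector) \<Rightarrow> bool" where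
  "smooth \<equiv> smooth_on UNIV"

lemma smooth_differentiable: "smooth f \<Longrightarrow> f differentiable at x"
  unfolding smooth_on_def by (metis UNIV_I partials_Nil)

lemma smooth_partial: "smooth f \<Longrightarrow> smooth (partial i f)"
  unfolding smooth_on_def by (metis partials_snoc)

lemma smooth_partials: "smooth f \<Longrightarrow> smooth (partials is f)"
  by (induction "is") (auto intro: smooth_partial)

lemma smooth_isCont: "smooth f \<Longrightarrow> isCont f x"
  by (simp add: differentiable_imp_continuous_within smooth_differentiable)

lemma smooth_continuous_on: "smooth f \<Longrightarrow> continuous_on S f"
  by (simp add: continuous_at_imp_continuous_on smooth_isCont)

lemma smooth_linear:
  assumes "bounded_linear F" "smooth f"
  shows "smooth (\<lambda>x. F (f x))" "partials is (\<lambda>x. F (f x)) = (\<lambda>x. F (partials is f x))"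
proof -
  show *: "partials is (\<lambda>x. F (f x)) = (\<lambda>x. F (partials is f x))" for "is"
    by (induction "is")
      (auto simp: partial_linear[OF assms(1)] smooth_partials assms(2) smooth_differentiable)
  show "smooth (\<lambda>x. F (f x))"
    unfolding smooth_on_def *
    using bounded_linear.has_derivative[OF assms(1)] smooth_differentiable smooth_partials[OF assms(2)]
    unfolding differentiable_def by blast
qed

lemma smooth_nth:
  fixes f :: "real^3 \<Rightarrow> 'b::real_normed_vector^'n"
  shows "smooth f \<Longrightarrow> smooth (\<lambda>x. f x $ k)"
  by (rule smooth_linear[OF bounded_linear_vec_nth])

lemma differentiable_vec:
  fixes f :: "real^3 \<Rightarrow> 'b::real_normed_vector^'n"
  assumes "\<And>k. (\<lambda>x. f x $ k) differentiable at x"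
  shows "f differentiable at x"
proof -
  have ax: "bounded_linear (\<lambda>v::'b. axis k v :: 'b^'n)" for k
    by (rule bounded_linear_intro[where K=1])
      (auto simp: vec_eq_iff axis_def norm_vec_def L2_set_def if_distrib[of norm]
        if_distrib[of "\<lambda>x. x\<^sup>2"] sum.If_cases cong: if_cong)
  have "(\<lambda>x. axis k (f x $ k) :: 'b^'n) differentiable at x" for k
    using bounded_linear.has_derivative[OF ax] assms[of k] unfolding differentiable_def by blast
  then have "(\<lambda>x. \<Sum>k\<in>UNIV. axis k (f x $ k) :: 'b^'n) differentiable at x"
    by (intro differentiable_sum) auto
  moreover have "(\<lambda>x. \<Sum>k\<in>UNIV. axis k (f x $ k) :: 'b^'n) = f"
    by (auto simp: vec_eq_iff axis_def if_distrib cong: if_cong)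
  ultimately show ?thesis by simp
qed

lemma smooth_vec:
  fixes f :: "real^3 \<Rightarrow> 'b::real_normed_vector^'n"
  assumes "\<And>k. smooth (\<lambda>x. f x $ k)"
  shows "smooth f"
proof -
  have *: "(\<lambda>x. partials is f x $ k) = partials is (\<lambda>x. f x $ k)" for "is" k
  proof (induction "is" arbitrary: k)
    case (Cons i "is")
    have "partials is f differentiable at x" for x
      by (rule differentiable_vec) (simp add: Cons smooth_partials assms smooth_differentiable)
    then show ?case by (auto simp: partial_nth[symmetric] Cons)
  qed auto
  show ?thesis
    unfolding smooth_on_def
    by (auto intro!: differentiable_vec simp: * smooth_partials assms smooth_differentiable)
qed

section \<open>Smoothness of compositions and of flat functions\<close>

text \<open>The function lies in a family closed under derivatives on \<open>U\<close>. Exhibiting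
  such a family proves smoothness without formulas for higher derivatives, and the derivative
  supplied by the family is again \<open>smooth1\<close> on the same \<open>U\<close>.\<close>

definition smooth1 :: "real set \<Rightarrow> (real \<Rightarrow> real) \<Rightarrow> bool" where
  "smooth1 U h \<longleftrightarrow> (\<exists>F. h \<in> F \<and> (\<forall>g\<in>F. \<exists>g'\<in>F. \<forall>t\<in>U. (g has_real_derivative g' t) (at t)))"

lemma smooth1_deriv:
  assumes "smooth1 U h"
  obtains h' where "smooth1 U h'" "\<And>t. t \<in> U \<Longrightarrow> (h has_real_derivative h' t) (at t)"
  using assms unfolding smooth1_def by metis

text \<open>The generators are chosen so that partial derivatives stay in the class: the chain rule
  turns \<open>comp\<close> into the product of another \<open>comp\<close> with a partial
  derivative of the inner function. Smoothness then follows by induction on the index list.\<close>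

inductive_set smooth_alg :: "(real^3 \<Rightarrow> real) set" where
  const: "(\<lambda>x. c) \<in> smooth_alg"
| coord: "(\<lambda>x. x $ k) \<in> smooth_alg"
| add: "f \<in> smooth_alg \<Longrightarrow> g \<in> smooth_alg \<Longrightarrow> (\<lambda>x. f x + g x) \<in> smooth_alg"
| mult: "f \<in> smooth_alg \<Longrightarrow> g \<in> smooth_alg \<Longrightarrow> (\<lambda>x. f x * g x) \<in> smooth_alg"
| comp: "f \<in> smooth_alg \<Longrightarrow> smooth1 U h \<Longrightarrow> range f \<subseteq> U \<Longrightarrow> (\<lambda>x. h (f x)) \<in> smooth_alg"

lemma smooth_alg_partial:
  assumes "f \<in> smooth_alg"
  shows "(\<forall>x. f differentiable at x) \<and> (\<forall>i. partial i f \<in> smooth_alg)"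
  using assms
proof induction
  case (const c)
  then show ?case by (auto intro: smooth_alg.intros)
next
  case (coord k)
  have "(if i = k then 1 else 0 :: real) = (c::real) \<Longrightarrow>
      (\<lambda>x. (if i = k then 1 else 0)) \<in> smooth_alg" for i c
    by (rule smooth_alg.const)
  then show ?case
    using bounded_linear_imp_differentiable[OF bounded_linear_vec_nth] by (auto simp: partial_coord)
next
  case (add f g)
  then have "partial i (\<lambda>x. f x + g x) = (\<lambda>x. partial i f x + partial i g x)" for i
    by (auto simp: partial_add)
  with add show ?case by (auto intro: smooth_alg.intros)
next
  case (mult f g)
  then have "partial i (\<lambda>x. f x * g x) = (\<lambda>x. f x * partial i g x + partial i f x * g x)" for i
    by (auto simp: partial_mult)
  with mult show ?case by (auto intro!: smooth_alg.add smooth_alg.mult)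
next
  case (comp f U h)
  then obtain h' where h': "smooth1 U h'" "\<And>t. t \<in> U \<Longrightarrow> (h has_real_derivative h' t) (at t)"
    using smooth1_deriv by metis
  have d: "(h has_real_derivative h' (f x)) (at (f x))" for x
    using h'(2) comp by auto
  have "partial i (\<lambda>x. h (f x)) = (\<lambda>x. h' (f x) * partial i f x)" for i
    using d comp by (auto simp: partial_chain)
  moreover have "(\<lambda>x. h (f x)) differentiable at x" for x
    using d[of x] comp(4) differentiable_compose[of h f x UNIV]
    by (metis differentiable_def has_field_derivative_imp_has_derivative)
  moreover have "(\<lambda>x. h' (f x)) \<in> smooth_alg"
    using smooth_alg.comp[OF comp(1) h'(1) comp(3)] .
  ultimately show ?case
    using comp by (auto intro: smooth_alg.intros)
qed

lemma smooth_alg_smooth: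
  assumes "f \<in> smooth_alg" shows "smooth f"
proof -
  have "partials is f \<in> smooth_alg" for "is"
    by (induction "is") (auto simp: assms smooth_alg_partial)
  then show ?thesis
    unfolding smooth_on_def using smooth_alg_partial by blast
qed

lemma smooth_alg_sum:
  "(\<And>k. k \<in> I \<Longrightarrow> f k \<in> smooth_alg) \<Longrightarrow> (\<lambda>x. \<Sum>k\<in>I. f k x) \<in> smooth_alg"
  by (induction I rule: infinite_finite_induct) (auto intro: smooth_alg.intros)

lemma smooth_alg_prod:
  "(\<And>k. k \<in> I \<Longrightarrow> f k \<in> smooth_alg) \<Longrightarrow> (\<lambda>x. \<Prod>k\<in>I. f k x) \<in> smooth_alg"
  by (induction I rule: infinite_finite_induct) (auto intro: smooth_alg.intros)

lemma smooth_alg_power: "f \<in> smooth_alg \<Longrightarrow> (\<lambda>x. f x ^ n) \<in> smooth_alg"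
  by (induction n) (auto intro: smooth_alg.intros)

lemma smooth_alg_uminus: "f \<in> smooth_alg \<Longrightarrow> (\<lambda>x. - f x) \<in> smooth_alg"
  using smooth_alg.mult[OF smooth_alg.const[of "-1"]] by simp

lemma smooth_alg_diff: "f \<in> smooth_alg \<Longrightarrow> g \<in> smooth_alg \<Longrightarrow> (\<lambda>x. f x - g x) \<in> smooth_alg"
  using smooth_alg.add[OF _ smooth_alg_uminus] by fastforce

lemma smooth1_exp: "smooth1 UNIV exp"
  unfolding smooth1_def by (intro exI[of _ "{exp}"]) auto

lemma smooth1_inverse: "smooth1 {0<..} inverse"
  unfolding smooth1_def
proof (intro exI[of _ "range (\<lambda>(c, n). \<lambda>t::real. c * inverse t ^ n)"] conjI ballI)
  show "inverse \<in> range (\<lambda>(c, n). \<lambda>t::real. c * inverse t ^ n)"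
    by (rule range_eqI[of _ _ "(1, 1)"]) auto
  fix g assume "g \<in> range (\<lambda>(c, n). \<lambda>t::real. c * inverse t ^ n)"
  then obtain c n where g: "g = (\<lambda>t. c * inverse t ^ n)" by auto
  have "(g has_real_derivative - (c * n) * inverse t ^ (n+1)) (at t)" if "t \<in> {0<..}" for t
  proof -
    have "(g has_real_derivative c * (n * (- (inverse t ^ Suc (Suc 0)) * inverse t ^ (n - Suc 0)))) (at t)"
      unfolding g using that by (intro DERIV_cmult DERIV_power DERIV_inverse) auto
    then show ?thesis by (cases n) (simp_all add: ac_simps)
  qed
  then show "\<exists>g'\<in>range (\<lambda>(c, n). \<lambda>t::real. c * inverse t ^ n). \<forall>t\<in>{0<..}. (g has_real_derivative g' t) (at t)"
    by (intro bexI[of _ "\<lambda>t. - (c * n) * inverse t ^ (n+1)"])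
      (auto intro!: range_eqI[of _ _ "(- (c * n), n+1)"])
qed

lemma smooth1_ln: "smooth1 {0<..} ln"
proof -
  obtain F where F: "inverse \<in> F" "\<forall>g\<in>F. \<exists>g'\<in>F. \<forall>t\<in>{0<..}. (g has_real_derivative g' t) (at t)"
    using smooth1_inverse unfolding smooth1_def by auto
  moreover have "\<forall>t\<in>{0<..}. (ln has_real_derivative inverse t) (at t)"
    by (auto intro!: derivative_eq_intros simp: field_simps)
  ultimately show ?thesis
    unfolding smooth1_def by (intro exI[of _ "insert ln F"]) auto
qed

text \<open>The polynomial factor in \<open>1 / t\<close> makes the family closed under
  differentiation. The rate \<open>a\<close> stays a parameter because bumps with \<open>a\<close>
  tending to 0 approach indicator functions.\<close>

definition flat_exp :: "real \<Rightarrow> real poly \<Rightarrow> real \<Rightarrow> real" where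
  "flat_exp a p t = (if 0 < t then poly p (1 / t) * exp (- a / t) else 0)"

lemma poly_mult_exp_tendsto_0:
  assumes "0 < (a::real)" shows "((\<lambda>s. poly p s * exp (- a * s)) \<longlongrightarrow> 0) at_top"
proof -
  have *: "((\<lambda>s. s ^ n * exp (- a * s)) \<longlongrightarrow> 0) at_top" for n
  proof -
    have f: "filterlim (\<lambda>s. a * s) at_top at_top"
      using filterlim_tendsto_pos_mult_at_top[OF tendsto_const assms filterlim_ident] .
    have "((\<lambda>s. (a * s) ^ n / exp (a * s)) \<longlongrightarrow> 0) at_top"
      by (rule filterlim_compose[OF tendsto_power_div_exp_0 f])
    then have "((\<lambda>s. (1/a)^n * ((a * s) ^ n / exp (a * s))) \<longlongrightarrow> (1/a)^n * 0) at_top"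
      by (intro tendsto_mult tendsto_const)
    then show ?thesis
      using assms by (simp add: exp_minus field_simps)
  qed
  have "((\<lambda>s. \<Sum>i\<le>degree p. coeff p i * (s ^ i * exp (- a * s))) \<longlongrightarrow> (\<Sum>i\<le>degree p. coeff p i * 0)) at_top"
    by (intro tendsto_sum tendsto_mult tendsto_const *)
  then show ?thesis by (simp add: poly_altdef sum_distrib_right mult.assoc)
qed

text \<open>In the variable \<open>s = 1 / t\<close>, whose derivative is \<open>- s * s\<close>,
  the derivative of \<open>p(s) exp(- a s)\<close> is
  \<open>s * s * (a p(s) - p'(s)) exp(- a s)\<close>. At 0 the right difference quotient is
  \<open>s p(s) exp(- a s)\<close> with \<open>s\<close> tending to infinity.\<close>

lemma flat_exp_deriv:
  assumes "0 < a"
  shows "(flat_exp a p has_real_derivative flat_exp a (monom 1 2 * (smult a p - pderiv p)) t) (at t)"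
proof (cases "t = 0")
  case True
  have r: "((\<lambda>t. flat_exp a p t / t) \<longlongrightarrow> 0) (at_right 0)"
  proof -
    have "((\<lambda>t. poly (p * [:0,1:]) (inverse t) * exp (- a * inverse t)) \<longlongrightarrow> 0) (at_right 0)"
      by (rule filterlim_compose[OF poly_mult_exp_tendsto_0[OF assms] filterlim_inverse_at_top_right])
    then show ?thesis
      by (rule Lim_transform_eventually)
        (auto simp: flat_exp_def field_simps eventually_at_filter)
  qed
  have "((\<lambda>t. flat_exp a p t / t) \<longlongrightarrow> 0) (at_left 0)"
    by (rule Lim_transform_eventually[OF tendsto_const])
      (auto simp: flat_exp_def eventually_at_filter)
  with r have "((\<lambda>t. flat_exp a p t / t) \<longlongrightarrow> 0) (at 0)"
    by (simp add: filterlim_split_at)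
  then show ?thesis
    unfolding True has_field_derivative_iff by (simp add: flat_exp_def)
next
  case False
  then consider "t < 0" | "t > 0" by linarith
  then show ?thesis
  proof cases
    case 1
    have "((\<lambda>t. 0) has_real_derivative flat_exp a (monom 1 2 * (smult a p - pderiv p)) t) (at t)"
      using 1 by (simp add: flat_exp_def)
    then show ?thesis
      by (rule DERIV_cong_ev[THEN iffD1, rotated -1])
        (use 1 in \<open>auto simp: flat_exp_def eventually_nhds intro!: exI[of _ "{..<0}"]\<close>)
  next
    case 2
    have "((\<lambda>t. poly p (1/t) * exp (-a/t)) has_real_derivative
        flat_exp a (monom 1 2 * (smult a p - pderiv p)) t) (at t)"
      using 2
      by (auto intro!: derivative_eq_intros DERIV_chain'[OF _ poly_DERIV]
          simp: flat_exp_def poly_monom power2_eq_square field_simps)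
    then show ?thesis
      by (rule DERIV_cong_ev[THEN iffD1, rotated -1])
        (use 2 in \<open>auto simp: flat_exp_def eventually_nhds intro!: exI[of _ "{0<..}"]\<close>)
  qed
qed

lemma smooth1_flat_exp: "0 < a \<Longrightarrow> smooth1 UNIV (flat_exp a p)"
  unfolding smooth1_def
  by (rule exI[of _ "range (flat_exp a)"]) (use flat_exp_deriv in blast)

text \<open>A smooth substitute for \<open>max t 0\<close>. For \<open>t > 0\<close> its derivative
  \<open>(1 + a / t) exp(- a / t)\<close> lies between 0 and 1 and tends to 1 as \<open>a\<close>
  tends to 0. The factor \<open>t\<close> puts it outside the \<open>flat_exp\<close> family, to
  which its derivative belongs.\<close>

definition flat_id :: "real \<Rightarrow> real \<Rightarrow> real" where
  "flat_id a t = (if 0 < t then t * exp (- a / t) else 0)"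

lemma flat_id_deriv:
  assumes "0 < a"
  shows "(flat_id a has_real_derivative flat_exp a [:1, a:] t) (at t)"
proof (cases "t = 0")
  case True
  have d: "flat_id a t / t = flat_exp a 1 t" if "t \<noteq> 0" for t
    using that by (auto simp: flat_id_def flat_exp_def)
  have "isCont (flat_exp a 1) 0"
    using flat_exp_deriv[OF assms] DERIV_isCont by blast
  then have "(flat_exp a 1 \<longlongrightarrow> 0) (at 0)"
    by (simp add: isCont_def flat_exp_def)
  then have "((\<lambda>t. flat_id a t / t) \<longlongrightarrow> 0) (at 0)"
    by (rule Lim_transform_eventually) (auto simp: eventually_at_filter d)
  then show ?thesis
    unfolding True has_field_derivative_iff by (simp add: flat_exp_def flat_id_def)
next
  case False
  then consider "t < 0" | "t > 0" by linarith
  then show ?thesis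
  proof cases
    case 1
    have "((\<lambda>t. 0) has_real_derivative flat_exp a [:1, a:] t) (at t)"
      using 1 by (simp add: flat_exp_def)
    then show ?thesis
      by (rule DERIV_cong_ev[THEN iffD1, rotated -1])
        (use 1 in \<open>auto simp: flat_id_def eventually_nhds intro!: exI[of _ "{..<0}"]\<close>)
  next
    case 2
    have "((\<lambda>t. t * exp (-a/t)) has_real_derivative flat_exp a [:1, a:] t) (at t)"
      using 2
      by (auto intro!: derivative_eq_intros simp: flat_exp_def power2_eq_square field_simps)
    then show ?thesis
      by (rule DERIV_cong_ev[THEN iffD1, rotated -1])
        (use 2 in \<open>auto simp: flat_id_def eventually_nhds intro!: exI[of _ "{0<..}"]\<close>)
  qed
qed

lemma smooth1_flat_id:
  assumes "0 < a" shows "smooth1 UNIV (flat_id a)"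
  unfolding smooth1_def
  by (rule exI[of _ "insert (flat_id a) (range (flat_exp a))"])
    (use flat_exp_deriv[OF assms] flat_id_deriv[OF assms] in blast)

text \<open>The second difference \<open>D h\<close> is symmetric in the two directions. Two
  applications of the mean value theorem, in either order, write it as \<open>h * h\<close> times a
  mixed derivative at a point within \<open>2 * h\<close> of \<open>x\<close>; letting
  \<open>h\<close> tend to 0 identifies the two mixed derivatives.\<close>

lemma partial_commute:
  fixes f :: "real^3 \<Rightarrow> real"
  assumes f: "smooth f"
  shows "partial i (partial j f) x = partial j (partial i f) x"
proof -
  have line: "((\<lambda>t. g (y + t *\<^sub>R axis k 1)) has_real_derivative partial k g (y + t *\<^sub>R axis k 1)) (at t)"
    if "smooth g" for g :: "real^3 \<Rightarrow> real" and y k t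
  proof -
    have "((\<lambda>t. y + t *\<^sub>R axis k 1) has_derivative (\<lambda>s. s *\<^sub>R axis k 1)) (at t)"
      by (auto intro!: derivative_eq_intros)
    moreover have g: "(g has_derivative frechet_derivative g (at (y + t *\<^sub>R axis k 1))) (at (y + t *\<^sub>R axis k 1))"
      using smooth_differentiable[OF that] frechet_derivative_works by blast
    ultimately have "((\<lambda>t. g (y + t *\<^sub>R axis k 1)) has_derivative
       (\<lambda>s. frechet_derivative g (at (y + t *\<^sub>R axis k 1)) (s *\<^sub>R axis k 1))) (at t)"
      by (rule has_derivative_compose)
    then show ?thesis
      unfolding has_field_derivative_def partial_def
      using linear_scale[OF has_derivative_linear[OF g]] by (simp add: mult.commute mult_commute_abs)
  qed
  define D where "D h = f (x + h *\<^sub>R axis i 1 + h *\<^sub>R axis j 1) - f (x + h *\<^sub>R axis i 1)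
     - f (x + h *\<^sub>R axis j 1) + f x" for h
  have key: "\<exists>s t. 0 < s \<and> s < h \<and> 0 < t \<and> t < h \<and>
      f (x + h *\<^sub>R axis a 1 + h *\<^sub>R axis b 1) - f (x + h *\<^sub>R axis a 1) - f (x + h *\<^sub>R axis b 1) + f x
       = h * (h * partial b (partial a f) (x + s *\<^sub>R axis a 1 + t *\<^sub>R axis b 1))" if "0 < h" for h a b
  proof -
    have "\<exists>s>0. s < h \<and> (f ((x + h *\<^sub>R axis b 1) + h *\<^sub>R axis a 1) - f (x + h *\<^sub>R axis a 1))
       - (f ((x + h *\<^sub>R axis b 1) + 0 *\<^sub>R axis a 1) - f (x + 0 *\<^sub>R axis a 1))
       = (h - 0) * (partial a f ((x + h *\<^sub>R axis b 1) + s *\<^sub>R axis a 1) - partial a f (x + s *\<^sub>R axis a 1))"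
      by (rule MVT2[OF that]) (intro DERIV_diff line f)
    then obtain s where s: "0 < s" "s < h" and 1: "f (x + h *\<^sub>R axis a 1 + h *\<^sub>R axis b 1) - f (x + h *\<^sub>R axis a 1)
       - f (x + h *\<^sub>R axis b 1) + f x
       = h * (partial a f (x + s *\<^sub>R axis a 1 + h *\<^sub>R axis b 1) - partial a f (x + s *\<^sub>R axis a 1))"
      by (auto simp: algebra_simps)
    have "\<exists>t>0. t < h \<and> partial a f ((x + s *\<^sub>R axis a 1) + h *\<^sub>R axis b 1) - partial a f ((x + s *\<^sub>R axis a 1) + 0 *\<^sub>R axis b 1)
       = (h - 0) * partial b (partial a f) ((x + s *\<^sub>R axis a 1) + t *\<^sub>R axis b 1)"
      by (rule MVT2[OF that]) (intro line smooth_partial f)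
    with 1 s show ?thesis by auto
  qed
  have "\<forall>h. \<exists>y. h > 0 \<longrightarrow> norm (y - x) \<le> 2*h \<and> D h = h * (h * partial b (partial a f) y)"
    if "(a,b) = (i,j) \<or> (a,b) = (j,i)" for a b
  proof (intro allI)
    fix h :: real
    show "\<exists>y. h > 0 \<longrightarrow> norm (y - x) \<le> 2*h \<and> D h = h * (h * partial b (partial a f) y)"
    proof (cases "h > 0")
      case True
      from key[OF True, of a b] obtain s t where st: "0 < s" "s < h" "0 < t" "t < h"
        and e: "f (x + h *\<^sub>R axis a 1 + h *\<^sub>R axis b 1) - f (x + h *\<^sub>R axis a 1) - f (x + h *\<^sub>R axis b 1) + f x
          = h * (h * partial b (partial a f) (x + s *\<^sub>R axis a 1 + t *\<^sub>R axis b 1))" by blast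
      have "norm ((x + s *\<^sub>R axis a 1 + t *\<^sub>R axis b 1) - x) \<le> 2*h"
        using st norm_triangle_ineq[of "s *\<^sub>R axis a (1::real)" "t *\<^sub>R axis b 1"] by simp
      moreover have "D h = h * (h * partial b (partial a f) (x + s *\<^sub>R axis a 1 + t *\<^sub>R axis b 1))"
        using e that unfolding D_def by (auto simp: algebra_simps)
      ultimately show ?thesis by blast
    qed auto
  qed
  then have "\<forall>h. \<exists>y. h > 0 \<longrightarrow> norm (y - x) \<le> 2*h \<and> D h = h * (h * partial j (partial i f) y)"
    "\<forall>h. \<exists>y. h > 0 \<longrightarrow> norm (y - x) \<le> 2*h \<and> D h = h * (h * partial i (partial j f) y)"
    by blast+
  then obtain Y Z where Y: "\<And>h. h > 0 \<Longrightarrow> norm (Y h - x) \<le> 2*h \<and> D h = h * (h * partial j (partial i f) (Y h))"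
    and Z: "\<And>h. h > 0 \<Longrightarrow> norm (Z h - x) \<le> 2*h \<and> D h = h * (h * partial i (partial j f) (Z h))"
    by metis
  have lim: "(W \<longlongrightarrow> x) (at_right 0)" if W: "\<And>h. h > 0 \<Longrightarrow> norm (W h - x) \<le> 2*h" for W :: "real \<Rightarrow> real^3"
  proof -
    have "((\<lambda>h. W h - x) \<longlongrightarrow> 0) (at_right 0)"
    proof (rule tendsto_0_le[where K=2])
      show "((\<lambda>h::real. h) \<longlongrightarrow> 0) (at_right 0)" by (simp add: tendsto_ident_at)
      show "\<forall>\<^sub>F h in at_right 0. norm (W h - x) \<le> norm h * 2"
        using W by (auto simp: eventually_at_filter mult.commute)
    qed
    then show ?thesis by (simp add: LIM_zero_iff)
  qed
  have "((\<lambda>h. partial j (partial i f) (Y h)) \<longlongrightarrow> partial j (partial i f) x) (at_right 0)"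
    using isCont_tendsto_compose[OF smooth_isCont lim] Y f smooth_partial by blast
  moreover have zlim: "((\<lambda>h. partial i (partial j f) (Z h)) \<longlongrightarrow> partial i (partial j f) x) (at_right 0)"
    using isCont_tendsto_compose[OF smooth_isCont lim] Z f smooth_partial by blast
  moreover have "partial j (partial i f) (Y h) = partial i (partial j f) (Z h)" if "h > 0" for h
    using Y[OF that] Z[OF that] that by auto
  then have "\<forall>\<^sub>F h in at_right 0. partial j (partial i f) (Y h) = partial i (partial j f) (Z h)"
    by (auto simp: eventually_at_filter)
  ultimately have "((\<lambda>h. partial i (partial j f) (Z h)) \<longlongrightarrow> partial j (partial i f) x) (at_right 0)"
    using Lim_transform_eventually by fast
  from tendsto_unique[OF trivial_limit_at_right_real zlim this] show ?thesis .
qed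

section \<open>Polynomials\<close>

lemma finite_multiindices: "finite {\<alpha>::3 \<Rightarrow> nat. sum \<alpha> UNIV \<le> r}"
proof (rule finite_subset)
  have "\<alpha> i \<le> r" if "sum \<alpha> UNIV \<le> r" for \<alpha> :: "3 \<Rightarrow> nat" and i
    using that member_le_sum[of i UNIV \<alpha>] by simp
  then show "{\<alpha>::3 \<Rightarrow> nat. sum \<alpha> UNIV \<le> r} \<subseteq> PiE UNIV (\<lambda>_. {..r})"
    by (simp add: PiE_UNIV_domain subset_iff Pi_iff)
  show "finite (PiE UNIV (\<lambda>_. {..r}) :: (3 \<Rightarrow> nat) set)"
    by (rule finite_PiE) auto
qed

abbreviation monomial :: "(3 \<Rightarrow> nat) \<Rightarrow> real^3 \<Rightarrow> real" where
  "monomial \<alpha> x \<equiv> (\<Prod>i\<in>UNIV. (x $ i) ^ \<alpha> i)"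

lemma poly_fun_add:
  assumes "poly_fun n p" "poly_fun n q" shows "poly_fun n (\<lambda>x. p x + q x)"
proof -
  obtain c d where "p = (\<lambda>x. \<Sum>\<alpha> | sum \<alpha> UNIV \<le> n. c \<alpha> * monomial \<alpha> x)"
    "q = (\<lambda>x. \<Sum>\<alpha> | sum \<alpha> UNIV \<le> n. d \<alpha> * monomial \<alpha> x)"
    using assms unfolding poly_fun_def by auto
  then show ?thesis
    unfolding poly_fun_def
    by (intro exI[of _ "\<lambda>\<alpha>. c \<alpha> + d \<alpha>"]) (simp add: sum.distrib distrib_right)
qed

lemma poly_fun_cmult:
  assumes "poly_fun n p" shows "poly_fun n (\<lambda>x. a * p x)"
proof -
  obtain c where "p = (\<lambda>x. \<Sum>\<alpha> | sum \<alpha> UNIV \<le> n. c \<alpha> * monomial \<alpha> x)"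
    using assms unfolding poly_fun_def by auto
  then show ?thesis
    unfolding poly_fun_def
    by (intro exI[of _ "\<lambda>\<alpha>. a * c \<alpha>"]) (simp add: sum_distrib_left mult.assoc)
qed

lemma poly_fun_zero: "poly_fun n (\<lambda>x. 0)"
  unfolding poly_fun_def by (intro exI[of _ "\<lambda>_. 0"]) simp

lemma poly_fun_sum:
  "(\<And>k. k \<in> I \<Longrightarrow> poly_fun n (f k)) \<Longrightarrow> poly_fun n (\<lambda>x. \<Sum>k\<in>I. f k x)"
  by (induction I rule: infinite_finite_induct) (auto intro: poly_fun_add poly_fun_zero)

lemma poly_fun_uminus: "poly_fun n p \<Longrightarrow> poly_fun n (\<lambda>x. - p x)"
  using poly_fun_cmult[of n p "-1"] by simp

lemma poly_fun_diff: "poly_fun n p \<Longrightarrow> poly_fun n q \<Longrightarrow> poly_fun n (\<lambda>x. p x - q x)"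
  using poly_fun_add[OF _ poly_fun_uminus] by fastforce

lemma poly_fun_monomial:
  assumes "sum \<alpha> UNIV \<le> n" shows "poly_fun n (\<lambda>x. monomial \<alpha> x)"
  unfolding poly_fun_def
proof (intro exI ext)
  fix x
  have "(\<Sum>\<beta> | sum \<beta> UNIV \<le> n. (if \<beta> = \<alpha> then 1 else 0) * monomial \<beta> x)
      = (\<Sum>\<beta> | sum \<beta> UNIV \<le> n. if \<beta> = \<alpha> then monomial \<alpha> x else 0)"
    by (intro sum.cong) auto
  also have "\<dots> = monomial \<alpha> x"
    using assms by (simp add: finite_multiindices)
  finally show "monomial \<alpha> x = (\<Sum>\<beta> | sum \<beta> UNIV \<le> n. (if \<beta> = \<alpha> then 1 else 0) * monomial \<beta> x)" ..
qed

lemma poly_fun_induct [consumes 1, case_names zero add cmult monomial]: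
  assumes "poly_fun n p"
    and "C (\<lambda>x. 0)"
    and add: "\<And>p q. poly_fun n p \<Longrightarrow> poly_fun n q \<Longrightarrow> C p \<Longrightarrow> C q \<Longrightarrow> C (\<lambda>x. p x + q x)"
    and cm: "\<And>a p. poly_fun n p \<Longrightarrow> C p \<Longrightarrow> C (\<lambda>x. a * p x)"
    and mono: "\<And>\<alpha>. sum \<alpha> UNIV \<le> n \<Longrightarrow> C (monomial \<alpha>)"
  shows "C p"
proof -
  obtain c where p: "p = (\<lambda>x. \<Sum>\<alpha> | sum \<alpha> UNIV \<le> n. c \<alpha> * monomial \<alpha> x)"
    using assms(1) unfolding poly_fun_def by auto
  have "poly_fun n (\<lambda>x. \<Sum>\<alpha>\<in>A. c \<alpha> * monomial \<alpha> x) \<and> C (\<lambda>x. \<Sum>\<alpha>\<in>A. c \<alpha> * monomial \<alpha> x)"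
    if "finite A" "A \<subseteq> {\<alpha>. sum \<alpha> UNIV \<le> n}" for A
    using that
  proof induction
    case empty
    then show ?case by (simp add: poly_fun_zero assms(2))
  next
    case (insert \<alpha> A)
    then have "poly_fun n (\<lambda>x. c \<alpha> * monomial \<alpha> x)" "C (\<lambda>x. c \<alpha> * monomial \<alpha> x)"
      using poly_fun_cmult poly_fun_monomial cm mono by auto
    with insert show ?case by (simp add: poly_fun_add add)
  qed
  from this[OF finite_multiindices order_refl] show ?thesis by (simp add: p)
qed

lemma poly_fun_mono:
  assumes "poly_fun m p" "m \<le> n" shows "poly_fun n p"
  using assms(1)
  by (induction rule: poly_fun_induct)
    (use assms(2) in \<open>auto intro: poly_fun_zero poly_fun_add poly_fun_cmult poly_fun_monomial\<close>)

lemma poly_fun_const: "poly_fun n (\<lambda>x. c)"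
  using poly_fun_cmult[OF poly_fun_monomial[of "\<lambda>_. 0" n], of c] by simp

lemma poly_fun_coord: "poly_fun (Suc n) (\<lambda>x. x $ k)"
proof -
  have "monomial (\<lambda>i. if i = k then 1 else 0) = (\<lambda>x. x $ k)"
    by (auto simp: if_distrib[of "\<lambda>n. _ ^ n"] cong: if_cong)
  with poly_fun_monomial[of "\<lambda>i. if i = k then 1 else 0" "Suc n"] show ?thesis by simp
qed

lemma poly_fun_affine: "poly_fun (Suc n) (\<lambda>x. a \<bullet> x + c)"
  unfolding inner_vec_def
  by (auto intro!: poly_fun_add poly_fun_const poly_fun_sum poly_fun_cmult poly_fun_coord)

lemma poly_fun_mult:
  assumes "poly_fun m p" "poly_fun n q" shows "poly_fun (m + n) (\<lambda>x. p x * q x)"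
  using assms(1)
proof (induction rule: poly_fun_induct)
  case (monomial \<alpha>)
  show ?case using assms(2)
  proof (induction rule: poly_fun_induct)
    case (monomial \<beta>)
    have "sum (\<lambda>i. \<alpha> i + \<beta> i) UNIV \<le> m + n"
      using monomial \<open>sum \<alpha> UNIV \<le> m\<close> by (simp add: sum.distrib)
    from poly_fun_monomial[OF this] show ?case by (simp add: power_add prod.distrib)
  next
    case (cmult a p)
    then show ?case using poly_fun_cmult[of _ _ a] by (simp add: ac_simps)
  qed (auto simp: distrib_left intro: poly_fun_zero poly_fun_add)
next
  case (cmult a p)
  then show ?case using poly_fun_cmult[of _ _ a] by (simp add: ac_simps)
qed (auto simp: distrib_right intro: poly_fun_zero poly_fun_add)

lemma poly_fun_smooth_alg: "poly_fun n p \<Longrightarrow> p \<in> smooth_alg"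
  by (induction rule: poly_fun_induct)
    (auto intro!: smooth_alg.intros smooth_alg_prod smooth_alg_power)

lemma poly_fun_smooth: "poly_fun n p \<Longrightarrow> smooth p"
  by (simp add: poly_fun_smooth_alg smooth_alg_smooth)

lemma poly_fun_partial:
  assumes "poly_fun n p" shows "poly_fun (n - 1) (partial k p)"
  using assms
proof (induction rule: poly_fun_induct)
  case (add p q)
  then have "partial k (\<lambda>x. p x + q x) = (\<lambda>x. partial k p x + partial k q x)"
    using partial_add poly_fun_smooth smooth_differentiable by blast
  with add show ?case by (simp add: poly_fun_add)
next
  case (cmult a p)
  then have "partial k (\<lambda>x. a * p x) = (\<lambda>x. a * partial k p x)"
    using partial_linear[OF bounded_linear_mult_right] poly_fun_smooth smooth_differentiable by blast
  with cmult show ?case by (simp add: poly_fun_cmult)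
next
  case (monomial \<alpha>)
  have split: "monomial \<beta> x = (x $ k) ^ \<beta> k * (\<Prod>i\<in>UNIV - {k}. (x $ i) ^ \<beta> i)" for \<beta> x
    by (simp add: prod.remove)
  let ?R = "\<lambda>x::real^3. \<Prod>i\<in>UNIV - {k}. (x $ i) ^ \<alpha> i"
  have sm: "?R \<in> smooth_alg" "(\<lambda>x::real^3. (x $ k) ^ m) \<in> smooth_alg" for m
    by (auto intro!: smooth_alg_prod smooth_alg_power smooth_alg.intros)
  have pow: "partial k (\<lambda>x. (x $ i) ^ m) x = (if i = k then m * (x $ k) ^ (m - 1) else 0)" for i m x
    using partial_chain[of "\<lambda>x. x $ i" x "\<lambda>t. t ^ m" "m * (x $ i) ^ (m - 1)" k]
    by (auto simp: partial_coord bounded_linear_imp_differentiable[OF bounded_linear_vec_nth]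
        intro!: derivative_eq_intros)
  have R0: "partial k (\<lambda>x. \<Prod>i\<in>J. (x $ i) ^ \<alpha> i) x = 0" if "k \<notin> J" for J x
    using that
  proof (induction J rule: infinite_finite_induct)
    case (insert j J)
    then show ?case
      by (auto simp: partial_mult pow intro!: partial_mult[THEN trans] smooth_differentiable
          smooth_alg_smooth smooth_alg_prod smooth_alg_power smooth_alg.intros)
  qed auto
  have "partial k (monomial \<alpha>) x = real (\<alpha> k) * monomial (\<alpha>(k := \<alpha> k - 1)) x" for x
  proof -
    have "partial k (monomial \<alpha>) x = partial k (\<lambda>x. (x $ k) ^ \<alpha> k * ?R x) x"
      by (simp add: split)
    also have "\<dots> = partial k (\<lambda>x. (x $ k) ^ \<alpha> k) x * ?R x"
      using R0[of "UNIV - {k}"] sm by (subst partial_mult) (auto simp: smooth_differentiable smooth_alg_smooth)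
    finally have *: "partial k (monomial \<alpha>) x = partial k (\<lambda>x. (x $ k) ^ \<alpha> k) x * ?R x" .
    have "monomial (\<alpha>(k := \<alpha> k - 1)) x = (x $ k) ^ (\<alpha> k - 1) * ?R x"
      unfolding split by (intro arg_cong2[of _ _ _ _ "(*)"] prod.cong) auto
    then have "partial k (\<lambda>x. (x $ k) ^ \<alpha> k) x * ?R x = real (\<alpha> k) * monomial (\<alpha>(k := \<alpha> k - 1)) x"
      by (simp add: pow)
    with * show ?thesis by simp
  qed
  \<comment> \<open>If \<open>\<alpha> k = 0\<close> the coefficient vanishes and the truncated
    \<open>\<alpha> k - 1\<close> is harmless; otherwise lowering \<open>\<alpha> k\<close> lowers
    the degree by one.\<close>
  moreover have "poly_fun (n - 1) (\<lambda>x. real (\<alpha> k) * monomial (\<alpha>(k := \<alpha> k - 1)) x)"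
  proof (cases "\<alpha> k = 0")
    case False
    have "sum \<alpha> UNIV = \<alpha> k + sum \<alpha> (UNIV - {k})" for \<alpha> :: "3 \<Rightarrow> nat"
      by (simp add: sum.remove)
    from this[of \<alpha>] this[of "\<alpha>(k := \<alpha> k - 1)"] have "sum (\<alpha>(k := \<alpha> k - 1)) UNIV \<le> n - 1"
      using monomial False by simp
    then show ?thesis by (intro poly_fun_cmult poly_fun_monomial)
  qed (simp add: poly_fun_zero)
  ultimately show ?case by presburger
qed (simp add: poly_fun_zero)

lemma poly_fun_on_line:
  assumes "poly_fun n p"
  obtains q where "\<And>t. p (x + t *\<^sub>R y) = poly q t"
proof -
  have "\<exists>q. \<forall>t. p (x + t *\<^sub>R y) = poly q t"
    using assms
  proof (induction rule: poly_fun_induct)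
    case zero
    then show ?case by (intro exI[of _ 0]) auto
  next
    case (add p q)
    then show ?case by (metis poly_add)
  next
    case (cmult a p)
    then show ?case by (metis poly_smult)
  next
    case (monomial \<alpha>)
    show ?case
      by (intro exI[of _ "\<Prod>i\<in>UNIV. [:x $ i, y $ i:] ^ \<alpha> i"]) (auto simp: poly_prod)
  qed
  then show ?thesis using that by blast
qed

text \<open>On a line a polynomial becomes univariate, and infinitely many roots make it zero. This
  is how identities near one point of a face are carried to its whole plane.\<close>

lemma poly_fun_zero_on_line:
  assumes "poly_fun n p" "0 < e" "\<And>t. 0 < t \<Longrightarrow> t < e \<Longrightarrow> p (x + t *\<^sub>R y) = 0"
  shows "p (x + t *\<^sub>R y) = 0"
proof -
  obtain q where q: "\<And>t. p (x + t *\<^sub>R y) = poly q t"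
    using poly_fun_on_line[OF assms(1)] by blast
  have "infinite {0<..<e}" using assms(2) by simp
  moreover have "{0<..<e} \<subseteq> {t. poly q t = 0}" using assms(3) q by auto
  ultimately have "q = 0" using poly_roots_finite finite_subset by blast
  with q show ?thesis by simp
qed

section \<open>Homogenization and polynomials in four variables\<close>

text \<open>The homogeneous form can be evaluated at weights that do not sum to one, which is what
  remains of a point when some of its barycentric coordinates are dropped.\<close>

lemma poly_fun_homogenization:
  assumes "poly_fun n p"
  obtains H :: "real^3 \<Rightarrow> real \<Rightarrow> real" and c where
    "H = (\<lambda>y w. \<Sum>\<alpha> | sum \<alpha> UNIV \<le> n. c \<alpha> * (monomial \<alpha> y * w ^ (n - sum \<alpha> UNIV)))"
    "\<And>y. H y 1 = p y" "\<And>k y w. H (k *\<^sub>R y) (k * w) = k ^ n * H y w"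
proof -
  obtain c where p: "p = (\<lambda>x. \<Sum>\<alpha> | sum \<alpha> UNIV \<le> n. c \<alpha> * monomial \<alpha> x)"
    using assms unfolding poly_fun_def by auto
  have "monomial \<alpha> (k *\<^sub>R y) * (k * w) ^ (n - sum \<alpha> UNIV) = k ^ n * (monomial \<alpha> y * w ^ (n - sum \<alpha> UNIV))"
    if "sum \<alpha> UNIV \<le> n" for \<alpha> k y w
  proof -
    have "k ^ n = k ^ sum \<alpha> UNIV * k ^ (n - sum \<alpha> UNIV)"
      using that by (simp flip: power_add)
    then show ?thesis by (simp add: power_mult_distrib prod.distrib power_sum)
  qed
  then show ?thesis
    by (intro that[of "\<lambda>y w. \<Sum>\<alpha> | sum \<alpha> UNIV \<le> n. c \<alpha> * (monomial \<alpha> y * w ^ (n - sum \<alpha> UNIV))" c])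
      (auto simp: p sum_distrib_left mult.left_commute[of "k ^ n" for k] intro!: sum.cong)
qed

text \<open>\<open>Q x s = poly (R x) s\<close> is a polynomial of total degree at most \<open>n\<close> in the four
  variables \<open>(x, s)\<close>.\<close>
definition param_poly :: "nat \<Rightarrow> (real^3 \<Rightarrow> real poly) \<Rightarrow> bool" where
  "param_poly n R \<longleftrightarrow> (\<forall>x. degree (R x) \<le> n) \<and> (\<forall>k\<le>n. poly_fun (n - k) (\<lambda>x. coeff (R x) k))"

text \<open>For \<open>k > n\<close> the truncated \<open>n - k\<close> is 0, and the bound holds
  because the coefficient vanishes.\<close>

lemma param_poly_coeff:
  assumes "param_poly n R" shows "poly_fun (n - k) (\<lambda>x. coeff (R x) k)"
proof (cases "k \<le> n")
  case False
  then have "coeff (R x) k = 0" for x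
    using assms unfolding param_poly_def by (meson coeff_eq_0 le_less_trans not_le)
  then show ?thesis by (simp add: poly_fun_zero)
qed (use assms in \<open>auto simp: param_poly_def\<close>)

lemma param_poly_add: "param_poly n R \<Longrightarrow> param_poly n S \<Longrightarrow> param_poly n (\<lambda>x. R x + S x)"
  unfolding param_poly_def by (auto intro: poly_fun_add degree_add_le)

lemma param_poly_const: "param_poly n (\<lambda>x. [:c:])"
  unfolding param_poly_def by (auto simp: coeff_pCons intro: poly_fun_zero poly_fun_const split: nat.split)

lemma param_poly_affine: "param_poly 1 (\<lambda>x. [:a \<bullet> x + c, d:])"
  unfolding param_poly_def
  by (auto simp: le_Suc_eq coeff_pCons split: nat.split intro: poly_fun_const poly_fun_affine[of 0, simplified])

lemma param_poly_mult:
  assumes "param_poly m R" "param_poly n S" shows "param_poly (m + n) (\<lambda>x. R x * S x)"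
  unfolding param_poly_def
proof (intro conjI allI impI)
  fix x show "degree (R x * S x) \<le> m + n"
    using assms unfolding param_poly_def by (meson add_mono degree_mult_le order_trans)
next
  fix k assume k: "k \<le> m + n"
  have "poly_fun (m + n - k) (\<lambda>x. coeff (R x) i * coeff (S x) (k - i))" if "i \<le> k" for i
  proof (cases "i \<le> m \<and> k - i \<le> n")
    case True
    have "poly_fun ((m - i) + (n - (k - i))) (\<lambda>x. coeff (R x) i * coeff (S x) (k - i))"
      using assms True unfolding param_poly_def by (intro poly_fun_mult) auto
    moreover have "(m - i) + (n - (k - i)) = m + n - k" using True that by linarith
    ultimately show ?thesis by simp
  next
    \<comment> \<open>One index exceeds the degree of its factor. The summand is zero, so it does
      not matter that the degrees fail to add up.\<close>
    case False
    then have "coeff (R x) i * coeff (S x) (k - i) = 0" for x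
      using assms unfolding param_poly_def
      by (metis coeff_eq_0 le_less_trans linorder_not_le mult_eq_0_iff)
    then have "(\<lambda>x. coeff (R x) i * coeff (S x) (k - i)) = (\<lambda>x. 0)" by blast
    then show ?thesis by (simp add: poly_fun_zero)
  qed
  then show "poly_fun (m + n - k) (\<lambda>x. coeff (R x * S x) k)"
    unfolding coeff_mult by (intro poly_fun_sum) auto
qed

lemma param_poly_sum:
  "(\<And>k. k \<in> I \<Longrightarrow> param_poly n (f k)) \<Longrightarrow> param_poly n (\<lambda>x. \<Sum>k\<in>I. f k x)"
  by (induction I rule: infinite_finite_induct)
    (auto intro: param_poly_add param_poly_const[of n 0, simplified])

lemma param_poly_power: "param_poly m R \<Longrightarrow> param_poly (k * m) (\<lambda>x. R x ^ k)"
  by (induction k) (auto intro: param_poly_mult param_poly_const[of 0 1, simplified one_pCons[symmetric]])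

lemma param_poly_prod:
  "finite I \<Longrightarrow> (\<And>k. k \<in> I \<Longrightarrow> param_poly (m k) (f k)) \<Longrightarrow> param_poly (\<Sum>k\<in>I. m k) (\<lambda>x. \<Prod>k\<in>I. f k x)"
  by (induction I rule: finite_induct)
    (auto intro: param_poly_mult param_poly_const[of 0 1, simplified one_pCons[symmetric]])

lemma param_poly_altdef:
  assumes "param_poly n R" shows "poly (R x) s = (\<Sum>k\<le>n. coeff (R x) k * s ^ k)"
proof -
  have "(\<Sum>k\<le>n. coeff (R x) k * s ^ k) = (\<Sum>k\<le>degree (R x). coeff (R x) k * s ^ k)"
    using assms unfolding param_poly_def
    by (intro sum.mono_neutral_right) (auto simp: coeff_eq_0)
  then show ?thesis by (simp add: poly_altdef)
qed

text \<open>Since \<open>s\<close> has weight one in the total degree, an affine function may be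
  substituted for it without raising the degree.\<close>

lemma param_poly_eval_affine:
  assumes "param_poly n R" shows "poly_fun n (\<lambda>x. poly (R x) (a \<bullet> x + c))"
proof -
  have pow: "poly_fun k (\<lambda>x. (a \<bullet> x + c) ^ k)" for k
  proof (induction k)
    case (Suc k)
    then show ?case using poly_fun_mult[OF poly_fun_affine[of 0 a c]] by simp
  qed (simp add: poly_fun_const)
  have "poly_fun n (\<lambda>x. coeff (R x) k * (a \<bullet> x + c) ^ k)" if "k \<le> n" for k
    using poly_fun_mult[OF param_poly_coeff[OF assms, of k] pow[of k]] that by simp
  then have "poly_fun n (\<lambda>x. \<Sum>k\<le>n. coeff (R x) k * (a \<bullet> x + c) ^ k)"
    by (intro poly_fun_sum) auto
  then show ?thesis by (simp add: param_poly_altdef[OF assms])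
qed

section \<open>Integration by parts and normal traces\<close>

lemma frechet_derivative_partial:
  fixes f :: "real^3 \<Rightarrow> real"
  assumes "f differentiable at x"
  shows "frechet_derivative f (at x) v = (\<Sum>k\<in>UNIV. v $ k * partial k f x)"
proof -
  have lin: "linear (frechet_derivative f (at x))"
    using assms frechet_derivative_works has_derivative_linear by blast
  have "frechet_derivative f (at x) v = frechet_derivative f (at x) (\<Sum>k\<in>UNIV. (v $ k) *\<^sub>R axis k 1)"
    using basis_expansion[of v] by (simp add: scalar_mult_eq_scaleR)
  then show ?thesis
    by (simp add: linear_sum[OF lin] linear_scale[OF lin] partial_def)
qed

lemma has_derivative_partial:
  fixes f :: "real^3 \<Rightarrow> real"
  assumes "f differentiable at x"
  shows "(f has_derivative (\<lambda>v. \<Sum>k\<in>UNIV. v $ k * partial k f x)) (at x)"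
  using assms frechet_derivative_partial[OF assms] frechet_derivative_works
  by (metis (no_types, lifting) ext)

lemma partial_cong_open:
  assumes "open S" "x \<in> S" "\<And>y. y \<in> S \<Longrightarrow> f y = g y"
  shows "partial i f x = partial i g x"
proof -
  have "(f has_derivative D) (at x) \<longleftrightarrow> (g has_derivative D) (at x)" for D
    using has_derivative_transform_within_open[OF _ assms(1,2)] assms(3) by metis
  then show ?thesis by (simp add: partial_def frechet_derivative_def)
qed

lemma partials_cong_open:
  assumes "open S" "\<And>y. y \<in> S \<Longrightarrow> f y = g y"
  shows "x \<in> S \<Longrightarrow> partials is f x = partials is g x"
  by (induction "is" arbitrary: x) (auto simp: assms(2) intro: partial_cong_open[OF assms(1)])

section \<open>Locally Lipschitz functions and vanishing integrals of derivatives\<close>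

text \<open>Lipschitz on every ball. The class contains the smooth functions and the minimum
  \<open>mu\<close>, is closed under products, and is regular enough for integration by
  parts.\<close>

definition loc_lip :: "(real^3 \<Rightarrow> real) \<Rightarrow> bool" where
  "loc_lip f \<longleftrightarrow> (\<forall>R. \<exists>L. \<forall>x\<in>cball 0 R. \<forall>y\<in>cball 0 R. \<bar>f x - f y\<bar> \<le> L * norm (x - y))"

lemma loc_lipE:
  assumes "loc_lip f"
  obtains L where "0 \<le> L" "\<And>x y. norm x \<le> R \<Longrightarrow> norm y \<le> R \<Longrightarrow> \<bar>f x - f y\<bar> \<le> L * norm (x - y)"
proof -
  obtain L where L: "\<forall>x\<in>cball 0 R. \<forall>y\<in>cball 0 R. \<bar>f x - f y\<bar> \<le> L * norm (x - y)"
    using assms unfolding loc_lip_def by blast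
  have "\<bar>f x - f y\<bar> \<le> \<bar>L\<bar> * norm (x - y)" if "norm x \<le> R" "norm y \<le> R" for x y
  proof -
    have "\<bar>f x - f y\<bar> \<le> L * norm (x - y)" using L that by auto
    also have "\<dots> \<le> \<bar>L\<bar> * norm (x - y)" by (intro mult_right_mono) auto
    finally show ?thesis .
  qed
  then show ?thesis using that[of "\<bar>L\<bar>"] by auto
qed

lemma loc_lip_bounded:
  assumes "loc_lip f"
  obtains B where "0 \<le> B" "\<And>x. norm x \<le> R \<Longrightarrow> \<bar>f x\<bar> \<le> B"
proof -
  obtain L where L: "0 \<le> L" "\<And>x y. norm x \<le> R \<Longrightarrow> norm y \<le> R \<Longrightarrow> \<bar>f x - f y\<bar> \<le> L * norm (x - y)"
    using loc_lipE[OF assms] by blast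
  have "\<bar>f x\<bar> \<le> \<bar>f 0\<bar> + L * \<bar>R\<bar>" if "norm x \<le> R" for x
  proof -
    have "0 \<le> R" using that norm_ge_zero[of x] by linarith
    then have "\<bar>f x - f 0\<bar> \<le> L * norm (x - 0)" using L(2)[of x 0] that by auto
    also have "\<dots> \<le> L * \<bar>R\<bar>" using that L(1) by (intro mult_left_mono) auto
    finally show ?thesis by linarith
  qed
  then show ?thesis using that[of "\<bar>f 0\<bar> + L * \<bar>R\<bar>"] L(1) by auto
qed

lemma loc_lip_add:
  assumes "loc_lip f" "loc_lip g" shows "loc_lip (\<lambda>x. f x + g x)"
  unfolding loc_lip_def
proof
  fix R
  obtain L where L: "\<And>x y. norm x \<le> R \<Longrightarrow> norm y \<le> R \<Longrightarrow> \<bar>f x - f y\<bar> \<le> L * norm (x - y)"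
    using loc_lipE[OF assms(1)] by blast
  obtain M where M: "\<And>x y. norm x \<le> R \<Longrightarrow> norm y \<le> R \<Longrightarrow> \<bar>g x - g y\<bar> \<le> M * norm (x - y)"
    using loc_lipE[OF assms(2)] by blast
  have "\<bar>(f x + g x) - (f y + g y)\<bar> \<le> (L + M) * norm (x - y)" if "norm x \<le> R" "norm y \<le> R" for x y
    using L[OF that] M[OF that] by (simp add: distrib_right)
  then show "\<exists>L. \<forall>x\<in>cball 0 R. \<forall>y\<in>cball 0 R. \<bar>(f x + g x) - (f y + g y)\<bar> \<le> L * norm (x - y)" by (intro exI ballI) auto
qed

lemma loc_lip_mult:
  assumes "loc_lip f" "loc_lip g" shows "loc_lip (\<lambda>x. f x * g x)"
  unfolding loc_lip_def
proof
  fix R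
  obtain L where L: "0 \<le> L" "\<And>x y. norm x \<le> R \<Longrightarrow> norm y \<le> R \<Longrightarrow> \<bar>f x - f y\<bar> \<le> L * norm (x - y)"
    using loc_lipE[OF assms(1)] by blast
  obtain M where M: "0 \<le> M" "\<And>x y. norm x \<le> R \<Longrightarrow> norm y \<le> R \<Longrightarrow> \<bar>g x - g y\<bar> \<le> M * norm (x - y)"
    using loc_lipE[OF assms(2)] by blast
  obtain A where A: "0 \<le> A" "\<And>x. norm x \<le> R \<Longrightarrow> \<bar>f x\<bar> \<le> A" using loc_lip_bounded[OF assms(1)] by blast
  obtain B where B: "0 \<le> B" "\<And>x. norm x \<le> R \<Longrightarrow> \<bar>g x\<bar> \<le> B" using loc_lip_bounded[OF assms(2)] by blast
  have "\<bar>f x * g x - f y * g y\<bar> \<le> (A * M + B * L) * norm (x - y)" if "norm x \<le> R" "norm y \<le> R" for x y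
  proof -
    have "f x * g x - f y * g y = f x * (g x - g y) + g y * (f x - f y)" by (simp add: algebra_simps)
    then have "\<bar>f x * g x - f y * g y\<bar> \<le> \<bar>f x\<bar> * \<bar>g x - g y\<bar> + \<bar>g y\<bar> * \<bar>f x - f y\<bar>"
      by (metis abs_mult abs_triangle_ineq)
    also have "\<dots> \<le> A * (M * norm (x - y)) + B * (L * norm (x - y))"
      using L M A B that by (intro add_mono mult_mono) auto
    finally show ?thesis by (simp add: algebra_simps)
  qed
  then show "\<exists>L. \<forall>x\<in>cball 0 R. \<forall>y\<in>cball 0 R. \<bar>f x * g x - f y * g y\<bar> \<le> L * norm (x - y)" by (intro exI ballI) auto
qed

lemma loc_lip_const: "loc_lip (\<lambda>x. c)"
  unfolding loc_lip_def by (auto intro: exI[of _ 0])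

lemma loc_lip_sum: "(\<And>k. k \<in> I \<Longrightarrow> loc_lip (f k)) \<Longrightarrow> loc_lip (\<lambda>x. \<Sum>k\<in>I. f k x)"
  by (induction I rule: infinite_finite_induct) (auto intro: loc_lip_add loc_lip_const)

lemma loc_lip_power: "loc_lip f \<Longrightarrow> loc_lip (\<lambda>x. f x ^ n)"
  by (induction n) (auto intro: loc_lip_mult loc_lip_const)

lemma smooth_loc_lip:
  fixes f :: "real^3 \<Rightarrow> real"
  assumes "smooth f" shows "loc_lip f"
  unfolding loc_lip_def
proof
  fix R
  have "\<exists>B. \<forall>x\<in>cball 0 R. \<bar>partial k f x\<bar> \<le> B" for k
    using compact_imp_bounded[OF compact_continuous_image[OF smooth_continuous_on compact_cball], of "partial k f" 0 R]
      smooth_partial[OF assms] by (auto simp: bounded_iff)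
  then obtain B where B: "\<And>k x. x \<in> cball 0 R \<Longrightarrow> \<bar>partial k f x\<bar> \<le> B k" by metis
  have "norm (f x - f y) \<le> (\<Sum>k\<in>UNIV. B k) * norm (x - y)" if "x \<in> cball 0 R" "y \<in> cball 0 R" for x y
  proof (rule differentiable_bound[OF convex_cball _ _ that])
    fix w assume w: "w \<in> cball (0::real^3) R"
    show "(f has_derivative (\<lambda>v. \<Sum>k\<in>UNIV. v $ k * partial k f w)) (at w within cball 0 R)"
      by (rule has_derivative_at_withinI[OF has_derivative_partial[OF smooth_differentiable[OF assms]]])
    show "onorm (\<lambda>v. \<Sum>k\<in>UNIV. v $ k * partial k f w) \<le> (\<Sum>k\<in>UNIV. B k)"
    proof (rule onorm_le)
      fix v :: "real^3"
      have "norm (\<Sum>k\<in>UNIV. v $ k * partial k f w) \<le> (\<Sum>k\<in>UNIV. norm (v $ k * partial k f w))"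
        by (rule norm_sum)
      also have "\<dots> \<le> (\<Sum>k\<in>UNIV. norm v * B k)"
        using B[OF w] by (intro sum_mono) (auto simp: abs_mult intro!: mult_mono component_le_norm_cart)
      finally show "norm (\<Sum>k\<in>UNIV. v $ k * partial k f w) \<le> (\<Sum>k\<in>UNIV. B k) * norm v"
        by (simp add: sum_distrib_left mult.commute)
    qed
  qed
  then show "\<exists>L. \<forall>x\<in>cball 0 R. \<forall>y\<in>cball 0 R. \<bar>f x - f y\<bar> \<le> L * norm (x - y)" by (intro exI ballI) auto
qed

text \<open>If one point lies in the support ball, the other either lies in the ball enlarged by
  one, where the local constant applies, or is at distance at least one, where the bound
  \<open>B\<close> on the values suffices. Otherwise both values vanish.\<close>

lemma loc_lip_compact_support:
  assumes "loc_lip f" "\<And>x. f x \<noteq> 0 \<Longrightarrow> norm x \<le> R"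
  obtains L where "\<And>x y. \<bar>f x - f y\<bar> \<le> L * norm (x - y)"
proof -
  obtain L where L: "0 \<le> L" "\<And>x y. norm x \<le> R + 1 \<Longrightarrow> norm y \<le> R + 1 \<Longrightarrow> \<bar>f x - f y\<bar> \<le> L * norm (x - y)"
    using loc_lipE[OF assms(1)] by blast
  obtain B where B: "0 \<le> B" "\<And>x. norm x \<le> R \<Longrightarrow> \<bar>f x\<bar> \<le> B" using loc_lip_bounded[OF assms(1)] by blast
  have one: "\<bar>f x - f y\<bar> \<le> (L + B) * norm (x - y)" if "norm x \<le> R" for x y
  proof (cases "norm y \<le> R + 1")
    case True
    have "\<bar>f x - f y\<bar> \<le> L * norm (x - y)" using L(2) True that by simp
    also have "\<dots> \<le> (L + B) * norm (x - y)" using B(1) by (intro mult_right_mono) auto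
    finally show ?thesis .
  next
    case False
    then have y: "f y = 0" using assms(2)[of y] by linarith
    have "1 \<le> norm (x - y)" using False that norm_triangle_ineq2[of y x] by (simp add: norm_minus_commute)
    then have "B * 1 \<le> B * norm (x - y)" using B(1) by (intro mult_left_mono) auto
    moreover have "\<bar>f x - f y\<bar> \<le> B" using B(2)[OF that] y by simp
    ultimately show ?thesis using L(1) by (simp add: distrib_right add_increasing)
  qed
  have "\<bar>f x - f y\<bar> \<le> (L + B) * norm (x - y)" for x y
  proof (cases "norm x \<le> R \<or> norm y \<le> R")
    case True
    then show ?thesis using one[of x y] one[of y x] by (auto simp: norm_minus_commute abs_minus_commute)
  next
    case False
    then have "f x = 0" "f y = 0" using assms(2) by blast+
    then show ?thesis using L(1) B(1) by simp
  qed
  then show ?thesis using that by blast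
qed

text \<open>Difference quotients have zero integral by translation invariance; dominated convergence
  then replaces the divergence theorem.\<close>
lemma integral_partial_eq_0:
  fixes f D :: "real^3 \<Rightarrow> real"
  assumes f: "loc_lip f" "\<And>x. f x \<noteq> 0 \<Longrightarrow> norm x \<le> R"
    and D[measurable]: "D \<in> borel_measurable borel"
    and lim: "AE x in lborel. f differentiable at x \<and> D x = partial i f x"
  shows "integrable lborel D" "(\<integral>x. D x \<partial>lborel) = 0"
proof -
  obtain L where L: "\<And>x y. \<bar>f x - f y\<bar> \<le> L * norm (x - y)"
    using loc_lip_compact_support[OF f] by blast
  have cont: "continuous_on UNIV f"
  proof (rule lipschitz_on_continuous_on[of "\<bar>L\<bar>"], rule lipschitz_onI)
    fix x y show "dist (f x) (f y) \<le> \<bar>L\<bar> * dist x y"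
      using L[of x y] mult_right_mono[OF abs_ge_self[of L] norm_ge_zero[of "x - y"]]
      by (simp add: dist_norm)
  qed simp
  then have [measurable]: "f \<in> borel_measurable borel" by (rule borel_measurable_continuous_onI)
  define s where "s n x = (f (x + (1 / real (Suc n)) *\<^sub>R axis i 1) - f x) * real (Suc n)" for n x
  \<comment> \<open>The shifts have length at most one, so the difference quotients vanish outside
    the ball of radius \<open>R + 1\<close>, and the Lipschitz constant bounds them inside.\<close>
  define w where "w x = \<bar>L\<bar> * indicator (cball 0 (R + 1)) x" for x :: "real^3"
  have [measurable]: "s n \<in> borel_measurable lborel" for n
    unfolding s_def by measurable
  have int_f: "integrable lborel f"
  proof -
    have "integrable lborel (\<lambda>x. indicator (cball 0 R) x *\<^sub>R f x)"
      by (rule borel_integrable_compact) (auto intro: continuous_on_subset[OF cont])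
    moreover have "(\<lambda>x. indicator (cball 0 R) x *\<^sub>R f x) = f"
      using f(2) by (fastforce simp: indicator_def fun_eq_iff)
    ultimately show ?thesis by simp
  qed
  have shift: "integrable lborel (\<lambda>x. f (x + c))" "(\<integral>x. f (x + c) \<partial>lborel) = (\<integral>x. f x \<partial>lborel)" for c
  proof -
    have "integrable (distr lborel borel ((+) c)) f" using int_f by (simp add: lborel_distr_plus)
    then have "integrable lborel (\<lambda>x. f (c + x))" by (rule integrable_distr[rotated]) simp
    then show "integrable lborel (\<lambda>x. f (x + c))" by (simp add: add.commute)
    have "(\<integral>x. f x \<partial>lborel) = (\<integral>x. f x \<partial>distr lborel borel ((+) c))" by (simp add: lborel_distr_plus)
    also have "\<dots> = (\<integral>x. f (c + x) \<partial>lborel)" by (rule integral_distr) auto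
    finally show "(\<integral>x. f (x + c) \<partial>lborel) = (\<integral>x. f x \<partial>lborel)" by (simp add: add.commute)
  qed
  have s0: "(\<integral>x. s n x \<partial>lborel) = 0" for n
    unfolding s_def using shift int_f by simp
  have w: "integrable lborel w"
    unfolding w_def by (intro integrable_mult_right integrable_real_indicator)
      (auto simp: emeasure_bounded_finite[OF bounded_cball, simplified])
  have bound: "norm (s n x) \<le> w x" for n x
  proof -
    let ?e = "(1 / real (Suc n)) *\<^sub>R axis i 1 :: real^3"
    have ne: "norm ?e = 1 / real (Suc n)" by simp
    then have ne1: "norm ?e \<le> 1" by simp
    have "\<bar>f (x + ?e) - f x\<bar> \<le> L * (1 / real (Suc n))" using L[of "x + ?e" x] ne by simp
    then have "\<bar>f (x + ?e) - f x\<bar> * real (Suc n) \<le> L"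
      by (simp add: field_simps)
    then have 1: "\<bar>s n x\<bar> \<le> \<bar>L\<bar>" unfolding s_def abs_mult by simp
    show ?thesis
    proof (cases "norm x \<le> R + 1")
      case False
      then have "f x = 0" using f(2)[of x] by linarith
      moreover have "\<not> norm (x + ?e) \<le> R"
      proof
        assume "norm (x + ?e) \<le> R"
        moreover have "norm x \<le> norm (x + ?e) + norm ?e"
          using norm_triangle_ineq[of "x + ?e" "- ?e"] by (simp only: norm_minus_cancel add_uminus_conv_diff add_diff_cancel_right')
        ultimately show False using False ne1 by linarith
      qed
      then have "f (x + ?e) = 0" using f(2) by blast
      ultimately show ?thesis by (simp add: s_def w_def)
    qed (use 1 in \<open>simp add: w_def\<close>)
  qed
  have conv: "AE x in lborel. (\<lambda>n. s n x) \<longlonglongrightarrow> D x"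
    using lim
  proof eventually_elim
    case (elim x)
    then have d: "(f has_derivative frechet_derivative f (at x)) (at x)"
      using frechet_derivative_works by blast
    have "((\<lambda>h. x + h *\<^sub>R axis i 1) has_derivative (\<lambda>s. s *\<^sub>R axis i 1)) (at (0::real))"
      by (auto intro!: derivative_eq_intros)
    moreover have "(f has_derivative frechet_derivative f (at x)) (at (x + 0 *\<^sub>R axis i 1))" using d by simp
    ultimately have "((\<lambda>h. f (x + h *\<^sub>R axis i 1)) has_derivative (\<lambda>s. frechet_derivative f (at x) (s *\<^sub>R axis i 1))) (at 0)"
      by (rule has_derivative_compose)
    moreover have "(\<lambda>s. frechet_derivative f (at x) (s *\<^sub>R axis i 1)) = (*) (D x)"
      using linear_scale[OF has_derivative_linear[OF d]] elim by (auto simp: partial_def mult.commute)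
    ultimately have "((\<lambda>h. f (x + h *\<^sub>R axis i 1)) has_real_derivative D x) (at 0)"
      by (simp add: has_field_derivative_def)
    then have "((\<lambda>h. (f (x + h *\<^sub>R axis i 1) - f x) / h) \<longlongrightarrow> D x) (at 0)"
      by (simp add: has_field_derivative_iff)
    then have "((\<lambda>n. (f (x + (1 / real (Suc n)) *\<^sub>R axis i 1) - f x) / (1 / real (Suc n))) \<longlongrightarrow> D x) sequentially"
    proof (rule filterlim_compose)
      have "(\<lambda>n. 1 / real (Suc n)) \<longlonglongrightarrow> 0" by (rule LIMSEQ_Suc[OF lim_1_over_n])
      then show "filterlim (\<lambda>n. 1 / real (Suc n)) (at 0) sequentially" by (simp add: filterlim_at)
    qed
    then show ?case by (simp add: s_def)
  qed
  show "integrable lborel D"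
    by (rule integrable_dominated_convergence[OF _ _ w conv]) (use bound in auto)
  have "(\<lambda>n. \<integral>x. s n x \<partial>lborel) \<longlonglongrightarrow> (\<integral>x. D x \<partial>lborel)"
    by (rule integral_dominated_convergence[OF _ _ w conv]) (use bound in auto)
  then show "(\<integral>x. D x \<partial>lborel) = 0"
    by (simp add: s0 LIMSEQ_const_iff)
qed

section \<open>Test functions\<close>

lemma notin_closure_support: "x \<notin> closure {x. f x \<noteq> 0} \<Longrightarrow> f x = 0"
  using closure_subset[of "{x. f x \<noteq> 0}"] by auto

lemma test_fun_support:
  assumes "test_fun S \<phi>"
  obtains R where "\<And>x. \<phi> x \<noteq> 0 \<Longrightarrow> norm x \<le> R" "\<And>i x. partial i \<phi> x \<noteq> 0 \<Longrightarrow> norm x \<le> R"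
    "\<And>x. \<phi> x \<noteq> 0 \<Longrightarrow> x \<in> S" "\<And>i x. partial i \<phi> x \<noteq> 0 \<Longrightarrow> x \<in> S"
proof -
  let ?C = "closure {x. \<phi> x \<noteq> 0}"
  have C: "compact ?C" "?C \<subseteq> S" using assms by (auto simp: test_fun_def)
  then obtain R where R: "\<And>x. x \<in> ?C \<Longrightarrow> norm x \<le> R"
    using compact_imp_bounded bounded_iff by metis
  have 1: "x \<in> ?C" if "\<phi> x \<noteq> 0" for x using that notin_closure_support[of x \<phi>] by blast
  have 2: "x \<in> ?C" if "partial i \<phi> x \<noteq> 0" for x i
  proof (rule ccontr)
    assume "x \<notin> ?C"
    then have "partial i \<phi> x = partial i (\<lambda>_. 0) x"
      by (intro partial_cong_open[of "- ?C"]) (auto dest: 1)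
    with that show False by simp
  qed
  show ?thesis by (rule that[of R]) (use 1 2 R C(2) in \<open>blast+\<close>)
qed

lemma test_fun_smooth: "test_fun S \<phi> \<Longrightarrow> smooth \<phi>"
  by (simp add: test_fun_def)

lemma test_fun_mono: "test_fun S \<phi> \<Longrightarrow> S \<subseteq> S' \<Longrightarrow> test_fun S' \<phi>"
  by (auto simp: test_fun_def)

lemma test_funI:
  assumes "smooth \<phi>" "compact K" "K \<subseteq> S" "\<And>x. x \<notin> K \<Longrightarrow> \<phi> x = 0"
  shows "test_fun S \<phi>"
proof -
  have sub: "closure {x. \<phi> x \<noteq> 0} \<subseteq> K"
    by (rule closure_minimal) (use assms in \<open>auto simp: compact_imp_closed\<close>)
  then have "K \<inter> closure {x. \<phi> x \<noteq> 0} = closure {x. \<phi> x \<noteq> 0}" by (rule Int_absorb1)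
  with compact_Int_closed[OF assms(2) closed_closure, of "{x. \<phi> x \<noteq> 0}"]
  have "compact (closure {x. \<phi> x \<noteq> 0})" by simp
  with sub assms(1,3) show ?thesis
    unfolding test_fun_def by (intro conjI subset_trans[OF sub])
qed

lemma test_fun_supp_subset:
  assumes "test_fun S \<phi>" "smooth \<psi>" "\<And>x. x \<notin> closure {x. \<phi> x \<noteq> 0} \<Longrightarrow> \<psi> x = 0"
  shows "test_fun S \<psi>"
  using assms test_funI[OF assms(2), of "closure {x. \<phi> x \<noteq> 0}" S] by (auto simp: test_fun_def)

lemma test_fun_partial:
  assumes "test_fun S \<phi>" shows "test_fun S (partial i \<phi>)"
proof (rule test_fun_supp_subset[OF assms smooth_partial[OF test_fun_smooth[OF assms]]])
  fix x assume x: "x \<notin> closure {x. \<phi> x \<noteq> 0}"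
  have "partial i \<phi> x = partial i (\<lambda>_. 0) x"
  proof (rule partial_cong_open[of "- closure {x. \<phi> x \<noteq> 0}"])
    fix y assume "y \<in> - closure {x. \<phi> x \<noteq> 0}"
    then show "\<phi> y = 0" using notin_closure_support[of y \<phi>] by blast
  qed (use x in auto)
  then show "partial i \<phi> x = 0" by simp
qed

lemma test_fun_nth:
  fixes \<phi> :: "real^3 \<Rightarrow> real^'n"
  assumes "test_fun S \<phi>" shows "test_fun S (\<lambda>x. \<phi> x $ k)"
proof (rule test_fun_supp_subset[OF assms smooth_nth[OF test_fun_smooth[OF assms]]])
  fix x assume "x \<notin> closure {x. \<phi> x \<noteq> 0}"
  then have "\<phi> x = 0" using notin_closure_support[of x \<phi>] by blast
  then show "\<phi> x $ k = 0" by simp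
qed

lemma test_fun_scaleR:
  fixes \<phi> :: "real^3 \<Rightarrow> real" and a :: "'b::real_normed_vector"
  assumes "test_fun S \<phi>" shows "test_fun S (\<lambda>x. \<phi> x *\<^sub>R a)"
proof -
  have "smooth (\<lambda>x. \<phi> x *\<^sub>R a)"
    by (rule smooth_linear[OF bounded_linear_scaleR_left test_fun_smooth[OF assms]])
  moreover have "\<phi> x *\<^sub>R a = 0" if "x \<notin> closure {x. \<phi> x \<noteq> 0}" for x
    using notin_closure_support[OF that] by simp
  ultimately show ?thesis by (rule test_fun_supp_subset[OF assms])
qed

lemma integrable_smooth_support:
  fixes f :: "real^3 \<Rightarrow> real"
  assumes "continuous_on UNIV f" "\<And>x. f x \<noteq> 0 \<Longrightarrow> norm x \<le> R"
  shows "integrable lborel f"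
proof -
  have "integrable lborel (\<lambda>x. indicator (cball 0 R) x *\<^sub>R f x)"
    by (rule borel_integrable_compact) (auto intro: continuous_on_subset[OF assms(1)])
  moreover have "(\<lambda>x. indicator (cball 0 R) x *\<^sub>R f x) = f"
    using assms(2) by (fastforce simp: indicator_def fun_eq_iff)
  ultimately show ?thesis by simp
qed

text \<open>The divergence of \<open>\<phi> v\<close>, expanded by the product rule. Its integral
  over a half space sees only the normal component of \<open>v\<close> on the boundary
  plane.\<close>

definition dflux :: "(real^3 \<Rightarrow> real^3) \<Rightarrow> (real^3 \<Rightarrow> real) \<Rightarrow> real^3 \<Rightarrow> real" where
  "dflux v \<phi> x = (\<Sum>k\<in>UNIV. v x $ k * partial k \<phi> x + partial k (\<lambda>y. v y $ k) x * \<phi> x)"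

lemma dflux_props:
  fixes v :: "real^3 \<Rightarrow> real^3"
  assumes v: "\<And>k. smooth (\<lambda>x. v x $ k)" and \<phi>: "test_fun S \<phi>"
  shows "continuous_on UNIV (dflux v \<phi>)" "integrable lborel (dflux v \<phi>)" "(\<integral>x. dflux v \<phi> x \<partial>lborel) = 0"
proof -
  note s = test_fun_smooth[OF \<phi>]
  obtain R where R: "\<And>x. \<phi> x \<noteq> 0 \<Longrightarrow> norm x \<le> R" "\<And>i x. partial i \<phi> x \<noteq> 0 \<Longrightarrow> norm x \<le> R"
    using test_fun_support[OF \<phi>] by metis
  show c: "continuous_on UNIV (dflux v \<phi>)"
    unfolding dflux_def by (intro continuous_intros smooth_continuous_on v s smooth_partial)
  have "norm x \<le> R" if "dflux v \<phi> x \<noteq> 0" for x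
  proof (rule ccontr)
    assume "\<not> norm x \<le> R"
    then have "\<phi> x = 0" "\<And>k. partial k \<phi> x = 0" using R by blast+
    with that show False by (simp add: dflux_def)
  qed
  with c show "integrable lborel (dflux v \<phi>)" by (rule integrable_smooth_support)
  let ?g = "\<lambda>k x. v x $ k * partial k \<phi> x + partial k (\<lambda>y. v y $ k) x * \<phi> x"
  have g: "integrable lborel (?g k) \<and> (\<integral>x. ?g k x \<partial>lborel) = 0" for k
  proof -
    have 1: "loc_lip (\<lambda>x. v x $ k * \<phi> x)" by (intro loc_lip_mult smooth_loc_lip v s)
    have 2: "\<And>x. v x $ k * \<phi> x \<noteq> 0 \<Longrightarrow> norm x \<le> R" using R by auto
    have 3: "?g k \<in> borel_measurable borel"
      by (intro borel_measurable_continuous_onI continuous_intros smooth_continuous_on v s smooth_partial)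
    have 4: "AE x in lborel. (\<lambda>x. v x $ k * \<phi> x) differentiable at x \<and> ?g k x = partial k (\<lambda>x. v x $ k * \<phi> x) x"
      using v s by (auto simp: partial_mult smooth_differentiable intro!: differentiable_mult)
    show ?thesis using integral_partial_eq_0[OF 1 2 3 4] by auto
  qed
  then show "(\<integral>x. dflux v \<phi> x \<partial>lborel) = 0"
    unfolding dflux_def by (subst Bochner_Integration.integral_sum) auto
qed

lemma smooth_diff:
  fixes f g :: "real^3 \<Rightarrow> 'b::real_normed_vector"
  assumes "smooth f" "smooth g"
  shows "smooth (\<lambda>x. f x - g x)" "partials is (\<lambda>x. f x - g x) = (\<lambda>x. partials is f x - partials is g x)"
proof -
  show *: "partials is (\<lambda>x. f x - g x) = (\<lambda>x. partials is f x - partials is g x)" for "is"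
    by (induction "is") (auto simp: partial_diff smooth_differentiable smooth_partials assms)
  show "smooth (\<lambda>x. f x - g x)"
    unfolding smooth_on_def *
    by (intro allI ballI differentiable_diff smooth_differentiable smooth_partials assms)
qed

section \<open>The fundamental lemma of the calculus of variations\<close>

text \<open>Each factor is flat at one face of the box, so the product is smooth and supported in
  the closed box. For \<open>e\<close> tending to 0 it converges to the indicator of the open
  box.\<close>

definition box_bump :: "real^3 \<Rightarrow> real^3 \<Rightarrow> real \<Rightarrow> real^3 \<Rightarrow> real" where
  "box_bump a b e x = (\<Prod>k\<in>UNIV. flat_exp e 1 (x $ k - a $ k) * flat_exp e 1 (b $ k - x $ k))"

lemma flat_exp_1: "flat_exp e 1 t = (if 0 < t then exp (- e / t) else 0)"
  by (simp add: flat_exp_def)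

lemma flat_exp_1_bounds: "0 \<le> e \<Longrightarrow> 0 \<le> flat_exp e 1 t \<and> flat_exp e 1 t \<le> 1"
  by (simp add: flat_exp_1)

lemma box_bump_bounds: "0 \<le> e \<Longrightarrow> 0 \<le> box_bump a b e x \<and> box_bump a b e x \<le> 1"
  unfolding box_bump_def using flat_exp_1_bounds[of e]
  by (auto intro!: prod_nonneg prod_le_1 mult_nonneg_nonneg mult_le_one)

lemma box_bump_test_fun:
  assumes "0 < e" "cbox a b \<subseteq> S" shows "test_fun S (box_bump a b e)"
proof (rule test_funI[OF _ compact_cbox assms(2)])
  have "(\<lambda>x. flat_exp e 1 (x $ k - a $ k)) \<in> smooth_alg" for k
    by (rule smooth_alg.comp[of _ UNIV]) (auto intro: smooth_alg_diff smooth_alg.intros smooth1_flat_exp assms)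
  moreover have "(\<lambda>x. flat_exp e 1 (b $ k - x $ k)) \<in> smooth_alg" for k
    by (rule smooth_alg.comp[of _ UNIV]) (auto intro: smooth_alg_diff smooth_alg.intros smooth1_flat_exp assms)
  ultimately have "box_bump a b e \<in> smooth_alg"
    unfolding box_bump_def by (intro smooth_alg_prod smooth_alg.mult)
  then show "smooth (box_bump a b e)" by (rule smooth_alg_smooth)
  fix x assume "x \<notin> cbox a b"
  then have "\<not> (\<forall>k. a $ k \<le> x $ k \<and> x $ k \<le> b $ k)" by (simp add: mem_box_cart)
  then obtain k where "x $ k < a $ k \<or> b $ k < x $ k" using not_le by blast
  then have "flat_exp e 1 (x $ k - a $ k) * flat_exp e 1 (b $ k - x $ k) = 0" by (auto simp: flat_exp_1)
  then show "box_bump a b e x = 0" unfolding box_bump_def by (intro prod_zero) auto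
qed

lemma box_bump_tendsto: "(\<lambda>n. box_bump a b (1 / real (Suc n)) x) \<longlonglongrightarrow> indicator (box a b) x"
proof -
  have 1: "(\<lambda>n. flat_exp (1 / real (Suc n)) 1 t) \<longlonglongrightarrow> (if 0 < t then 1 else 0)" for t
  proof (cases "0 < t")
    case True
    have "(\<lambda>n. exp (- (1 / real (Suc n)) / t)) \<longlonglongrightarrow> exp (- 0 / t)"
      by (intro tendsto_intros LIMSEQ_Suc[OF lim_1_over_n]) (use True in auto)
    with True show ?thesis by (simp add: flat_exp_1)
  qed (simp add: flat_exp_1)
  have "(\<lambda>n. box_bump a b (1 / real (Suc n)) x) \<longlonglongrightarrow>
     (\<Prod>k\<in>UNIV. (if 0 < x $ k - a $ k then 1 else 0) * (if 0 < b $ k - x $ k then 1 else 0))"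
    unfolding box_bump_def by (intro tendsto_prod tendsto_mult 1)
  also have "(\<Prod>k\<in>UNIV. (if 0 < x $ k - a $ k then 1 else 0) * (if 0 < b $ k - x $ k then 1 else 0))
     = (indicator (box a b) x :: real)"
    by (auto simp: indicator_def mem_box_cart prod_zero_iff)
  finally show ?thesis .
qed

text \<open>Box bumps are test functions converging boundedly to indicators of open boxes, so the
  integral over every box in \<open>S\<close> vanishes. Boxes are an intersection-stable generator
  of the Borel sets, hence all integrals over Borel sets vanish locally, and the function is zero
  there almost everywhere.\<close>

lemma AE_eq_0_of_test_fun_integrals:
  fixes h :: "real^3 \<Rightarrow> real"
  assumes h: "integrable lebesgue h" and S: "open S"
    and test: "\<And>\<phi>. test_fun S \<phi> \<Longrightarrow> (\<integral>x. h x * \<phi> x \<partial>lebesgue) = 0"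
  shows "AE x in lebesgue. x \<in> S \<longrightarrow> h x = 0"
proof -
  \<comment> \<open>The generator argument is about Borel sets, so \<open>h\<close> is replaced by a
    Borel function equal to it almost everywhere.\<close>
  obtain g where [measurable]: "g \<in> borel_measurable borel" and gAE: "AE x in lborel. h x = g x"
    using completion_ex_borel_measurable_real[of h lborel] h by (auto simp: borel_measurable_integrable)
  have gAE': "AE x in lebesgue. h x = g x" using gAE by (rule AE_completion)
  have "integrable lebesgue g"
    by (rule integrable_cong_AE_imp[OF h _ gAE']) (auto intro!: measurable_completion)
  then have int: "integrable lborel g" by (simp add: integrable_completion)
  have gtest: "(\<integral>x. g x * \<phi> x \<partial>lborel) = 0" if "test_fun S \<phi>" for \<phi>
  proof -
    have [measurable]: "\<phi> \<in> borel_measurable borel"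
      using that by (intro borel_measurable_continuous_onI smooth_continuous_on test_fun_smooth)
    have "(\<integral>x. g x * \<phi> x \<partial>lborel) = (\<integral>x. g x * \<phi> x \<partial>lebesgue)"
      by (rule integral_completion[symmetric]) measurable
    also have "\<dots> = (\<integral>x. h x * \<phi> x \<partial>lebesgue)"
    proof (rule integral_cong_AE)
      show "AE x in lebesgue. g x * \<phi> x = h x * \<phi> x" using gAE' by eventually_elim simp
      have m: "\<phi> \<in> borel_measurable lebesgue" by (intro measurable_completion) simp
      show "(\<lambda>x. g x * \<phi> x) \<in> borel_measurable lebesgue" by (intro measurable_completion) measurable
      show "(\<lambda>x. h x * \<phi> x) \<in> borel_measurable lebesgue"
        using m borel_measurable_integrable[OF h] by (rule borel_measurable_times[rotated])
    qed
    finally show ?thesis using test[OF that] by simp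
  qed
  have box0: "(\<integral>x. indicator (box a b) x * g x \<partial>lborel) = 0" if "cbox a b \<subseteq> S" for a b
  proof -
    have "(\<lambda>n. \<integral>x. box_bump a b (1 / real (Suc n)) x * g x \<partial>lborel) \<longlonglongrightarrow> (\<integral>x. indicator (box a b) x * g x \<partial>lborel)"
    proof (rule integral_dominated_convergence[where w="\<lambda>x. \<bar>g x\<bar>"])
      have [measurable]: "box_bump a b e \<in> borel_measurable borel" for e
        unfolding box_bump_def flat_exp_1 by measurable
      show "(\<lambda>x. box_bump a b (1 / real (Suc n)) x * g x) \<in> borel_measurable lborel" for n by measurable
      show "integrable lborel (\<lambda>x. \<bar>g x\<bar>)" using int by simp
      show "AE x in lborel. (\<lambda>n. box_bump a b (1 / real (Suc n)) x * g x) \<longlonglongrightarrow> indicator (box a b) x * g x"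
        by (intro AE_I2 tendsto_mult box_bump_tendsto tendsto_const)
      show "AE x in lborel. norm (box_bump a b (1 / real (Suc n)) x * g x) \<le> \<bar>g x\<bar>" for n
        using box_bump_bounds[of "1 / real (Suc n)" a b]
        by (auto simp: abs_mult intro!: mult_left_le_one_le)
    qed measurable
    moreover have "(\<integral>x. box_bump a b (1 / real (Suc n)) x * g x \<partial>lborel) = 0" for n
      using gtest[OF box_bump_test_fun[OF _ that, of "1 / real (Suc n)"]] by (simp add: mult.commute)
    ultimately show ?thesis by (simp add: LIMSEQ_const_iff)
  qed
  have local: "AE x in lborel. x \<in> box a0 b0 \<longrightarrow> g x = 0" if ab: "cbox a0 b0 \<subseteq> S" for a0 b0
  proof -
    let ?G = "range (\<lambda>(a, b). box a b :: (real^3) set)"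
    define h0 where "h0 x = indicator (box a0 b0) x * g x" for x
    have int0: "integrable lborel h0"
      unfolding h0_def using integrable_mult_indicator[OF _ int, of "box a0 b0"] by simp
    have basic_box: "(LINT x:box a b|lborel. h0 x) = 0" for a b
    proof -
      obtain c d where cd: "box a b \<inter> box a0 b0 = box c d" by (rule that, rule box_Int_box)
      have "indicat_real (box a b) x * h0 x = indicator (box c d) x * g x" for x
        unfolding h0_def cd[symmetric] by (auto simp: indicator_def)
      then have e: "(LINT x:box a b|lborel. h0 x) = (\<integral>x. indicator (box c d) x * g x \<partial>lborel)"
        by (simp add: set_lebesgue_integral_def)
      \<comment> \<open>Only a nonempty \<open>box c d\<close> has \<open>cbox c d\<close> as its
        closure; this places \<open>cbox c d\<close> inside \<open>cbox a0 b0\<close> and hence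
        inside \<open>S\<close>.\<close>
      show ?thesis
      proof (cases "box c d = {}")
        case False
        then have "cbox c d = closure (box c d)" by simp
        also have "\<dots> \<subseteq> closure (box a0 b0)" using cd by (intro closure_mono) auto
        also have "\<dots> \<subseteq> cbox a0 b0" by (intro closure_minimal box_subset_cbox closed_cbox)
        finally show ?thesis using e box0 ab by auto
      qed (simp add: e)
    qed
    have "(LINT x:A|lborel. h0 x) = 0" if "A \<in> sets lborel" for A
    proof -
      have st: "Int_stable ?G" by (auto simp: Int_stable_def box_Int_box)
      have sP: "?G \<subseteq> Pow UNIV" by simp
      have A: "A \<in> sigma_sets UNIV ?G" using that by (simp add: borel_eq_box)
      have sub: "sigma_sets UNIV ?G = sets borel" by (simp add: borel_eq_box)
      have tot: "(LINT x|lborel. h0 x) = 0" using box0[OF ab] by (simp add: h0_def)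
      show ?thesis
        using st sP A
      proof (induction rule: sigma_sets_induct_disjoint)
        case (basic A)
        then show ?case using basic_box by auto
      next
        case empty
        then show ?case by (simp add: set_lebesgue_integral_def)
      next
        case (compl A)
        then have [measurable]: "A \<in> sets lborel" by (simp add: sub)
        have "(LINT x:UNIV - A|lborel. h0 x) = (\<integral>x. h0 x - indicator A x *\<^sub>R h0 x \<partial>lborel)"
          unfolding set_lebesgue_integral_def by (intro Bochner_Integration.integral_cong) (auto simp: indicator_def)
        also have "\<dots> = 0"
          using compl(2) tot int0 \<open>A \<in> sets lborel\<close> by (subst Bochner_Integration.integral_diff)
            (auto simp: set_lebesgue_integral_def intro!: integrable_mult_indicator[of A lborel h0, simplified])
        finally show ?case .
      next
        case (union A)
        have m: "A i \<in> sets lborel" for i using union(2) by (auto simp: sub)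
        have "(LINT x:(\<Union>i. A i)|lborel. h0 x) = (\<Sum>i. (LINT x:A i|lborel. h0 x))"
        proof (rule lebesgue_integral_countable_add[OF m])
          show "\<And>i j. i \<noteq> j \<Longrightarrow> A i \<inter> A j = {}" using union(1) by (auto simp: disjoint_family_on_def)
          show "set_integrable lborel (\<Union>i. A i) h0"
            unfolding set_integrable_def by (intro integrable_mult_indicator int0) (use m in auto)
        qed
        then show ?case using union(3) by simp
      qed
    qed
    then have "AE x in lborel. h0 x = (\<lambda>_. 0) x"
      by (intro density_unique_real) (auto simp: int0)
    then show ?thesis by eventually_elim (auto simp: h0_def)
  qed
  \<comment> \<open>The cover of \<open>S\<close> is by closed boxes while the local statement is
    about open ones; the boundaries of countably many boxes are null.\<close>
  obtain E where E: "countable E" "E \<subseteq> Pow S" "\<And>Y. Y \<in> E \<Longrightarrow> \<exists>a b. Y = cbox a b" "\<Union>E = S"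
    by (rule open_countable_Union_open_cbox[OF S], rule that)
  have "AE x in lborel. \<forall>Y\<in>E. x \<in> Y \<longrightarrow> g x = 0"
    unfolding AE_ball_countable[OF E(1)]
  proof
    fix Y assume Y: "Y \<in> E"
    then obtain c d where c: "Y = cbox c d" using E(3) by blast
    have sub: "cbox c d \<subseteq> S" using E(2) Y c by auto
    have "negligible (cbox c d - box c d)" by (rule negligible_frontier_interval)
    then have "AE x in lebesgue. x \<notin> cbox c d - box c d"
      by (intro AE_not_in) (simp add: negligible_iff_null_sets)
    then have "AE x in lborel. x \<notin> cbox c d - box c d"
      by (simp only: AE_completion_iff)
    with local[OF sub] show "AE x in lborel. x \<in> Y \<longrightarrow> g x = 0"
      unfolding c by eventually_elim auto
  qed
  then have "AE x in lborel. x \<in> S \<longrightarrow> g x = 0"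
  proof eventually_elim
    case (elim x)
    then show ?case using E(4) by blast
  qed
  then have "AE x in lebesgue. x \<in> S \<longrightarrow> g x = 0" by (rule AE_completion)
  with gAE' show ?thesis by eventually_elim auto
qed

section \<open>Normal traces across a plane\<close>

text \<open>The denominator is positive because at every \<open>t\<close> at least one of the two
  bumps is. Being constant for \<open>t \<ge> 0\<close>, the cutoff is invisible to derivatives on
  the open half line \<open>t > 0\<close>.\<close>

definition smooth_step :: "real \<Rightarrow> real" where
  "smooth_step t = flat_exp 1 1 (t + 1) * inverse (flat_exp 1 1 (t + 1) + flat_exp 1 1 (- t))"

lemma smooth_step_smooth_alg:
  assumes "f \<in> smooth_alg" shows "(\<lambda>x. smooth_step (f x)) \<in> smooth_alg"
proof -
  have 1: "(\<lambda>x. flat_exp 1 1 (f x + 1)) \<in> smooth_alg"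
    by (rule smooth_alg.comp[of _ UNIV]) (auto intro: smooth_alg.intros assms smooth1_flat_exp)
  have 2: "(\<lambda>x. flat_exp 1 1 (- f x)) \<in> smooth_alg"
    by (rule smooth_alg.comp[of _ UNIV]) (auto intro: smooth_alg_uminus assms smooth1_flat_exp)
  have "flat_exp 1 1 (t + 1) + flat_exp 1 1 (- t) > 0" for t
    by (auto simp: flat_exp_1 add_pos_pos)
  then have "range (\<lambda>x. flat_exp 1 1 (f x + 1) + flat_exp 1 1 (- f x)) \<subseteq> {0<..}" by auto
  from smooth_alg.comp[OF smooth_alg.add[OF 1 2] smooth1_inverse this]
  show ?thesis unfolding smooth_step_def by (rule smooth_alg.mult[OF 1])
qed

lemma smooth_step_1: "0 \<le> t \<Longrightarrow> smooth_step t = 1"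
  by (simp add: smooth_step_def flat_exp_1)

lemma smooth_step_0: "t \<le> -1 \<Longrightarrow> smooth_step t = 0"
  by (simp add: smooth_step_def flat_exp_1)

text \<open>The test function is a bump \<open>exp (- 1 / (\<delta> - h))\<close> in \<open>h = C d + \<bar>x - x0\<bar>\<^sup>2\<close>, \<open>d\<close> being the signed
  distance to the plane: near \<open>x0\<close> its derivative along \<open>q\<close> is negative on the half space and dominates
  the zero order term. The factor \<open>smooth_step\<close> cuts the bump off on the other side of the plane.\<close>
lemma normal_component_not_pos:
  fixes q :: "real^3 \<Rightarrow> real^3"
  assumes q: "\<And>k. smooth (\<lambda>x. q x $ k)" and \<rho>: "0 < \<rho>"
    and flux: "\<And>\<phi>. test_fun (ball x0 \<rho>) \<phi> \<Longrightarrow> (\<integral>x. indicator {x. 0 < \<nu> \<bullet> (x - x0)} x * dflux q \<phi> x \<partial>lborel) = 0"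
  shows "\<not> 0 < q x0 \<bullet> \<nu>"
proof
  assume pos: "0 < q x0 \<bullet> \<nu>"
  define c where "c = q x0 \<bullet> \<nu>"
  define divq where "divq x = (\<Sum>k\<in>UNIV. partial k (\<lambda>y. q y $ k) x)" for x
  have cq: "continuous_on UNIV q"
    using q by (intro continuous_on_vec_lambda[of UNIV "\<lambda>k x. q x $ k", simplified] smooth_continuous_on)
  have cd: "continuous_on UNIV divq"
    unfolding divq_def by (intro continuous_intros smooth_continuous_on smooth_partial q)
  obtain \<eta>0 where \<eta>0: "0 < \<eta>0" "\<And>x. dist x x0 < \<eta>0 \<Longrightarrow> c / 2 < q x \<bullet> \<nu>"
  proof -
    have "isCont (\<lambda>x. q x \<bullet> \<nu>) x0"
      using cq by (intro continuous_intros) (simp add: continuous_on_eq_continuous_at)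
    then have "\<forall>\<^sub>F x in at x0. c / 2 < q x \<bullet> \<nu>"
      unfolding isCont_def by (rule order_tendstoD(1)) (use pos in \<open>simp add: c_def\<close>)
    then have "\<forall>\<^sub>F x in nhds x0. c / 2 < q x \<bullet> \<nu>"
      unfolding eventually_nhds_conv_at using pos by (simp add: c_def)
    then show ?thesis using that unfolding eventually_nhds_metric by blast
  qed
  define \<eta> where "\<eta> = min (\<eta>0 / 2) (\<rho> / 2)"
  have \<eta>: "0 < \<eta>" "\<eta> < \<eta>0" "\<eta> < \<rho>" using \<eta>0 \<rho> by (auto simp: \<eta>_def)
  obtain B where B: "0 < B" "\<And>x. x \<in> cball x0 \<eta> \<Longrightarrow> norm (q x) \<le> B"
    using compact_imp_bounded[OF compact_continuous_image[OF continuous_on_subset[OF cq] compact_cball[of x0 \<eta>]]]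
    by (auto simp: bounded_pos)
  obtain B' where B': "0 < B'" "\<And>x. x \<in> cball x0 \<eta> \<Longrightarrow> norm (divq x) \<le> B'"
    using compact_imp_bounded[OF compact_continuous_image[OF continuous_on_subset[OF cd] compact_cball[of x0 \<eta>]]]
    by (auto simp: bounded_pos)
  \<comment> \<open>Chosen so that \<open>C * (c / 2) = 1 + 2 * \<eta> * B\<close>. The gradient of
    \<open>h\<close> is \<open>C \<nu> + 2 (x - x0)\<close>, so the derivative of \<open>h\<close>
    along \<open>q\<close> is at least 1 in the ball of radius \<open>\<eta>\<close>.\<close>
  define C where "C = 2 * (1 + 2 * \<eta> * B) / c"
  have c0: "0 < c" using pos by (simp add: c_def)
  have C0: "0 < C" unfolding C_def using c0 B(1) \<eta>(1) by (simp add: add_pos_pos)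
  \<comment> \<open>The first bound is half of the budget \<open>\<eta>\<^sup>2\<close> that keeps
    the support in the ball; the second makes \<open>1 / t\<^sup>2\<close> exceed the bound
    \<open>B'\<close> on the divergence for \<open>0 < t \<le> \<delta>\<close>.\<close>
  define \<delta> where "\<delta> = min (\<eta>\<^sup>2 / 2) (1 / (B' + 1))"
  have "1 / (B' + 1) \<le> 1" using B'(1) by simp
  moreover have "\<delta> \<le> 1 / (B' + 1)" by (simp add: \<delta>_def)
  ultimately have "\<delta> \<le> 1" by linarith
  have \<delta>: "0 < \<delta>" "\<delta> \<le> \<eta>\<^sup>2 / 2" "\<delta> \<le> 1" "\<delta> \<le> 1 / (B' + 1)"
    using \<eta>(1) B'(1) \<open>\<delta> \<le> 1\<close> by (auto simp: \<delta>_def)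
  \<comment> \<open>The cutoff ends at \<open>d = - \<kappa>\<close>, where
    \<open>C * d = - \<eta>\<^sup>2 / 2\<close>. This is the other half of the budget.\<close>
  define \<kappa> where "\<kappa> = \<eta>\<^sup>2 / (2 * C)"
  have \<kappa>: "0 < \<kappa>" "C * \<kappa> = \<eta>\<^sup>2 / 2" using \<eta>(1) C0 by (auto simp: \<kappa>_def)
  define d where "d x = \<nu> \<bullet> (x - x0)" for x
  define h where "h x = C * d x + (x - x0) \<bullet> (x - x0)" for x
  define \<phi> where "\<phi> x = flat_exp 1 1 (\<delta> - h x) * smooth_step (d x / \<kappa>)" for x
  have d_alg: "d \<in> smooth_alg"
    unfolding d_def inner_vec_def by (auto intro!: smooth_alg_sum smooth_alg.mult smooth_alg.const smooth_alg_diff smooth_alg.coord)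
  have h_alg: "h \<in> smooth_alg"
    unfolding h_def inner_vec_def[of "_ - x0"]
    by (auto intro!: smooth_alg.add smooth_alg_sum smooth_alg.mult smooth_alg.const smooth_alg_diff smooth_alg.coord d_alg)
  have d\<kappa>_alg: "(\<lambda>x. d x / \<kappa>) \<in> smooth_alg"
    using smooth_alg.mult[OF d_alg smooth_alg.const[of "1/\<kappa>"]] by simp
  have b_alg: "(\<lambda>x. flat_exp 1 1 (\<delta> - h x)) \<in> smooth_alg"
    by (rule smooth_alg.comp[of _ UNIV]) (auto intro: smooth_alg_diff smooth_alg.const h_alg smooth1_flat_exp)
  have \<phi>_alg: "\<phi> \<in> smooth_alg"
    unfolding \<phi>_def by (intro smooth_alg.mult b_alg smooth_step_smooth_alg d\<kappa>_alg)
  have in_ball: "x \<in> cball x0 \<eta>" if "h x \<le> \<delta>" "- \<kappa> \<le> d x" for x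
  proof -
    have "C * - \<kappa> \<le> C * d x" using that C0 by (intro mult_left_mono) auto
    then have "(x - x0) \<bullet> (x - x0) \<le> \<eta>\<^sup>2" using that \<kappa> \<delta>(2) by (simp add: h_def)
    then have "(norm (x - x0))\<^sup>2 \<le> \<eta>\<^sup>2" by (simp add: power2_norm_eq_inner)
    then show ?thesis using \<eta>(1) by (simp add: dist_norm norm_minus_commute power2_le_iff_abs_le)
  qed
  have tf: "test_fun (ball x0 \<rho>) \<phi>"
  proof (rule test_funI[OF smooth_alg_smooth[OF \<phi>_alg] compact_cball])
    show "cball x0 \<eta> \<subseteq> ball x0 \<rho>" using \<eta>(3) by auto
    fix x assume "x \<notin> cball x0 \<eta>"
    then have "\<delta> < h x \<or> d x < - \<kappa>" using in_ball[of x] by linarith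
    then show "\<phi> x = 0"
    proof
      assume "d x < - \<kappa>"
      then have "d x / \<kappa> \<le> -1" using \<kappa>(1) by (simp add: field_simps)
      then show ?thesis by (simp add: \<phi>_def smooth_step_0)
    qed (simp add: \<phi>_def flat_exp_1)
  qed
  have partial_h: "partial k h x = C * \<nu> $ k + 2 * (x - x0) $ k" for k x
  proof -
    have "(h has_derivative (\<lambda>v. C * (\<nu> \<bullet> v) + (v \<bullet> (x - x0) + (x - x0) \<bullet> v))) (at x)"
      unfolding h_def d_def by (auto intro!: derivative_eq_intros simp: inner_commute)
    from partial_at[OF this, of k] show ?thesis by (simp add: inner_axis inner_axis')
  qed
  have open_pos: "open {x. 0 < d x}"
    using smooth_alg_smooth[OF d_alg] by (intro open_Collect_less continuous_intros smooth_continuous_on)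
  \<comment> \<open>On the open half space the cutoff equals 1. The polynomial
    \<open>monom 1 2\<close> comes from the derivative \<open>exp(- 1 / t) / t\<^sup>2\<close> of
    \<open>exp(- 1 / t)\<close>.\<close>
  have flux_eq: "dflux q \<phi> x = flat_exp 1 1 (\<delta> - h x) * divq x
      - flat_exp 1 (monom 1 2) (\<delta> - h x) * (\<Sum>k\<in>UNIV. q x $ k * partial k h x)" if "0 < d x" for x
  proof -
    have s1: "smooth_step (d y / \<kappa>) = 1" if "0 < d y" for y
      using that \<kappa>(1) by (intro smooth_step_1) simp
    have "partial k \<phi> x = - flat_exp 1 (monom 1 2) (\<delta> - h x) * partial k h x" for k
    proof -
      have "partial k \<phi> x = partial k (\<lambda>x. flat_exp 1 1 (\<delta> - h x)) x"
        by (rule partial_cong_open[OF open_pos]) (use that s1 in \<open>auto simp: \<phi>_def\<close>)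
      also have "\<dots> = flat_exp 1 (monom 1 2) (\<delta> - h x) * partial k (\<lambda>x. \<delta> - h x) x"
      proof (rule partial_chain)
        show "(\<lambda>x. \<delta> - h x) differentiable at x"
          by (intro differentiable_diff) (auto intro: smooth_differentiable smooth_alg_smooth h_alg)
        show "(flat_exp 1 1 has_real_derivative flat_exp 1 (monom 1 2) (\<delta> - h x)) (at (\<delta> - h x))"
          using flat_exp_deriv[of 1 1] by simp
      qed
      also have "partial k (\<lambda>x. \<delta> - h x) x = - partial k h x"
        by (subst partial_diff) (auto intro: smooth_differentiable smooth_alg_smooth h_alg)
      finally show ?thesis by simp
    qed
    moreover have "\<phi> x = flat_exp 1 1 (\<delta> - h x)" using s1[OF that] by (simp add: \<phi>_def)
    ultimately show ?thesis
      by (simp add: dflux_def divq_def sum.distrib sum_distrib_left sum_distrib_right sum_negf sum_subtractf algebra_simps)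
  qed
  have neg: "dflux q \<phi> x < 0" if "0 < d x" "h x < \<delta>" for x
  proof -
    have x: "x \<in> cball x0 \<eta>" by (rule in_ball) (use that \<kappa>(1) in auto)
    have xn: "norm (x - x0) \<le> \<eta>" using x by (simp add: dist_norm norm_minus_commute)
    have "(\<Sum>k\<in>UNIV. q x $ k * partial k h x) = C * (q x \<bullet> \<nu>) + 2 * (q x \<bullet> (x - x0))"
      by (simp add: partial_h inner_vec_def sum.distrib sum_distrib_left sum_subtractf algebra_simps)
    moreover have "C * (q x \<bullet> \<nu>) \<ge> C * (c / 2)"
      using \<eta>0(2)[of x] x \<eta>(2) C0 by (intro mult_left_mono) (auto simp: dist_commute)
    moreover have "C * (c / 2) = 1 + 2 * \<eta> * B" using c0 by (simp add: C_def)
    moreover have "\<bar>q x \<bullet> (x - x0)\<bar> \<le> \<eta> * B"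
    proof -
      have "\<bar>q x \<bullet> (x - x0)\<bar> \<le> norm (q x) * norm (x - x0)" by (rule Cauchy_Schwarz_ineq2)
      also have "\<dots> \<le> B * \<eta>" using B(2)[OF x] xn B(1) by (intro mult_mono) auto
      finally show ?thesis by (simp add: mult.commute)
    qed
    ultimately have g: "1 \<le> (\<Sum>k\<in>UNIV. q x $ k * partial k h x)" by linarith
    define t where "t = \<delta> - h x"
    have "0 \<le> h x" unfolding h_def using that(1) C0 by simp
    then have t: "0 < t" "t \<le> \<delta>" using that by (auto simp: t_def)
    have "B' < 1 / t\<^sup>2"
    proof -
      have "B' + 1 \<le> 1 / \<delta>" using \<delta>(1,4) B'(1) by (simp add: field_simps)
      also have "\<dots> \<le> 1 / t" using t by (simp add: frac_le)
      also have "\<dots> \<le> 1 / t\<^sup>2" using t \<delta>(3) by (simp add: power2_eq_square frac_le mult_le_one)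
      finally show ?thesis by simp
    qed
    moreover have "divq x \<le> B'" using B'(2)[OF x] by (simp add: abs_le_iff)
    moreover have "1 / t\<^sup>2 \<le> 1 / t\<^sup>2 * (\<Sum>k\<in>UNIV. q x $ k * partial k h x)"
      using mult_left_mono[OF g, of "1 / t\<^sup>2"] by simp
    ultimately have "divq x - 1 / t\<^sup>2 * (\<Sum>k\<in>UNIV. q x $ k * partial k h x) < 0" by linarith
    moreover have "dflux q \<phi> x = exp (- 1 / t) * (divq x - 1 / t\<^sup>2 * (\<Sum>k\<in>UNIV. q x $ k * partial k h x))"
      unfolding flux_eq[OF that(1)] t_def[symmetric] using t
      by (simp add: flat_exp_def poly_monom power_one_over algebra_simps)
    ultimately show ?thesis by (simp add: mult_less_0_iff)
  qed
  have nonpos: "dflux q \<phi> x \<le> 0" if "0 < d x" for x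
  proof (cases "h x < \<delta>")
    case False
    then show ?thesis using flux_eq[OF that] by (simp add: flat_exp_def)
  qed (use neg that in force)
  have int: "integrable lborel (\<lambda>x. - (indicator {x. 0 < d x} x * dflux q \<phi> x))"
    using integrable_mult_indicator[of "{x. 0 < d x}" lborel "dflux q \<phi>"] dflux_props(2)[OF q tf] open_pos by simp
  have "(\<integral>x. - (indicator {x. 0 < d x} x * dflux q \<phi> x) \<partial>lborel) = 0"
    using flux[OF tf] by (simp add: d_def)
  then have "AE x in lborel. - (indicator {x. 0 < d x} x * dflux q \<phi> x) = 0"
    using nonpos by (subst (asm) integral_nonneg_eq_0_iff_AE[OF int]) (auto simp: indicator_def)
  then have ae: "AE x in lborel. x \<in> - ({x. 0 < d x} \<inter> {x. h x < \<delta>})"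
    by eventually_elim (use neg in \<open>force simp: indicator_def\<close>)
  have op: "open ({x. 0 < d x} \<inter> {x. h x < \<delta>})"
    using smooth_alg_smooth[OF h_alg]
    by (intro open_Int open_pos open_Collect_less continuous_intros smooth_continuous_on)
  have all: "x \<in> - ({x. 0 < d x} \<inter> {x. h x < \<delta>})" for x
    by (rule mem_closed_if_AE_lebesgue[OF _ AE_completion[OF ae]]) (use op in \<open>simp only: closed_open double_complement\<close>)
  have "\<nu> \<noteq> 0" using pos by auto
  \<comment> \<open>The set where the integrand is strictly negative is open and null, hence empty;
    yet it contains \<open>x0 + s \<nu>\<close> for all small \<open>s > 0\<close>.\<close>
  define y where "y s = x0 + s *\<^sub>R \<nu>" for s :: real
  have dy: "d (y s) = s * (\<nu> \<bullet> \<nu>)" for s by (simp add: d_def y_def)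
  have "h (y s) = s * (C * (\<nu> \<bullet> \<nu>) + s * (\<nu> \<bullet> \<nu>))" for s by (simp add: h_def dy) (simp add: y_def algebra_simps)
  then have "((\<lambda>s. h (y s)) \<longlongrightarrow> 0 * (C * (\<nu> \<bullet> \<nu>) + 0 * (\<nu> \<bullet> \<nu>))) (at_right 0)"
    by (simp only:) (intro tendsto_intros)
  then have "\<forall>\<^sub>F s in at_right 0. h (y s) < \<delta>" using \<delta>(1) by (intro order_tendstoD(2)[where y=0]) auto
  moreover have "\<forall>\<^sub>F s in at_right 0. 0 < d (y s)"
    using \<open>\<nu> \<noteq> 0\<close> by (auto simp: dy eventually_at_filter)
  ultimately have "\<forall>\<^sub>F s in at_right (0::real). False"
    by eventually_elim (use all in auto)
  then show False by simp
qed

text \<open>The integral of \<open>dflux q \<phi>\<close> over the whole space is 0, so subtracting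
  it leaves the flux of \<open>p - q\<close> on the half space alone. The one-sided result for
  \<open>p - q\<close> and for \<open>q - p\<close> excludes both signs of the normal
  component.\<close>

lemma normal_component_jump:
  fixes p q :: "real^3 \<Rightarrow> real^3"
  assumes p: "\<And>k. smooth (\<lambda>x. p x $ k)" and q: "\<And>k. smooth (\<lambda>x. q x $ k)" and \<rho>: "0 < \<rho>"
    and flux: "\<And>\<phi>. test_fun (ball x0 \<rho>) \<phi> \<Longrightarrow>
      (\<integral>x. (if 0 < \<nu> \<bullet> (x - x0) then dflux p \<phi> x else dflux q \<phi> x) \<partial>lborel) = 0"
  shows "p x0 \<bullet> \<nu> = q x0 \<bullet> \<nu>"
proof -
  let ?H = "{x. 0 < \<nu> \<bullet> (x - x0)}"
  have H: "open ?H" by (intro open_Collect_less continuous_intros)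
  have lin: "dflux (\<lambda>x. v x - w x) \<phi> x = dflux v \<phi> x - dflux w \<phi> x"
    if "\<And>k. smooth (\<lambda>x. v x $ k)" "\<And>k. smooth (\<lambda>x. w x $ k)" for v w \<phi> x
    using that by (simp add: dflux_def partial_diff smooth_differentiable algebra_simps sum_subtractf sum.distrib)
  have main: "\<not> 0 < (v x0 - w x0) \<bullet> \<nu>"
    if v: "\<And>k. smooth (\<lambda>x. v x $ k)" and w: "\<And>k. smooth (\<lambda>x. w x $ k)" and
      z: "\<And>\<phi>. test_fun (ball x0 \<rho>) \<phi> \<Longrightarrow> (\<integral>x. indicator ?H x * (dflux v \<phi> x - dflux w \<phi> x) \<partial>lborel) = 0" for v w
  proof (rule normal_component_not_pos[of "\<lambda>x. v x - w x", OF _ \<rho>])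
    show "smooth (\<lambda>x. (v x - w x) $ k)" for k
      using smooth_diff(1)[OF v[of k] w[of k]] by simp
    fix \<phi> :: "real^3 \<Rightarrow> real" assume "test_fun (ball x0 \<rho>) \<phi>"
    from z[OF this] show "(\<integral>x. indicator ?H x * dflux (\<lambda>x. v x - w x) \<phi> x \<partial>lborel) = 0"
      by (simp add: lin v w)
  qed
  have zero: "(\<integral>x. indicator ?H x * (dflux p \<phi> x - dflux q \<phi> x) \<partial>lborel) = 0" if t: "test_fun (ball x0 \<rho>) \<phi>" for \<phi>
  proof -
    note ip = dflux_props(2,3)[OF p t] and iq = dflux_props(2,3)[OF q t]
    have i: "integrable lborel (\<lambda>x. indicator ?H x * (dflux p \<phi> x - dflux q \<phi> x))"
      using integrable_mult_indicator[of ?H lborel "\<lambda>x. dflux p \<phi> x - dflux q \<phi> x"] ip(1) iq(1) H by simp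
    have "0 = (\<integral>x. (if 0 < \<nu> \<bullet> (x - x0) then dflux p \<phi> x else dflux q \<phi> x) \<partial>lborel)"
      by (rule flux[OF t, symmetric])
    also have "\<dots> = (\<integral>x. indicator ?H x * (dflux p \<phi> x - dflux q \<phi> x) + dflux q \<phi> x \<partial>lborel)"
      by (intro Bochner_Integration.integral_cong) (auto simp: indicator_def)
    also have "\<dots> = (\<integral>x. indicator ?H x * (dflux p \<phi> x - dflux q \<phi> x) \<partial>lborel)"
      using i iq by simp
    finally show ?thesis ..
  qed
  have "\<not> 0 < (p x0 - q x0) \<bullet> \<nu>" by (rule main[OF p q zero])
  moreover have "\<not> 0 < (q x0 - p x0) \<bullet> \<nu>"
  proof (rule main[OF q p])
    fix \<phi> :: "real^3 \<Rightarrow> real" assume "test_fun (ball x0 \<rho>) \<phi>"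
    then have "(\<integral>x. - (indicator ?H x * (dflux p \<phi> x - dflux q \<phi> x)) \<partial>lborel) = 0" by (simp add: zero)
    then show "(\<integral>x. indicator ?H x * (dflux q \<phi> x - dflux p \<phi> x) \<partial>lborel) = 0"
      by (simp add: algebra_simps)
  qed
  ultimately show ?thesis by (simp add: inner_diff_left)
qed

section \<open>Geometry of the Alfeld split\<close>

lemma interior_halfspaces:
  fixes A :: "'i::finite \<Rightarrow> real^3"
  assumes "\<And>i. A i \<noteq> 0"
  shows "interior {x. \<forall>i. 0 \<le> A i \<bullet> x + B i} = {x. \<forall>i. 0 < A i \<bullet> x + B i}"
proof
  have "open (\<Inter>i. {x. 0 < A i \<bullet> x + B i})"
    by (intro open_INT ballI open_Collect_less continuous_intros) simp
  moreover have "(\<Inter>i. {x. 0 < A i \<bullet> x + B i}) = {x. \<forall>i. 0 < A i \<bullet> x + B i}" by auto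
  ultimately show "{x. \<forall>i. 0 < A i \<bullet> x + B i} \<subseteq> interior {x. \<forall>i. 0 \<le> A i \<bullet> x + B i}"
    by (intro interior_maximal) (auto intro: less_imp_le)
  show "interior {x. \<forall>i. 0 \<le> A i \<bullet> x + B i} \<subseteq> {x. \<forall>i. 0 < A i \<bullet> x + B i}"
  proof (rule subsetI, unfold mem_Collect_eq, rule allI)
    fix x i assume "x \<in> interior {x. \<forall>i. 0 \<le> A i \<bullet> x + B i}"
    then obtain e where e: "0 < e" "ball x e \<subseteq> {x. \<forall>i. 0 \<le> A i \<bullet> x + B i}" by (auto simp: mem_interior)
    define y where "y = x - (e / (2 * norm (A i))) *\<^sub>R A i"
    have "dist x y < e" using e(1) assms[of i] by (simp add: y_def dist_norm)
    then have "0 \<le> A i \<bullet> y + B i" using e(2) by auto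
    moreover have "A i \<bullet> y = A i \<bullet> x - e / 2 * norm (A i)"
      using assms[of i] by (simp add: y_def inner_diff_right dot_square_norm power2_eq_square)
    moreover have "0 < e / 2 * norm (A i)" using e(1) assms[of i] by simp
    ultimately show "0 < A i \<bullet> x + B i" by linarith
  qed
qed

lemma all_if_eq: "(\<forall>j. R (if j = i then p else q j)) \<longleftrightarrow> R p \<and> (\<forall>j. j \<noteq> i \<longrightarrow> R (q j))"
  by metis

lemma ex_other_index: "\<exists>k::4. k \<noteq> i"
  by (metis one_neq_zero)

lemma sum_mult_delta:
  fixes t c :: "'i \<Rightarrow> real"
  assumes "finite A"
  shows "(\<Sum>m\<in>A. t m * (if m = j then c m else 0)) = (if j \<in> A then t j * c j else 0)"
    "(\<Sum>m\<in>A. t m * (if j = m then c m else 0)) = (if j \<in> A then t j * c j else 0)"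
proof -
  have "(\<Sum>m\<in>A. t m * (if m = j then c m else 0)) = (\<Sum>m\<in>A. if m = j then t j * c j else 0)"
    by (rule sum.cong) auto
  then show *: "(\<Sum>m\<in>A. t m * (if m = j then c m else 0)) = (if j \<in> A then t j * c j else 0)"
    using assms by simp
  show "(\<Sum>m\<in>A. t m * (if j = m then c m else 0)) = (if j \<in> A then t j * c j else 0)"
    unfolding eq_commute[of j] by (rule *)
qed

lemma sum_option_UNIV:
  "(\<Sum>m\<in>(UNIV::('i::finite) option set). f m) = f None + (\<Sum>i\<in>UNIV. f (Some i))"
  by (simp add: UNIV_option_conv sum.reindex)

locale alfeld_split =
  fixes X :: "4 \<Rightarrow> real^3" and z :: "real^3"
  assumes nondeg: "nondegenerate X" and z: "z \<in> interior (tet X)"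
begin

section \<open>Barycentric coordinates\<close>

text \<open>Seen from a vertex \<open>X k\<close> with \<open>k \<noteq> i\<close>, the edge vectors
  are independent. The functional that is 1 on the edge to \<open>X i\<close> and 0 on the others,
  shifted to vanish at \<open>X k\<close>, is the coordinate of index \<open>i\<close>.\<close>

lemma ex_barycentric:
  "\<exists>(g :: 4 \<Rightarrow> real^3) h. (\<forall>i j. g i \<bullet> X j + h i = (if i = j then 1 else 0))"
proof -
  have inj: "inj X" and ind: "\<not> affine_dependent (range X)"
    using nondeg by (auto simp: nondegenerate_def)
  have "\<exists>(g :: real^3) h. \<forall>j. g \<bullet> X j + h = (if i = j then 1 else 0)" for i
  proof -
    obtain k where k: "k \<noteq> i" using ex_other_index by blast
    have "independent ((\<lambda>x. x - X k) ` (range X - {X k}))"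
      using ind affine_dependent_iff_dependent2[of "X k" "range X", OF rangeI] by simp
    from linear_independent_extend[OF this, of "\<lambda>v. if v = X i - X k then 1 else (0::real)"]
    obtain f :: "real^3 \<Rightarrow> real" where f: "linear f"
      "\<And>v. v \<in> (\<lambda>x. x - X k) ` (range X - {X k}) \<Longrightarrow> f v = (if v = X i - X k then 1 else 0)" by blast
    have fe: "f v = (\<chi> n. f (axis n 1)) \<bullet> v" for v
    proof -
      have "f v = f (\<Sum>n\<in>UNIV. (v $ n) *\<^sub>R axis n 1)"
        using basis_expansion[of v] by (simp add: scalar_mult_eq_scaleR)
      then show ?thesis by (simp add: linear_sum[OF f(1)] linear_scale[OF f(1)] inner_vec_def mult.commute)
    qed
    have "f (X j - X k) = (if i = j then 1 else 0)" for j
    proof (cases "j = k")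
      case True
      then show ?thesis using k linear_0[OF f(1)] by simp
    next
      case False
      then have "X j \<noteq> X k" using inj by (auto dest: injD)
      then have "f (X j - X k) = (if X j - X k = X i - X k then 1 else 0)" by (intro f(2)) auto
      then show ?thesis using inj by (auto dest: injD)
    qed
    then have "\<forall>j. (\<chi> n. f (axis n 1)) \<bullet> X j + - ((\<chi> n. f (axis n 1)) \<bullet> X k) = (if i = j then 1 else 0)"
      using fe[of "X j - X k" for j] by (simp add: inner_diff_right)
    then show ?thesis by blast
  qed
  then show ?thesis by metis
qed

definition bary :: "(4 \<Rightarrow> real^3) \<times> (4 \<Rightarrow> real)" where
  "bary = (SOME gh. \<forall>i j. fst gh i \<bullet> X j + snd gh i = (if i = j then 1 else 0))"

definition lam :: "4 \<Rightarrow> real^3 \<Rightarrow> real" where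
  "lam i x = fst bary i \<bullet> x + snd bary i"

lemma lam_X: "lam i (X j) = (if i = j then 1 else 0)"
proof -
  have "\<exists>gh::(4 \<Rightarrow> real^3) \<times> (4 \<Rightarrow> real). \<forall>i j. fst gh i \<bullet> X j + snd gh i = (if i = j then 1 else 0)"
    using ex_barycentric by auto
  from someI_ex[OF this] show ?thesis unfolding lam_def bary_def by blast
qed

lemma lam_combination:
  assumes "sum u I = 1"
  shows "lam i (\<Sum>k\<in>I. u k *\<^sub>R v k) = (\<Sum>k\<in>I. u k * lam i (v k))"
proof -
  have "(\<Sum>k\<in>I. u k * lam i (v k)) = (\<Sum>k\<in>I. u k * (fst bary i \<bullet> v k)) + (\<Sum>k\<in>I. u k) * snd bary i"
    by (simp add: lam_def distrib_left sum.distrib sum_distrib_right)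
  then show ?thesis by (simp add: lam_def inner_sum_right assms)
qed

lemma bary_repr: "(\<Sum>i\<in>UNIV. lam i x) = 1" "(\<Sum>i\<in>UNIV. lam i x *\<^sub>R X i) = x"
proof -
  have inj: "inj X" and ind: "\<not> affine_dependent (range X)"
    using nondeg by (auto simp: nondegenerate_def)
  have "card (range X) = Suc DIM(real^3)" using card_image[OF inj] by simp
  then have "affine hull (range X) = UNIV" using affine_independent_span_eq[OF ind] by blast
  then have "x \<in> affine hull (range X)" by simp
  then obtain u where u: "sum u (range X) = 1" "(\<Sum>v\<in>range X. u v *\<^sub>R v) = x"
    by (subst (asm) affine_hull_finite) auto
  then have u': "(\<Sum>i\<in>UNIV. u (X i)) = 1" "(\<Sum>i\<in>UNIV. u (X i) *\<^sub>R X i) = x"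
    by (simp_all add: sum.reindex[OF inj])
  have "lam i x = u (X i)" for i
    using lam_combination[OF u'(1), of i X] by (simp add: u'(2) lam_X if_distrib[of "\<lambda>t. _ * t"] cong: if_cong)
  with u' show "(\<Sum>i\<in>UNIV. lam i x) = 1" "(\<Sum>i\<in>UNIV. lam i x *\<^sub>R X i) = x" by simp_all
qed

lemma bary_nonzero: "fst bary i \<noteq> 0"
proof
  assume 0: "fst bary i = 0"
  have "lam i x = snd bary i" for x by (simp add: lam_def 0)
  moreover obtain k where "k \<noteq> i" using ex_other_index by blast
  ultimately show False using lam_X[of i i] lam_X[of i k] by simp
qed

lemma mem_convex_hull_image:
  fixes v :: "'i::finite \<Rightarrow> 'a::real_vector"
  shows "x \<in> convex hull (v ` I) \<longleftrightarrow> (\<exists>u. (\<forall>i\<in>I. 0 \<le> u i) \<and> sum u I = 1 \<and> (\<Sum>i\<in>I. u i *\<^sub>R v i) = x)"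
proof
  assume "x \<in> convex hull (v ` I)"
  then show "\<exists>u. (\<forall>i\<in>I. 0 \<le> u i) \<and> sum u I = 1 \<and> (\<Sum>i\<in>I. u i *\<^sub>R v i) = x"
  proof -
    have "convex hull (v ` I) \<subseteq> {x. \<exists>u. (\<forall>i\<in>I. 0 \<le> u i) \<and> sum u I = 1 \<and> (\<Sum>i\<in>I. u i *\<^sub>R v i) = x}"
  proof (intro hull_minimal subsetI, unfold mem_Collect_eq)
    fix y assume "y \<in> v ` I"
    then obtain k where k: "k \<in> I" "y = v k" by blast
    then show "\<exists>u. (\<forall>i\<in>I. 0 \<le> u i) \<and> sum u I = 1 \<and> (\<Sum>i\<in>I. u i *\<^sub>R v i) = y"
      by (intro exI[of _ "\<lambda>i. if i = k then 1 else 0"])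
        (simp add: if_distrib[of "\<lambda>t. t *\<^sub>R _"] cong: if_cong)
  next
    show "convex {x. \<exists>u. (\<forall>i\<in>I. 0 \<le> u i) \<and> sum u I = 1 \<and> (\<Sum>i\<in>I. u i *\<^sub>R v i) = x}"
    proof (rule convexI, unfold mem_Collect_eq, elim exE conjE)
      fix x y :: 'a and a b :: real and s t
      assume "0 \<le> a" "0 \<le> b" "a + b = 1" "\<forall>i\<in>I. 0 \<le> s i" "sum s I = 1" "(\<Sum>i\<in>I. s i *\<^sub>R v i) = x"
        "\<forall>i\<in>I. 0 \<le> t i" "sum t I = 1" "(\<Sum>i\<in>I. t i *\<^sub>R v i) = y"
      then show "\<exists>u. (\<forall>i\<in>I. 0 \<le> u i) \<and> sum u I = 1 \<and> (\<Sum>i\<in>I. u i *\<^sub>R v i) = a *\<^sub>R x + b *\<^sub>R y"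
        by (intro exI[of _ "\<lambda>i. a * s i + b * t i"])
          (auto simp: sum.distrib sum_distrib_left[symmetric] scaleR_left_distrib scaleR_scaleR[symmetric]
            scaleR_sum_right[symmetric] simp del: scaleR_scaleR)
    qed
  qed
  with \<open>x \<in> convex hull (v ` I)\<close> show ?thesis by auto
  qed
next
  assume "\<exists>u. (\<forall>i\<in>I. 0 \<le> u i) \<and> sum u I = 1 \<and> (\<Sum>i\<in>I. u i *\<^sub>R v i) = x"
  then obtain u where "\<forall>i\<in>I. 0 \<le> u i" "sum u I = 1" "(\<Sum>i\<in>I. u i *\<^sub>R v i) = x" by blast
  then show "x \<in> convex hull (v ` I)"
    using convex_sum[of I "convex hull (v ` I)" u v] by (auto simp: hull_inc)
qed

lemma tet_eq_lam: "tet X = {x. \<forall>i. 0 \<le> lam i x}"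
proof (intro set_eqI iffI)
  fix x assume "x \<in> tet X"
  then obtain u where u: "\<forall>i. 0 \<le> u i" "sum u UNIV = 1" "(\<Sum>i\<in>UNIV. u i *\<^sub>R X i) = x"
    unfolding tet_def mem_convex_hull_image by auto
  then show "x \<in> {x. \<forall>i. 0 \<le> lam i x}"
    using lam_combination[OF u(2), of _ X] by (simp add: u(3) lam_X if_distrib[of "\<lambda>t. _ * t"] cong: if_cong)
next
  fix x assume "x \<in> {x. \<forall>i. 0 \<le> lam i x}"
  then show "x \<in> tet X"
    unfolding tet_def mem_convex_hull_image using bary_repr by (intro exI[of _ "\<lambda>i. lam i x"]) auto
qed

definition cz :: "4 \<Rightarrow> real" where "cz i = lam i z"

lemma cz_pos: "0 < cz i"
  using z interior_halfspaces[of "fst bary" "snd bary"] bary_nonzero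
  unfolding tet_eq_lam cz_def lam_def by auto

text \<open>Besides the four affine functions \<open>lam i / lam i z\<close>, the zero function plays the role of the
  exterior of \<open>T\<close>: vanishing on \<open>\<partial>T\<close> is continuity across the faces \<open>L (Some i) = L None\<close>.\<close>
definition av :: "4 option \<Rightarrow> real^3" where
  "av m = (case m of None \<Rightarrow> 0 | Some i \<Rightarrow> (1 / cz i) *\<^sub>R fst bary i)"

definition bv :: "4 option \<Rightarrow> real" where
  "bv m = (case m of None \<Rightarrow> 0 | Some i \<Rightarrow> snd bary i / cz i)"

definition L :: "4 option \<Rightarrow> real^3 \<Rightarrow> real" where
  "L m x = av m \<bullet> x + bv m"

section \<open>The 4-simplex over the split\<close>

text \<open>The points \<open>(vt m, sv m)\<close>, with \<open>z\<close> at height 1 and the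
  \<open>X i\<close> at height 0, are the vertices of a 4-simplex. The factor \<open>kap m\<close>
  normalizes \<open>L m x - s\<close> to the barycentric coordinate of \<open>(x, s)\<close> at the
  vertex with index \<open>m\<close>.\<close>

definition vt :: "4 option \<Rightarrow> real^3" where
  "vt m = (case m of None \<Rightarrow> z | Some i \<Rightarrow> X i)"

definition kap :: "4 option \<Rightarrow> real" where
  "kap m = (case m of None \<Rightarrow> -1 | Some i \<Rightarrow> cz i)"

definition sv :: "4 option \<Rightarrow> real" where
  "sv m = (case m of None \<Rightarrow> 1 | Some i \<Rightarrow> 0)"

lemma L_None [simp]: "L None x = 0"
  by (simp add: L_def av_def bv_def)

lemma av_None [simp]: "av None = 0"
  by (simp add: av_def)

lemma L_Some: "L (Some i) x = lam i x / cz i"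
  using cz_pos[of i] by (simp add: L_def av_def bv_def lam_def add_divide_distrib)

lemma kap_nonzero: "kap m \<noteq> 0"
  using cz_pos by (cases m) (auto simp: kap_def less_le)

lemma L_vt: "L m (vt n) = sv n + (if m = n then 1 / kap m else 0)"
proof -
  have "lam i z \<noteq> 0" for i using cz_pos[of i] by (simp add: cz_def)
  then show ?thesis by (cases m; cases n) (auto simp: L_Some lam_X vt_def kap_def sv_def cz_def)
qed

lemma L_combination:
  assumes "sum u I = 1"
  shows "L m (\<Sum>k\<in>I. u k *\<^sub>R v k) = (\<Sum>k\<in>I. u k * L m (v k))"
proof -
  have "(\<Sum>k\<in>I. u k * L m (v k)) = (\<Sum>k\<in>I. u k * (av m \<bullet> v k)) + (\<Sum>k\<in>I. u k) * bv m"
    by (simp add: L_def distrib_left sum.distrib sum_distrib_right)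
  then show ?thesis by (simp add: L_def inner_sum_right assms)
qed

lemma kap_L: "kap (Some i) * (L (Some i) x - s) = lam i x - s * cz i"
  using cz_pos[of i] by (simp add: kap_def L_Some field_simps)

lemma kap_sum: "(\<Sum>m\<in>UNIV. kap m * (L m x - s)) = 1"
  by (simp add: sum_option_UNIV kap_L sum_subtractf bary_repr sum_distrib_left[symmetric] cz_def)
     (simp add: kap_def)

lemma kap_sum_vt: "(\<Sum>m\<in>UNIV. (kap m * (L m x - s)) *\<^sub>R vt m) = x"
proof -
  have "(\<Sum>i\<in>UNIV. (lam i x - s * cz i) *\<^sub>R X i) = x - s *\<^sub>R z"
    by (simp add: scaleR_left_diff_distrib sum_subtractf bary_repr cz_def
        scaleR_scaleR[symmetric] scaleR_sum_right[symmetric] del: scaleR_scaleR)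
  then show ?thesis
    by (simp add: sum_option_UNIV kap_L vt_def) (simp add: kap_def)
qed

text \<open>The two hypotheses make the combination of the \<open>L m\<close> with weights
  \<open>t m\<close> constant. Its value at \<open>vt j\<close> is \<open>t j / kap j\<close> for
  \<open>j\<close> in \<open>A\<close> and 0 otherwise, so an index \<open>n\<close> missing from
  \<open>A\<close> forces every weight to vanish.\<close>

lemma av_independent:
  assumes "(\<Sum>m\<in>A. t m *\<^sub>R av m) = 0" "(\<Sum>m\<in>A. t m) = 0" "n \<notin> A" "k \<in> A"
  shows "t k = 0"
proof -
  have fin: "finite A" by simp
  have const: "(\<Sum>m\<in>A. t m * L m x) = (\<Sum>m\<in>A. t m * bv m)" for x
  proof -
    have "(\<Sum>m\<in>A. t m * (av m \<bullet> x)) = (\<Sum>m\<in>A. t m *\<^sub>R av m) \<bullet> x" by (simp add: inner_sum_left)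
    then show ?thesis using assms(1) by (simp add: L_def distrib_left sum.distrib)
  qed
  have "(\<Sum>m\<in>A. t m * L m (vt j)) = (if j \<in> A then t j / kap j else 0)" for j
  proof -
    have "(\<Sum>m\<in>A. t m * L m (vt j)) = (\<Sum>m\<in>A. t m) * sv j + (\<Sum>m\<in>A. t m * (if m = j then 1 / kap m else 0))"
      by (simp add: L_vt distrib_left sum.distrib sum_distrib_right)
    then show ?thesis using fin by (simp add: assms(2) sum_mult_delta)
  qed
  from this[of k] this[of n] show ?thesis using const assms(3,4) kap_nonzero[of k] by simp
qed

lemma av_neq: "m \<noteq> n \<Longrightarrow> av m \<noteq> av n"
proof
  assume mn: "m \<noteq> n" and eq: "av m = av n"
  obtain k where "k \<notin> {m, n}"
  proof -
    have "card (UNIV :: 4 option set) = 5" by (simp add: card_UNIV_option)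
    then have "{m, n} \<noteq> UNIV" using card_insert_le_m1[of 2 "{n}" m] by (metis card_2_iff mn numeral_eq_iff semiring_norm(85) semiring_norm(89))
    then show ?thesis using that by blast
  qed
  then have "(1::real) = 0"
    using av_independent[of "\<lambda>j. if j = m then 1 else -1" "{m,n}" k m] mn eq by simp
  then show False by simp
qed

text \<open>Among five indices one lies outside the triple, so the three gradients are affinely
  independent; the weights here are \<open>s\<close>, \<open>t - s\<close> and
  \<open>- t\<close>.\<close>

lemma av_triple_diff:
  assumes d: "m \<noteq> n" "n \<noteq> k" "m \<noteq> k" and e: "s *\<^sub>R (av m - av n) + t *\<^sub>R (av n - av k) = 0"
  shows "s = 0 \<and> t = 0"
proof -
  obtain j where j: "j \<notin> {m, n, k}"
  proof -
    have "card (UNIV :: 4 option set) = 5" by (simp add: card_UNIV_option)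
    moreover have "card {m, n, k} \<le> 3" by (simp add: card_insert_if)
    ultimately have "{m, n, k} \<noteq> UNIV" by auto
    then show ?thesis using that by blast
  qed
  let ?t = "\<lambda>j. if j = m then s else if j = n then t - s else - t"
  have 1: "(\<Sum>i\<in>{m,n,k}. ?t i *\<^sub>R av i) = 0" using d e by (simp add: algebra_simps)
  have 2: "(\<Sum>i\<in>{m,n,k}. ?t i) = 0" using d by simp
  show ?thesis using av_independent[OF 1 2 j, of m] av_independent[OF 1 2 j, of k] d by auto
qed

section \<open>Cells, faces and vertices described by inequalities\<close>

lemma tet_eq: "tet X = {x. \<forall>i. 0 \<le> L (Some i) x}"
  unfolding tet_eq_lam L_Some using cz_pos by (auto simp: zero_le_divide_iff less_imp_le not_le[symmetric])

lemma interior_tet: "interior (tet X) = {x. \<forall>i. 0 < L (Some i) x}"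
  unfolding tet_eq L_def by (rule interior_halfspaces) (metis av_None av_neq option.distinct(1))

text \<open>With \<open>s = L (Some i) x\<close> the barycentric coordinate of \<open>(x, s)\<close>
  at \<open>Some i\<close> vanishes, so the other four are the coordinates of \<open>x\<close> with
  respect to \<open>z\<close> and the \<open>X j\<close>, \<open>j \<noteq> i\<close>. The
  coordinate at \<open>z\<close> is \<open>s\<close> itself, and the others are positive multiples
  of \<open>L (Some j) x - s\<close>.\<close>

lemma subtet_eq: "subtet X z i = {x. 0 \<le> L (Some i) x \<and> (\<forall>j. L (Some i) x \<le> L (Some j) x)}"
proof -
  have im: "insert z (X ` (UNIV - {i})) = vt ` (UNIV - {Some i})"
  proof -
    have "UNIV - {Some i} = insert None (Some ` (UNIV - {i}))"
    proof (rule set_eqI)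
      fix m show "m \<in> UNIV - {Some i} \<longleftrightarrow> m \<in> insert None (Some ` (UNIV - {i}))" by (cases m) auto
    qed
    then show ?thesis by (simp add: vt_def image_image)
  qed
  show ?thesis
  proof (intro set_eqI iffI)
    fix x assume "x \<in> subtet X z i"
    then obtain u where u: "\<forall>m\<in>UNIV - {Some i}. 0 \<le> u m" "sum u (UNIV - {Some i}) = 1"
      "(\<Sum>m\<in>UNIV - {Some i}. u m *\<^sub>R vt m) = x"
      unfolding subtet_def im mem_convex_hull_image by blast
    have e: "L (Some j) x = u None + (if j = i then 0 else u (Some j) / cz j)" for j
    proof -
      have "L (Some j) x = (\<Sum>m\<in>UNIV - {Some i}. u m * L (Some j) (vt m))"
        using L_combination[OF u(2), of "Some j" vt] u(3) by simp
      also have "\<dots> = (\<Sum>m\<in>UNIV - {Some i}. u m * sv m) + (\<Sum>m\<in>UNIV - {Some i}. u m * (if Some j = m then 1 / kap (Some j) else 0))"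
        by (simp add: L_vt distrib_left sum.distrib)
      also have "(\<Sum>m\<in>UNIV - {Some i}. u m * sv m) = (\<Sum>m\<in>UNIV - {Some i}. u m * (if m = None then 1 else 0))"
        by (intro sum.cong) (auto simp: sv_def split: option.splits)
      finally show ?thesis by (auto simp: kap_def sum_mult_delta)
    qed
    show "x \<in> {x. 0 \<le> L (Some i) x \<and> (\<forall>j. L (Some i) x \<le> L (Some j) x)}"
      using u(1) cz_pos by (auto simp: e intro!: divide_nonneg_pos)
  next
    fix x assume x: "x \<in> {x. 0 \<le> L (Some i) x \<and> (\<forall>j. L (Some i) x \<le> L (Some j) x)}"
    let ?s = "L (Some i) x"
    let ?u = "\<lambda>m. kap m * (L m x - ?s)"
    have "?u (Some i) = 0" by simp
    then have "sum ?u (UNIV - {Some i}) = 1" "(\<Sum>m\<in>UNIV - {Some i}. ?u m *\<^sub>R vt m) = x"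
      using kap_sum[of x ?s] kap_sum_vt[of x ?s] by (simp_all add: sum.remove[of UNIV "Some i"] del: sum_option_UNIV)
    moreover have "0 \<le> ?u m" for m
      using x cz_pos by (cases m) (auto simp: kap_def less_imp_le)
    ultimately show "x \<in> subtet X z i"
      unfolding subtet_def im mem_convex_hull_image by (intro exI[of _ ?u]) simp
  qed
qed

text \<open>The open cells are pairwise disjoint and cover T up to the planes
  \<open>L m = L l\<close>. Almost-everywhere statements are phrased on them, so values on faces
  never have to be chosen.\<close>

definition cell :: "4 \<Rightarrow> (real^3) set" where
  "cell i = interior (subtet X z i)"

lemma cell_eq: "cell i = {x. 0 < L (Some i) x \<and> (\<forall>j. j \<noteq> i \<longrightarrow> L (Some i) x < L (Some j) x)}"
proof -
  let ?A = "\<lambda>j. if j = i then av (Some i) else av (Some j) - av (Some i)"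
  let ?B = "\<lambda>j. if j = i then bv (Some i) else bv (Some j) - bv (Some i)"
  have "av (Some j) \<noteq> av (Some i)" if "j \<noteq> i" for j using av_neq that by auto
  moreover have "av (Some i) \<noteq> 0" using av_neq[of "Some i" None] by simp
  ultimately have nz: "?A j \<noteq> 0" for j by auto
  have e: "?A j \<bullet> x + ?B j = (if j = i then L (Some i) x else L (Some j) x - L (Some i) x)" for j x
    by (simp add: L_def inner_diff_left)
  have "subtet X z i = {x. \<forall>j. 0 \<le> ?A j \<bullet> x + ?B j}"
  proof -
    have "(\<forall>j. L (Some i) x \<le> L (Some j) x) \<longleftrightarrow> (\<forall>j. j \<noteq> i \<longrightarrow> 0 \<le> L (Some j) x - L (Some i) x)" for x
      by (metis diff_ge_0_iff_ge order_refl)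
    then show ?thesis unfolding e subtet_eq all_if_eq[of "\<lambda>t. 0 \<le> t"] by simp
  qed
  then have "cell i = {x. \<forall>j. 0 < ?A j \<bullet> x + ?B j}"
    unfolding cell_def using interior_halfspaces[of ?A ?B] nz by simp
  then show ?thesis unfolding e all_if_eq[of "\<lambda>t. 0 < t"] by simp
qed

lemma open_cell: "open (cell i)" by (simp add: cell_def)

lemma cell_subset_subtet: "cell i \<subseteq> subtet X z i" by (simp add: cell_def interior_subset)

lemma cell_disjoint: "x \<in> cell i \<Longrightarrow> x \<in> cell j \<Longrightarrow> i = j"
  unfolding cell_eq by (metis (mono_tags, lifting) mem_Collect_eq not_less_iff_gr_or_eq)

lemma subtet_subset_tet: "subtet X z i \<subseteq> tet X"
  unfolding subtet_eq tet_eq by (auto intro: order_trans)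

lemma cell_subset_interior: "cell i \<subseteq> interior (tet X)"
  unfolding cell_def by (rule interior_mono[OF subtet_subset_tet])

lemma cell_nonempty: "cell i \<noteq> {}"
proof -
  define x where "x = (\<Sum>m\<in>UNIV - {Some i}. (1/4) *\<^sub>R vt m)"
  have c: "card (UNIV - {Some i} :: 4 option set) = 4" by (simp add: card_UNIV_option)
  have "L (Some j) x = 1/4 + (if j = i then 0 else 1 / (4 * cz j))" for j
  proof -
    have "L (Some j) x = (\<Sum>m\<in>UNIV - {Some i}. (1/4) * L (Some j) (vt m))"
      unfolding x_def by (rule L_combination) (simp add: c)
    also have "\<dots> = (\<Sum>m\<in>UNIV - {Some i}. (if m = None then 1/4 else 0) + (if m = Some j then 1 / (4 * cz j) else 0))"
      by (intro sum.cong) (auto simp: L_vt sv_def kap_def split: option.splits)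
    finally show ?thesis by (auto simp: sum.distrib)
  qed
  then have "x \<in> cell i" unfolding cell_eq using cz_pos by auto
  then show ?thesis by blast
qed

lemma convex_subtet: "convex (subtet X z i)" unfolding subtet_def by (rule convex_convex_hull)

lemma compact_tet: "compact (tet X)"
  unfolding tet_def by (intro finite_imp_compact_convex_hull) simp

lemma compact_subtet: "compact (subtet X z i)"
  unfolding subtet_def by (intro finite_imp_compact_convex_hull) simp

lemma subtet_closure_cell: "closure (cell i) = subtet X z i"
  using convex_closure_interior[OF convex_subtet, of i] cell_nonempty[of i]
    compact_imp_closed[OF compact_subtet, of i] unfolding cell_def by simp

lemma AE_L_neq: "AE x in lebesgue. \<forall>m n. m \<noteq> n \<longrightarrow> L m x \<noteq> L n x"
proof -
  have "AE x in lebesgue. L m x \<noteq> L n x" if "m \<noteq> n" for m n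
  proof -
    have "negligible {x. (av m - av n) \<bullet> x = bv n - bv m}"
      by (rule negligible_hyperplane) (use av_neq[OF that] in auto)
    then have "AE x in lebesgue. x \<notin> {x. (av m - av n) \<bullet> x = bv n - bv m}"
      by (intro AE_not_in) (simp add: negligible_iff_null_sets)
    then show ?thesis by eventually_elim (auto simp: L_def inner_diff_left)
  qed
  then have "\<forall>m n. AE x in lebesgue. m \<noteq> n \<longrightarrow> L m x \<noteq> L n x" by auto
  then show ?thesis by (simp add: AE_all_countable)
qed

lemma tet_cell_cover:
  assumes "x \<in> tet X" "\<forall>m n. m \<noteq> n \<longrightarrow> L m x \<noteq> L n x"
  obtains i where "x \<in> cell i"
proof -
  obtain i where i: "\<And>j. L (Some i) x \<le> L (Some j) x"
    using ex_min_if_finite[of "(\<lambda>i. L (Some i) x) ` UNIV"] by (auto simp: not_less)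
  have "x \<in> cell i"
    unfolding cell_eq mem_Collect_eq
  proof (intro conjI allI impI)
    have "0 \<le> L (Some i) x" using assms(1) by (simp add: tet_eq)
    moreover have "L (Some i) x \<noteq> L None x" using assms(2) by blast
    ultimately show "0 < L (Some i) x" by simp
    fix j assume "j \<noteq> i"
    then have "L (Some i) x \<noteq> L (Some j) x" using assms(2) by (metis option.inject)
    with i[of j] show "L (Some i) x < L (Some j) x" by simp
  qed
  then show ?thesis by (rule that)
qed

lemma AE_tet_cell: "AE x in lebesgue. x \<in> tet X \<longrightarrow> (\<exists>i. x \<in> cell i)"
  using AE_L_neq by eventually_elim (use tet_cell_cover in blast)

lemma AE_subtet_cell: "AE x in lebesgue. x \<in> subtet X z i \<longrightarrow> x \<in> cell i"
  using AE_L_neq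
proof eventually_elim
  case (elim x)
  show ?case
  proof
    assume x: "x \<in> subtet X z i"
    then obtain j where j: "x \<in> cell j" using tet_cell_cover[OF _ elim] subtet_subset_tet by blast
    have "j = i" using x j unfolding subtet_eq cell_eq by (auto simp: not_less[symmetric])
    with j show "x \<in> cell i" by simp
  qed
qed

lemma tet_sets: "tet X \<in> sets lebesgue" "subtet X z i \<in> sets lebesgue"
  by (auto intro!: sets_completionI_sets borel_compact compact_tet compact_subtet)

lemma AE_on_tet_iff: "(AE x in lebesgue_on (tet X). Q x) \<longleftrightarrow> (AE x in lebesgue. \<forall>i. x \<in> cell i \<longrightarrow> Q x)"
proof -
  have "(AE x in lebesgue_on (tet X). Q x) \<longleftrightarrow> (AE x in lebesgue. x \<in> tet X \<longrightarrow> Q x)"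
    by (simp add: AE_restrict_space_iff tet_sets)
  also have "\<dots> \<longleftrightarrow> (AE x in lebesgue. \<forall>i. x \<in> cell i \<longrightarrow> Q x)"
  proof
    assume "AE x in lebesgue. x \<in> tet X \<longrightarrow> Q x"
    then show "AE x in lebesgue. \<forall>i. x \<in> cell i \<longrightarrow> Q x"
      by eventually_elim (use cell_subset_interior interior_subset in blast)
  next
    assume "AE x in lebesgue. \<forall>i. x \<in> cell i \<longrightarrow> Q x"
    with AE_tet_cell show "AE x in lebesgue. x \<in> tet X \<longrightarrow> Q x" by eventually_elim auto
  qed
  finally show ?thesis .
qed

lemma AE_on_subtet_iff: "(AE x in lebesgue_on (subtet X z i). Q x) \<longleftrightarrow> (AE x in lebesgue. x \<in> cell i \<longrightarrow> Q x)"
proof -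
  have "(AE x in lebesgue_on (subtet X z i). Q x) \<longleftrightarrow> (AE x in lebesgue. x \<in> subtet X z i \<longrightarrow> Q x)"
    by (simp add: AE_restrict_space_iff tet_sets)
  also have "\<dots> \<longleftrightarrow> (AE x in lebesgue. x \<in> cell i \<longrightarrow> Q x)"
  proof
    assume "AE x in lebesgue. x \<in> subtet X z i \<longrightarrow> Q x"
    then show "AE x in lebesgue. x \<in> cell i \<longrightarrow> Q x"
      by eventually_elim (use cell_subset_subtet in blast)
  next
    assume "AE x in lebesgue. x \<in> cell i \<longrightarrow> Q x"
    with AE_subtet_cell[of i] show "AE x in lebesgue. x \<in> subtet X z i \<longrightarrow> Q x" by eventually_elim auto
  qed
  finally show ?thesis .
qed

lemma face_eq: "face X i = {x. L (Some i) x = 0 \<and> (\<forall>j. 0 \<le> L (Some j) x)}"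
proof (intro set_eqI iffI)
  fix x assume "x \<in> face X i"
  then obtain u where u: "\<forall>j\<in>UNIV - {i}. 0 \<le> u j" "sum u (UNIV - {i}) = 1" "(\<Sum>j\<in>UNIV - {i}. u j *\<^sub>R X j) = x"
    unfolding face_def mem_convex_hull_image by blast
  have "lam k x = (if k = i then 0 else u k)" for k
    using lam_combination[OF u(2), of k X] by (simp add: u(3) lam_X if_distrib[of "\<lambda>t. _ * t"] cong: if_cong)
  then show "x \<in> {x. L (Some i) x = 0 \<and> (\<forall>j. 0 \<le> L (Some j) x)}"
    using u(1) cz_pos by (auto simp: L_Some intro!: divide_nonneg_pos)
next
  fix x assume x: "x \<in> {x. L (Some i) x = 0 \<and> (\<forall>j. 0 \<le> L (Some j) x)}"
  have i0: "lam i x = 0" using x cz_pos[of i] by (auto simp: L_Some)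
  have "0 \<le> lam j x" for j using x cz_pos[of j] by (auto simp: L_Some zero_le_divide_iff)
  moreover have "sum (\<lambda>j. lam j x) (UNIV - {i}) = 1" "(\<Sum>j\<in>UNIV - {i}. lam j x *\<^sub>R X j) = x"
    using bary_repr[of x] i0 by (simp_all add: sum.remove[of UNIV i])
  ultimately show "x \<in> face X i"
    unfolding face_def mem_convex_hull_image by (intro exI[of _ "\<lambda>j. lam j x"]) simp
qed

lemma vertex_in_subtet: "X j \<in> subtet X z i \<longleftrightarrow> i \<noteq> j"
  unfolding subtet_eq using cz_pos ex_other_index[of j] by (auto simp: L_Some lam_X less_imp_le not_le)

lemma frontier_tet_iff: "x \<in> frontier (tet X) \<longleftrightarrow> x \<in> tet X \<and> (\<exists>i. L (Some i) x = 0)"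
proof -
  have "x \<in> frontier (tet X) \<longleftrightarrow> x \<in> tet X \<and> x \<notin> interior (tet X)"
    using compact_imp_closed[OF compact_tet] by (simp add: frontier_def)
  also have "\<dots> \<longleftrightarrow> x \<in> tet X \<and> (\<exists>i. \<not> 0 < L (Some i) x)"
    by (simp add: interior_tet)
  also have "\<dots> \<longleftrightarrow> x \<in> tet X \<and> (\<exists>i. L (Some i) x = 0)"
  proof (rule conj_cong[OF refl])
    assume "x \<in> tet X"
    then have "0 \<le> L (Some i) x" for i by (simp add: tet_eq)
    then show "(\<exists>i. \<not> 0 < L (Some i) x) \<longleftrightarrow> (\<exists>i. L (Some i) x = 0)" by (simp add: not_less order_eq_iff)
  qed
  finally show ?thesis .
qed

end

section \<open>Interpolation across faces\<close>

text \<open>Split the gradient at \<open>x0\<close> into a normal part and a tangential part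
  \<open>\<tau>\<close>. The function vanishes along the line through \<open>x0\<close> in direction
  \<open>\<tau>\<close>, so \<open>\<tau>\<close> is orthogonal to the gradient and therefore to
  itself.\<close>

lemma partial_parallel_normal:
  fixes f :: "real^3 \<Rightarrow> real"
  assumes d: "f differentiable at x0" and \<nu>: "\<nu> \<noteq> 0"
    and z: "\<And>x. \<nu> \<bullet> (x - x0) = 0 \<Longrightarrow> f x = 0"
  obtains c where "\<And>j. partial j f x0 = c * \<nu> $ j"
proof -
  define g where "g = (\<chi> j. partial j f x0)"
  have tang: "\<tau> \<bullet> g = 0" if "\<tau> \<bullet> \<nu> = 0" for \<tau>
  proof -
    have "((\<lambda>t. x0 + t *\<^sub>R \<tau>) has_derivative (\<lambda>t. t *\<^sub>R \<tau>)) (at (0::real))"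
      by (auto intro!: derivative_eq_intros)
    moreover have "(f has_derivative (\<lambda>v. \<Sum>k\<in>UNIV. v $ k * partial k f x0)) (at (x0 + 0 *\<^sub>R \<tau>))"
      using has_derivative_partial[OF d] by simp
    ultimately have "((\<lambda>t. f (x0 + t *\<^sub>R \<tau>)) has_derivative (\<lambda>t. \<Sum>k\<in>UNIV. (t *\<^sub>R \<tau>) $ k * partial k f x0)) (at 0)"
      by (rule has_derivative_compose)
    moreover have "(\<lambda>t. f (x0 + t *\<^sub>R \<tau>)) = (\<lambda>t. 0)"
      using that by (auto intro!: z simp: inner_commute)
    ultimately have "((\<lambda>t. 0) has_derivative (\<lambda>t. \<Sum>k\<in>UNIV. (t *\<^sub>R \<tau>) $ k * partial k f x0)) (at (0::real))"
      by simp
    from has_derivative_unique[OF this has_derivative_const]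
    have "(\<Sum>k\<in>UNIV. (1 *\<^sub>R \<tau>) $ k * partial k f x0) = 0" by (rule fun_cong)
    then show ?thesis by (simp add: g_def inner_vec_def)
  qed
  define \<tau> where "\<tau> = g - ((g \<bullet> \<nu>) / (\<nu> \<bullet> \<nu>)) *\<^sub>R \<nu>"
  have "\<tau> \<bullet> \<nu> = 0" using \<nu> by (simp add: \<tau>_def inner_diff_left)
  then have "\<tau> \<bullet> g = 0" "\<tau> \<bullet> \<nu> = 0" using tang by auto
  then have "\<tau> \<bullet> \<tau> = 0" by (subst \<tau>_def) (simp add: inner_diff_left inner_commute inner_diff_right)
  then have "g = ((g \<bullet> \<nu>) / (\<nu> \<bullet> \<nu>)) *\<^sub>R \<nu>" by (simp add: \<tau>_def)
  then have "partial j f x0 = ((g \<bullet> \<nu>) / (\<nu> \<bullet> \<nu>)) * \<nu> $ j" for j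
    by (metis g_def vec_lambda_beta vector_scaleR_component real_scaleR_def)
  then show ?thesis by (rule that)
qed

text \<open>\<open>M\<close> and the exponents are left open because the formula serves both the
  affine functions \<open>L m\<close> and their smooth replacement \<open>soft_hat\<close>, with
  exponents \<open>k\<close> or \<open>Suc k\<close>.\<close>

lemma partial_sum_powers:
  fixes \<beta> :: "nat \<Rightarrow> real^3 \<Rightarrow> real" and M :: "real^3 \<Rightarrow> real"
  assumes "\<And>k. k \<le> n \<Longrightarrow> \<beta> k differentiable at x" "M differentiable at x"
  shows "partial j (\<lambda>x. \<Sum>k\<le>n. \<beta> k x * M x ^ e k) x
    = (\<Sum>k\<le>n. partial j (\<beta> k) x * M x ^ e k) + (\<Sum>k\<le>n. \<beta> k x * (e k * M x ^ (e k - 1))) * partial j M x"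
    "(\<lambda>x. \<Sum>k\<le>n. \<beta> k x * M x ^ e k) differentiable at x"
proof -
  have pd: "(\<lambda>x. M x ^ m) differentiable at x" for m
    using assms(2) by (rule differentiable_power)
  have p: "partial j (\<lambda>x. M x ^ m) x = real m * M x ^ (m - 1) * partial j M x" for m
    by (rule partial_chain[OF assms(2)]) (auto intro!: derivative_eq_intros)
  have "partial j (\<lambda>x. \<Sum>k\<le>n. \<beta> k x * M x ^ e k) x = (\<Sum>k\<le>n. partial j (\<lambda>x. \<beta> k x * M x ^ e k) x)"
    using assms pd by (intro partial_sum differentiable_mult) auto
  also have "\<dots> = (\<Sum>k\<le>n. partial j (\<beta> k) x * M x ^ e k + \<beta> k x * (e k * M x ^ (e k - 1)) * partial j M x)"
    using assms pd by (intro sum.cong) (auto simp: partial_mult p)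
  finally show "partial j (\<lambda>x. \<Sum>k\<le>n. \<beta> k x * M x ^ e k) x
    = (\<Sum>k\<le>n. partial j (\<beta> k) x * M x ^ e k) + (\<Sum>k\<le>n. \<beta> k x * (e k * M x ^ (e k - 1))) * partial j M x"
    by (simp add: sum.distrib sum_distrib_right)
  show "(\<lambda>x. \<Sum>k\<le>n. \<beta> k x * M x ^ e k) differentiable at x"
    using assms pd by (intro differentiable_sum differentiable_mult) auto
qed

context alfeld_split
begin

lemma L_smooth: "smooth (L m)"
  unfolding L_def[abs_def] by (rule poly_fun_smooth[OF poly_fun_affine])

lemma partial_L: "partial j (L m) x = av m $ j"
proof -
  have "(L m has_derivative (\<lambda>v. av m \<bullet> v)) (at x)"
    unfolding L_def[abs_def] by (auto intro!: derivative_eq_intros)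
  from partial_at[OF this] show ?thesis by (simp add: inner_axis)
qed

lemma L_eq_iff: "L m x0 = L n x0 \<Longrightarrow> L m x = L n x \<longleftrightarrow> (av m - av n) \<bullet> (x - x0) = 0"
  by (auto simp: L_def inner_diff_right inner_diff_left)

text \<open>\<open>kap m * (L m x - s)\<close> are the barycentric coordinates of \<open>(x, s)\<close> in a 4-simplex of \<open>\<real>\<^sup>4\<close> with
  facets \<open>s = L m x\<close>. The extension \<open>R\<close> of \<open>p\<close> from the flat \<open>s = L m x\<close>, \<open>m \<in> A\<close>, drops the
  coordinates in \<open>A\<close> from the homogenized polynomial.\<close>
lemma extension_from_flat:
  assumes p: "poly_fun n p" and n: "1 \<le> n"
  obtains R where "param_poly n R" "\<And>x s. (\<forall>m\<in>A. L m x = s) \<Longrightarrow> poly (R x) s = p x"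
    "\<And>B x s. (\<forall>m\<in>B. L m x = s) \<Longrightarrow> (\<And>y t. (\<forall>m\<in>A \<union> B. L m y = t) \<Longrightarrow> p y = 0) \<Longrightarrow> poly (R x) s = 0"
proof -
  obtain H :: "real^3 \<Rightarrow> real \<Rightarrow> real" and c where
    H: "H = (\<lambda>y w. \<Sum>\<alpha> | sum \<alpha> UNIV \<le> n. c \<alpha> * (monomial \<alpha> y * w ^ (n - sum \<alpha> UNIV)))"
    and H1: "\<And>y. H y 1 = p y" and Hk: "\<And>k y w. H (k *\<^sub>R y) (k * w) = k ^ n * H y w"
    by (rule poly_fun_homogenization[OF p], rule that)
  \<comment> \<open>As a polynomial in \<open>s\<close>, \<open>q f x\<close> is the sum of the
    barycentric coordinates of \<open>(x, s)\<close> outside \<open>A\<close>, weighted by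
    \<open>f\<close>.\<close>
  define q where "q f x = [:(\<Sum>m\<in>-A. (kap m * f m) *\<^sub>R av m) \<bullet> x + (\<Sum>m\<in>-A. kap m * f m * bv m), - (\<Sum>m\<in>-A. kap m * f m):]"
    for f :: "4 option \<Rightarrow> real" and x :: "real^3"
  have q: "poly (q f x) s = (\<Sum>m\<in>-A. kap m * (L m x - s) * f m)" for f x s
    by (simp add: q_def L_def inner_sum_left sum.distrib sum_subtractf sum_distrib_left algebra_simps)
  define R where "R x = (\<Sum>\<alpha> | sum \<alpha> UNIV \<le> n. [:c \<alpha>:] *
      ((\<Prod>i\<in>UNIV. q (\<lambda>m. vt m $ i) x ^ \<alpha> i) * q (\<lambda>_. 1) x ^ (n - sum \<alpha> UNIV)))" for x
  have pp_q: "param_poly 1 (q f)" for f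
    unfolding q_def by (rule param_poly_affine)
  have "param_poly n R"
    unfolding R_def
  proof (rule param_poly_sum)
    fix \<alpha> :: "3 \<Rightarrow> nat" assume "\<alpha> \<in> {\<alpha>. sum \<alpha> UNIV \<le> n}"
    then have e: "0 + ((\<Sum>i\<in>UNIV. \<alpha> i * 1) + (n - sum \<alpha> UNIV) * 1) = n" by simp
    have "param_poly (0 + ((\<Sum>i\<in>UNIV. \<alpha> i * 1) + (n - sum \<alpha> UNIV) * 1)) (\<lambda>x. [:c \<alpha>:] *
      ((\<Prod>i\<in>UNIV. q (\<lambda>m. vt m $ i) x ^ \<alpha> i) * q (\<lambda>_. 1) x ^ (n - sum \<alpha> UNIV)))"
      by (intro param_poly_mult param_poly_prod param_poly_const param_poly_power pp_q) auto
    then show "param_poly n (\<lambda>x. [:c \<alpha>:] *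
      ((\<Prod>i\<in>UNIV. q (\<lambda>m. vt m $ i) x ^ \<alpha> i) * q (\<lambda>_. 1) x ^ (n - sum \<alpha> UNIV)))" unfolding e .
  qed
  moreover have R: "poly (R x) s = H (\<Sum>m\<in>-A. (kap m * (L m x - s)) *\<^sub>R vt m) (\<Sum>m\<in>-A. kap m * (L m x - s))" for x s
    by (simp add: R_def H poly_sum poly_prod q)
  have "poly (R x) s = p x" if "\<forall>m\<in>A. L m x = s" for x s
  proof -
    have "(\<Sum>m\<in>-A. (kap m * (L m x - s)) *\<^sub>R vt m) = x" "(\<Sum>m\<in>-A. kap m * (L m x - s)) = 1"
      using that kap_sum_vt[of x s] kap_sum[of x s]
      by (auto simp: sum.subset_diff[of "-A" UNIV, OF _ finite] Compl_eq_Diff_UNIV[symmetric])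
    then show ?thesis by (simp add: R H1)
  qed
  moreover have "poly (R x) s = 0"
    if B: "\<forall>m\<in>B. L m x = s" and z: "\<And>y t. (\<forall>m\<in>A \<union> B. L m y = t) \<Longrightarrow> p y = 0" for B x s
  proof -
    let ?C = "- (A \<union> B)"
    \<comment> \<open>Coordinates with nonzero sum rescale to a point where all \<open>L k\<close>
      with \<open>k\<close> in \<open>A \<union> B\<close> agree, and \<open>p\<close> vanishes
      there by assumption.\<close>
    have key: "H (\<Sum>m\<in>?C. v m *\<^sub>R vt m) (\<Sum>m\<in>?C. v m) = 0" if w: "(\<Sum>m\<in>?C. v m) \<noteq> 0" for v
    proof -
      let ?w = "\<Sum>m\<in>?C. v m"
      let ?y = "\<Sum>m\<in>?C. (v m / ?w) *\<^sub>R vt m"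
      have one: "(\<Sum>m\<in>?C. v m / ?w) = 1" using w by (simp add: sum_divide_distrib[symmetric])
      have "L k ?y = (\<Sum>m\<in>?C. v m / ?w * sv m)" if "k \<in> A \<union> B" for k
        unfolding L_combination[OF one] using that by (intro sum.cong) (auto simp: L_vt)
      then have "p ?y = 0" by (intro z) blast
      moreover have "(\<Sum>m\<in>?C. v m *\<^sub>R vt m) = ?w *\<^sub>R ?y"
        using w by (simp add: scaleR_sum_right)
      ultimately show ?thesis using Hk[of ?w ?y 1] H1[of ?y] by simp
    qed
    have key': "H (\<Sum>m\<in>?C. v m *\<^sub>R vt m) (\<Sum>m\<in>?C. v m) = 0" for v
    proof (cases "(\<Sum>m\<in>?C. v m) = 0")
      case w: True
      show ?thesis
      proof (cases "?C = {}")
        case True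
        \<comment> \<open>A homogeneous form of positive degree vanishes at the origin; this is
          where \<open>1 \<le> n\<close> enters.\<close>
        have "H 0 0 = 0" using Hk[of 0 0 0] n by (simp add: power_0_left)
        then show ?thesis by (simp only: True sum.empty)
      next
        case False
        then obtain m0 where m0: "m0 \<in> ?C" by blast
        \<comment> \<open>Raising one coordinate by \<open>e\<close> makes the sum equal to
          \<open>e\<close>; the case of sum 0 then follows by continuity of \<open>H\<close> as
          \<open>e\<close> tends to 0.\<close>
        let ?v = "\<lambda>e m. v m + (if m = m0 then e else 0)"
        have s1: "(\<Sum>m\<in>?C. ?v e m) = e" for e
          using w m0 by (simp add: sum.distrib)
        have s2: "(\<Sum>m\<in>?C. ?v e m *\<^sub>R vt m) = (\<Sum>m\<in>?C. v m *\<^sub>R vt m) + e *\<^sub>R vt m0" for e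
        proof -
          have "(\<Sum>m\<in>?C. (if m = m0 then e else 0) *\<^sub>R vt m) = (\<Sum>m\<in>?C. if m = m0 then e *\<^sub>R vt m0 else 0)"
            by (rule sum.cong) auto
          then show ?thesis using m0 by (simp add: scaleR_left_distrib sum.distrib)
        qed
        define y0 where "y0 = (\<Sum>m\<in>?C. v m *\<^sub>R vt m)"
        have "H (y0 + e *\<^sub>R vt m0) e = 0" if "e \<noteq> 0" for e
          using key[of "?v e"] that unfolding s1 s2 y0_def by blast
        then have "((\<lambda>e. H (y0 + e *\<^sub>R vt m0) e) \<longlongrightarrow> 0) (at 0)"
          by (intro Lim_transform_eventually[OF tendsto_const]) (auto simp: eventually_at_filter)
        moreover have "((\<lambda>e. H (y0 + e *\<^sub>R vt m0) e) \<longlongrightarrow> H (y0 + 0 *\<^sub>R vt m0) 0) (at 0)"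
          unfolding H by (intro tendsto_intros)
        ultimately have "H y0 0 = 0" using LIM_unique by fastforce
        then show ?thesis using w by (simp add: y0_def)
      qed
    qed (rule key)
    have "(\<Sum>m\<in>-A. (kap m * (L m x - s)) *\<^sub>R vt m) = (\<Sum>m\<in>?C. (kap m * (L m x - s)) *\<^sub>R vt m)"
      "(\<Sum>m\<in>-A. kap m * (L m x - s)) = (\<Sum>m\<in>?C. kap m * (L m x - s))"
      using B by (auto intro!: sum.mono_neutral_right)
    then show ?thesis unfolding R using key'[of "\<lambda>m. kap m * (L m x - s)"] by simp
  qed
  ultimately show ?thesis by (rule that)
qed

section \<open>Interpolation and the lifting of normal jumps\<close>

text \<open>Flats are treated one at a time, as in Newton interpolation. The residual on a new flat
  vanishes where that flat meets the older ones, so its extension vanishes on all of them and leaves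
  the values attained there untouched.\<close>

lemma interpolation:
  assumes "finite I" and n: "1 \<le> n"
    and "\<And>i. i \<in> I \<Longrightarrow> poly_fun n (g i)" "\<And>i. i \<in> I \<Longrightarrow> A i \<noteq> {}"
    and "\<And>i j x t. i \<in> I \<Longrightarrow> j \<in> I \<Longrightarrow> (\<forall>m\<in>A i \<union> A j. L m x = t) \<Longrightarrow> g i x = g j x"
  shows "\<exists>R. param_poly n R \<and> (\<forall>i\<in>I. \<forall>x s. (\<forall>m\<in>A i. L m x = s) \<longrightarrow> poly (R x) s = g i x)"
  using assms(1,3-)
proof (induction I rule: finite_induct)
  case empty
  then show ?case using param_poly_const[of n 0] by (intro exI[of _ "\<lambda>_. 0"]) simp
next
  case (insert i I)
  then obtain R where R: "param_poly n R" "\<And>j x s. j \<in> I \<Longrightarrow> (\<forall>m\<in>A j. L m x = s) \<Longrightarrow> poly (R x) s = g j x"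
    by (metis insertI2)
  obtain m where m: "m \<in> A i" using insert.prems(2)[of i] by auto
  \<comment> \<open>On the flat of \<open>A i\<close> the variable \<open>s\<close> equals
    \<open>L m x\<close>, which makes the residual a polynomial in \<open>x\<close> alone.\<close>
  define r where "r x = g i x - poly (R x) (L m x)" for x
  have "poly_fun n r"
    unfolding r_def L_def
    by (intro poly_fun_diff param_poly_eval_affine[OF R(1)]) (use insert.prems(1) in auto)
  from extension_from_flat[OF this n, of "A i"] obtain S where S: "param_poly n S"
    "\<And>x s. (\<forall>m\<in>A i. L m x = s) \<Longrightarrow> poly (S x) s = r x"
    "\<And>B x s. (\<forall>m\<in>B. L m x = s) \<Longrightarrow> (\<And>y t. (\<forall>m\<in>A i \<union> B. L m y = t) \<Longrightarrow> r y = 0) \<Longrightarrow> poly (S x) s = 0"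
    by metis
  have "poly (R x + S x) s = g j x" if j: "j \<in> insert i I" and e: "\<forall>m\<in>A j. L m x = s" for j x s
  proof (cases "j = i")
    case True
    then have "poly (S x) s = r x" "L m x = s" using S(2)[of x s] e m by auto
    then show ?thesis using True by (simp add: r_def)
  next
    case False
    then have jI: "j \<in> I" using j by simp
    have "poly (S x) s = 0"
    proof (rule S(3)[OF e])
      fix y t assume yt: "\<forall>m\<in>A i \<union> A j. L m y = t"
      then have "g i y = g j y" using insert.prems(3)[of i j] jI by blast
      moreover have "poly (R y) t = g j y" using R(2)[OF jI] yt by blast
      ultimately show "r y = 0" using yt m by (simp add: r_def)
    qed
    then show ?thesis using R(2)[OF jI e] by simp
  qed
  then show ?case using param_poly_add[OF R(1) S(1)] by (intro exI[of _ "\<lambda>x. R x + S x"]) auto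
qed

text \<open>The gradient of \<open>\<psi> m\<close> has one part that depends on \<open>m\<close>
  only through the value \<open>L m x\<close>, hence agrees across \<open>L m = L l\<close>, and the
  part \<open>- poly (R x) (L m x)\<close> times \<open>av m\<close>. The jump of the latter is a
  multiple of \<open>av m - av l\<close> and cancels the given one, because
  \<open>poly (R x) (L m x)\<close> is the coefficient of the given jump.\<close>

lemma normal_jump_lift:
  fixes \<rho> :: "4 option \<Rightarrow> real^3 \<Rightarrow> real^3"
  assumes n: "1 \<le> n" and \<rho>: "\<And>m k. m \<in> N \<Longrightarrow> poly_fun n (\<lambda>x. \<rho> m x $ k)"
    and jump: "\<And>m l x. m \<in> N \<Longrightarrow> l \<in> N \<Longrightarrow> L m x = L l x \<Longrightarrow> \<exists>c. \<rho> m x - \<rho> l x = c *\<^sub>R (av m - av l)"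
  obtains \<psi> where "\<And>m. poly_fun (Suc n) (\<psi> m)"
    "\<And>m l x. L m x = L l x \<Longrightarrow> \<psi> m x = \<psi> l x" "\<And>x. \<psi> None x = 0"
    "\<And>m l x k. m \<in> N \<Longrightarrow> l \<in> N \<Longrightarrow> L m x = L l x \<Longrightarrow>
       \<rho> m x $ k + partial k (\<psi> m) x = \<rho> l x $ k + partial k (\<psi> l) x"
proof -
  define g where "g = (\<lambda>(m, l) x. (\<rho> m x - \<rho> l x) \<bullet> (av m - av l) / ((av m - av l) \<bullet> (av m - av l)))"
  have g: "\<rho> m x - \<rho> l x = g (m, l) x *\<^sub>R (av m - av l)"
    if ml: "m \<in> N" "l \<in> N" "L m x = L l x" "m \<noteq> l" for m l x
  proof -
    obtain c where c: "\<rho> m x - \<rho> l x = c *\<^sub>R (av m - av l)" using jump[OF ml(1-3)] by blast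
    have "av m - av l \<noteq> 0" using av_neq[OF ml(4)] by simp
    then have "g (m, l) x = c" by (simp add: g_def c)
    with c show ?thesis by simp
  qed
  have g_sym: "g (m, l) x = g (l, m) x" for m l x
    unfolding g_def by (simp add: inner_diff_left inner_diff_right algebra_simps)
  \<comment> \<open>Compatibility on the lines where three planes meet; for \<open>a = c\<close> it
    reduces to the symmetry of \<open>g\<close>.\<close>
  have g_chain: "g (a, b) x = g (b, c) x"
    if "a \<in> N" "b \<in> N" "c \<in> N" "a \<noteq> b" "b \<noteq> c" "L a x = t" "L b x = t" "L c x = t" for a b c x t
  proof (cases "a = c")
    case True
    then show ?thesis using g_sym by simp
  next
    case False
    have "(\<rho> a x - \<rho> b x) + (\<rho> b x - \<rho> c x) = \<rho> a x - \<rho> c x" by simp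
    then have "g (a, b) x *\<^sub>R (av a - av b) + g (b, c) x *\<^sub>R (av b - av c) = g (a, c) x *\<^sub>R (av a - av c)"
      using that False g[of a b x] g[of b c x] g[of a c x] by simp
    then have "(g (a, b) x - g (a, c) x) *\<^sub>R (av a - av b) + (g (b, c) x - g (a, c) x) *\<^sub>R (av b - av c) = 0"
      by (simp add: algebra_simps)
    from av_triple_diff[OF that(4,5) False this] show ?thesis by simp
  qed
  let ?I = "{(m, l). m \<in> N \<and> l \<in> N \<and> m \<noteq> l}"
  have "\<exists>R. param_poly n R \<and> (\<forall>i\<in>?I. \<forall>x s. (\<forall>m\<in>{fst i, snd i}. L m x = s) \<longrightarrow> poly (R x) s = g i x)"
  proof (rule interpolation[OF _ n])
    show "finite ?I" by (rule finite_subset[OF subset_UNIV]) simp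
    fix i assume i: "i \<in> ?I"
    then obtain m l where ml: "i = (m, l)" "m \<in> N" "l \<in> N" "m \<noteq> l" by auto
    have "poly_fun n (\<lambda>x. inverse ((av m - av l) \<bullet> (av m - av l)) *
        (\<Sum>k\<in>UNIV. (av m - av l) $ k * (\<rho> m x $ k - \<rho> l x $ k)))"
      using \<rho> ml by (intro poly_fun_cmult poly_fun_sum poly_fun_diff) auto
    moreover have "(\<lambda>x. inverse ((av m - av l) \<bullet> (av m - av l)) *
        (\<Sum>k\<in>UNIV. (av m - av l) $ k * (\<rho> m x $ k - \<rho> l x $ k))) = g i"
      by (rule ext) (simp add: g_def ml(1) inner_vec_def[of "\<rho> m _ - \<rho> l _"] divide_inverse mult.commute)
    ultimately show "poly_fun n (g i)" by simp
    show "{fst i, snd i} \<noteq> {}" by simp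
    fix j x t assume j: "j \<in> ?I" and e: "\<forall>m\<in>{fst i, snd i} \<union> {fst j, snd j}. L m x = t"
    then obtain a b where ab: "j = (a, b)" "a \<in> N" "b \<in> N" "a \<noteq> b" by auto
    \<comment> \<open>Unless the pairs already form a chain with \<open>l = a\<close>, they are
      linked through the pair \<open>(l, a)\<close>; every index involved takes the value
      \<open>t\<close> at \<open>x\<close>.\<close>
    show "g i x = g j x"
    proof (cases "l = a")
      case True
      then show ?thesis using g_chain[of m a b x t] e ml ab by simp
    next
      case False
      then show ?thesis using g_chain[of m l a x t] g_chain[of l a b x t] e ml ab by simp
    qed
  qed
  then obtain R where R: "param_poly n R"
    and R': "\<forall>i\<in>?I. \<forall>x s. (\<forall>m\<in>{fst i, snd i}. L m x = s) \<longrightarrow> poly (R x) s = g i x"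
    by blast
  have RI: "poly (R x) (L m x) = g (m, l) x" if "m \<in> N" "l \<in> N" "m \<noteq> l" "L m x = L l x" for m l x
    using bspec[OF R', of "(m, l)", THEN spec, of x, THEN spec, of "L m x"] that by simp
  \<comment> \<open>The coefficients of minus the antiderivative in \<open>s\<close> that vanishes
    at \<open>s = 0\<close>. Hence \<open>\<psi> None = 0\<close>, since
    \<open>L None = 0\<close>.\<close>
  define \<beta> where "\<beta> k x = - (coeff (R x) k / Suc k)" for k x
  define \<psi> where "\<psi> m x = (\<Sum>k\<le>n. \<beta> k x * L m x ^ Suc k)" for m x
  have \<beta>: "poly_fun (n - k) (\<beta> k)" for k
    unfolding \<beta>_def using poly_fun_cmult[OF param_poly_coeff[OF R, of k], of "- (1 / Suc k)"] by simp
  have Lpow: "poly_fun j (\<lambda>x. L m x ^ j)" for m j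
  proof (induction j)
    case (Suc j)
    then show ?case using poly_fun_mult[OF poly_fun_affine[of 0 "av m" "bv m"]] by (simp add: L_def)
  qed (simp add: poly_fun_const)
  have "poly_fun (Suc n) (\<psi> m)" for m
    unfolding \<psi>_def
  proof (rule poly_fun_sum)
    fix k assume "k \<in> {..n}"
    then have "n - k + Suc k = Suc n" by simp
    with poly_fun_mult[OF \<beta> Lpow, of k "Suc k" m] show "poly_fun (Suc n) (\<lambda>x. \<beta> k x * L m x ^ Suc k)" by metis
  qed
  moreover have "\<psi> m x = \<psi> l x" if "L m x = L l x" for m l x using that by (simp add: \<psi>_def)
  moreover have "\<psi> None x = 0" for x by (simp add: \<psi>_def)
  moreover have "\<rho> m x $ j + partial j (\<psi> m) x = \<rho> l x $ j + partial j (\<psi> l) x"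
    if ml: "m \<in> N" "l \<in> N" "L m x = L l x" for m l x j
  proof (cases "m = l")
    case False
    have grad: "partial j (\<psi> a) x = (\<Sum>k\<le>n. partial j (\<beta> k) x * L a x ^ Suc k) - poly (R x) (L a x) * av a $ j" for a
    proof -
      have "partial j (\<psi> a) x = (\<Sum>k\<le>n. partial j (\<beta> k) x * L a x ^ Suc k)
         + (\<Sum>k\<le>n. \<beta> k x * (Suc k * L a x ^ (Suc k - 1))) * partial j (L a) x"
        unfolding \<psi>_def
        by (rule partial_sum_powers) (intro smooth_differentiable poly_fun_smooth[OF \<beta>] L_smooth)+
      moreover have "(\<Sum>k\<le>n. \<beta> k x * (Suc k * L a x ^ (Suc k - 1))) = - poly (R x) (L a x)"
        unfolding param_poly_altdef[OF R] \<beta>_def sum_negf[symmetric] by (intro sum.cong) auto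
      ultimately show ?thesis by (simp add: partial_L)
    qed
    have "\<rho> m x $ j - \<rho> l x $ j = g (m, l) x * (av m $ j - av l $ j)"
      using g[OF ml False] by (metis vector_minus_component vector_scaleR_component real_scaleR_def)
    then show ?thesis unfolding grad using ml(3) RI[OF ml(1,2) False ml(3)] by (simp add: algebra_simps)
  qed simp
  ultimately show ?thesis by (rule that)
qed

section \<open>Gradient jumps at a point common to three planes\<close>

text \<open>Continuity across the plane makes the gradient jump of component \<open>k\<close> equal
  to \<open>c k\<close> times the normal. Equal curls make the jump matrix symmetric, and a
  symmetric matrix of this rank-one form is a multiple of \<open>\<nu> \<nu>'\<close>.\<close>

lemma gradient_jump_symmetric:
  fixes p q :: "real^3 \<Rightarrow> real^3"
  assumes p: "smooth p" and q: "smooth q" and ml: "m \<noteq> l" and x0: "L m x0 = L l x0"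
    and C0: "\<And>x. L m x = L l x \<Longrightarrow> p x = q x" and curl: "curl p x0 = curl q x0"
  obtains s where "\<And>j k. partial j p x0 $ k - partial j q x0 $ k
    = s * ((av m $ j - av l $ j) * (av m $ k - av l $ k))"
proof -
  let ?\<nu> = "av m - av l"
  define D where "D j k = partial j p x0 $ k - partial j q x0 $ k" for j k
  have \<nu>: "?\<nu> \<noteq> 0" using av_neq[OF ml] by simp
  have "\<exists>c. \<forall>j. D j k = c * ?\<nu> $ j" for k
  proof -
    have d: "partial j (\<lambda>x. p x $ k - q x $ k) x0 = D j k" for j
      by (subst partial_diff) (simp_all add: D_def partial_nth p q smooth_nth smooth_differentiable)
    have "(\<lambda>x. p x $ k - q x $ k) differentiable at x0"
      by (intro differentiable_diff smooth_differentiable smooth_nth p q)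
    then obtain c where "\<And>j. partial j (\<lambda>x. p x $ k - q x $ k) x0 = c * ?\<nu> $ j"
      by (rule partial_parallel_normal[OF _ \<nu>]) (use C0 L_eq_iff[OF x0] in auto)
    then show ?thesis unfolding d by blast
  qed
  then obtain c where c: "\<And>j k. D j k = c k * ?\<nu> $ j" by metis
  have sym: "D j k = D k j" for j k
  proof -
    have "D 2 3 = D 3 2" "D 3 1 = D 1 3" "D 1 2 = D 2 1"
      using curl unfolding curl_def D_def vec_eq_iff forall_3 by (simp_all add: algebra_simps)
    then show ?thesis using exhaust_3[of j] exhaust_3[of k] by auto
  qed
  define s where "s = (\<Sum>j\<in>UNIV. c j * ?\<nu> $ j) / (?\<nu> \<bullet> ?\<nu>)"
  have "c k = s * ?\<nu> $ k" for k
  proof -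
    have "c k * (?\<nu> \<bullet> ?\<nu>) = (\<Sum>j\<in>UNIV. D j k * ?\<nu> $ j)"
      by (simp add: c inner_vec_def sum_distrib_left mult.assoc)
    also have "\<dots> = (\<Sum>j\<in>UNIV. D k j * ?\<nu> $ j)" by (simp add: sym[of _ k])
    also have "\<dots> = ?\<nu> $ k * (\<Sum>j\<in>UNIV. c j * ?\<nu> $ j)"
      by (simp add: c sum_distrib_left mult.assoc mult.left_commute)
    finally show ?thesis using \<nu> by (simp add: s_def field_simps)
  qed
  then have "D j k = s * ((av m $ j - av l $ j) * (av m $ k - av l $ k))" for j k
    by (simp add: c mult.commute mult.left_commute)
  then show ?thesis by (intro that[of s]) (simp add: D_def)
qed

text \<open>The gradient jumps across three planes through \<open>x0\<close> are multiples of \<open>\<nu> \<nu>'\<close> and sum to zero, while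
  the three symmetric matrices \<open>\<nu> \<nu>'\<close> are linearly independent.\<close>
lemma gradients_agree:
  fixes w :: "4 option \<Rightarrow> real^3 \<Rightarrow> real^3"
  assumes w: "\<And>m. m \<in> {a, b, c} \<Longrightarrow> smooth (w m)"
    and d: "a \<noteq> b" "b \<noteq> c" "a \<noteq> c" and x0: "L a x0 = L b x0" "L b x0 = L c x0"
    and C0: "\<And>m l x. m \<in> {a, b, c} \<Longrightarrow> l \<in> {a, b, c} \<Longrightarrow> L m x = L l x \<Longrightarrow> w m x = w l x"
    and curl: "\<And>m l. m \<in> {a, b, c} \<Longrightarrow> l \<in> {a, b, c} \<Longrightarrow> curl (w m) x0 = curl (w l) x0"
  shows "partial j (w a) x0 = partial j (w b) x0"
proof -
  have x0': "L c x0 = L a x0" using x0 by simp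
  obtain s1 where s1: "\<And>j k. partial j (w a) x0 $ k - partial j (w b) x0 $ k
    = s1 * ((av a $ j - av b $ j) * (av a $ k - av b $ k))"
    by (rule gradient_jump_symmetric[OF w w d(1) x0(1) C0 curl, of a b]) auto
  obtain s2 where s2: "\<And>j k. partial j (w b) x0 $ k - partial j (w c) x0 $ k
    = s2 * ((av b $ j - av c $ j) * (av b $ k - av c $ k))"
    by (rule gradient_jump_symmetric[OF w w d(2) x0(2) C0 curl, of b c]) auto
  obtain s3 where s3: "\<And>j k. partial j (w c) x0 $ k - partial j (w a) x0 $ k
    = s3 * ((av c $ j - av a $ j) * (av c $ k - av a $ k))"
    by (rule gradient_jump_symmetric[OF w w d(3)[symmetric] x0' C0 curl, of c a]) auto
  let ?u = "av a - av b" and ?v = "av b - av c"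
  have sum0: "s1 * ((av a $ j - av b $ j) * (av a $ k - av b $ k))
     + s2 * ((av b $ j - av c $ j) * (av b $ k - av c $ k))
     + s3 * ((av c $ j - av a $ j) * (av c $ k - av a $ k)) = 0" for j k
    unfolding s1[symmetric] s2[symmetric] s3[symmetric] by simp
  \<comment> \<open>With \<open>u\<close> and \<open>v\<close> the two differences, row
    \<open>k\<close> of \<open>s1 u u' + s2 v v' + s3 (u + v) (u + v)'\<close> is a combination of
    \<open>u\<close> and \<open>v\<close>. Their independence is used once for each row and once
    more for the vector formed by the coefficients of \<open>u\<close>.\<close>
  have "((s1 + s3) * ?u $ k + s3 * ?v $ k) *\<^sub>R ?u + (s3 * ?u $ k + (s2 + s3) * ?v $ k) *\<^sub>R ?v = 0" for k
    unfolding vec_eq_iff using sum0[of _ k] by (simp add: algebra_simps)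
  then have 1: "(s1 + s3) * ?u $ k + s3 * ?v $ k = 0" for k
    using av_triple_diff[OF d] by blast
  have "(s1 + s3) *\<^sub>R ?u + s3 *\<^sub>R ?v = 0"
    unfolding vec_eq_iff using 1 by simp
  from av_triple_diff[OF d this] have "s1 = 0" by simp
  with s1 show ?thesis by (simp add: vec_eq_iff)
qed

end

section \<open>Weak derivatives of piecewise polynomials\<close>

lemma borel_measurable_lebesgue_AE:
  fixes f g :: "'a::euclidean_space \<Rightarrow> 'b::euclidean_space"
  assumes g: "g \<in> borel_measurable lebesgue" and ae: "AE x in lebesgue. f x = g x"
  shows "f \<in> borel_measurable lebesgue"
proof (rule measurableI)
  fix A :: "'b set" assume A: "A \<in> sets borel"
  have "g -` A \<inter> space lebesgue \<in> sets lebesgue" using g A by (rule measurable_sets)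
  moreover have "AE x in lebesgue. x \<in> g -` A \<inter> space lebesgue \<longleftrightarrow> x \<in> f -` A \<inter> space lebesgue"
    using ae by eventually_elim auto
  ultimately show "f -` A \<inter> space lebesgue \<in> sets lebesgue"
    using completion.in_sets_AE[of "g -` A \<inter> space lebesgue" "f -` A \<inter> space lebesgue" lborel] by blast
qed auto

lemma integrable_of_square:
  fixes f :: "'a \<Rightarrow> real"
  assumes "finite_measure M" "f \<in> borel_measurable M" "integrable M (\<lambda>x. (f x)\<^sup>2)"
  shows "integrable M f"
proof -
  interpret finite_measure M by fact
  have "integrable M (\<lambda>x. 1 + (f x)\<^sup>2)" using assms(3) by simp
  moreover have "norm (f x) \<le> norm (1 + (f x)\<^sup>2)" for x
  proof -
    have "0 \<le> (\<bar>f x\<bar> - 1)\<^sup>2" by simp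
    then have "2 * \<bar>f x\<bar> \<le> 1 + (f x)\<^sup>2" by (simp add: power2_diff)
    moreover have "0 \<le> 1 + (f x)\<^sup>2" by simp
    ultimately show ?thesis unfolding real_norm_def by linarith
  qed
  ultimately show ?thesis
    by (intro Bochner_Integration.integrable_bound[OF _ assms(2) AE_I2])
qed

context alfeld_split
begin

section \<open>Piecewise functions and their integrals\<close>

definition pw :: "(4 option \<Rightarrow> real^3 \<Rightarrow> 'b::real_normed_vector) \<Rightarrow> real^3 \<Rightarrow> 'b" where
  "pw p x = (\<Sum>i\<in>UNIV. indicator (cell i) x *\<^sub>R p (Some i) x)"

text \<open>The entry \<open>p None\<close> is unconstrained; it stands for the values outside T and
  is set to zero wherever boundary values matter.\<close>

definition rep :: "(4 option \<Rightarrow> real^3 \<Rightarrow> 'b) \<Rightarrow> (real^3 \<Rightarrow> 'b) \<Rightarrow> bool" where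
  "rep p f \<longleftrightarrow> (AE x in lebesgue. \<forall>i. x \<in> cell i \<longrightarrow> f x = p (Some i) x)"

text \<open>Continuity across the interior faces for \<open>N = range Some\<close>; for \<open>N = UNIV\<close> and \<open>p None = 0\<close> also
  zero boundary values. Agreement is required on the whole plane \<open>L m = L l\<close>: for polynomials this
  follows from agreement on the face.\<close>
definition C0 :: "4 option set \<Rightarrow> (4 option \<Rightarrow> real^3 \<Rightarrow> 'b) \<Rightarrow> bool" where
  "C0 N p \<longleftrightarrow> (\<forall>m\<in>N. \<forall>l\<in>N. \<forall>x. L m x = L l x \<longrightarrow> p m x = p l x)"

definition tetM :: "(real^3) measure" where "tetM = lebesgue_on (tet X)"

lemma pw_cell: assumes "x \<in> cell i" shows "pw p x = p (Some i) x"
proof -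
  have "pw p x = (\<Sum>j\<in>UNIV. if j = i then p (Some i) x else 0)"
    unfolding pw_def
  proof (intro sum.cong refl)
    fix j
    show "indicator (cell j) x *\<^sub>R p (Some j) x = (if j = i then p (Some i) x else 0)"
    proof (cases "j = i")
      case False
      then have "x \<notin> cell j" using cell_disjoint[OF assms, of j] by blast
      with False show ?thesis by simp
    qed (use assms in simp)
  qed
  then show ?thesis by simp
qed

lemma pw_outside: "(\<And>i. x \<notin> cell i) \<Longrightarrow> pw p x = 0"
  by (simp add: pw_def)

lemma rep_pw: "rep p (pw p)"
  unfolding rep_def by (intro AE_I2) (auto simp: pw_cell)

lemma rep_cong: "rep p f \<Longrightarrow> (\<And>i x. p (Some i) x = Q (Some i) x) \<Longrightarrow> rep Q f"
  unfolding rep_def by simp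

lemma rep_map: "rep p f \<Longrightarrow> rep (\<lambda>m x. h x (p m x)) (\<lambda>x. h x (f x))"
  unfolding rep_def by (erule eventually_mono) simp

lemma rep_map2:
  assumes "rep p f" "rep Q g" shows "rep (\<lambda>m x. h x (p m x) (Q m x)) (\<lambda>x. h x (f x) (g x))"
  using assms unfolding rep_def by eventually_elim auto

lemma rep_AE_iff: "rep p f \<Longrightarrow> rep p g \<longleftrightarrow> (AE x in tetM. f x = g x)"
proof
  assume f: "rep p f"
  show "AE x in tetM. f x = g x" if "rep p g"
    unfolding tetM_def AE_on_tet_iff using f[unfolded rep_def] that[unfolded rep_def] by eventually_elim auto
  show "rep p g" if "AE x in tetM. f x = g x"
    using f[unfolded rep_def] that[unfolded tetM_def AE_on_tet_iff] unfolding rep_def by eventually_elim auto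
qed

lemma pw_measurable [measurable]:
  fixes p :: "4 option \<Rightarrow> real^3 \<Rightarrow> 'b::euclidean_space"
  assumes "\<And>m. continuous_on UNIV (p m)" shows "pw p \<in> borel_measurable borel"
  unfolding pw_def[abs_def]
  by (intro borel_measurable_sum borel_measurable_scaleR borel_measurable_indicator
      borel_measurable_continuous_onI assms borel_open open_cell)

lemma space_tetM: "tet X \<inter> space lebesgue \<in> sets lebesgue"
  using tet_sets by simp

lemma finite_measure_tetM: "finite_measure tetM"
proof
  have "emeasure lebesgue (tet X) < \<infinity>"
    using emeasure_bounded_finite[OF compact_imp_bounded[OF compact_tet]] compact_tet
    by (simp add: borel_compact)
  then show "emeasure tetM (space tetM) \<noteq> \<infinity>"
    unfolding tetM_def by (simp add: emeasure_restrict_space tet_sets less_top)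
qed

lemma rep_measurable:
  fixes p :: "4 option \<Rightarrow> real^3 \<Rightarrow> 'b::euclidean_space"
  assumes "rep p f" "\<And>m. continuous_on UNIV (p m)"
  shows "f \<in> borel_measurable tetM"
proof -
  have "(\<lambda>x. if x \<in> tet X then f x else 0) \<in> borel_measurable lebesgue"
  proof (rule borel_measurable_lebesgue_AE)
    show "pw p \<in> borel_measurable lebesgue" using pw_measurable[OF assms(2)] by (intro measurable_completion) simp
    show "AE x in lebesgue. (if x \<in> tet X then f x else 0) = pw p x"
      using assms(1)[unfolded rep_def] AE_tet_cell
    proof eventually_elim
      case (elim x)
      show ?case
      proof (cases "x \<in> tet X")
        case True
        then show ?thesis using elim pw_cell by metis
      next
        case False
        then have "x \<notin> cell i" for i using cell_subset_subtet subtet_subset_tet by blast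
        with False show ?thesis by (simp add: pw_outside)
      qed
    qed
  qed
  then show ?thesis unfolding tetM_def by (rule borel_measurable_if_D)
qed

lemma pw_integrable:
  fixes p :: "4 option \<Rightarrow> real^3 \<Rightarrow> real"
  assumes "\<And>m. continuous_on UNIV (p m)" shows "integrable lborel (pw p)"
proof -
  have "integrable lborel (\<lambda>x. indicator (cell i) x *\<^sub>R p (Some i) x)" for i
  proof -
    have "integrable lborel (\<lambda>x. indicator (subtet X z i) x *\<^sub>R p (Some i) x)"
      by (rule borel_integrable_compact[OF compact_subtet continuous_on_subset[OF assms]]) auto
    then have "integrable lborel (\<lambda>x. indicator (cell i) x *\<^sub>R (indicator (subtet X z i) x *\<^sub>R p (Some i) x))"
      by (rule integrable_mult_indicator[rotated]) (simp add: borel_open open_cell)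
    moreover have "indicator (cell i) x *\<^sub>R (indicator (subtet X z i) x *\<^sub>R p (Some i) x) = indicator (cell i) x *\<^sub>R p (Some i) x" for x
      using cell_subset_subtet[of i] by (auto simp: indicator_def)
    ultimately show ?thesis by (simp only:)
  qed
  then show ?thesis unfolding pw_def[abs_def] by (intro Bochner_Integration.integrable_sum)
qed

text \<open>Integrals over T of a class become Borel integrals of \<open>pw p\<close> over the whole
  space, the setting in which the vanishing integrals of derivatives are available.\<close>

lemma rep_integral:
  fixes p :: "4 option \<Rightarrow> real^3 \<Rightarrow> real"
  assumes f: "rep p f" and p: "\<And>m. continuous_on UNIV (p m)"
  shows "integrable tetM f" "(\<integral>x. f x \<partial>tetM) = (\<integral>x. pw p x \<partial>lborel)"
proof -
  have ae: "AE x in lebesgue. indicator (tet X) x *\<^sub>R f x = pw p x"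
    using f[unfolded rep_def] AE_tet_cell
  proof eventually_elim
    case (elim x)
    show ?case
    proof (cases "x \<in> tet X")
      case True
      then obtain i where "x \<in> cell i" using elim by blast
      then show ?thesis using elim True by (simp add: pw_cell)
    next
      case False
      then have "x \<notin> cell i" for i using cell_subset_subtet subtet_subset_tet by blast
      with False show ?thesis by (simp add: pw_outside)
    qed
  qed
  have m1: "pw p \<in> borel_measurable lebesgue" using pw_measurable[OF p] by (intro measurable_completion) simp
  have m2: "(\<lambda>x. indicator (tet X) x *\<^sub>R f x) \<in> borel_measurable lebesgue"
    by (rule borel_measurable_lebesgue_AE[OF m1 ae])
  have ae': "AE x in lebesgue. pw p x = indicator (tet X) x *\<^sub>R f x" using ae by eventually_elim simp
  have il: "integrable lebesgue (pw p)" using pw_integrable[OF p] pw_measurable[OF p] by (simp add: integrable_completion)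
  have "integrable lebesgue (\<lambda>x. indicator (tet X) x *\<^sub>R f x)"
    by (rule integrable_cong_AE_imp[OF il m2 ae'])
  then show "integrable tetM f" unfolding tetM_def integrable_restrict_space[OF space_tetM] .
  have "(\<integral>x. f x \<partial>tetM) = (\<integral>x. indicator (tet X) x *\<^sub>R f x \<partial>lebesgue)"
    unfolding tetM_def by (rule integral_restrict_space[OF space_tetM])
  also have "\<dots> = (\<integral>x. pw p x \<partial>lebesgue)" by (rule integral_cong_AE[OF m2 m1 ae])
  also have "\<dots> = (\<integral>x. pw p x \<partial>lborel)" using pw_measurable[OF p] by (intro integral_completion) simp
  finally show "(\<integral>x. f x \<partial>tetM) = (\<integral>x. pw p x \<partial>lborel)" .
qed

lemma rep_L2:
  fixes p :: "4 option \<Rightarrow> real^3 \<Rightarrow> 'b::euclidean_space"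
  assumes "rep p f" "\<And>m. continuous_on UNIV (p m)" shows "f \<in> L2 (tet X)"
proof -
  have "integrable tetM (\<lambda>x. (norm (f x))\<^sup>2)"
    by (rule rep_integral(1)[OF rep_map[OF assms(1), of "\<lambda>_ y. (norm y)\<^sup>2"]]) (intro continuous_intros assms(2))
  then show ?thesis using rep_measurable[OF assms] unfolding L2_def tetM_def by simp
qed

lemma L2_integrable:
  fixes g :: "real^3 \<Rightarrow> real"
  assumes "g \<in> L2 (tet X)" shows "integrable tetM g" "g \<in> borel_measurable tetM"
proof -
  show m: "g \<in> borel_measurable tetM" using assms by (simp add: L2_def tetM_def)
  have "integrable tetM (\<lambda>x. (g x)\<^sup>2)" using assms by (simp add: L2_def tetM_def)
  then show "integrable tetM g" by (rule integrable_of_square[OF finite_measure_tetM m])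
qed

lemma integrable_mult_test:
  fixes g \<phi> :: "real^3 \<Rightarrow> real"
  assumes g: "integrable tetM g" and \<phi>: "test_fun S \<phi>"
  shows "integrable tetM (\<lambda>x. g x * \<phi> x)"
proof -
  obtain R where R: "\<And>x. \<phi> x \<noteq> 0 \<Longrightarrow> norm x \<le> R" by (rule test_fun_support[OF \<phi>], rule that)
  obtain B where B: "0 \<le> B" "\<And>x. norm x \<le> R \<Longrightarrow> \<bar>\<phi> x\<bar> \<le> B"
    using loc_lip_bounded[OF smooth_loc_lip[OF test_fun_smooth[OF \<phi>]]] by blast
  have b: "\<bar>\<phi> x\<bar> \<le> B" for x using B R[of x] by (cases "\<phi> x = 0") auto
  have "\<phi> \<in> borel_measurable borel"
    by (intro borel_measurable_continuous_onI smooth_continuous_on test_fun_smooth[OF \<phi>])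
  then have m: "\<phi> \<in> borel_measurable tetM"
    unfolding tetM_def by (intro measurable_restrict_space1 measurable_completion) simp
  show ?thesis
  proof (rule Bochner_Integration.integrable_bound[of tetM "\<lambda>x. B * g x"])
    show "integrable tetM (\<lambda>x. B * g x)" using g by simp
    show "(\<lambda>x. g x * \<phi> x) \<in> borel_measurable tetM" using m borel_measurable_integrable[OF g] by measurable
    show "AE x in tetM. norm (g x * \<phi> x) \<le> norm (B * g x)"
      using b B(1) by (intro AE_I2) (auto simp: abs_mult mult.commute intro!: mult_right_mono)
  qed
qed

section \<open>Normal jumps of a field with a weak divergence\<close>

text \<open>\<open>m'\<close> and \<open>l'\<close> name the pieces on the two sides of the plane.
  They are separate from \<open>m\<close> and \<open>l\<close> because the order is reversed at the
  boundary: across an interior face the smaller function names the cell, whereas the side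
  \<open>L (Some i) < L None\<close> of a boundary face is the exterior.\<close>

lemma flux_jump:
  fixes v :: "4 option \<Rightarrow> real^3 \<Rightarrow> real^3"
  assumes v: "\<And>m k. smooth (\<lambda>x. v m x $ k)" and v0: "\<And>x. v None x = 0"
    and U: "open U" "x0 \<in> U" and x0: "L m x0 = L l x0" and ml: "m \<noteq> l"
    and flux: "\<And>\<phi>. test_fun U \<phi> \<Longrightarrow> (\<integral>x. pw (\<lambda>m. dflux (v m) \<phi>) x \<partial>lborel) = 0"
    and cm: "\<And>x p. x \<in> U \<Longrightarrow> L m x < L l x \<Longrightarrow> p None x = 0 \<Longrightarrow> pw p x = (p m' x :: real)"
    and cl: "\<And>x p. x \<in> U \<Longrightarrow> L l x < L m x \<Longrightarrow> p None x = 0 \<Longrightarrow> pw p x = (p l' x :: real)"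
  shows "v m' x0 \<bullet> (av m - av l) = v l' x0 \<bullet> (av m - av l)"
proof -
  obtain \<rho> where \<rho>: "0 < \<rho>" "ball x0 \<rho> \<subseteq> U" using U open_contains_ball by blast
  let ?\<nu> = "av l - av m"
  have \<nu>: "0 < ?\<nu> \<bullet> (x - x0) \<longleftrightarrow> L m x < L l x" for x
    using x0 by (auto simp: L_def inner_diff_left inner_diff_right)
  have "v m' x0 \<bullet> ?\<nu> = v l' x0 \<bullet> ?\<nu>"
  proof (rule normal_component_jump[OF v v \<rho>(1)])
    fix \<phi> :: "real^3 \<Rightarrow> real" assume t: "test_fun (ball x0 \<rho>) \<phi>"
    have cont: "continuous_on UNIV (dflux (v m) \<phi>)" for m by (rule dflux_props(1)[OF v t])
    have "0 = (\<integral>x. pw (\<lambda>m. dflux (v m) \<phi>) x \<partial>lborel)"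
      using flux[OF test_fun_mono[OF t \<rho>(2)]] by simp
    also have "\<dots> = (\<integral>x. (if 0 < ?\<nu> \<bullet> (x - x0) then dflux (v m') \<phi> x else dflux (v l') \<phi> x) \<partial>lborel)"
    proof (rule integral_cong_AE)
      show "pw (\<lambda>m. dflux (v m) \<phi>) \<in> borel_measurable lborel" using pw_measurable[OF cont] by simp
      have [measurable]: "dflux (v m) \<phi> \<in> borel_measurable borel" for m
        by (rule borel_measurable_continuous_onI[OF cont])
      show "(\<lambda>x. if 0 < ?\<nu> \<bullet> (x - x0) then dflux (v m') \<phi> x else dflux (v l') \<phi> x) \<in> borel_measurable lborel"
        by measurable
      show "AE x in lborel. pw (\<lambda>m. dflux (v m) \<phi>) x = (if 0 < ?\<nu> \<bullet> (x - x0) then dflux (v m') \<phi> x else dflux (v l') \<phi> x)"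
        using AE_L_neq[unfolded AE_completion_iff]
      proof eventually_elim
        case (elim x)
        have d0: "dflux (v None) \<phi> x = 0" by (simp add: dflux_def v0)
        show ?case
        proof (cases "x \<in> ball x0 \<rho>")
          case True
          then have x: "x \<in> U" using \<rho>(2) by blast
          have "L m x \<noteq> L l x" using elim ml by blast
          then consider "L m x < L l x" | "L l x < L m x" by linarith
          then show ?thesis
            by cases (use cm[OF x, of "\<lambda>m. dflux (v m) \<phi>"] cl[OF x, of "\<lambda>m. dflux (v m) \<phi>"] d0 \<nu>[of x] in auto)
        next
          case False
          have "\<phi> x = 0" "partial k \<phi> x = 0" for k using test_fun_support[OF t] False by meson+
          then have "dflux (v m) \<phi> x = 0" for m by (simp add: dflux_def)
          then show ?thesis by (simp add: pw_def)
        qed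
      qed
    qed
    finally show "(\<integral>x. (if 0 < ?\<nu> \<bullet> (x - x0) then dflux (v m') \<phi> x else dflux (v l') \<phi> x) \<partial>lborel) = 0" ..
  qed
  then show ?thesis by (simp add: inner_diff_right)
qed

text \<open>The centroid of the three \<open>vt n\<close> with \<open>n\<close> different from
  \<open>m\<close> and \<open>l\<close>, a point in the relative interior of the face on
  \<open>L m = L l\<close>. The value \<open>s\<close> is 1/3 when \<open>z\<close> is one of the
  three, since only \<open>z\<close> has height 1.\<close>

lemma face_point:
  assumes "m \<noteq> l"
  obtains x0 s where "\<And>k. L k x0 = s + (if k = m \<or> k = l then 0 else 1 / (3 * kap k))"
    "s = (if None \<in> {m, l} then 0 else 1/3)"
proof -
  have c: "card (UNIV - {m, l}) = 3"
    using assms by (simp add: card_Diff_subset card_UNIV_option)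
  let ?x = "\<Sum>n\<in>UNIV - {m, l}. (1/3) *\<^sub>R vt n"
  have "L k ?x = (if None \<in> {m, l} then 0 else 1/3) + (if k = m \<or> k = l then 0 else 1 / (3 * kap k))" for k
  proof -
    have "L k ?x = (\<Sum>n\<in>UNIV - {m, l}. (1/3) * L k (vt n))" by (rule L_combination) (simp add: c)
    also have "\<dots> = (\<Sum>n\<in>UNIV - {m, l}. (1/3) * (if n = None then 1 else 0)) + (\<Sum>n\<in>UNIV - {m, l}. (1/3) * (if k = n then 1 / kap k else 0))"
      unfolding sum.distrib[symmetric] by (intro sum.cong) (auto simp: L_vt sv_def split: option.splits)
    also have "\<dots> = (if None \<in> {m, l} then 0 else 1/3) + (if k = m \<or> k = l then 0 else 1 / (3 * kap k))"
      using sum_mult_delta(1)[of "UNIV - {m, l}" "\<lambda>_. 1/3" None "\<lambda>_. 1"]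
        sum_mult_delta(2)[of "UNIV - {m, l}" "\<lambda>_. 1/3" k "\<lambda>_. 1 / kap k"] by auto
    finally show ?thesis .
  qed
  then show ?thesis by (rule that) simp
qed

text \<open>Every point of the plane is joined to \<open>x0\<close> by a segment inside the plane,
  and the polynomial vanishes on the part of it near \<open>x0\<close>.\<close>

lemma plane_poly_eq:
  assumes U: "open U" "x0 \<in> U" and x0: "L m x0 = L l x0" and q: "poly_fun n q"
    and z: "\<And>x. x \<in> U \<Longrightarrow> L m x = L l x \<Longrightarrow> q x = 0" and x: "L m x = L l x"
  shows "q x = 0"
proof -
  obtain e where e: "0 < e" "ball x0 e \<subseteq> U" using U open_contains_ball by blast
  define d where "d = e / (norm (x - x0) + 1)"
  have d: "0 < d" using e(1) by (simp add: d_def add_nonneg_pos)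
  have "q (x0 + t *\<^sub>R (x - x0)) = 0" if t: "0 < t" "t < d" for t
  proof (rule z)
    have "t * norm (x - x0) \<le> t * (norm (x - x0) + 1)" using t by simp
    also have "\<dots> < e" using t add_nonneg_pos[OF norm_ge_zero[of "x - x0"] zero_less_one] by (simp add: d_def pos_less_divide_eq)
    finally show "x0 + t *\<^sub>R (x - x0) \<in> U" using e(2) t by (auto simp: dist_norm subset_iff)
    have "(av m - av l) \<bullet> (x - x0) = 0" using x L_eq_iff[OF x0] by blast
    then show "L m (x0 + t *\<^sub>R (x - x0)) = L l (x0 + t *\<^sub>R (x - x0))" by (simp add: L_eq_iff[OF x0])
  qed
  from poly_fun_zero_on_line[OF q d this, of 1] show ?thesis by simp
qed

lemma interior_flux_jump:
  fixes v :: "4 option \<Rightarrow> real^3 \<Rightarrow> real^3"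
  assumes v: "\<And>m k. poly_fun n (\<lambda>x. v m x $ k)" and v0: "\<And>x. v None x = 0" and ij: "i \<noteq> j"
    and flux: "\<And>\<phi>. test_fun (interior (tet X)) \<phi> \<Longrightarrow> (\<integral>x. pw (\<lambda>m. dflux (v m) \<phi>) x \<partial>lborel) = 0"
    and x: "L (Some i) x = L (Some j) x"
  shows "v (Some i) x \<bullet> (av (Some i) - av (Some j)) = v (Some j) x \<bullet> (av (Some i) - av (Some j))"
proof -
  \<comment> \<open>An open set around the common open face of the cells \<open>i\<close> and
    \<open>j\<close> that meets no other cell.\<close>
  define U where "U = {x. \<forall>k. if k = i \<or> k = j then 0 < L (Some k) x else L (Some i) x < L (Some k) x \<and> L (Some j) x < L (Some k) x}"
  obtain x0 s where x0: "\<And>k. L k x0 = s + (if k = Some i \<or> k = Some j then 0 else 1 / (3 * kap k))"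
    and s: "s = (if None \<in> {Some i, Some j} then 0 else 1/3)" using face_point[of "Some i" "Some j"] ij by blast
  have "open (\<Inter>k. {x. if k = i \<or> k = j then 0 < L (Some k) x else L (Some i) x < L (Some k) x \<and> L (Some j) x < L (Some k) x})"
  proof (intro open_INT ballI)
    fix k
    have "open {x. 0 < L (Some k) x}" "open {x. L (Some i) x < L (Some k) x}" "open {x. L (Some j) x < L (Some k) x}"
      by (intro open_Collect_less continuous_intros smooth_continuous_on L_smooth)+
    then show "open {x. if k = i \<or> k = j then 0 < L (Some k) x else L (Some i) x < L (Some k) x \<and> L (Some j) x < L (Some k) x}"
      by (cases "k = i \<or> k = j") (simp_all add: open_Collect_conj)
  qed simp
  moreover have "(\<Inter>k. {x. if k = i \<or> k = j then 0 < L (Some k) x else L (Some i) x < L (Some k) x \<and> L (Some j) x < L (Some k) x}) = U"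
    by (auto simp: U_def)
  ultimately have U: "open U" by simp
  have x0U: "x0 \<in> U" unfolding U_def using cz_pos by (simp add: x0 kap_def s)
  have cellD: "x \<in> cell a" if "x \<in> U" "L (Some a) x < L (Some b) x" "(a, b) = (i, j) \<or> (a, b) = (j, i)" for a b x
    unfolding cell_eq mem_Collect_eq
  proof (intro conjI allI impI)
    have all: "if k = i \<or> k = j then 0 < L (Some k) x else L (Some i) x < L (Some k) x \<and> L (Some j) x < L (Some k) x" for k
      using that(1) unfolding U_def by blast
    show "0 < L (Some a) x" using all[of a] that(3) by auto
    fix k assume "k \<noteq> a"
    then show "L (Some a) x < L (Some k) x" using all[of k] that by (auto split: if_splits)
  qed
  have US: "U \<subseteq> interior (tet X)"
  proof
    fix x assume "x \<in> U"
    then have all: "if k = i \<or> k = j then 0 < L (Some k) x else L (Some i) x < L (Some k) x \<and> L (Some j) x < L (Some k) x" for k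
      unfolding U_def by blast
    have "0 < L (Some k) x" for k using all[of k] all[of i] by (auto split: if_splits)
    then show "x \<in> interior (tet X)" by (simp add: interior_tet)
  qed
  have jmp: "v (Some i) y \<bullet> (av (Some i) - av (Some j)) = v (Some j) y \<bullet> (av (Some i) - av (Some j))"
    if y: "y \<in> U" "L (Some i) y = L (Some j) y" for y
  proof (rule flux_jump[where v=v, OF poly_fun_smooth[OF v] v0 U y])
    show "Some i \<noteq> Some j" using ij by simp
    show "(\<integral>x. pw (\<lambda>m. dflux (v m) \<phi>) x \<partial>lborel) = 0" if "test_fun U \<phi>" for \<phi>
      by (rule flux[OF test_fun_mono[OF that US]])
  qed (auto intro!: pw_cell cellD)
  let ?q = "\<lambda>x. \<Sum>k\<in>UNIV. (av (Some i) - av (Some j)) $ k * (v (Some i) x $ k - v (Some j) x $ k)"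
  have q: "?q x = v (Some i) x \<bullet> (av (Some i) - av (Some j)) - v (Some j) x \<bullet> (av (Some i) - av (Some j))" for x
    by (simp add: inner_vec_def sum_subtractf[symmetric] algebra_simps)
  have e0: "L (Some i) x0 = L (Some j) x0" by (simp add: x0)
  have "poly_fun n ?q" by (intro poly_fun_sum poly_fun_cmult poly_fun_diff v)
  from plane_poly_eq[OF U x0U e0 this _ x] have "?q x = 0" unfolding q using jmp by auto
  then show ?thesis unfolding q by simp
qed

lemma boundary_flux_jump:
  fixes v :: "4 option \<Rightarrow> real^3 \<Rightarrow> real^3"
  assumes v: "\<And>m k. poly_fun n (\<lambda>x. v m x $ k)" and v0: "\<And>x. v None x = 0"
    and flux: "\<And>\<phi>. test_fun UNIV \<phi> \<Longrightarrow> (\<integral>x. pw (\<lambda>m. dflux (v m) \<phi>) x \<partial>lborel) = 0"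
    and x: "L (Some i) x = 0"
  shows "v (Some i) x \<bullet> av (Some i) = 0"
proof -
  \<comment> \<open>Off the plane \<open>L (Some i) = 0\<close>, this set consists of points of cell
    \<open>i\<close> and of the exterior of T only.\<close>
  define U where "U = {x. \<forall>k. k \<noteq> i \<longrightarrow> L (Some i) x < L (Some k) x}"
  obtain x0 s where x0: "\<And>k. L k x0 = s + (if k = Some i \<or> k = None then 0 else 1 / (3 * kap k))"
    and s: "s = (if None \<in> {Some i, None} then 0 else 1/3)" using face_point[of "Some i" None] by blast
  have "open (\<Inter>k. {x. k \<noteq> i \<longrightarrow> L (Some i) x < L (Some k) x})"
  proof (intro open_INT ballI)
    fix k
    have "open {x. L (Some i) x < L (Some k) x}"
      by (intro open_Collect_less continuous_intros smooth_continuous_on L_smooth)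
    then show "open {x. k \<noteq> i \<longrightarrow> L (Some i) x < L (Some k) x}" by (cases "k = i") simp_all
  qed simp
  moreover have "(\<Inter>k. {x. k \<noteq> i \<longrightarrow> L (Some i) x < L (Some k) x}) = U" by (auto simp: U_def)
  ultimately have U: "open U" by simp
  have x0U: "x0 \<in> U" unfolding U_def using cz_pos by (simp add: x0 kap_def s)
  have jmp: "v (Some i) y \<bullet> av (Some i) = 0" if y: "y \<in> U" "L (Some i) y = L None y" for y
  proof -
    have "v None y \<bullet> (av (Some i) - av None) = v (Some i) y \<bullet> (av (Some i) - av None)"
    proof (rule flux_jump[where v=v, OF poly_fun_smooth[OF v] v0 U y])
      show "(\<integral>x. pw (\<lambda>m. dflux (v m) \<phi>) x \<partial>lborel) = 0" if "test_fun U \<phi>" for \<phi>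
        by (rule flux[OF test_fun_mono[OF that]]) simp
      show "pw p x = p None x" if "x \<in> U" "L (Some i) x < L None x" "p None x = 0" for x and p :: "4 option \<Rightarrow> real^3 \<Rightarrow> real"
      proof -
        have "x \<notin> cell k" for k
        proof
          assume "x \<in> cell k"
          then have "x \<in> tet X" using cell_subset_subtet subtet_subset_tet by blast
          then have "0 \<le> L (Some i) x" by (simp add: tet_eq)
          with that show False by simp
        qed
        then show ?thesis using that by (simp add: pw_outside)
      qed
      show "pw p x = p (Some i) x" if "x \<in> U" "L None x < L (Some i) x" for x and p :: "4 option \<Rightarrow> real^3 \<Rightarrow> real"
        using that by (intro pw_cell) (simp add: cell_eq U_def)
    qed simp
    then show ?thesis by (simp add: v0)
  qed
  let ?q = "\<lambda>x. \<Sum>k\<in>UNIV. av (Some i) $ k * v (Some i) x $ k"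
  have q: "?q x = v (Some i) x \<bullet> av (Some i)" for x by (simp add: inner_vec_def mult.commute)
  have e0: "L (Some i) x0 = L None x0" by (simp add: x0)
  have "poly_fun n ?q" by (intro poly_fun_sum poly_fun_cmult v)
  from plane_poly_eq[OF U x0U e0 this, of x] have "?q x = 0" unfolding q using jmp x by auto
  then show ?thesis unfolding q .
qed

text \<open>Test functions supported in one cell identify \<open>G\<close> with the classical
  divergence there. After that, test functions across a face see only the jump of the normal
  component. Weak partial derivatives and weak curls are both instances, by the choice of
  \<open>v\<close>.\<close>

lemma weak_divergence:
  fixes v :: "4 option \<Rightarrow> real^3 \<Rightarrow> real^3"
  assumes v: "\<And>m k. poly_fun n (\<lambda>x. v m x $ k)" and v0: "\<And>x. v None x = 0" and G: "integrable tetM G"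
    and weak: "\<And>\<phi>. test_fun (interior (tet X)) \<phi> \<Longrightarrow>
      (\<integral>x. pw (\<lambda>m x. \<Sum>k\<in>UNIV. v m x $ k * partial k \<phi> x) x \<partial>lborel) = - (\<integral>x. G x * \<phi> x \<partial>tetM)"
  shows "rep (\<lambda>m x. \<Sum>k\<in>UNIV. partial k (\<lambda>y. v m y $ k) x) G"
    "i \<noteq> j \<Longrightarrow> L (Some i) x = L (Some j) x \<Longrightarrow>
      v (Some i) x \<bullet> (av (Some i) - av (Some j)) = v (Some j) x \<bullet> (av (Some i) - av (Some j))"
proof -
  let ?div = "\<lambda>m x. \<Sum>k\<in>UNIV. partial k (\<lambda>y. v m y $ k) x"
  note vs = poly_fun_smooth[OF v]
  have cdiv: "continuous_on UNIV (?div m)" for m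
    by (intro continuous_intros smooth_continuous_on smooth_partial vs)
  have dfl: "dflux (v m) \<phi> x = (\<Sum>k\<in>UNIV. v m x $ k * partial k \<phi> x) + ?div m x * \<phi> x" for m \<phi> x
    by (simp add: dflux_def sum.distrib sum_distrib_right)
  have intT: "integrable tetM f \<Longrightarrow> integrable lebesgue (\<lambda>x. indicator (tet X) x * f x) \<and>
      (\<integral>x. f x \<partial>tetM) = (\<integral>x. indicator (tet X) x * f x \<partial>lebesgue)" for f :: "real^3 \<Rightarrow> real"
    unfolding tetM_def using integrable_restrict_space[OF space_tetM, of f] integral_restrict_space[OF space_tetM, of f] by simp
  show rep: "rep ?div G"
  proof -
    have "AE x in lebesgue. x \<in> cell i \<longrightarrow> indicator (tet X) x * (G x - ?div (Some i) x) = 0" for i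
    proof (rule AE_eq_0_of_test_fun_integrals[OF _ open_cell])
      have d: "integrable tetM (?div (Some i))"
        by (rule rep_integral(1)[of "\<lambda>_. ?div (Some i)"]) (simp add: rep_def, rule cdiv)
      show "integrable lebesgue (\<lambda>x. indicator (tet X) x * (G x - ?div (Some i) x))"
        using intT[of "\<lambda>x. G x - ?div (Some i) x"] G d by simp
      fix \<phi> :: "real^3 \<Rightarrow> real" assume t: "test_fun (cell i) \<phi>"
      note tT = test_fun_mono[OF t cell_subset_interior]
      have off: "\<phi> x = 0" "partial k \<phi> x = 0" if "x \<notin> cell i" for x k
        using test_fun_support[OF t] that by meson+
      have c1: "continuous_on UNIV (\<lambda>x. \<Sum>k\<in>UNIV. v m x $ k * partial k \<phi> x)" for m
        by (intro continuous_intros smooth_continuous_on smooth_partial vs test_fun_smooth[OF t])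
      have c2: "continuous_on UNIV (\<lambda>x. ?div m x * \<phi> x)" for m
        by (intro continuous_intros cdiv smooth_continuous_on test_fun_smooth[OF t])
      have pw1: "pw (\<lambda>m. h m) x = h (Some i) x" if "\<And>m. x \<notin> cell i \<Longrightarrow> h m x = 0" for h :: "4 option \<Rightarrow> real^3 \<Rightarrow> real" and x
      proof (cases "x \<in> cell i")
        case False
        then show ?thesis using that by (simp add: pw_def)
      qed (rule pw_cell)
      have "(\<integral>x. G x * \<phi> x \<partial>tetM) = - (\<integral>x. (\<Sum>k\<in>UNIV. v (Some i) x $ k * partial k \<phi> x) \<partial>lborel)"
      proof -
        have "(\<integral>x. pw (\<lambda>m x. \<Sum>k\<in>UNIV. v m x $ k * partial k \<phi> x) x \<partial>lborel)
            = (\<integral>x. (\<Sum>k\<in>UNIV. v (Some i) x $ k * partial k \<phi> x) \<partial>lborel)"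
          by (intro Bochner_Integration.integral_cong refl pw1) (simp add: off)
        then show ?thesis using weak[OF tT] by simp
      qed
      moreover have "(\<integral>x. ?div (Some i) x * \<phi> x \<partial>tetM) = (\<integral>x. ?div (Some i) x * \<phi> x \<partial>lborel)"
      proof -
        have "(\<integral>x. ?div (Some i) x * \<phi> x \<partial>tetM) = (\<integral>x. pw (\<lambda>_ x. ?div (Some i) x * \<phi> x) x \<partial>lborel)"
          by (rule rep_integral(2)) (simp add: rep_def, rule c2)
        also have "\<dots> = (\<integral>x. ?div (Some i) x * \<phi> x \<partial>lborel)"
          by (intro Bochner_Integration.integral_cong refl pw1) (simp add: off)
        finally show ?thesis .
      qed
      moreover have "(\<integral>x. (\<Sum>k\<in>UNIV. v (Some i) x $ k * partial k \<phi> x) + ?div (Some i) x * \<phi> x \<partial>lborel) = 0"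
        using dflux_props(3)[OF vs t, of "Some i"] unfolding dfl .
      moreover have i1: "integrable lborel (\<lambda>x. \<Sum>k\<in>UNIV. v (Some i) x $ k * partial k \<phi> x)"
        and i2: "integrable lborel (\<lambda>x. ?div (Some i) x * \<phi> x)"
      proof -
        obtain R where R: "\<And>x. \<phi> x \<noteq> 0 \<Longrightarrow> norm x \<le> R" "\<And>i x. partial i \<phi> x \<noteq> 0 \<Longrightarrow> norm x \<le> R"
          by (rule test_fun_support[OF t], rule that)
        show "integrable lborel (\<lambda>x. ?div (Some i) x * \<phi> x)"
          by (rule integrable_smooth_support[OF c2, of _ R]) (use R(1) in auto)
        show "integrable lborel (\<lambda>x. \<Sum>k\<in>UNIV. v (Some i) x $ k * partial k \<phi> x)"
        proof (rule integrable_smooth_support[OF c1, of _ R])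
          fix x assume "(\<Sum>k\<in>UNIV. v (Some i) x $ k * partial k \<phi> x) \<noteq> 0"
          then obtain k where "v (Some i) x $ k * partial k \<phi> x \<noteq> 0" by (meson sum.neutral)
          then show "norm x \<le> R" using R(2)[of k x] by auto
        qed
      qed
      ultimately have z: "(\<integral>x. G x * \<phi> x \<partial>tetM) - (\<integral>x. ?div (Some i) x * \<phi> x \<partial>tetM) = 0"
        by (simp add: Bochner_Integration.integral_add)
      have j1: "integrable tetM (\<lambda>x. G x * \<phi> x)" by (rule integrable_mult_test[OF G t])
      have j2: "integrable tetM (\<lambda>x. ?div (Some i) x * \<phi> x)" by (rule integrable_mult_test[OF d t])
      have "(\<integral>x. indicator (tet X) x * (G x - ?div (Some i) x) * \<phi> x \<partial>lebesgue)
          = (\<integral>x. G x * \<phi> x - ?div (Some i) x * \<phi> x \<partial>tetM)"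
        using intT[of "\<lambda>x. G x * \<phi> x - ?div (Some i) x * \<phi> x"] j1 j2 by (simp add: algebra_simps)
      also have "\<dots> = 0" using z j1 j2 by simp
      finally show "(\<integral>x. indicator (tet X) x * (G x - ?div (Some i) x) * \<phi> x \<partial>lebesgue) = 0" .
    qed
    then have "AE x in lebesgue. \<forall>i. x \<in> cell i \<longrightarrow> indicator (tet X) x * (G x - ?div (Some i) x) = 0"
      by (simp add: AE_all_countable)
    then show ?thesis
      unfolding rep_def by eventually_elim (use cell_subset_subtet subtet_subset_tet in \<open>fastforce simp: indicator_def\<close>)
  qed
  show "v (Some i) x \<bullet> (av (Some i) - av (Some j)) = v (Some j) x \<bullet> (av (Some i) - av (Some j))"
    if ij: "i \<noteq> j" and x: "L (Some i) x = L (Some j) x"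
  proof (rule interior_flux_jump[where v=v, OF v v0 ij _ x])
    fix \<phi> :: "real^3 \<Rightarrow> real" assume t: "test_fun (interior (tet X)) \<phi>"
    have c1: "continuous_on UNIV (\<lambda>x. \<Sum>k\<in>UNIV. v m x $ k * partial k \<phi> x)" for m
      by (intro continuous_intros smooth_continuous_on smooth_partial vs test_fun_smooth[OF t])
    have c2: "continuous_on UNIV (\<lambda>x. ?div m x * \<phi> x)" for m
      by (intro continuous_intros cdiv smooth_continuous_on test_fun_smooth[OF t])
    have "(\<integral>x. G x * \<phi> x \<partial>tetM) = (\<integral>x. pw (\<lambda>m x. ?div m x * \<phi> x) x \<partial>lborel)"
      by (rule rep_integral(2)[OF rep_map[OF rep, of "\<lambda>x y. y * \<phi> x"] c2])
    then have "(\<integral>x. pw (\<lambda>m x. \<Sum>k\<in>UNIV. v m x $ k * partial k \<phi> x) x + pw (\<lambda>m x. ?div m x * \<phi> x) x \<partial>lborel) = 0"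
      using weak[OF t] pw_integrable[OF c1] pw_integrable[OF c2] by simp
    moreover have "pw (\<lambda>m. dflux (v m) \<phi>) x = pw (\<lambda>m x. \<Sum>k\<in>UNIV. v m x $ k * partial k \<phi> x) x + pw (\<lambda>m x. ?div m x * \<phi> x) x" for x
      by (simp add: pw_def dfl distrib_left sum.distrib)
    ultimately show "(\<integral>x. pw (\<lambda>m. dflux (v m) \<phi>) x \<partial>lborel) = 0" by simp
  qed
qed

section \<open>Continuity across interior faces and weak partial derivatives\<close>

lemma PA_iff: "f \<in> PA n X z \<longleftrightarrow> (\<exists>p. (\<forall>m. poly_fun n (p m)) \<and> (\<forall>x. p None x = 0) \<and> rep p f)"
proof
  assume "f \<in> PA n X z"
  then have "\<exists>q. poly_fun n q \<and> (AE x in lebesgue. x \<in> cell i \<longrightarrow> f x = q x)" for i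
    unfolding PA_def alfeld_def P_def by (auto simp: AE_on_subtet_iff)
  then have "\<exists>q. \<forall>i. poly_fun n (q i) \<and> (AE x in lebesgue. x \<in> cell i \<longrightarrow> f x = q i x)" by (intro choice allI)
  then obtain q where q: "\<And>i. poly_fun n (q i)" "\<And>i. AE x in lebesgue. x \<in> cell i \<longrightarrow> f x = q i x" by blast
  define p where "p m x = (case m of None \<Rightarrow> 0 | Some i \<Rightarrow> q i x)" for m x
  have "poly_fun n (p m)" for m
    using q(1) poly_fun_zero by (cases m) (simp_all add: p_def[abs_def])
  moreover have "rep p f"
    unfolding rep_def AE_all_countable using q(2) by (simp add: p_def)
  moreover have "p None x = 0" for x by (simp add: p_def)
  ultimately show "\<exists>p. (\<forall>m. poly_fun n (p m)) \<and> (\<forall>x. p None x = 0) \<and> rep p f" by blast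
next
  assume "\<exists>p. (\<forall>m. poly_fun n (p m)) \<and> (\<forall>x. p None x = 0) \<and> rep p f"
  then obtain p where p: "\<And>m. poly_fun n (p m)" "rep p f" by blast
  have "AE x in lebesgue. x \<in> cell i \<longrightarrow> f x = p (Some i) x" for i
    using p(2)[unfolded rep_def] by eventually_elim blast
  then show "f \<in> PA n X z"
    unfolding PA_def alfeld_def P_def using p(1) by (auto simp: AE_on_subtet_iff)
qed

text \<open>Interpolation with singletons as index sets: the hyperplanes \<open>s = L m x\<close>
  and \<open>s = L l x\<close> meet over \<open>L m = L l\<close>, where \<open>C0\<close> is the
  compatibility condition. The degree is raised by one because interpolation asks for a positive
  degree.\<close>

lemma C0_interpolation:
  assumes p: "\<And>m. poly_fun n (p m)" and C: "C0 N p"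
  obtains R where "param_poly (Suc n) R" "\<And>m x. m \<in> N \<Longrightarrow> poly (R x) (L m x) = p m x"
proof -
  have "\<exists>R. param_poly (Suc n) R \<and> (\<forall>i\<in>N. \<forall>x s. (\<forall>m\<in>{i}. L m x = s) \<longrightarrow> poly (R x) s = p i x)"
  proof (rule interpolation)
    show "finite N" by (rule finite_subset[OF subset_UNIV]) simp
    show "poly_fun (Suc n) (p i)" for i using poly_fun_mono[OF p] by simp
    fix i j x t assume ij: "i \<in> N" "j \<in> N" and e: "\<forall>m\<in>{i} \<union> {j}. L m x = t"
    from e have "L i x = L j x" by simp
    with C ij show "p i x = p j x" unfolding C0_def by blast
  qed simp_all
  then obtain R where R: "param_poly (Suc n) R" "\<forall>i\<in>N. \<forall>x s. (\<forall>m\<in>{i}. L m x = s) \<longrightarrow> poly (R x) s = p i x"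
    by blast
  show ?thesis by (rule that[OF R(1)]) (use R(2) in simp)
qed

text \<open>On T this is the hat function of \<open>z\<close>. Substituting it for \<open>s\<close>
  in the interpolant gives a locally Lipschitz function on the whole space that equals the right
  polynomial on each cell.\<close>

definition mu :: "real^3 \<Rightarrow> real" where
  "mu x = Min (range (\<lambda>i. L (Some i) x))"

lemma mu_le: "mu x \<le> L (Some i) x" unfolding mu_def by (intro Min_le) auto

lemma mu_cell: assumes "x \<in> cell i" shows "mu x = L (Some i) x"
  unfolding mu_def
proof (rule Min_eqI)
  fix y assume "y \<in> range (\<lambda>i. L (Some i) x)"
  then obtain j where "y = L (Some j) x" by blast
  then show "L (Some i) x \<le> y" using assms by (cases "j = i") (auto simp: cell_eq less_imp_le)
qed auto

lemma loc_lip_mu: "loc_lip mu"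
  unfolding loc_lip_def
proof (intro allI exI ballI)
  fix x y :: "real^3"
  let ?M = "\<Sum>i\<in>UNIV. norm (av (Some i))"
  have le: "mu x - mu y \<le> ?M * norm (x - y)" for x y
  proof -
    have "mu y \<in> range (\<lambda>i. L (Some i) y)" unfolding mu_def by (intro Min_in) auto
    then obtain i where i: "mu y = L (Some i) y" by blast
    have "mu x - mu y \<le> L (Some i) x - L (Some i) y" using mu_le[of x i] i by simp
    also have "\<dots> = av (Some i) \<bullet> (x - y)" by (simp add: L_def inner_diff_right)
    also have "\<dots> \<le> norm (av (Some i)) * norm (x - y)" by (rule norm_cauchy_schwarz)
    also have "\<dots> \<le> ?M * norm (x - y)" by (intro mult_right_mono member_le_sum) auto
    finally show ?thesis .
  qed
  from le[of x y] le[of y x] show "\<bar>mu x - mu y\<bar> \<le> ?M * norm (x - y)" by (simp add: norm_minus_commute)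
qed

text \<open>The product of \<open>\<phi>\<close> with the interpolant at \<open>s = mu x\<close> is
  locally Lipschitz with bounded support, equals \<open>p (Some i) x * \<phi> x\<close> on cell
  \<open>i\<close> and vanishes outside T, so its derivatives have zero integral.\<close>

lemma C0_weak_partial:
  assumes p: "\<And>m. poly_fun n (p m)" and C: "C0 (range Some) p" and t: "test_fun (interior (tet X)) \<phi>"
  shows "(\<integral>x. pw (\<lambda>m x. p m x * partial k \<phi> x + partial k (p m) x * \<phi> x) x \<partial>lborel) = 0"
proof -
  note s = test_fun_smooth[OF t] and ps = poly_fun_smooth[OF p]
  obtain R where R: "param_poly (Suc n) R" "\<And>m x. m \<in> range Some \<Longrightarrow> poly (R x) (L m x) = p m x"
    using C0_interpolation[OF p C] by blast
  obtain r where r: "\<And>x. \<phi> x \<noteq> 0 \<Longrightarrow> norm x \<le> r"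
    by (rule test_fun_support[OF t], rule that)
  have off: "\<phi> x \<noteq> 0 \<Longrightarrow> x \<in> interior (tet X)" for x
    using test_fun_support[OF t] by meson
  define F where "F x = (\<Sum>j\<le>Suc n. coeff (R x) j * mu x ^ j) * \<phi> x" for x
  have Fp: "F x = p (Some i) x * \<phi> x" if "x \<in> cell i" for x i
    using R(2)[of "Some i" x] by (simp add: F_def param_poly_altdef[OF R(1)] mu_cell[OF that])
  let ?D = "pw (\<lambda>m x. p m x * partial k \<phi> x + partial k (p m) x * \<phi> x)"
  have cont: "continuous_on UNIV (\<lambda>x. p m x * partial k \<phi> x + partial k (p m) x * \<phi> x)" for m
    by (intro continuous_intros smooth_continuous_on smooth_partial ps s)
  show ?thesis
  proof (rule integral_partial_eq_0)
    show "loc_lip F"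
      unfolding F_def
      by (intro loc_lip_mult loc_lip_sum loc_lip_power loc_lip_mu smooth_loc_lip s poly_fun_smooth[OF param_poly_coeff[OF R(1)]])
    show "F x \<noteq> 0 \<Longrightarrow> norm x \<le> r" for x using r by (auto simp: F_def)
    show "?D \<in> borel_measurable borel" by (rule pw_measurable[OF cont])
    show "AE x in lborel. F differentiable at x \<and> ?D x = partial k F x"
      using AE_L_neq[unfolded AE_completion_iff]
    proof eventually_elim
      case (elim x)
      show ?case
      proof (cases "x \<in> tet X")
        case True
        then obtain i where i: "x \<in> cell i" using tet_cell_cover[OF _ elim] by blast
        have d: "(\<lambda>y. p (Some i) y * \<phi> y) differentiable at x"
          by (intro differentiable_mult smooth_differentiable ps s)
        then have "(F has_derivative frechet_derivative (\<lambda>y. p (Some i) y * \<phi> y) (at x)) (at x)"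
          unfolding frechet_derivative_works
          by (rule has_derivative_transform_within_open[OF _ open_cell i]) (simp add: Fp)
        then have "F differentiable at x" by (auto simp: differentiable_def)
        moreover have "partial k F x = partial k (\<lambda>y. p (Some i) y * \<phi> y) x"
          by (rule partial_cong_open[OF open_cell i Fp])
        ultimately show ?thesis
          using i by (simp add: pw_cell partial_mult smooth_differentiable ps s)
      next
        case False
        have o: "open (- tet X)" using compact_imp_closed[OF compact_tet] by (simp add: open_Compl)
        have F0: "F y = 0" if "y \<in> - tet X" for y using off[of y] interior_subset that by (auto simp: F_def)
        have x: "x \<in> - tet X" using False by simp
        have "(F has_derivative (\<lambda>_. 0)) (at x)"
          by (rule has_derivative_transform_within_open[OF has_derivative_const o x]) (simp add: F0)
        moreover have "partial k F x = partial k (\<lambda>_. 0) x" by (rule partial_cong_open[OF o x]) (rule F0)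
        moreover have "x \<notin> cell i" for i using False cell_subset_subtet subtet_subset_tet by blast
        ultimately show ?thesis by (auto simp: differentiable_def pw_outside)
      qed
    qed
  qed
qed

lemma has_wpartial_C0:
  assumes f: "rep p f" and p: "\<And>m. poly_fun n (p m)" and C: "C0 (range Some) p"
    and g: "rep (\<lambda>m. partial k (p m)) g"
  shows "has_wpartial (tet X) k f g"
  unfolding has_wpartial_def tetM_def[symmetric]
proof (intro conjI allI impI)
  note ps = poly_fun_smooth[OF p]
  show "f \<in> L2 (tet X)" by (rule rep_L2[OF f]) (intro smooth_continuous_on ps)
  show "g \<in> L2 (tet X)" by (rule rep_L2[OF g]) (intro smooth_continuous_on smooth_partial ps)
  fix \<phi> :: "real^3 \<Rightarrow> real" assume t: "test_fun (interior (tet X)) \<phi>"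
  note s = test_fun_smooth[OF t]
  have c1: "continuous_on UNIV (\<lambda>x. p m x * partial k \<phi> x)" and c2: "continuous_on UNIV (\<lambda>x. partial k (p m) x * \<phi> x)" for m
    by (intro continuous_intros smooth_continuous_on smooth_partial ps s)+
  have "(\<integral>x. f x * partial k \<phi> x \<partial>tetM) = (\<integral>x. pw (\<lambda>m x. p m x * partial k \<phi> x) x \<partial>lborel)"
    by (rule rep_integral(2)[OF rep_map[OF f, of "\<lambda>x y. y * partial k \<phi> x"] c1])
  moreover have "(\<integral>x. g x * \<phi> x \<partial>tetM) = (\<integral>x. pw (\<lambda>m x. partial k (p m) x * \<phi> x) x \<partial>lborel)"
    by (rule rep_integral(2)[OF rep_map[OF g, of "\<lambda>x y. y * \<phi> x"] c2])
  moreover have "pw (\<lambda>m x. p m x * partial k \<phi> x + partial k (p m) x * \<phi> x) x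
      = pw (\<lambda>m x. p m x * partial k \<phi> x) x + pw (\<lambda>m x. partial k (p m) x * \<phi> x) x" for x
    by (simp add: pw_def distrib_left sum.distrib)
  ultimately show "(\<integral>x. f x * partial k \<phi> x \<partial>tetM) = - (\<integral>x. g x * \<phi> x \<partial>tetM)"
    using C0_weak_partial[OF p C t, of k] pw_integrable[OF c1] pw_integrable[OF c2] by simp
qed

lemma C0_imp_H1:
  assumes "rep p f" "\<And>m. poly_fun n (p m)" "C0 (range Some) p"
  shows "f \<in> H1 (tet X)"
  unfolding H1_def using has_wpartial_C0[OF assms rep_pw] by blast

lemma sum_axis: "(\<Sum>j\<in>UNIV. axis k (c::real) $ j * a j) = c * a (k::3)"
proof -
  have "(\<Sum>j\<in>UNIV. axis k c $ j * a j) = (\<Sum>j\<in>UNIV. if j = k then c * a k else 0)"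
    by (intro sum.cong) (auto simp: axis_def)
  then show ?thesis by simp
qed

lemma partial_axis_field:
  fixes q :: "real^3 \<Rightarrow> real"
  shows "(\<Sum>j\<in>UNIV. partial j (\<lambda>y. axis k (q y) $ j) x) = partial k q x"
proof -
  have "partial j (\<lambda>y. axis k (q y) $ j) x = (if j = k then partial k q x else 0)" for j
    by (cases "j = k") (simp_all add: axis_def)
  then show "(\<Sum>j\<in>UNIV. partial j (\<lambda>y. axis k (q y) $ j) x) = partial k q x" by simp
qed

lemma poly_fun_axis: "poly_fun n q \<Longrightarrow> poly_fun n (\<lambda>x. axis k (q x) $ j)"
  by (cases "j = k") (simp_all add: axis_def poly_fun_zero)

text \<open>The weak divergence is applied to the field whose only nonzero component is the one with
  index \<open>k\<close>, equal to \<open>p\<close>. Its divergence is \<open>partial k p\<close>,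
  and its normal component is \<open>p\<close> times component \<open>k\<close> of the
  normal.\<close>

lemma has_wpartial_rep:
  assumes w: "has_wpartial (tet X) k f g" and f: "rep p f" and p: "\<And>m. poly_fun n (p m)"
    and p0: "\<And>x. p None x = 0"
  shows "rep (\<lambda>m. partial k (p m)) g"
    "i \<noteq> j \<Longrightarrow> L (Some i) x = L (Some j) x \<Longrightarrow>
      (p (Some i) x - p (Some j) x) * (av (Some i) - av (Some j)) $ k = 0"
proof -
  let ?v = "\<lambda>m x. axis k (p m x) :: real^3"
  have v: "poly_fun n (\<lambda>x. ?v m x $ j)" for m j by (rule poly_fun_axis[OF p])
  have v0: "?v None x = 0" for x by (simp add: p0 axis_def vec_eq_iff)
  have g: "integrable tetM g" using w L2_integrable unfolding has_wpartial_def by blast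
  have weak: "(\<integral>x. pw (\<lambda>m x. \<Sum>j\<in>UNIV. ?v m x $ j * partial j \<phi> x) x \<partial>lborel) = - (\<integral>x. g x * \<phi> x \<partial>tetM)"
    if t: "test_fun (interior (tet X)) \<phi>" for \<phi>
  proof -
    have c1: "continuous_on UNIV (\<lambda>x. p m x * partial k \<phi> x)" for m
      by (intro continuous_intros smooth_continuous_on smooth_partial poly_fun_smooth[OF p] test_fun_smooth[OF t])
    have "(\<integral>x. pw (\<lambda>m x. p m x * partial k \<phi> x) x \<partial>lborel) = (\<integral>x. f x * partial k \<phi> x \<partial>tetM)"
      by (rule rep_integral(2)[OF rep_map[OF f, of "\<lambda>x y. y * partial k \<phi> x"] c1, symmetric])
    then show ?thesis using w t unfolding has_wpartial_def tetM_def[symmetric] sum_axis by simp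
  qed
  show "rep (\<lambda>m. partial k (p m)) g"
    using weak_divergence(1)[where v="?v", OF v v0 g weak] unfolding partial_axis_field .
  show "(p (Some i) x - p (Some j) x) * (av (Some i) - av (Some j)) $ k = 0"
    if "i \<noteq> j" "L (Some i) x = L (Some j) x"
  proof -
    have e: "?v m x \<bullet> w = p m x * w $ k" for m and w :: "real^3"
      by (simp add: inner_axis')
    show ?thesis
      using weak_divergence(2)[where v="?v", OF v v0 g weak that] unfolding e by (simp add: algebra_simps)
  qed
qed

lemma H1_imp_C0:
  assumes H: "f \<in> H1 (tet X)" and f: "rep p f" and p: "\<And>m. poly_fun n (p m)" and p0: "\<And>x. p None x = 0"
  shows "C0 (range Some) p"
  unfolding C0_def
proof (intro ballI allI impI)
  fix m l x assume "m \<in> range Some" "l \<in> range Some" and e: "L m x = L l x"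
  then obtain i j where ij: "m = Some i" "l = Some j" by blast
  show "p m x = p l x"
  proof (cases "i = j")
    case False
    have "(p m x - p l x) * (av m - av l) $ k = 0" for k
    proof -
      obtain g where "has_wpartial (tet X) k f g" using H unfolding H1_def by blast
      from has_wpartial_rep(2)[OF this f p p0 False] e show ?thesis by (simp add: ij)
    qed
    moreover have "\<exists>k. (av m - av l) $ k \<noteq> 0"
      using av_neq[of m l] False ij by (auto simp: vec_eq_iff)
    ultimately show ?thesis by auto
  qed (simp add: ij)
qed

lemma wpartial_rep:
  assumes H: "f \<in> H1 (tet X)" and f: "rep p f" and p: "\<And>m. poly_fun n (p m)" and p0: "\<And>x. p None x = 0"
  shows "rep (\<lambda>m. partial k (p m)) (wpartial (tet X) k f)"
proof -
  have "\<exists>g. has_wpartial (tet X) k f g" using H unfolding H1_def by blast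
  then have "has_wpartial (tet X) k f (wpartial (tet X) k f)" unfolding wpartial_def by (rule someI_ex)
  from has_wpartial_rep(1)[OF this f p p0] show ?thesis .
qed

section \<open>Zero trace forces zero boundary values\<close>

lemma L2_tendsto_test:
  fixes d :: "nat \<Rightarrow> real^3 \<Rightarrow> real"
  assumes d: "\<And>N. rep (q N) (d N)" and q: "\<And>N m. continuous_on UNIV (q N m)"
    and \<psi>: "continuous_on UNIV \<psi>" and lim: "(\<lambda>N. \<integral>x. (d N x)\<^sup>2 \<partial>tetM) \<longlonglongrightarrow> 0"
  shows "(\<lambda>N. \<integral>x. d N x * \<psi> x \<partial>tetM) \<longlonglongrightarrow> 0"
proof -
  let ?Y = "\<integral>x. (\<psi> x)\<^sup>2 \<partial>tetM"
  have rc: "rep (\<lambda>_. h) h" for h :: "real^3 \<Rightarrow> real" by (simp add: rep_def)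
  have i1: "integrable tetM (\<lambda>x. (d N x)\<^sup>2)" for N
    by (rule rep_integral(1)[OF rep_map[OF d, of "\<lambda>_ y. y\<^sup>2"]]) (intro continuous_intros q)
  have i2: "integrable tetM (\<lambda>x. (\<psi> x)\<^sup>2)"
    by (rule rep_integral(1)[OF rc]) (intro continuous_intros \<psi>)
  have i3: "integrable tetM (\<lambda>x. d N x * \<psi> x)" for N
    by (rule rep_integral(1)[OF rep_map[OF d, of "\<lambda>x y. y * \<psi> x"]]) (intro continuous_intros q \<psi>)
  have Y: "0 \<le> ?Y" by (rule integral_nonneg_AE) simp
  have CS: "(\<integral>x. d N x * \<psi> x \<partial>tetM)\<^sup>2 \<le> (\<integral>x. (d N x)\<^sup>2 \<partial>tetM) * (?Y + 1)" for N
  proof -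
    let ?I = "\<integral>x. d N x * \<psi> x \<partial>tetM" and ?D = "\<integral>x. (d N x)\<^sup>2 \<partial>tetM"
    \<comment> \<open>The quadratic in \<open>t\<close> would be minimal at \<open>?I / ?Y\<close>;
      the shift by 1 avoids a zero denominator and only weakens the constant.\<close>
    define t where "t = ?I / (?Y + 1)"
    have e: "(d N x - t * \<psi> x)\<^sup>2 = (d N x)\<^sup>2 - 2 * t * (d N x * \<psi> x) + t\<^sup>2 * (\<psi> x)\<^sup>2" for x
      by (simp add: power2_eq_square algebra_simps)
    have "0 \<le> (\<integral>x. (d N x - t * \<psi> x)\<^sup>2 \<partial>tetM)" by (rule integral_nonneg_AE) simp
    also have "\<dots> = ?D - 2 * t * ?I + t\<^sup>2 * ?Y"
      unfolding e using i1[of N] i2 i3[of N] by simp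
    finally have 1: "0 \<le> ?D - 2 * t * ?I + t\<^sup>2 * ?Y" .
    have "?Y + 1 \<noteq> 0" using Y by linarith
    then have I: "?I = t * (?Y + 1)" by (simp add: t_def)
    have "2 * t * ?I - t\<^sup>2 * ?Y = t\<^sup>2 * (?Y + 2)" unfolding I by (simp add: power2_eq_square algebra_simps)
    moreover have "t\<^sup>2 * (?Y + 1) \<le> t\<^sup>2 * (?Y + 2)" by (intro mult_left_mono) auto
    ultimately have "t\<^sup>2 * (?Y + 1) \<le> ?D" using 1 by linarith
    then have "t\<^sup>2 * (?Y + 1) * (?Y + 1) \<le> ?D * (?Y + 1)" using Y by (intro mult_right_mono) auto
    then show ?thesis unfolding I by (simp add: power2_eq_square mult.assoc mult.left_commute)
  qed
  have "(\<lambda>N. (\<integral>x. (d N x)\<^sup>2 \<partial>tetM) * (?Y + 1)) \<longlonglongrightarrow> 0 * (?Y + 1)" by (intro tendsto_mult lim tendsto_const)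
  then have "(\<lambda>N. (\<integral>x. d N x * \<psi> x \<partial>tetM)\<^sup>2) \<longlonglongrightarrow> 0"
    using tendsto_sandwich[OF always_eventually always_eventually tendsto_const[of 0], of
        "\<lambda>N. (\<integral>x. d N x * \<psi> x \<partial>tetM)\<^sup>2" "\<lambda>N. (\<integral>x. (d N x)\<^sup>2 \<partial>tetM) * (?Y + 1)"] CS by simp
  then show ?thesis using power_tendsto_0_iff[of 2] by simp
qed

text \<open>The test function \<open>\<phi>\<close> is not confined to T, but the approximants
  \<open>h N\<close> vanish near the boundary, so the derivative of \<open>h N * \<phi>\<close> has
  zero integral. In the limit, \<open>p\<close> extended by zero has no flux through the boundary,
  and some component of each normal is nonzero.\<close>

lemma H1_0_imp_boundary:
  assumes H: "f \<in> H1_0 (tet X)" and f: "rep p f" and p: "\<And>m. poly_fun n (p m)" and p0: "\<And>x. p None x = 0"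
    and x: "L (Some i) x = 0"
  shows "p (Some i) x = 0"
proof -
  note ps = poly_fun_smooth[OF p]
  have H1: "f \<in> H1 (tet X)" using H by (simp add: H1_0_def)
  obtain h where h: "\<And>N. test_fun (interior (tet X)) (h N)"
    and lim0: "(\<lambda>N. \<integral>x. (h N x - f x)\<^sup>2 \<partial>tetM) \<longlonglongrightarrow> 0"
    and lim1: "\<And>k. (\<lambda>N. \<integral>x. (partial k (h N) x - wpartial (tet X) k f x)\<^sup>2 \<partial>tetM) \<longlonglongrightarrow> 0"
    using H unfolding H1_0_def tetM_def[symmetric] by blast
  note hs = test_fun_smooth[OF h]
  note wr = wpartial_rep[OF H1 f p p0]
  have "p (Some i) x * av (Some i) $ k = 0" for k
  proof -
    let ?v = "\<lambda>m x. axis k (p m x) :: real^3"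
    have "?v (Some i) x \<bullet> av (Some i) = 0"
    proof (rule boundary_flux_jump[where v="?v", OF poly_fun_axis[OF p] _ _ x])
      show "?v None x = 0" for x by (simp add: p0 axis_def vec_eq_iff)
      fix \<phi> :: "real^3 \<Rightarrow> real" assume t: "test_fun UNIV \<phi>"
      note s = test_fun_smooth[OF t]
      have dfl: "dflux (\<lambda>x. axis k (q x)) \<phi> x = q x * partial k \<phi> x + partial k q x * \<phi> x" for q :: "real^3 \<Rightarrow> real" and x
        by (simp add: dflux_def sum.distrib sum_distrib_right[symmetric] sum_axis partial_axis_field)
      have c: "continuous_on UNIV (\<lambda>x. q x * partial k \<phi> x + partial k q x * \<phi> x)" if "smooth q" for q
        by (intro continuous_intros smooth_continuous_on smooth_partial that s)
      let ?d0 = "\<lambda>N x. h N x - f x" and ?d1 = "\<lambda>N x. partial k (h N) x - wpartial (tet X) k f x"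
      have r0: "rep (\<lambda>m x. h N x - p m x) (?d0 N)" for N by (rule rep_map[OF f, of "\<lambda>x y. h N x - y"])
      have r1: "rep (\<lambda>m x. partial k (h N) x - partial k (p m) x) (?d1 N)" for N
        by (rule rep_map[OF wr, of "\<lambda>x y. partial k (h N) x - y"])
      have c0: "continuous_on UNIV (\<lambda>x. h N x - p m x)" and c1: "continuous_on UNIV (\<lambda>x. partial k (h N) x - partial k (p m) x)" for N m
        by (intro continuous_intros smooth_continuous_on smooth_partial ps hs)+
      have cf: "continuous_on UNIV \<phi>" "continuous_on UNIV (partial k \<phi>)"
        by (intro smooth_continuous_on smooth_partial s)+
      let ?A = "\<integral>x. pw (\<lambda>m. dflux (?v m) \<phi>) x \<partial>lborel"
      have A: "(\<integral>x. f x * partial k \<phi> x + wpartial (tet X) k f x * \<phi> x \<partial>tetM) = ?A"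
        unfolding dfl[abs_def]
        by (rule rep_integral(2)[OF rep_map2[OF f wr, of "\<lambda>x y w. y * partial k \<phi> x + w * \<phi> x"] c[OF ps]])
      have zero: "(\<integral>x. h N x * partial k \<phi> x + partial k (h N) x * \<phi> x \<partial>tetM) = 0" for N
      proof -
        have sh: "smooth (\<lambda>x. axis k (h N x) $ j :: real)" for j
          using hs smooth_alg_smooth[OF smooth_alg.const] by (cases "j = k") (simp_all add: axis_def)
        have "(\<integral>x. h N x * partial k \<phi> x + partial k (h N) x * \<phi> x \<partial>tetM)
            = (\<integral>x. pw (\<lambda>_ x. h N x * partial k \<phi> x + partial k (h N) x * \<phi> x) x \<partial>lborel)"
          by (rule rep_integral(2)[OF _ c[OF hs]]) (simp add: rep_def)
        also have "\<dots> = (\<integral>x. dflux (\<lambda>x. axis k (h N x)) \<phi> x \<partial>lborel)"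
        proof (rule integral_cong_AE)
          show "pw (\<lambda>_ x. h N x * partial k \<phi> x + partial k (h N) x * \<phi> x) \<in> borel_measurable lborel"
            using pw_measurable[OF c[OF hs]] by simp
          show "dflux (\<lambda>x. axis k (h N x)) \<phi> \<in> borel_measurable lborel"
            using borel_measurable_continuous_onI[OF dflux_props(1)[OF sh t]] by simp
          show "AE x in lborel. pw (\<lambda>_ x. h N x * partial k \<phi> x + partial k (h N) x * \<phi> x) x = dflux (\<lambda>x. axis k (h N x)) \<phi> x"
            using AE_tet_cell[unfolded AE_completion_iff]
          proof eventually_elim
            case (elim x)
            show ?case
            proof (cases "x \<in> tet X")
              case True
              then obtain i where "x \<in> cell i" using elim by blast
              then show ?thesis by (simp add: pw_cell dfl)
            next
              case False
              then have "x \<notin> interior (tet X)" using interior_subset by blast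
              then have "h N x = 0" "partial k (h N) x = 0" using test_fun_support[OF h[of N]] by meson+
              then show ?thesis by (simp add: pw_def dfl)
            qed
          qed
        qed
        also have "\<dots> = 0" by (rule dflux_props(3)[OF sh t])
        finally show ?thesis .
      qed
      have "(\<lambda>N. (\<integral>x. ?d0 N x * partial k \<phi> x \<partial>tetM) + (\<integral>x. ?d1 N x * \<phi> x \<partial>tetM)) \<longlonglongrightarrow> 0 + 0"
        by (intro tendsto_add L2_tendsto_test[OF r0 c0 cf(2) lim0] L2_tendsto_test[OF r1 c1 cf(1) lim1])
      moreover have "(\<integral>x. ?d0 N x * partial k \<phi> x \<partial>tetM) + (\<integral>x. ?d1 N x * \<phi> x \<partial>tetM) = - ?A" for N
      proof -
        have i0: "integrable tetM (\<lambda>x. ?d0 N x * partial k \<phi> x)"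
          by (rule rep_integral(1)[OF rep_map[OF r0, of "\<lambda>x y. y * partial k \<phi> x"]]) (intro continuous_intros c0 cf)
        have i1: "integrable tetM (\<lambda>x. ?d1 N x * \<phi> x)"
          by (rule rep_integral(1)[OF rep_map[OF r1, of "\<lambda>x y. y * \<phi> x"]]) (intro continuous_intros c1 cf)
        have iA: "integrable tetM (\<lambda>x. f x * partial k \<phi> x + wpartial (tet X) k f x * \<phi> x)"
          by (rule rep_integral(1)[OF rep_map2[OF f wr, of "\<lambda>x y w. y * partial k \<phi> x + w * \<phi> x"] c[OF ps]])
        have iz: "integrable tetM (\<lambda>x. h N x * partial k \<phi> x + partial k (h N) x * \<phi> x)"
          by (rule rep_integral(1)[of "\<lambda>_ x. h N x * partial k \<phi> x + partial k (h N) x * \<phi> x", OF _ c[OF hs]]) (simp add: rep_def)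
        have "(\<integral>x. ?d0 N x * partial k \<phi> x \<partial>tetM) + (\<integral>x. ?d1 N x * \<phi> x \<partial>tetM)
            = (\<integral>x. ?d0 N x * partial k \<phi> x + ?d1 N x * \<phi> x \<partial>tetM)"
          by (rule Bochner_Integration.integral_add[OF i0 i1, symmetric])
        also have "\<dots> = (\<integral>x. (h N x * partial k \<phi> x + partial k (h N) x * \<phi> x)
            - (f x * partial k \<phi> x + wpartial (tet X) k f x * \<phi> x) \<partial>tetM)"
          by (intro Bochner_Integration.integral_cong) (auto simp: algebra_simps)
        also have "\<dots> = - ?A"
          unfolding Bochner_Integration.integral_diff[OF iz iA] zero A by simp
        finally show ?thesis .
      qed
      ultimately show "?A = 0" by (simp add: LIMSEQ_const_iff)
    qed
    then show ?thesis by (simp add: inner_axis')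
  qed
  moreover have "\<exists>k. av (Some i) $ k \<noteq> 0"
    using av_neq[of "Some i" None] by (auto simp: vec_eq_iff)
  ultimately show ?thesis by auto
qed

end

lemma flat_exp_1_bound:
  assumes "0 < e" shows "0 \<le> flat_exp e [:1, e:] t \<and> flat_exp e [:1, e:] t \<le> 1"
proof (cases "0 < t")
  case True
  have "1 + e / t \<le> exp (e / t)" by (rule exp_ge_add_one_self)
  then have "(1 + e / t) * exp (- (e / t)) \<le> exp (e / t) * exp (- (e / t))" by (intro mult_right_mono) auto
  then show ?thesis using True assms by (simp add: flat_exp_def exp_minus)
qed (simp add: flat_exp_def)

lemma flat_id_bound: "0 < e \<Longrightarrow> 0 \<le> flat_id e t \<and> flat_id e t \<le> max t 0"
  by (auto simp: flat_id_def mult_le_cancel_left1)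

context alfeld_split
begin

lemma continuous_bounded_on_tet:
  fixes q :: "real^3 \<Rightarrow> real"
  assumes "continuous_on UNIV q" obtains B where "0 \<le> B" "\<And>x. x \<in> tet X \<Longrightarrow> \<bar>q x\<bar> \<le> B"
proof -
  have "bounded (q ` tet X)"
    by (intro compact_imp_bounded compact_continuous_image continuous_on_subset[OF assms] compact_tet) simp
  then obtain B where "0 < B" "\<forall>y\<in>q ` tet X. norm y \<le> B" by (auto simp: bounded_pos)
  then show ?thesis by (intro that[of B]) auto
qed

lemma L2_tendsto_dominated:
  fixes h :: "nat \<Rightarrow> real^3 \<Rightarrow> real"
  assumes f: "rep q f" and q: "\<And>m. continuous_on UNIV (q m)" and h: "\<And>N. continuous_on UNIV (h N)"
    and B: "\<And>N x. x \<in> tet X \<Longrightarrow> \<bar>h N x\<bar> \<le> B"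
    and conv: "\<And>i x. x \<in> cell i \<Longrightarrow> (\<lambda>N. h N x) \<longlonglongrightarrow> q (Some i) x"
  shows "(\<lambda>N. \<integral>x. (h N x - f x)\<^sup>2 \<partial>tetM) \<longlonglongrightarrow> 0"
proof -
  have sub: "x \<in> tet X" if "x \<in> cell i" for x i using that cell_subset_subtet subtet_subset_tet by blast
  have "\<exists>b. \<forall>x\<in>tet X. \<bar>q m x\<bar> \<le> b" for m using continuous_bounded_on_tet[OF q] by meson
  then have "\<exists>b. \<forall>m. \<forall>x\<in>tet X. \<bar>q m x\<bar> \<le> b m" by (intro choice allI)
  then obtain b where b: "\<And>m x. x \<in> tet X \<Longrightarrow> \<bar>q m x\<bar> \<le> b m" by blast
  define W where "W = (\<bar>B\<bar> + (\<Sum>i\<in>UNIV. \<bar>b (Some i)\<bar>))\<^sup>2"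
  have r: "rep (\<lambda>m x. (h N x - q m x)\<^sup>2) (\<lambda>x. (h N x - f x)\<^sup>2)" for N
    by (rule rep_map[OF f, of "\<lambda>x y. (h N x - y)\<^sup>2"])
  have c: "continuous_on UNIV (\<lambda>x. (h N x - q m x)\<^sup>2)" for N m by (intro continuous_intros h q)
  have "(\<lambda>N. \<integral>x. (h N x - f x)\<^sup>2 \<partial>tetM) \<longlonglongrightarrow> (\<integral>x. 0 \<partial>tetM)"
  proof (rule integral_dominated_convergence[where w="\<lambda>_. W"])
    show "(\<lambda>x. (h N x - f x)\<^sup>2) \<in> borel_measurable tetM" for N by (rule rep_measurable[OF r c])
    show "integrable tetM (\<lambda>_. W)"
      using finite_measure.integrable_const[OF finite_measure_tetM] .
    show "AE x in tetM. (\<lambda>N. (h N x - f x)\<^sup>2) \<longlonglongrightarrow> 0"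
      unfolding tetM_def AE_on_tet_iff using f[unfolded rep_def]
    proof eventually_elim
      case (elim x)
      show ?case
      proof (intro allI impI)
        fix i assume i: "x \<in> cell i"
        have "(\<lambda>N. (h N x - q (Some i) x)\<^sup>2) \<longlonglongrightarrow> (q (Some i) x - q (Some i) x)\<^sup>2"
          by (intro tendsto_intros conv i)
        then show "(\<lambda>N. (h N x - f x)\<^sup>2) \<longlonglongrightarrow> 0" using elim i by simp
      qed
    qed
    show "AE x in tetM. norm ((h N x - f x)\<^sup>2) \<le> W" for N
      unfolding tetM_def AE_on_tet_iff using f[unfolded rep_def]
    proof eventually_elim
      case (elim x)
      show ?case
      proof (intro allI impI)
        fix i assume i: "x \<in> cell i"
        have "\<bar>b (Some i)\<bar> \<le> (\<Sum>i\<in>UNIV. \<bar>b (Some i)\<bar>)" by (rule member_le_sum) auto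
        then have "\<bar>h N x - f x\<bar> \<le> \<bar>B\<bar> + (\<Sum>i\<in>UNIV. \<bar>b (Some i)\<bar>)"
          using B[OF sub[OF i], of N] b[OF sub[OF i], of "Some i"] elim i by simp
        then have "\<bar>h N x - f x\<bar>\<^sup>2 \<le> W" unfolding W_def by (intro power_mono) auto
        then show "norm ((h N x - f x)\<^sup>2) \<le> W" by simp
      qed
    qed
  qed simp
  then show ?thesis by simp
qed

section \<open>Smooth approximation with support inside T\<close>

definition exp_sum :: "real \<Rightarrow> real^3 \<Rightarrow> real" where
  "exp_sum e x = (\<Sum>i\<in>UNIV. exp (- L (Some i) x / e))"

text \<open>A soft minimum of the \<open>L (Some i)\<close>, composed with a flat cutoff: smooth, supported in
  \<open>T\<close>, and convergent to the hat function at \<open>z\<close> together with its gradient as \<open>e \<rightarrow> 0\<close>.\<close>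
definition soft_hat :: "real \<Rightarrow> real^3 \<Rightarrow> real" where
  "soft_hat e x = flat_id e (- e * ln (exp_sum e x))"

lemma exp_sum_pos: "0 < exp_sum e x"
  unfolding exp_sum_def by (intro sum_pos) auto

lemma exp_less_exp_sum: "exp (- L (Some i) x / e) < exp_sum e x"
proof -
  obtain k where k: "k \<noteq> i" using ex_other_index by blast
  have "exp_sum e x = exp (- L (Some i) x / e) + (\<Sum>j\<in>UNIV - {i}. exp (- L (Some j) x / e))"
    unfolding exp_sum_def by (simp add: sum.remove[of UNIV i])
  moreover have "0 < (\<Sum>j\<in>UNIV - {i}. exp (- L (Some j) x / e))" using k by (intro sum_pos) auto
  ultimately show ?thesis by linarith
qed

lemma softmin_less: assumes "0 < e" shows "- e * ln (exp_sum e x) < L (Some i) x"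
proof -
  have "ln (exp (- L (Some i) x / e)) < ln (exp_sum e x)"
    using exp_less_exp_sum exp_sum_pos by (subst ln_less_cancel_iff) auto
  then show ?thesis using assms by (simp add: field_simps)
qed

text \<open>On cell \<open>i\<close> each of the four summands is at most
  \<open>exp(- L (Some i) x / e)\<close>, which accounts for the error
  \<open>e * ln 4\<close>.\<close>

lemma softmin_ge: assumes e: "0 < e" and x: "x \<in> cell i" shows "L (Some i) x - e * ln 4 \<le> - e * ln (exp_sum e x)"
proof -
  have "exp_sum e x \<le> (\<Sum>j\<in>(UNIV::4 set). exp (- L (Some i) x / e))"
    unfolding exp_sum_def
  proof (rule sum_mono)
    fix j
    have "L (Some i) x \<le> L (Some j) x" using x by (cases "j = i") (auto simp: cell_eq less_imp_le)
    then show "exp (- L (Some j) x / e) \<le> exp (- L (Some i) x / e)" using e by (simp add: divide_right_mono)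
  qed
  then have "ln (exp_sum e x) \<le> ln (4 * exp (- L (Some i) x / e))" using exp_sum_pos by (subst ln_le_cancel_iff) auto
  also have "\<dots> = ln 4 - L (Some i) x / e" by (simp add: ln_mult)
  finally have "e * ln (exp_sum e x) \<le> e * (ln 4 - L (Some i) x / e)" using e by (intro mult_left_mono) auto
  then show ?thesis using e by (simp add: algebra_simps)
qed

lemma L_smooth_alg: "L m \<in> smooth_alg"
  unfolding L_def[abs_def] by (rule poly_fun_smooth_alg[OF poly_fun_affine])

lemma exp_term_smooth_alg: "(\<lambda>x. exp (- L m x / e)) \<in> smooth_alg"
proof -
  have "(\<lambda>x. (- 1 / e) * L m x) \<in> smooth_alg" by (intro smooth_alg.mult smooth_alg.const L_smooth_alg)
  from smooth_alg.comp[OF this smooth1_exp] show ?thesis by simp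
qed

lemma exp_sum_smooth_alg: "exp_sum e \<in> smooth_alg"
  unfolding exp_sum_def[abs_def] by (intro smooth_alg_sum exp_term_smooth_alg)

lemma softmin_smooth_alg: "(\<lambda>x. - e * ln (exp_sum e x)) \<in> smooth_alg"
proof -
  have "(\<lambda>x. ln (exp_sum e x)) \<in> smooth_alg"
    by (rule smooth_alg.comp[OF exp_sum_smooth_alg smooth1_ln]) (use exp_sum_pos in auto)
  then show ?thesis by (intro smooth_alg.mult smooth_alg.const)
qed

lemma soft_hat_smooth_alg: "0 < e \<Longrightarrow> soft_hat e \<in> smooth_alg"
  unfolding soft_hat_def[abs_def] by (rule smooth_alg.comp[OF softmin_smooth_alg smooth1_flat_id]) auto

text \<open>The softmax weights. The gradient of the soft minimum is the average of the
  \<open>av (Some i)\<close> with these weights, hence bounded uniformly in \<open>e\<close>; inside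
  cell \<open>i\<close> the weights concentrate on \<open>i\<close> as \<open>e\<close> tends to
  0.\<close>

definition soft_weight :: "real \<Rightarrow> 4 \<Rightarrow> real^3 \<Rightarrow> real" where
  "soft_weight e i x = exp (- L (Some i) x / e) / exp_sum e x"

lemma soft_weight_props: "0 \<le> soft_weight e i x" "soft_weight e i x \<le> 1" "(\<Sum>i\<in>UNIV. soft_weight e i x) = 1"
proof -
  show "0 \<le> soft_weight e i x" "soft_weight e i x \<le> 1"
    unfolding soft_weight_def using exp_sum_pos[of e x] exp_less_exp_sum[of i x e] by (simp_all add: field_simps)
  show "(\<Sum>i\<in>UNIV. soft_weight e i x) = 1"
    unfolding soft_weight_def sum_divide_distrib[symmetric] exp_sum_def[symmetric] using exp_sum_pos[of e x] by simp
qed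

lemma partial_soft_hat:
  assumes e: "0 < e"
  shows "partial j (soft_hat e) x
    = flat_exp e [:1, e:] (- e * ln (exp_sum e x)) * (\<Sum>i\<in>UNIV. soft_weight e i x * av (Some i) $ j)"
proof -
  have d: "f \<in> smooth_alg \<Longrightarrow> f differentiable at x" for f
    by (intro smooth_differentiable smooth_alg_smooth)
  have p1: "partial j (\<lambda>x. exp (- L (Some i) x / e)) x = - (exp (- L (Some i) x / e) / e * av (Some i) $ j)" for i
  proof -
    have "partial j (\<lambda>x. exp (- L (Some i) x / e)) x = - exp (- L (Some i) x / e) / e * partial j (L (Some i)) x"
      by (rule partial_chain[where h="\<lambda>t. exp (- t / e)", OF d[OF L_smooth_alg]]) (use e in \<open>auto intro!: derivative_eq_intros\<close>)
    then show ?thesis by (simp add: partial_L)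
  qed
  have "partial j (exp_sum e) x = (\<Sum>i\<in>UNIV. partial j (\<lambda>x. exp (- L (Some i) x / e)) x)"
    unfolding exp_sum_def[abs_def] by (rule partial_sum) (rule d[OF exp_term_smooth_alg])
  then have p2: "partial j (exp_sum e) x = - (\<Sum>i\<in>UNIV. exp (- L (Some i) x / e) * av (Some i) $ j) / e"
    unfolding p1 by (simp add: sum_negf sum_divide_distrib)
  have "partial j (\<lambda>x. - e * ln (exp_sum e x)) x = - e / exp_sum e x * partial j (exp_sum e) x"
    by (rule partial_chain[where h="\<lambda>t. - e * ln t", OF d[OF exp_sum_smooth_alg]])
      (use exp_sum_pos[of e x] in \<open>auto intro!: derivative_eq_intros\<close>)
  then have p3: "partial j (\<lambda>x. - e * ln (exp_sum e x)) x = (\<Sum>i\<in>UNIV. soft_weight e i x * av (Some i) $ j)"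
    unfolding p2 soft_weight_def using e by (simp add: sum_divide_distrib[symmetric])
  show ?thesis
    unfolding soft_hat_def[abs_def] p3[symmetric]
    by (rule partial_chain[OF d[OF softmin_smooth_alg] flat_id_deriv[OF e]])
qed

lemma partial_soft_hat_bound:
  assumes e: "0 < e" shows "\<bar>partial j (soft_hat e) x\<bar> \<le> (\<Sum>i\<in>UNIV. \<bar>av (Some i) $ j\<bar>)"
proof -
  have "\<bar>\<Sum>i\<in>UNIV. soft_weight e i x * av (Some i) $ j\<bar> \<le> (\<Sum>i\<in>UNIV. \<bar>soft_weight e i x * av (Some i) $ j\<bar>)"
    by (rule sum_abs)
  also have "\<dots> \<le> (\<Sum>i\<in>UNIV. \<bar>av (Some i) $ j\<bar>)"
    using soft_weight_props(1,2)[of e _ x] by (intro sum_mono) (auto simp: abs_mult intro!: mult_left_le_one_le)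
  finally have 1: "\<bar>\<Sum>i\<in>UNIV. soft_weight e i x * av (Some i) $ j\<bar> \<le> (\<Sum>i\<in>UNIV. \<bar>av (Some i) $ j\<bar>)" .
  have "\<bar>partial j (soft_hat e) x\<bar> \<le> 1 * \<bar>\<Sum>i\<in>UNIV. soft_weight e i x * av (Some i) $ j\<bar>"
    unfolding partial_soft_hat[OF e] abs_mult
    using flat_exp_1_bound[OF e] by (intro mult_right_mono) auto
  with 1 show ?thesis by simp
qed

abbreviation eN :: "nat \<Rightarrow> real" where "eN N \<equiv> 1 / real (Suc N)"

lemma eN_tendsto: "(\<lambda>N. eN N) \<longlonglongrightarrow> 0"
  by (rule LIMSEQ_Suc[OF lim_1_over_n])

lemma softmin_tendsto:
  assumes x: "x \<in> cell i" shows "(\<lambda>N. - eN N * ln (exp_sum (eN N) x)) \<longlonglongrightarrow> L (Some i) x"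
proof (rule tendsto_sandwich)
  show "\<forall>\<^sub>F N in sequentially. L (Some i) x - eN N * ln 4 \<le> - eN N * ln (exp_sum (eN N) x)"
    by (intro always_eventually allI softmin_ge[OF _ x]) simp
  show "\<forall>\<^sub>F N in sequentially. - eN N * ln (exp_sum (eN N) x) \<le> L (Some i) x"
    by (intro always_eventually allI less_imp_le softmin_less) simp
  have "(\<lambda>N. L (Some i) x - eN N * ln 4) \<longlonglongrightarrow> L (Some i) x - 0 * ln 4" by (intro tendsto_intros eN_tendsto)
  then show "(\<lambda>N. L (Some i) x - eN N * ln 4) \<longlonglongrightarrow> L (Some i) x" by simp
qed (rule tendsto_const)

lemma soft_hat_tendsto:
  assumes x: "x \<in> cell i" shows "(\<lambda>N. soft_hat (eN N) x) \<longlonglongrightarrow> L (Some i) x"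
    "(\<lambda>N. partial j (soft_hat (eN N)) x) \<longlonglongrightarrow> av (Some i) $ j"
proof -
  let ?t = "\<lambda>N. - eN N * ln (exp_sum (eN N) x)"
  have pos: "0 < L (Some i) x" using x by (simp add: cell_eq)
  note t = softmin_tendsto[OF x]
  have ev: "\<forall>\<^sub>F N in sequentially. 0 < ?t N" using order_tendstoD(1)[OF t pos] .
  have ex: "(\<lambda>N. exp (- eN N / ?t N)) \<longlonglongrightarrow> exp (- 0 / L (Some i) x)"
    by (intro tendsto_intros t eN_tendsto) (use pos in auto)
  have "(\<lambda>N. ?t N * exp (- eN N / ?t N)) \<longlonglongrightarrow> L (Some i) x * exp (- 0 / L (Some i) x)"
    by (rule tendsto_mult[OF t ex])
  then have "(\<lambda>N. ?t N * exp (- eN N / ?t N)) \<longlonglongrightarrow> L (Some i) x" by simp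
  then show "(\<lambda>N. soft_hat (eN N) x) \<longlonglongrightarrow> L (Some i) x"
    by (rule Lim_transform_eventually) (use ev in eventually_elim, simp add: soft_hat_def flat_id_def)
  have "(\<lambda>N. (1 + eN N * (1 / ?t N)) * exp (- eN N / ?t N)) \<longlonglongrightarrow> (1 + 0 * (1 / L (Some i) x)) * exp (- 0 / L (Some i) x)"
    by (intro tendsto_intros t eN_tendsto ex) (use pos in auto)
  then have "(\<lambda>N. (1 + eN N * (1 / ?t N)) * exp (- eN N / ?t N)) \<longlonglongrightarrow> 1" by simp
  then have f1: "(\<lambda>N. flat_exp (eN N) [:1, eN N:] (?t N)) \<longlonglongrightarrow> 1"
    by (rule Lim_transform_eventually) (use ev in eventually_elim, simp add: flat_exp_def mult.commute)
  \<comment> \<open>The weight of another index is at most \<open>exp(- g / e)\<close>, with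
    \<open>g > 0\<close> the gap between the two affine functions, and this is at most
    \<open>e / g\<close>.\<close>
  have w: "(\<lambda>N. soft_weight (eN N) k x) \<longlonglongrightarrow> 0" if "k \<noteq> i" for k
  proof -
    define g where "g = L (Some k) x - L (Some i) x"
    have g: "0 < g" using x that by (simp add: cell_eq g_def)
    have bound: "soft_weight (eN N) k x \<le> eN N * (1 / g)" for N
    proof -
      have "soft_weight (eN N) k x \<le> exp (- L (Some k) x / eN N) / exp (- L (Some i) x / eN N)"
        unfolding soft_weight_def using exp_less_exp_sum[of i x "eN N"] by (intro divide_left_mono) (auto simp: exp_sum_pos)
      also have "\<dots> = exp (- (g / eN N))" by (simp add: exp_diff[symmetric] g_def algebra_simps)
      also have "\<dots> \<le> 1 / (g / eN N)"
      proof -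
        have "g / eN N \<le> exp (g / eN N)" using exp_ge_add_one_self[of "g / eN N"] by linarith
        moreover have "0 < g / eN N" using g by simp
        ultimately show ?thesis by (simp only: exp_minus inverse_eq_divide) (rule divide_left_mono, auto)
      qed
      finally show ?thesis by (simp add: mult.commute)
    qed
    have "(\<lambda>N. eN N * (1 / g)) \<longlonglongrightarrow> 0 * (1 / g)" by (intro tendsto_mult eN_tendsto tendsto_const)
    then have "(\<lambda>N. eN N * (1 / g)) \<longlonglongrightarrow> 0" by simp
    then show ?thesis
      by (rule tendsto_sandwich[OF always_eventually always_eventually tendsto_const, rotated 2])
        (use bound soft_weight_props(1) in auto)
  qed
  have eq: "(\<Sum>k\<in>UNIV. soft_weight (eN N) k x * av (Some k) $ j)
      = av (Some i) $ j + (\<Sum>k\<in>UNIV - {i}. soft_weight (eN N) k x * (av (Some k) $ j - av (Some i) $ j))" for N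
  proof -
    have "(\<Sum>k\<in>UNIV. soft_weight (eN N) k x * av (Some k) $ j)
       = (\<Sum>k\<in>UNIV. soft_weight (eN N) k x) * av (Some i) $ j + (\<Sum>k\<in>UNIV. soft_weight (eN N) k x * (av (Some k) $ j - av (Some i) $ j))"
      unfolding sum_distrib_right sum.distrib[symmetric] by (intro sum.cong) (auto simp: algebra_simps)
    then show ?thesis by (simp add: soft_weight_props(3) sum.remove[of UNIV i])
  qed
  have "(\<lambda>N. av (Some i) $ j + (\<Sum>k\<in>UNIV - {i}. soft_weight (eN N) k x * (av (Some k) $ j - av (Some i) $ j)))
      \<longlonglongrightarrow> av (Some i) $ j + (\<Sum>k\<in>UNIV - {i}. 0 * (av (Some k) $ j - av (Some i) $ j))"
    by (intro tendsto_intros w) auto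
  then have "(\<lambda>N. \<Sum>k\<in>UNIV. soft_weight (eN N) k x * av (Some k) $ j) \<longlonglongrightarrow> av (Some i) $ j"
    unfolding eq by simp
  from tendsto_mult[OF f1 this] show "(\<lambda>N. partial j (soft_hat (eN N)) x) \<longlonglongrightarrow> av (Some i) $ j"
    by (simp only: partial_soft_hat[of "eN _"] of_nat_0_less_iff zero_less_Suc zero_less_divide_1_iff mult_1)
qed

lemma soft_hat_support: "0 < e \<Longrightarrow> 1 < exp_sum e x \<Longrightarrow> soft_hat e x = 0"
  by (simp add: soft_hat_def flat_id_def mult_nonneg_nonneg less_imp_le not_less)

text \<open>If the four positive exponentials sum to at most 1, each is strictly below 1, so every
  \<open>L (Some i)\<close> is strictly positive. Points where \<open>soft_hat\<close> is nonzero
  lie in this closed sublevel set.\<close>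

lemma exp_sum_compact:
  assumes e: "0 < e" shows "compact {x. exp_sum e x \<le> 1}" "{x. exp_sum e x \<le> 1} \<subseteq> interior (tet X)"
proof -
  show sub: "{x. exp_sum e x \<le> 1} \<subseteq> interior (tet X)"
  proof
    fix x assume x: "x \<in> {x. exp_sum e x \<le> 1}"
    have "exp (- L (Some i) x / e) < exp 0" for i
      by (rule less_le_trans[OF exp_less_exp_sum]) (use x in simp)
    then have "- L (Some i) x / e < 0" for i unfolding exp_less_cancel_iff .
    then show "x \<in> interior (tet X)" using e by (simp add: interior_tet zero_less_divide_iff)
  qed
  have "closed {x. exp_sum e x \<le> 1}"
    by (intro closed_Collect_le smooth_continuous_on smooth_alg_smooth[OF exp_sum_smooth_alg] continuous_intros)
  moreover have "bounded {x. exp_sum e x \<le> 1}"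
    using bounded_subset[OF compact_imp_bounded[OF compact_tet]] sub interior_subset by blast
  ultimately show "compact {x. exp_sum e x \<le> 1}" by (simp add: compact_eq_bounded_closed)
qed

text \<open>In the representation of \<open>p m x\<close> as a polynomial in \<open>L m x\<close>
  with coefficients \<open>\<beta> k x\<close>, all \<open>L m x\<close> are replaced by the single
  smooth function \<open>soft_hat\<close>. Values and gradients converge on each cell and stay
  bounded on T.\<close>

lemma C0_imp_H1_0:
  assumes f: "rep p f" and p: "\<And>m. poly_fun n (p m)" and C: "C0 UNIV p" and p0: "\<And>x. p None x = 0"
  shows "f \<in> H1_0 (tet X)"
proof -
  note ps = poly_fun_smooth[OF p]
  have C': "C0 (range Some) p" using C unfolding C0_def by blast
  have H: "f \<in> H1 (tet X)" by (rule C0_imp_H1[OF f p C'])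
  note wr = wpartial_rep[OF H f p p0]
  obtain R where R: "param_poly (Suc n) R" "\<And>m x. m \<in> UNIV \<Longrightarrow> poly (R x) (L m x) = p m x"
    using C0_interpolation[OF p C] by blast
  define \<beta> where "\<beta> k x = coeff (R x) k" for k x
  have \<beta>: "\<beta> k \<in> smooth_alg" for k
    unfolding \<beta>_def[abs_def] by (rule poly_fun_smooth_alg[OF param_poly_coeff[OF R(1)]])
  note \<beta>s = smooth_alg_smooth[OF \<beta>]
  have pe: "p m = (\<lambda>x. \<Sum>k\<le>Suc n. \<beta> k x * L m x ^ k)" for m
    using R(2)[of m] by (auto simp: param_poly_altdef[OF R(1)] \<beta>_def)
  define h where "h N x = (\<Sum>k\<le>Suc n. \<beta> k x * soft_hat (eN N) x ^ k)" for N x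
  have e0: "0 < eN N" for N by simp
  have h_alg: "h N \<in> smooth_alg" for N
    unfolding h_def[abs_def] by (intro smooth_alg_sum smooth_alg.mult \<beta> smooth_alg_power soft_hat_smooth_alg e0)
  note hs = smooth_alg_smooth[OF h_alg]
  \<comment> \<open>Where \<open>soft_hat\<close> vanishes, the approximant is the interpolant at
    \<open>s = 0\<close>, that is \<open>p None x\<close>; zero exterior values thus give compact
    support.\<close>
  have h0: "h N x = 0" if "soft_hat (eN N) x = 0" for N x
  proof -
    have "h N x = p None x" unfolding h_def that pe L_None ..
    then show ?thesis by (simp add: p0)
  qed
  have tf: "test_fun (interior (tet X)) (h N)" for N
  proof (rule test_funI[OF hs exp_sum_compact[OF e0]])
    fix x assume "x \<notin> {x. exp_sum (eN N) x \<le> 1}"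
    then show "h N x = 0" by (intro h0 soft_hat_support e0) simp
  qed
  have ph: "partial j (h N) x = (\<Sum>k\<le>Suc n. partial j (\<beta> k) x * soft_hat (eN N) x ^ k)
      + (\<Sum>k\<le>Suc n. \<beta> k x * (k * soft_hat (eN N) x ^ (k - 1))) * partial j (soft_hat (eN N)) x" for j N x
    unfolding h_def[abs_def]
    by (rule partial_sum_powers) (intro smooth_differentiable smooth_alg_smooth \<beta> soft_hat_smooth_alg e0)+
  have pp: "partial j (p m) x = (\<Sum>k\<le>Suc n. partial j (\<beta> k) x * L m x ^ k)
      + (\<Sum>k\<le>Suc n. \<beta> k x * (k * L m x ^ (k - 1))) * av m $ j" for j m x
    unfolding pe[of m] partial_L[where j=j and m=m and x=x, symmetric]
    by (rule partial_sum_powers) (intro smooth_differentiable smooth_alg_smooth \<beta> L_smooth_alg)+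
  \<comment> \<open>Any index serves, because the soft minimum lies below every
    \<open>L (Some i)\<close>.\<close>
  obtain i0 :: 4 where True by blast
  obtain M where M: "0 \<le> M" "\<And>x. x \<in> tet X \<Longrightarrow> \<bar>L (Some i0) x\<bar> \<le> M"
    using continuous_bounded_on_tet[OF smooth_continuous_on[OF L_smooth]] by blast
  have hat: "\<bar>soft_hat (eN N) x\<bar> \<le> M" if x: "x \<in> tet X" for N x
  proof -
    have "soft_hat (eN N) x \<le> max (- eN N * ln (exp_sum (eN N) x)) 0" "0 \<le> soft_hat (eN N) x"
      unfolding soft_hat_def using flat_id_bound[OF e0] by auto
    moreover have "- eN N * ln (exp_sum (eN N) x) \<le> M"
      using softmin_less[OF e0, of N x i0] M(2)[OF x] by linarith
    ultimately show ?thesis using M(1) by simp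
  qed
  have hatp: "\<bar>soft_hat (eN N) x ^ k\<bar> \<le> M ^ k" if "x \<in> tet X" for N x k
    unfolding power_abs using hat[OF that] by (intro power_mono) auto
  have "\<exists>b. \<forall>x\<in>tet X. \<bar>\<beta> k x\<bar> \<le> b" for k
    using continuous_bounded_on_tet[OF smooth_continuous_on[OF \<beta>s]] by meson
  then have "\<exists>b. \<forall>k. \<forall>x\<in>tet X. \<bar>\<beta> k x\<bar> \<le> b k" by (intro choice allI)
  then obtain b where b: "\<And>k x. x \<in> tet X \<Longrightarrow> \<bar>\<beta> k x\<bar> \<le> b k" by blast
  have "\<exists>b. \<forall>x\<in>tet X. \<bar>partial (fst c) (\<beta> (snd c)) x\<bar> \<le> b" for c
    using continuous_bounded_on_tet[OF smooth_continuous_on[OF smooth_partial[OF \<beta>s]]] by meson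
  then have "\<exists>b. \<forall>c. \<forall>x\<in>tet X. \<bar>partial (fst c) (\<beta> (snd c)) x\<bar> \<le> b c" by (intro choice allI)
  then obtain b' where b': "\<And>j k x. x \<in> tet X \<Longrightarrow> \<bar>partial j (\<beta> k) x\<bar> \<le> b' (j, k)" by fastforce
  have L2conv: "(\<lambda>N. \<integral>x. (h N x - f x)\<^sup>2 \<partial>tetM) \<longlonglongrightarrow> 0"
  proof (rule L2_tendsto_dominated[OF f])
    show "continuous_on UNIV (p m)" "continuous_on UNIV (h N)" for m N by (intro smooth_continuous_on ps hs)+
    show "\<bar>h N x\<bar> \<le> (\<Sum>k\<le>Suc n. b k * M ^ k)" if x: "x \<in> tet X" for N x
    proof -
      have "\<bar>h N x\<bar> \<le> (\<Sum>k\<le>Suc n. \<bar>\<beta> k x * soft_hat (eN N) x ^ k\<bar>)" unfolding h_def by (rule sum_abs)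
      also have "\<dots> \<le> (\<Sum>k\<le>Suc n. b k * M ^ k)"
        unfolding abs_mult using b[OF x] hatp[OF x] by (intro sum_mono mult_mono) (auto intro: order_trans[OF abs_ge_zero])
      finally show ?thesis .
    qed
    show "(\<lambda>N. h N x) \<longlonglongrightarrow> p (Some i) x" if x: "x \<in> cell i" for i x
      unfolding h_def pe by (intro tendsto_intros soft_hat_tendsto(1)[OF x])
  qed
  have L2conv1: "(\<lambda>N. \<integral>x. (partial j (h N) x - wpartial (tet X) j f x)\<^sup>2 \<partial>tetM) \<longlonglongrightarrow> 0" for j
  proof (rule L2_tendsto_dominated[OF wr])
    let ?A = "\<Sum>i\<in>UNIV. \<bar>av (Some i) $ j\<bar>"
    let ?B = "(\<Sum>k\<le>Suc n. b' (j, k) * M ^ k) + (\<Sum>k\<le>Suc n. b k * (k * M ^ (k - 1))) * ?A"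
    show "continuous_on UNIV (partial j (p m))" "continuous_on UNIV (partial j (h N))" for m N
      by (intro smooth_continuous_on smooth_partial ps hs)+
    show "\<bar>partial j (h N) x\<bar> \<le> ?B" if x: "x \<in> tet X" for N x
    proof -
      have "\<bar>\<Sum>k\<le>Suc n. partial j (\<beta> k) x * soft_hat (eN N) x ^ k\<bar>
          \<le> (\<Sum>k\<le>Suc n. \<bar>partial j (\<beta> k) x * soft_hat (eN N) x ^ k\<bar>)" by (rule sum_abs)
      also have "\<dots> \<le> (\<Sum>k\<le>Suc n. b' (j, k) * M ^ k)"
        unfolding abs_mult using b'[OF x] hatp[OF x] by (intro sum_mono mult_mono) (auto intro: order_trans[OF abs_ge_zero])
      finally have 1: "\<bar>\<Sum>k\<le>Suc n. partial j (\<beta> k) x * soft_hat (eN N) x ^ k\<bar> \<le> (\<Sum>k\<le>Suc n. b' (j, k) * M ^ k)" .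
      have "\<bar>\<Sum>k\<le>Suc n. \<beta> k x * (k * soft_hat (eN N) x ^ (k - 1))\<bar>
          \<le> (\<Sum>k\<le>Suc n. \<bar>\<beta> k x * (k * soft_hat (eN N) x ^ (k - 1))\<bar>)" by (rule sum_abs)
      also have "\<dots> \<le> (\<Sum>k\<le>Suc n. b k * (k * M ^ (k - 1)))"
        unfolding abs_mult using b[OF x] hatp[OF x]
        by (intro sum_mono mult_mono mult_left_mono) (auto intro: order_trans[OF abs_ge_zero])
      finally have 2: "\<bar>\<Sum>k\<le>Suc n. \<beta> k x * (k * soft_hat (eN N) x ^ (k - 1))\<bar> \<le> (\<Sum>k\<le>Suc n. b k * (k * M ^ (k - 1)))" .
      have "\<bar>(\<Sum>k\<le>Suc n. \<beta> k x * (k * soft_hat (eN N) x ^ (k - 1))) * partial j (soft_hat (eN N)) x\<bar>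
          \<le> (\<Sum>k\<le>Suc n. b k * (k * M ^ (k - 1))) * ?A"
        unfolding abs_mult by (rule mult_mono[OF 2 partial_soft_hat_bound[OF e0]]) (use 2 in linarith, simp)
      with 1 show ?thesis unfolding ph by linarith
    qed
    show "(\<lambda>N. partial j (h N) x) \<longlonglongrightarrow> partial j (p (Some i)) x" if x: "x \<in> cell i" for i x
      unfolding ph pp by (intro tendsto_intros soft_hat_tendsto[OF x])
  qed
  show ?thesis
    unfolding H1_0_def tetM_def[symmetric] using H tf L2conv L2conv1 by blast
qed

end

section \<open>Weak curls and limiting values\<close>

lemma parallel_of_minors:
  fixes d \<nu> :: "real^3"
  assumes \<nu>: "\<nu> \<noteq> 0" and m: "\<And>j k. d $ j * \<nu> $ k = d $ k * \<nu> $ j"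
  shows "\<exists>s. d = s *\<^sub>R \<nu>"
proof -
  have "d $ k * (\<nu> \<bullet> \<nu>) = (d \<bullet> \<nu>) * \<nu> $ k" for k
  proof -
    have "d $ k * (\<nu> \<bullet> \<nu>) = (\<Sum>j\<in>UNIV. (d $ k * \<nu> $ j) * \<nu> $ j)"
      by (simp add: inner_vec_def sum_distrib_left mult.assoc)
    also have "\<dots> = (\<Sum>j\<in>UNIV. (d $ j * \<nu> $ k) * \<nu> $ j)" using m by metis
    also have "\<dots> = (d \<bullet> \<nu>) * \<nu> $ k"
      by (simp add: inner_vec_def sum_distrib_left mult.assoc mult.commute mult.left_commute)
    finally show ?thesis .
  qed
  then have "d = ((d \<bullet> \<nu>) / (\<nu> \<bullet> \<nu>)) *\<^sub>R \<nu>" using \<nu> by (simp add: vec_eq_iff field_simps)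
  then show ?thesis ..
qed

lemma parallel_of_cross3:
  fixes d \<nu> :: "real^3"
  assumes \<nu>: "\<nu> \<noteq> 0" and c: "cross3 d \<nu> = 0"
  shows "\<exists>s. d = s *\<^sub>R \<nu>"
proof (rule parallel_of_minors[OF \<nu>])
  have "d $ 2 * \<nu> $ 3 = d $ 3 * \<nu> $ 2" "d $ 3 * \<nu> $ 1 = d $ 1 * \<nu> $ 3" "d $ 1 * \<nu> $ 2 = d $ 2 * \<nu> $ 1"
    using c by (simp_all add: cross3_def vec_eq_iff forall_3)
  then show "d $ j * \<nu> $ k = d $ k * \<nu> $ j" for j k using exhaust_3[of j] exhaust_3[of k] by auto
qed

lemma cross3_axis:
  fixes u :: "real^3"
  shows "cross3 (axis 1 1) u = vector [0, - u $ 3, u $ 2]"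
    "cross3 (axis 2 1) u = vector [u $ 3, 0, - u $ 1]"
    "cross3 (axis 3 1) u = vector [- u $ 2, u $ 1, 0]"
  by (simp_all add: cross3_def vec_eq_iff forall_3 axis_def)

lemma curl_components:
  fixes p :: "real^3 \<Rightarrow> real^3"
  assumes "p differentiable at x"
  shows "curl p x $ 1 = partial 2 (\<lambda>x. p x $ 3) x - partial 3 (\<lambda>x. p x $ 2) x"
    "curl p x $ 2 = partial 3 (\<lambda>x. p x $ 1) x - partial 1 (\<lambda>x. p x $ 3) x"
    "curl p x $ 3 = partial 1 (\<lambda>x. p x $ 2) x - partial 2 (\<lambda>x. p x $ 1) x"
  using assms by (simp_all add: curl_def partial_nth)

text \<open>Together with \<open>div (e_a x p) = - (curl p) $ a\<close>, this turns component
  \<open>a\<close> of a weak curl into a weak divergence, up to sign, of the field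
  \<open>e_a x w\<close>. The jump analysis for divergences then serves curls as well.\<close>

lemma inner_curl_scaled_axis:
  fixes \<psi> :: "real^3 \<Rightarrow> real"
  assumes "\<psi> differentiable at x"
  shows "u \<bullet> curl (\<lambda>x. \<psi> x *\<^sub>R axis a 1) x = (\<Sum>k\<in>UNIV. cross3 (axis a 1) u $ k * partial k \<psi> x)"
proof -
  have p: "partial b (\<lambda>x. \<psi> x *\<^sub>R (axis a 1 :: real^3)) x = partial b \<psi> x *\<^sub>R axis a 1" for a b
    by (rule partial_linear[OF bounded_linear_scaleR_left assms])
  have ax: "axis a (1::real) $ k = (if k = a then 1 else 0)" for a k :: 3 by (simp add: axis_def)
  consider "a = 1" | "a = 2" | "a = 3" using exhaust_3[of a] by blast
  then show ?thesis
    by cases (simp_all add: curl_def p cross3_axis inner_vec_def sum_3 ax)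
qed

lemma partial_uminus:
  assumes "f differentiable at x" shows "partial i (\<lambda>x. - f x) x = - partial i f x"
  by (rule partial_linear[OF bounded_linear_minus[OF bounded_linear_ident] assms])

lemma div_cross3_axis:
  fixes p :: "real^3 \<Rightarrow> real^3"
  assumes "smooth p"
  shows "(\<Sum>k\<in>UNIV. partial k (\<lambda>y. cross3 (axis a 1) (p y) $ k) x) = - curl p x $ a"
proof -
  note d = smooth_differentiable[OF smooth_nth[OF assms]]
  consider "a = 1" | "a = 2" | "a = 3" using exhaust_3[of a] by blast
  then show ?thesis
    by cases (simp_all add: cross3_axis sum_3 curl_components smooth_differentiable assms partial_uminus d)
qed

lemma curl_continuous:
  fixes p :: "real^3 \<Rightarrow> real^3"
  assumes "smooth p" shows "continuous_on S (\<lambda>x. curl p x $ a)"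
proof -
  note s = smooth_nth[OF assms]
  consider "a = 1" | "a = 2" | "a = 3" using exhaust_3[of a] by blast
  then show ?thesis
    by cases (simp_all add: curl_components smooth_differentiable assms,
        (intro continuous_intros smooth_continuous_on smooth_partial s)+)
qed

lemma curl_smooth:
  fixes p :: "real^3 \<Rightarrow> real^3"
  assumes "smooth p" shows "smooth (\<lambda>x. curl p x $ a)"
proof -
  note s = smooth_nth[OF assms]
  consider "a = 1" | "a = 2" | "a = 3" using exhaust_3[of a] by blast
  then show ?thesis
    by cases (simp_all add: curl_components smooth_differentiable assms,
        (intro smooth_diff smooth_partial s)+)
qed

lemma test_fun_diff:
  fixes f g :: "real^3 \<Rightarrow> 'b::real_normed_vector"
  assumes f: "test_fun S f" and g: "test_fun S g" shows "test_fun S (\<lambda>x. f x - g x)"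
proof (rule test_funI)
  show "smooth (\<lambda>x. f x - g x)" by (intro smooth_diff(1) test_fun_smooth[OF f] test_fun_smooth[OF g])
  show "compact (closure {x. f x \<noteq> 0} \<union> closure {x. g x \<noteq> 0})" using f g by (simp add: test_fun_def compact_Un)
  show "closure {x. f x \<noteq> 0} \<union> closure {x. g x \<noteq> 0} \<subseteq> S" using f g by (simp add: test_fun_def)
  show "f x - g x = 0" if "x \<notin> closure {x. f x \<noteq> 0} \<union> closure {x. g x \<noteq> 0}" for x
    using that notin_closure_support[of x f] notin_closure_support[of x g] by simp
qed

lemma test_fun_curl:
  fixes \<phi> :: "real^3 \<Rightarrow> real^3"
  assumes t: "test_fun S \<phi>" shows "test_fun S (\<lambda>x. curl \<phi> x $ a)"
proof -
  note d = smooth_differentiable[OF test_fun_smooth[OF t]]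
  consider "a = 1" | "a = 2" | "a = 3" using exhaust_3[of a] by blast
  then show ?thesis
    by cases (simp_all add: curl_components[OF d], (intro test_fun_diff test_fun_partial test_fun_nth t)+)
qed

lemma div_curl:
  fixes \<phi> :: "real^3 \<Rightarrow> real^3"
  assumes "smooth \<phi>" shows "(\<Sum>a\<in>UNIV. partial a (\<lambda>x. curl \<phi> x $ a) x) = 0"
proof -
  note s = smooth_nth[OF assms] and d = smooth_differentiable[OF assms]
  have c: "partial b (partial a (\<lambda>x. \<phi> x $ k)) x = partial a (partial b (\<lambda>x. \<phi> x $ k)) x" for a b k
    by (rule partial_commute[OF s])
  show ?thesis
    by (simp add: sum_3 curl_components[OF d] partial_diff smooth_differentiable smooth_partial s
        c[of 2 1] c[of 3 1] c[of 3 2])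
qed

lemma poly_fun_cross3_axis:
  assumes "\<And>k. poly_fun n (\<lambda>x. p x $ k)" shows "poly_fun n (\<lambda>x. cross3 (axis a 1) (p x) $ k)"
proof -
  consider "a = 1" | "a = 2" | "a = 3" using exhaust_3[of a] by blast
  then have "\<forall>k. poly_fun n (\<lambda>x. cross3 (axis a 1) (p x) $ k)"
    by cases (simp_all add: forall_3 cross3_axis assms poly_fun_zero poly_fun_uminus)
  then show ?thesis by blast
qed

context alfeld_split
begin

section \<open>Weak curls of piecewise polynomial fields\<close>

abbreviation vpoly :: "nat \<Rightarrow> (4 option \<Rightarrow> real^3 \<Rightarrow> real^3) \<Rightarrow> bool" where
  "vpoly n p \<equiv> (\<forall>m k. poly_fun n (\<lambda>x. p m x $ k)) \<and> (\<forall>x. p None x = 0)"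

lemma vpoly_smooth: "vpoly n p \<Longrightarrow> smooth (p m)"
  by (intro smooth_vec poly_fun_smooth) blast

lemma C0_map: assumes "C0 N p" shows "C0 N (\<lambda>m x. h x (p m x))"
  unfolding C0_def
proof (intro ballI allI impI)
  fix m l x assume "m \<in> N" "l \<in> N" "L m x = L l x"
  then have "p m x = p l x" using assms unfolding C0_def by blast
  then show "h x (p m x) = h x (p l x)" by (rule arg_cong)
qed

lemma rep_nth:
  fixes p :: "4 option \<Rightarrow> real^3 \<Rightarrow> 'b^'n"
  shows "rep p f \<longleftrightarrow> (\<forall>k. rep (\<lambda>m x. p m x $ k) (\<lambda>x. f x $ k))"
proof
  assume "rep p f"
  then show "\<forall>k. rep (\<lambda>m x. p m x $ k) (\<lambda>x. f x $ k)" by (intro allI rep_map[of p f "\<lambda>_ y. y $ k" for k])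
next
  assume "\<forall>k. rep (\<lambda>m x. p m x $ k) (\<lambda>x. f x $ k)"
  then have "AE x in lebesgue. \<forall>k. \<forall>i. x \<in> cell i \<longrightarrow> f x $ k = p (Some i) x $ k"
    unfolding rep_def by (simp add: AE_all_countable)
  then show "rep p f" unfolding rep_def by eventually_elim (simp add: vec_eq_iff)
qed

lemma L2_nth_integrable:
  fixes c :: "real^3 \<Rightarrow> real^3"
  assumes "c \<in> L2 (tet X)" shows "integrable tetM (\<lambda>x. c x $ a)"
proof -
  have m: "c \<in> borel_measurable tetM" and i: "integrable tetM (\<lambda>x. (norm (c x))\<^sup>2)"
    using assms by (auto simp: L2_def tetM_def)
  have m1: "(\<lambda>x. c x $ a) \<in> borel_measurable tetM"
    using borel_measurable_continuous_on[OF _ m, of "\<lambda>v. v $ a"] by (simp add: continuous_on_component)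
  have "integrable tetM (\<lambda>x. (c x $ a)\<^sup>2)"
  proof (rule Bochner_Integration.integrable_bound[OF i _ AE_I2])
    show "(\<lambda>x. (c x $ a)\<^sup>2) \<in> borel_measurable tetM" using m1 by measurable
    show "norm ((c x $ a)\<^sup>2) \<le> norm ((norm (c x))\<^sup>2)" for x
      using component_le_norm_cart[of "c x" a] abs_le_square_iff[of "c x $ a" "norm (c x)"] by simp
  qed
  then show ?thesis by (rule integrable_of_square[OF finite_measure_tetM m1])
qed

text \<open>The three fields \<open>e_a x p\<close> have weak divergences, so their normal
  components are continuous across interior faces. This says that the cross product of the jump of
  \<open>p\<close> with the normal vanishes.\<close>

lemma has_wcurl_rep:
  assumes w: "has_wcurl (tet X) w c" and r: "rep p w" and p: "vpoly n p"
  shows "rep (\<lambda>m. curl (p m)) c"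
    "i \<noteq> j \<Longrightarrow> L (Some i) x = L (Some j) x \<Longrightarrow> \<exists>s. p (Some i) x - p (Some j) x = s *\<^sub>R (av (Some i) - av (Some j))"
proof -
  note ps = vpoly_smooth[OF p]
  let ?v = "\<lambda>a m x. cross3 (axis a 1) (p m x)"
  have v: "poly_fun n (\<lambda>x. ?v a m x $ k)" for a m k by (rule poly_fun_cross3_axis) (use p in blast)
  have v0: "?v a None x = 0" for a x using p by simp
  have G: "integrable tetM (\<lambda>x. - c x $ a)" for a
    using L2_nth_integrable[of c a] w unfolding has_wcurl_def by simp
  have weak: "(\<integral>x. pw (\<lambda>m x. \<Sum>k\<in>UNIV. ?v a m x $ k * partial k \<psi> x) x \<partial>lborel) = - (\<integral>x. - c x $ a * \<psi> x \<partial>tetM)"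
    if t: "test_fun (interior (tet X)) \<psi>" for \<psi> a
  proof -
    note s = test_fun_smooth[OF t]
    let ?\<phi> = "\<lambda>x. \<psi> x *\<^sub>R (axis a 1 :: real^3)"
    have t': "test_fun (interior (tet X)) ?\<phi>" by (rule test_fun_scaleR[OF t])
    have c1: "continuous_on UNIV (\<lambda>x. \<Sum>k\<in>UNIV. ?v a m x $ k * partial k \<psi> x)" for m
      by (intro continuous_intros smooth_continuous_on smooth_partial s poly_fun_smooth[OF v])
    have "(\<integral>x. w x \<bullet> curl ?\<phi> x \<partial>tetM) = (\<integral>x. (\<Sum>k\<in>UNIV. cross3 (axis a 1) (w x) $ k * partial k \<psi> x) \<partial>tetM)"
      by (simp add: inner_curl_scaled_axis smooth_differentiable s)
    also have "\<dots> = (\<integral>x. pw (\<lambda>m x. \<Sum>k\<in>UNIV. ?v a m x $ k * partial k \<psi> x) x \<partial>lborel)"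
      by (rule rep_integral(2)[OF rep_map[OF r, of "\<lambda>x y. \<Sum>k\<in>UNIV. cross3 (axis a 1) y $ k * partial k \<psi> x"] c1])
    finally have "(\<integral>x. pw (\<lambda>m x. \<Sum>k\<in>UNIV. ?v a m x $ k * partial k \<psi> x) x \<partial>lborel) = (\<integral>x. c x \<bullet> ?\<phi> x \<partial>tetM)"
      using w t' unfolding has_wcurl_def tetM_def by simp
    then show ?thesis by (simp add: inner_axis mult.commute)
  qed
  have "rep (\<lambda>m x. - curl (p m) x $ a) (\<lambda>x. - c x $ a)" for a
    using weak_divergence(1)[where v="?v a", OF v v0 G weak] unfolding div_cross3_axis[OF ps] .
  from rep_map[OF this, of "\<lambda>_ y. - y"] show "rep (\<lambda>m. curl (p m)) c" by (simp add: rep_nth)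
  show "\<exists>s. p (Some i) x - p (Some j) x = s *\<^sub>R (av (Some i) - av (Some j))"
    if ij: "i \<noteq> j" and x: "L (Some i) x = L (Some j) x"
  proof (rule parallel_of_cross3)
    let ?\<nu> = "av (Some i) - av (Some j)" and ?d = "p (Some i) x - p (Some j) x"
    show "?\<nu> \<noteq> 0" using av_neq[of "Some i" "Some j"] ij by simp
    have "cross3 (axis a 1) (p (Some i) x) \<bullet> ?\<nu> = cross3 (axis a 1) (p (Some j) x) \<bullet> ?\<nu>" for a
      using weak_divergence(2)[where v="?v a", OF v v0 G weak ij x] .
    from this[of 1, unfolded cross3_axis] this[of 2, unfolded cross3_axis] this[of 3, unfolded cross3_axis]
    show "cross3 ?d ?\<nu> = 0"
      by (simp add: cross3_def vec_eq_iff forall_3 inner_vec_def sum_3 algebra_simps)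
  qed
qed

text \<open>The gradient of a continuous \<open>\<psi>\<close> may jump, but its weak curl is zero:
  integration by parts moves the derivative onto \<open>curl \<phi>\<close>, which is divergence
  free. So only \<open>p\<close> contributes to the weak curl.\<close>

lemma has_wcurl_C0_grad:
  assumes r: "rep (\<lambda>m x. p m x + (\<chi> k. partial k (\<psi> m) x)) w" and p: "vpoly n p" and C: "C0 (range Some) p"
    and \<psi>: "\<And>m. poly_fun n' (\<psi> m)" and C\<psi>: "C0 (range Some) \<psi>"
    and c: "rep (\<lambda>m. curl (p m)) c"
  shows "has_wcurl (tet X) w c"
  unfolding has_wcurl_def tetM_def[symmetric]
proof (intro conjI allI impI)
  note ps = vpoly_smooth[OF p] and \<psi>s = poly_fun_smooth[OF \<psi>]
  have cg: "continuous_on UNIV (\<lambda>x. (\<chi> k. partial k (\<psi> m) x) :: real^3)" for m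
    by (intro continuous_on_vec_lambda smooth_continuous_on smooth_partial \<psi>s)
  have cc: "continuous_on UNIV (curl (p m))" for m
  proof -
    have "continuous_on UNIV (\<lambda>x. \<chi> a. curl (p m) x $ a)"
      by (intro continuous_on_vec_lambda curl_continuous ps)
    then show ?thesis by simp
  qed
  have cp: "continuous_on UNIV (\<lambda>x. p m x + (\<chi> k. partial k (\<psi> m) x))" for m
    by (intro continuous_on_add smooth_continuous_on ps cg)
  show "w \<in> L2 (tet X)" by (rule rep_L2[OF r cp])
  show "c \<in> L2 (tet X)" by (rule rep_L2[OF c cc])
  fix \<phi> :: "real^3 \<Rightarrow> real^3" assume t: "test_fun (interior (tet X)) \<phi>"
  note s = test_fun_smooth[OF t] and tn = test_fun_nth[OF t]
  have c\<phi>: "continuous_on UNIV (curl \<phi>)"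
  proof -
    have "continuous_on UNIV (\<lambda>x. \<chi> a. curl \<phi> x $ a)"
      by (intro continuous_on_vec_lambda curl_continuous s)
    then show ?thesis by simp
  qed
  \<comment> \<open>\<open>E\<close> and \<open>F\<close> are partial derivatives of products of a
    continuous piecewise polynomial with a test function, so their integrals vanish; the difference
    of the two integrands is a signed sum of them.\<close>
  define E where "E a b d m x = p m x $ a * partial b (\<lambda>x. \<phi> x $ d) x + partial b (\<lambda>x. p m x $ a) x * \<phi> x $ d" for a b d m x
  define F where "F a m x = \<psi> m x * partial a (\<lambda>x. curl \<phi> x $ a) x + partial a (\<psi> m) x * curl \<phi> x $ a" for a m x
  have pC: "C0 (range Some) (\<lambda>m x. p m x $ a)" for a by (rule C0_map[OF C, of "\<lambda>_ y. y $ a"])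
  have E0: "(\<integral>x. pw (E a b d) x \<partial>lborel) = 0" for a b d
    unfolding E_def[abs_def] by (rule C0_weak_partial[OF _ pC tn]) (use p in blast)
  have F0: "(\<integral>x. pw (F a) x \<partial>lborel) = 0" for a
    unfolding F_def[abs_def] by (rule C0_weak_partial[OF \<psi> C\<psi> test_fun_curl[OF t]])
  have Ei: "integrable lborel (pw (E a b d))" for a b d
    unfolding E_def[abs_def]
    by (intro pw_integrable continuous_on_add continuous_on_mult smooth_continuous_on smooth_partial smooth_nth[OF ps] smooth_nth[OF s])
  have Fi: "integrable lborel (pw (F a))" for a
    unfolding F_def[abs_def]
    by (intro pw_integrable continuous_on_add continuous_on_mult smooth_continuous_on smooth_partial \<psi>s curl_smooth[OF s])
  have id: "(p m x + (\<chi> k. partial k (\<psi> m) x)) \<bullet> curl \<phi> x - curl (p m) x \<bullet> \<phi> x =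
      E 1 2 3 m x - E 1 3 2 m x + E 2 3 1 m x - E 2 1 3 m x + E 3 1 2 m x - E 3 2 1 m x
      + (F 1 m x + F 2 m x + F 3 m x)" for m x
  proof -
    have "F 1 m x + F 2 m x + F 3 m x = (\<chi> k. partial k (\<psi> m) x) \<bullet> curl \<phi> x
        + \<psi> m x * (\<Sum>a\<in>UNIV. partial a (\<lambda>x. curl \<phi> x $ a) x)"
      by (simp add: F_def inner_vec_def sum_3 algebra_simps)
    then have "F 1 m x + F 2 m x + F 3 m x = (\<chi> k. partial k (\<psi> m) x) \<bullet> curl \<phi> x" by (simp add: div_curl[OF s])
    moreover have "p m x \<bullet> curl \<phi> x - curl (p m) x \<bullet> \<phi> x =
      E 1 2 3 m x - E 1 3 2 m x + E 2 3 1 m x - E 2 1 3 m x + E 3 1 2 m x - E 3 2 1 m x"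
      by (simp add: E_def inner_vec_def sum_3 curl_components smooth_differentiable ps s algebra_simps)
    ultimately show ?thesis by (simp add: inner_add_left)
  qed
  have "rep (\<lambda>m x. (p m x + (\<chi> k. partial k (\<psi> m) x)) \<bullet> curl \<phi> x - curl (p m) x \<bullet> \<phi> x) (\<lambda>x. w x \<bullet> curl \<phi> x - c x \<bullet> \<phi> x)"
    by (rule rep_map2[OF r c, of "\<lambda>x y d. y \<bullet> curl \<phi> x - d \<bullet> \<phi> x"])
  then have "(\<integral>x. w x \<bullet> curl \<phi> x - c x \<bullet> \<phi> x \<partial>tetM)
    = (\<integral>x. pw (\<lambda>m x. (p m x + (\<chi> k. partial k (\<psi> m) x)) \<bullet> curl \<phi> x - curl (p m) x \<bullet> \<phi> x) x \<partial>lborel)"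
    by (rule rep_integral(2)) (intro continuous_on_diff continuous_on_inner cp c\<phi> cc smooth_continuous_on s)
  also have "\<dots> = (\<integral>x. pw (E 1 2 3) x - pw (E 1 3 2) x + pw (E 2 3 1) x - pw (E 2 1 3) x + pw (E 3 1 2) x - pw (E 3 2 1) x
      + (pw (F 1) x + pw (F 2) x + pw (F 3) x) \<partial>lborel)"
    unfolding id by (intro Bochner_Integration.integral_cong refl)
      (simp add: pw_def distrib_left right_diff_distrib sum.distrib sum_subtractf)
  also have "\<dots> = 0" using Ei Fi E0 F0 by simp
  finally have 0: "(\<integral>x. w x \<bullet> curl \<phi> x - c x \<bullet> \<phi> x \<partial>tetM) = 0" .
  have i1: "integrable tetM (\<lambda>x. w x \<bullet> curl \<phi> x)"
    by (rule rep_integral(1)[OF rep_map[OF r, of "\<lambda>x y. y \<bullet> curl \<phi> x"]]) (intro continuous_on_inner cp c\<phi>)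
  have i2: "integrable tetM (\<lambda>x. c x \<bullet> \<phi> x)"
    by (rule rep_integral(1)[OF rep_map[OF c, of "\<lambda>x y. y \<bullet> \<phi> x"]]) (intro continuous_on_inner cc smooth_continuous_on s)
  show "(\<integral>x. w x \<bullet> curl \<phi> x \<partial>tetM) = (\<integral>x. c x \<bullet> \<phi> x \<partial>tetM)"
    using 0 unfolding Bochner_Integration.integral_diff[OF i1 i2] by simp
qed

lemma wcurl_rep:
  assumes "w \<in> Hcurl (tet X)" "rep p w" "vpoly n p"
  shows "rep (\<lambda>m. curl (p m)) (wcurl (tet X) w)"
proof -
  have "has_wcurl (tet X) w (wcurl (tet X) w)"
    using assms(1) someI_ex[of "has_wcurl (tet X) w"] unfolding Hcurl_def wcurl_def by blast
  from has_wcurl_rep(1)[OF this assms(2,3)] show ?thesis .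
qed

section \<open>Limiting values and outward normals\<close>

text \<open>Any smooth representative agrees with the polynomial on the whole cell, since the subset
  of the cell where they differ is open and null. The limit is unique because \<open>x\<close> is a
  limit point of the cell.\<close>

lemma limiting_value_iff:
  fixes f :: "real^3 \<Rightarrow> 'b::real_normed_vector"
  assumes f: "rep p f" and p: "smooth (p (Some i))" and x: "x \<in> subtet X z i"
  shows "limiting_value (subtet X z i) is f x l \<longleftrightarrow> l = partials is (p (Some i)) x"
proof -
  let ?p = "p (Some i)"
  have AEp: "AE y in lebesgue. y \<in> cell i \<longrightarrow> f y = ?p y" using f[unfolded rep_def] by eventually_elim blast
  have lim: "(partials is ?p \<longlongrightarrow> partials is ?p x) (at x within cell i)"
  proof -
    have "isCont (partials is ?p) x" by (intro smooth_isCont smooth_partials p)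
    then show ?thesis unfolding isCont_def by (rule Lim_at_imp_Lim_at_within)
  qed
  have "x islimpt cell i"
  proof (cases "x \<in> cell i")
    case True
    then show ?thesis by (intro interior_limit_point) (simp add: interior_open open_cell)
  next
    case False
    then show ?thesis using x subtet_closure_cell[of i] by (auto simp: closure_def)
  qed
  then have nb: "at x within cell i \<noteq> bot" by (simp add: trivial_limit_within)
  show ?thesis
  proof
    assume "l = partials is ?p x"
    then show "limiting_value (subtet X z i) is f x l"
      unfolding limiting_value_def cell_def[symmetric] AE_on_subtet_iff
      using lim AEp p by (intro exI[of _ ?p]) (auto simp: smooth_on_def)
  next
    assume "limiting_value (subtet X z i) is f x l"
    then obtain g where g: "smooth_on (cell i) g" "AE y in lebesgue. y \<in> cell i \<longrightarrow> f y = g y"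
      and gl: "(partials is g \<longlongrightarrow> l) (at x within cell i)"
      unfolding limiting_value_def cell_def[symmetric] AE_on_subtet_iff by blast
    have gc: "continuous_on (cell i) g"
    proof (rule continuous_at_imp_continuous_on, rule ballI)
      fix y assume "y \<in> cell i"
      then have "g differentiable at y" using g(1) unfolding smooth_on_def by (metis partials_Nil)
      then show "isCont g y" by (rule differentiable_imp_continuous_within)
    qed
    have cont: "continuous_on (cell i) (\<lambda>y. g y - ?p y)"
      by (rule continuous_on_diff[OF gc smooth_continuous_on[OF p]])
    let ?U = "(\<lambda>y. g y - ?p y) -` (- {0}) \<inter> cell i"
    have "open ?U" using cont continuous_on_open_vimage[OF open_cell] by blast
    then have "closed (- ?U)" by (rule closed_Compl)
    moreover have "AE y in lebesgue. y \<in> - ?U" using AEp g(2) by eventually_elim auto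
    ultimately have "y \<in> - ?U" for y by (rule mem_closed_if_AE_lebesgue)
    then have eq: "g y = ?p y" if "y \<in> cell i" for y using that by auto
    have "partials is g y = partials is ?p y" if "y \<in> cell i" for y
      by (rule partials_cong_open[OF open_cell eq that])
    then have "\<forall>\<^sub>F y in at x within cell i. partials is g y = partials is ?p y"
      by (auto simp: eventually_at_filter)
    then have "(partials is ?p \<longlongrightarrow> l) (at x within cell i)" using gl by (rule Lim_transform_eventually[rotated])
    then show "l = partials is ?p x" using lim nb tendsto_unique by blast
  qed
qed

lemma Ck_at_iff:
  assumes f: "rep p f" and p: "\<And>m. smooth (p m)"
  shows "Ck_at k X z f x \<longleftrightarrow> (\<forall>is i j. length is \<le> k \<longrightarrow> x \<in> subtet X z i \<longrightarrow> x \<in> subtet X z j \<longrightarrow>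
      partials is (p (Some i)) x = partials is (p (Some j)) x)"
proof -
  have "(\<exists>l. \<forall>K\<in>alfeld X z. x \<in> K \<longrightarrow> limiting_value K is f x l) \<longleftrightarrow>
      (\<forall>i j. x \<in> subtet X z i \<longrightarrow> x \<in> subtet X z j \<longrightarrow> partials is (p (Some i)) x = partials is (p (Some j)) x)" for "is"
  proof -
    have "(\<exists>l. \<forall>K\<in>alfeld X z. x \<in> K \<longrightarrow> limiting_value K is f x l) \<longleftrightarrow>
      (\<exists>l. \<forall>i. x \<in> subtet X z i \<longrightarrow> l = partials is (p (Some i)) x)"
      unfolding alfeld_def using limiting_value_iff[OF f p] by auto
    also have "\<dots> \<longleftrightarrow> (\<forall>i j. x \<in> subtet X z i \<longrightarrow> x \<in> subtet X z j \<longrightarrow> partials is (p (Some i)) x = partials is (p (Some j)) x)"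
      by metis
    finally show ?thesis .
  qed
  then show ?thesis unfolding Ck_at_def by blast
qed

lemma vanishes_at_iff:
  assumes f: "rep p f" and p: "\<And>m. smooth (p m)"
  shows "vanishes_at X z f x \<longleftrightarrow> (\<forall>i. x \<in> subtet X z i \<longrightarrow> p (Some i) x = 0)"
  unfolding vanishes_at_def alfeld_def using limiting_value_iff[OF f p, of x _ "[]" 0] by auto

lemma grad_vanishes_at_iff:
  assumes f: "rep p f" and p: "\<And>m. smooth (p m)"
  shows "grad_vanishes_at X z f x \<longleftrightarrow> (\<forall>k i. x \<in> subtet X z i \<longrightarrow> partial k (p (Some i)) x = 0)"
  unfolding grad_vanishes_at_def alfeld_def using limiting_value_iff[OF f p, of x _ "[_]" 0] by auto

text \<open>Any \<open>v\<close> is the sum of the \<open>X j\<close> weighted by the derivatives of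
  the barycentric coordinates along \<open>v\<close>. These weights add up to zero, so in
  \<open>\<nu> \<bullet> v\<close> only the term of index \<open>i\<close> survives.\<close>

lemma normal_unique:
  assumes "\<And>j k. j \<noteq> i \<Longrightarrow> k \<noteq> i \<Longrightarrow> \<nu> \<bullet> (X j - X k) = 0"
  obtains t where "\<nu> = t *\<^sub>R av (Some i)"
proof -
  obtain k where k: "k \<noteq> i" using ex_other_index by blast
  let ?g = "fst bary"
  have lin: "lam j v - lam j 0 = ?g j \<bullet> v" for j v by (simp add: lam_def)
  have sum0: "(\<Sum>j\<in>UNIV. ?g j \<bullet> v) = 0" for v
    using bary_repr(1)[of v] bary_repr(1)[of 0] by (simp add: lin[symmetric] sum_subtractf)
  have v: "v = (\<Sum>j\<in>UNIV. (?g j \<bullet> v) *\<^sub>R X j)" for v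
    using bary_repr(2)[of v] bary_repr(2)[of 0] by (simp add: lin[symmetric] scaleR_left_diff_distrib sum_subtractf)
  define \<kappa> where "\<kappa> = \<nu> \<bullet> (X i - X k)"
  have key: "\<nu> \<bullet> v = \<kappa> * (?g i \<bullet> v)" for v
  proof -
    have "\<nu> \<bullet> v = \<nu> \<bullet> (\<Sum>j\<in>UNIV. (?g j \<bullet> v) *\<^sub>R X j)" by (rule arg_cong[OF v])
    also have "\<dots> = (\<Sum>j\<in>UNIV. (?g j \<bullet> v) * (\<nu> \<bullet> X j))"
      by (simp add: inner_sum_right)
    also have "\<dots> = (\<Sum>j\<in>UNIV. (?g j \<bullet> v) * (\<nu> \<bullet> (X j - X k))) + (\<Sum>j\<in>UNIV. ?g j \<bullet> v) * (\<nu> \<bullet> X k)"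
      by (simp add: inner_diff_right right_diff_distrib sum_subtractf sum_distrib_right)
    also have "(\<Sum>j\<in>UNIV. (?g j \<bullet> v) * (\<nu> \<bullet> (X j - X k))) = (?g i \<bullet> v) * (\<nu> \<bullet> (X i - X k))"
      using assms[OF _ k] by (subst sum.remove[of UNIV i]) auto
    finally show ?thesis by (simp add: sum0 mult.commute \<kappa>_def)
  qed
  have "(\<nu> - \<kappa> *\<^sub>R ?g i) \<bullet> v = 0" for v by (simp add: inner_diff_left key)
  then have "\<nu> - \<kappa> *\<^sub>R ?g i = 0" using inner_eq_zero_iff by blast
  then have "\<nu> = \<kappa> *\<^sub>R ?g i" by simp
  also have "\<dots> = (\<kappa> * cz i) *\<^sub>R av (Some i)"
    using cz_pos[of i] by (simp add: av_def)
  finally show ?thesis by (rule that)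
qed

text \<open>\<open>L (Some i)\<close> increases from the face towards \<open>X i\<close>, so minus
  its normalized gradient is the unique vector meeting the definite description. Only its direction
  matters for the condition on the cross product.\<close>

lemma outward_normal_parallel: obtains t where "t \<noteq> 0" "outward_normal X i = t *\<^sub>R av (Some i)"
proof -
  let ?a = "av (Some i)"
  have a: "?a \<noteq> 0" using av_neq[of "Some i" None] by simp
  let ?Q = "\<lambda>\<nu>. norm \<nu> = 1 \<and> (\<forall>x\<in>face X i. \<forall>y\<in>face X i. \<nu> \<bullet> (x - y) = 0) \<and> (\<forall>y\<in>face X i. \<nu> \<bullet> (X i - y) < 0)"
  have La: "?a \<bullet> (x - y) = L (Some i) x - L (Some i) y" for x y by (simp add: L_def inner_diff_right)
  have LX: "0 < L (Some i) (X i)" using cz_pos[of i] by (simp add: L_Some lam_X)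
  have Xface: "X j \<in> face X i" if "j \<noteq> i" for j unfolding face_def using that by (intro hull_inc) auto
  obtain k where k: "k \<noteq> i" using ex_other_index by blast
  let ?n = "(- 1 / norm ?a) *\<^sub>R ?a"
  have "?Q ?n"
  proof (intro conjI ballI)
    show "norm ?n = 1" using a by simp
    show "?n \<bullet> (x - y) = 0" if "x \<in> face X i" "y \<in> face X i" for x y using that by (simp add: La face_eq)
    show "?n \<bullet> (X i - y) < 0" if "y \<in> face X i" for y using that LX a by (simp add: La face_eq)
  qed
  moreover have "\<nu> = ?n" if Q: "?Q \<nu>" for \<nu>
  proof -
    obtain t where t: "\<nu> = t *\<^sub>R ?a" using normal_unique[of i \<nu>] Q Xface by metis
    have "\<nu> \<bullet> (X i - X k) < 0" using Q Xface[OF k] by blast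
    then have "t * L (Some i) (X i) < 0" using Xface[OF k] by (simp add: t La face_eq)
    then have "t < 0" using LX by (simp add: mult_less_0_iff)
    moreover have "\<bar>t\<bar> * norm ?a = 1" using Q by (simp add: t)
    ultimately have "t = - 1 / norm ?a" using a by (simp add: field_simps)
    then show ?thesis by (simp add: t)
  qed
  ultimately have "outward_normal X i = ?n" unfolding outward_normal_def by (rule the_equality)
  moreover have "- 1 / norm ?a \<noteq> 0" using a by simp
  ultimately show ?thesis using that by blast
qed

lemma poly_zero_face_plane:
  assumes q: "poly_fun n q" and z: "\<And>x. x \<in> face X i \<Longrightarrow> q x = 0" and x: "L (Some i) x = 0"
  shows "q x = 0"
proof -
  define U where "U = (\<Inter>k. {x. k \<noteq> i \<longrightarrow> 0 < L (Some k) x})"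
  obtain x0 s where x0: "\<And>k. L k x0 = s + (if k = Some i \<or> k = None then 0 else 1 / (3 * kap k))"
    and s: "s = (if None \<in> {Some i, None} then 0 else 1/3)" using face_point[of "Some i" None] by blast
  have U: "open U"
    unfolding U_def
  proof (intro open_INT ballI)
    fix k
    have "open {x. 0 < L (Some k) x}" by (intro open_Collect_less continuous_intros smooth_continuous_on L_smooth)
    then show "open {x. k \<noteq> i \<longrightarrow> 0 < L (Some k) x}" by (cases "k = i") simp_all
  qed simp
  have x0U: "x0 \<in> U" unfolding U_def using cz_pos by (simp add: x0 kap_def s)
  have e0: "L (Some i) x0 = L None x0" by (simp add: x0)
  show ?thesis
  proof (rule plane_poly_eq[OF U x0U e0 q])
    fix y assume y: "y \<in> U" "L (Some i) y = L None y"
    have "0 \<le> L (Some j) y" for j using y unfolding U_def by (cases "j = i") (auto intro: less_imp_le)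
    then show "q y = 0" using y by (intro z) (simp add: face_eq)
  qed (use x in simp)
qed

end

section \<open>Vertex conditions\<close>

lemma curl_const [simp]: "curl (\<lambda>x. c) x = 0"
  by (simp add: curl_def vec_eq_iff forall_3)

lemma cross3_axis_antisym: "cross3 (axis a 1) u $ b = - cross3 (axis b 1) u $ a"
  using exhaust_3[of a] exhaust_3[of b] by (elim disjE; simp add: cross3_axis)

lemma curl_diff:
  assumes "smooth p" "smooth q" shows "curl (\<lambda>x. p x - q x) x = curl p x - curl q x"
  by (simp add: curl_def vec_eq_iff forall_3 partial_diff smooth_differentiable assms)

text \<open>The identity \<open>curl (e_a x \<psi>) = (div \<psi>) e_a - partial a \<psi>\<close>,
  where \<open>e_a x \<psi>\<close> is row \<open>a\<close> of the skew field attached to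
  \<open>\<psi>\<close>.\<close>

lemma curl_skew:
  fixes \<psi> :: "real^3 \<Rightarrow> real^3"
  assumes "smooth \<psi>"
  shows "curl (\<lambda>x. cross3 (axis a 1) (\<psi> x)) x $ d
    = (if a = d then (\<Sum>e\<in>UNIV. partial e (\<lambda>x. \<psi> x $ e) x) else 0) - partial a (\<lambda>x. \<psi> x $ d) x"
proof -
  note s = smooth_nth[OF assms]
  have "smooth (\<lambda>x. cross3 (axis a 1) (\<psi> x))" for a
  proof (rule smooth_vec)
    fix k
    have u: "smooth (\<lambda>x. - \<psi> x $ j)" for j
      by (rule smooth_linear(1)[OF bounded_linear_minus[OF bounded_linear_ident] s])
    have c: "smooth (\<lambda>x. 0::real)" by (rule smooth_alg_smooth[OF smooth_alg.const])
    consider "a = 1" | "a = 2" | "a = 3" using exhaust_3[of a] by blast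
    then have "\<forall>k. smooth (\<lambda>x. cross3 (axis a 1) (\<psi> x) $ k)"
      by cases (simp_all add: forall_3 cross3_axis s u c)
    then show "smooth (\<lambda>x. cross3 (axis a 1) (\<psi> x) $ k)" by blast
  qed
  note d = smooth_differentiable[OF this] smooth_differentiable[OF s]
  consider "a = 1" | "a = 2" | "a = 3" using exhaust_3[of a] by blast
  then have "\<forall>d. curl (\<lambda>x. cross3 (axis a 1) (\<psi> x)) x $ d
    = (if a = d then (\<Sum>e\<in>UNIV. partial e (\<lambda>x. \<psi> x $ e) x) else 0) - partial a (\<lambda>x. \<psi> x $ d) x"
    unfolding forall_3 curl_components[OF d(1)] by cases (simp_all add: d cross3_axis partial_uminus sum_3)
  then show ?thesis by blast
qed

lemma curl_gradient:
  fixes f :: "real^3 \<Rightarrow> real"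
  assumes "smooth f" shows "curl (\<lambda>x. \<chi> k. partial k f x) x = 0"
proof -
  have "smooth (\<lambda>x. (\<chi> k. partial k f x) :: real^3)"
    by (rule smooth_vec) (simp add: smooth_partial assms)
  note d = smooth_differentiable[OF this]
  show ?thesis
    by (simp add: vec_eq_iff forall_3 curl_components[OF d] partial_commute[OF assms, of 2 1]
        partial_commute[OF assms, of 3 1] partial_commute[OF assms, of 3 2])
qed

context alfeld_split
begin

section \<open>Function spaces as conditions on polynomial families\<close>

lemma vpoly_curl: "vpoly n p \<Longrightarrow> vpoly (n - 1) (\<lambda>m. curl (p m))"
proof (intro conjI allI)
  assume p: "vpoly n p"
  note d = smooth_differentiable[OF vpoly_smooth[OF p]]
  have pk: "poly_fun n (\<lambda>x. p m x $ k)" for m k using p by blast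
  fix m k
  have "\<forall>k. poly_fun (n - 1) (\<lambda>x. curl (p m) x $ k)"
    unfolding forall_3 curl_components[OF d] by (intro conjI poly_fun_diff poly_fun_partial pk)
  then show "poly_fun (n - 1) (\<lambda>x. curl (p m) x $ k)" by blast
  fix x
  have "p None = (\<lambda>x. 0)" using p by auto
  then show "curl (p None) x = 0" by simp
qed

lemma C0_nth: "C0 N p \<longleftrightarrow> (\<forall>k. C0 N (\<lambda>m x. p m x $ k))"
proof
  show "\<forall>k. C0 N (\<lambda>m x. p m x $ k)" if "C0 N p" using C0_map[OF that, of "\<lambda>_ y. y $ k" for k] by blast
  show "\<forall>k. C0 N (\<lambda>m x. p m x $ k) \<Longrightarrow> C0 N p" unfolding C0_def vec_eq_iff by blast
qed

lemma C0_D: "C0 N p \<Longrightarrow> m \<in> N \<Longrightarrow> l \<in> N \<Longrightarrow> L m x = L l x \<Longrightarrow> p m x = p l x"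
  unfolding C0_def by blast

lemma PA_rep: "rep p f \<Longrightarrow> (\<And>m. poly_fun n (p m)) \<Longrightarrow> (\<And>x. p None x = 0) \<Longrightarrow> f \<in> PA n X z"
  unfolding PA_iff by blast

lemma W0_rep_iff:
  assumes f: "rep p f" and p: "\<And>m. poly_fun n (p m)" and p0: "\<And>x. p None x = 0"
  shows "f \<in> W0 n X z \<longleftrightarrow> C0 (range Some) p"
  unfolding W0_def using H1_imp_C0[OF _ f p p0] C0_imp_H1[OF f p] PA_rep[OF f p p0] by blast

lemma boundary_imp_C0_UNIV:
  assumes C: "C0 (range Some) p" and p0: "\<And>x. p None x = 0" and b: "\<And>i x. L (Some i) x = 0 \<Longrightarrow> p (Some i) x = 0"
  shows "C0 UNIV p"
  unfolding C0_def
proof (intro ballI allI impI)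
  fix m l x assume e: "L m x = L l x"
  show "p m x = p l x"
  proof (cases m; cases l)
    fix i j assume ij: "m = Some i" "l = Some j"
    show ?thesis by (rule C0_D[OF C]) (use ij e in auto)
  next
    fix i assume "m = Some i" "l = None"
    then show ?thesis using b[of i x] e p0 by simp
  next
    fix i assume "m = None" "l = Some i"
    then show ?thesis using b[of i x] e p0 by simp
  qed simp
qed

text \<open>Vanishing on a face extends to its plane \<open>L (Some i) = 0\<close>, which is where
  \<open>Some i\<close> and \<open>None\<close> are compared. Conversely, any subtetrahedron
  \<open>j\<close> containing a boundary point has \<open>L (Some j) = 0\<close> there, this being
  the least of the four values.\<close>

lemma W0_0_rep_iff:
  assumes f: "rep p f" and p: "\<And>m. poly_fun n (p m)" and p0: "\<And>x. p None x = 0"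
  shows "f \<in> W0_0 n X z \<longleftrightarrow> C0 UNIV p"
proof
  note van = vanishes_at_iff[OF f poly_fun_smooth[OF p]]
  {
    assume "f \<in> W0_0 n X z"
    then have C: "C0 (range Some) p" and v: "\<And>x i. x \<in> frontier (tet X) \<Longrightarrow> x \<in> subtet X z i \<Longrightarrow> p (Some i) x = 0"
      unfolding W0_0_def using W0_rep_iff[OF f p p0] van by auto
    show "C0 UNIV p"
    proof (rule boundary_imp_C0_UNIV[OF C p0])
      fix i x assume x: "L (Some i) x = 0"
      show "p (Some i) x = 0"
      proof (rule poly_zero_face_plane[OF p _ x])
        fix y assume "y \<in> face X i"
        then have y: "L (Some i) y = 0" "\<And>j. 0 \<le> L (Some j) y" by (auto simp: face_eq)
        then have "y \<in> tet X" "y \<in> subtet X z i" by (auto simp: tet_eq subtet_eq)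
        then show "p (Some i) y = 0" using y(1) by (intro v) (auto simp: frontier_tet_iff)
      qed
    qed
  next
    assume C: "C0 UNIV p"
    have "C0 (range Some) p" using C unfolding C0_def by blast
    moreover have "vanishes_at X z f x" if x: "x \<in> frontier (tet X)" for x
      unfolding van
    proof (intro allI impI)
      fix j assume j: "x \<in> subtet X z j"
      obtain i where i: "L (Some i) x = 0" using x frontier_tet_iff by blast
      have "0 \<le> L (Some j) x" "L (Some j) x \<le> L (Some i) x" using j subtet_eq by blast+
      then have "L (Some j) x = L None x" using i by simp
      then show "p (Some j) x = 0" using C0_D[OF C, of "Some j" None x] p0 by simp
    qed
    ultimately show "f \<in> W0_0 n X z" unfolding W0_0_def using W0_rep_iff[OF f p p0] by blast
  }
qed

lemma H1_0_rep_iff: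
  assumes f: "rep p f" and p: "\<And>m. poly_fun n (p m)" and p0: "\<And>x. p None x = 0"
  shows "f \<in> H1_0 (tet X) \<longleftrightarrow> C0 UNIV p"
proof
  assume H: "f \<in> H1_0 (tet X)"
  then have "f \<in> H1 (tet X)" by (simp add: H1_0_def)
  from H1_imp_C0[OF this f p p0] show "C0 UNIV p"
    by (rule boundary_imp_C0_UNIV[OF _ p0 H1_0_imp_boundary[OF H f p p0]])
qed (rule C0_imp_H1_0[OF f p _ p0])

lemma L1_rep_iff:
  assumes w: "rep p w" and p: "vpoly n p"
  shows "w \<in> L1 n X z \<longleftrightarrow> C0 (range Some) p" "w \<in> L1_0 n X z \<longleftrightarrow> C0 UNIV p"
proof -
  have r: "rep (\<lambda>m x. p m x $ k) (\<lambda>x. w x $ k)" for k using w rep_nth by blast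
  have pk: "poly_fun n (\<lambda>x. p m x $ k)" for m k using p by blast
  have p0: "p None x $ k = 0" for x k using p by simp
  show "w \<in> L1 n X z \<longleftrightarrow> C0 (range Some) p"
    unfolding L1_def mem_Collect_eq C0_nth[of _ p] using W0_rep_iff[OF r pk p0] by blast
  show "w \<in> L1_0 n X z \<longleftrightarrow> C0 UNIV p"
    unfolding L1_0_def mem_Collect_eq C0_nth[of _ p] using W0_0_rep_iff[OF r pk p0] by blast
qed

lemma ex_vpoly_rep:
  assumes "\<And>k. (\<lambda>x. w x $ k) \<in> PA n X z" obtains p where "vpoly n p" "rep p w"
proof -
  have "\<exists>q. (\<forall>m. poly_fun n (q m)) \<and> (\<forall>x. q None x = 0) \<and> rep q (\<lambda>x. w x $ k)" for k
    using assms PA_iff by blast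
  then have "\<exists>q. \<forall>k. (\<forall>m. poly_fun n (q k m)) \<and> (\<forall>x. q k None x = 0) \<and> rep (q k) (\<lambda>x. w x $ k)"
    by (intro choice allI)
  then obtain q where q: "\<And>k m. poly_fun n (q k m)" "\<And>k x. q k None x = 0" "\<And>k. rep (q k) (\<lambda>x. w x $ k)" by blast
  show ?thesis
    by (rule that[of "\<lambda>m x. \<chi> k. q k m x"]) (simp_all add: q rep_nth[of _ w] vec_eq_iff)
qed

lemma Hcurl_C0:
  assumes "rep p w" "vpoly n p" "C0 (range Some) p" shows "w \<in> Hcurl (tet X)"
proof -
  have "has_wcurl (tet X) w (pw (\<lambda>m. curl (p m)))"
  proof (rule has_wcurl_C0_grad[OF _ assms(2,3)])
    show "rep (\<lambda>m x. p m x + (\<chi> k. partial k (\<lambda>x. 0) x)) w"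
      by (rule rep_cong[OF assms(1)]) (simp add: vec_eq_iff)
    show "poly_fun 0 (\<lambda>x. 0)" for m :: "4 option" by (rule poly_fun_zero)
    show "C0 (range Some) (\<lambda>_ _. 0::real)" by (simp add: C0_def)
  qed (rule rep_pw)
  then show ?thesis unfolding Hcurl_def by blast
qed

section \<open>Agreement of derivatives at the vertices\<close>

text \<open>Subtetrahedron \<open>j\<close> does not contain \<open>X j\<close>, so its piece is
  left out. For \<open>N = UNIV\<close> and \<open>p None = 0\<close>, agreement means that the
  gradients vanish, and one notion serves the C1 condition and the vanishing condition.\<close>

definition grad_agree :: "4 option set \<Rightarrow> (4 option \<Rightarrow> real^3 \<Rightarrow> 'b::real_normed_vector) \<Rightarrow> bool" where
  "grad_agree N p \<longleftrightarrow> (\<forall>j k. \<forall>m\<in>N - {Some j}. \<forall>l\<in>N - {Some j}. partial k (p m) (X j) = partial k (p l) (X j))"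

definition curl_agree :: "4 option set \<Rightarrow> (4 option \<Rightarrow> real^3 \<Rightarrow> real^3) \<Rightarrow> bool" where
  "curl_agree N p \<longleftrightarrow> (\<forall>j. \<forall>m\<in>N - {Some j}. \<forall>l\<in>N - {Some j}. curl (p m) (X j) = curl (p l) (X j))"

lemma L_vertex: "m \<noteq> Some j \<Longrightarrow> L m (X j) = 0"
  by (cases m) (auto simp: L_Some lam_X)

text \<open>The condition of order zero follows from \<open>C0\<close>, since all \<open>L m\<close>
  with \<open>m \<noteq> Some j\<close> agree at \<open>X j\<close>; only first derivatives
  remain.\<close>

lemma Ck_at_1_iff:
  fixes f :: "real^3 \<Rightarrow> 'b::real_normed_vector"
  assumes f: "rep p f" and p: "\<And>m. smooth (p m)" and C: "C0 (range Some) p"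
  shows "(\<forall>x\<in>range X. Ck_at 1 X z f x) \<longleftrightarrow> grad_agree (range Some) p"
proof
  assume A: "\<forall>x\<in>range X. Ck_at 1 X z f x"
  show "grad_agree (range Some) p"
    unfolding grad_agree_def
  proof (intro allI ballI)
    fix j :: 4 and k m l assume "m \<in> range Some - {Some j}" "l \<in> range Some - {Some j}"
    then obtain a b where ab: "m = Some a" "l = Some b" "a \<noteq> j" "b \<noteq> j" by auto
    have "Ck_at 1 X z f (X j)" using A by blast
    then have "length [k] \<le> 1 \<longrightarrow> X j \<in> subtet X z a \<longrightarrow> X j \<in> subtet X z b \<longrightarrow>
        partials [k] (p (Some a)) (X j) = partials [k] (p (Some b)) (X j)"
      unfolding Ck_at_iff[OF f p] by blast
    then show "partial k (p m) (X j) = partial k (p l) (X j)" using ab by (simp add: vertex_in_subtet)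
  qed
next
  assume A: "grad_agree (range Some) p"
  show "\<forall>x\<in>range X. Ck_at 1 X z f x"
    unfolding Ck_at_iff[OF f p]
  proof (intro ballI allI impI)
    fix x a b and "is" :: "3 list" assume x: "x \<in> range X" "length is \<le> 1" "x \<in> subtet X z a" "x \<in> subtet X z b"
    then obtain j where j: "x = X j" by blast
    then have ab: "a \<noteq> j" "b \<noteq> j" using x by (auto simp: vertex_in_subtet)
    show "partials is (p (Some a)) x = partials is (p (Some b)) x"
    proof (cases "is")
      case Nil
      have "L (Some a) x = L (Some b) x" using ab j by (simp add: L_vertex)
      then show ?thesis using C0_D[OF C, of "Some a" "Some b" x] Nil by simp
    next
      case (Cons k ks)
      then have "is = [k]" using x(2) by simp
      then show ?thesis using A ab j unfolding grad_agree_def by simp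
    qed
  qed
qed

lemma grad_vanishes_iff:
  fixes f :: "real^3 \<Rightarrow> 'b::real_normed_vector"
  assumes f: "rep p f" and p: "\<And>m. smooth (p m)" and p0: "\<And>x. p None x = 0"
  shows "(\<forall>x\<in>range X. grad_vanishes_at X z f x) \<longleftrightarrow> grad_agree UNIV p"
proof -
  have pN: "partial k (p None) x = 0" for k x
  proof -
    have "p None = (\<lambda>x. 0)" using p0 by auto
    then show ?thesis by simp
  qed
  have "(\<forall>x\<in>range X. grad_vanishes_at X z f x) \<longleftrightarrow> (\<forall>j k i. i \<noteq> (j::4) \<longrightarrow> partial k (p (Some i)) (X j) = 0)"
    unfolding grad_vanishes_at_iff[OF f p] by (simp add: vertex_in_subtet)
  also have "\<dots> \<longleftrightarrow> grad_agree UNIV p"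
  proof
    assume A: "\<forall>j k i. i \<noteq> (j::4) \<longrightarrow> partial k (p (Some i)) (X j) = 0"
    have "partial k (p m) (X j) = 0" if "m \<noteq> Some j" for m k and j :: 4
      using A that pN by (cases m) auto
    then show "grad_agree UNIV p" unfolding grad_agree_def by simp
  next
    assume "grad_agree UNIV p"
    then have "partial k (p (Some i)) (X j) = partial k (p None) (X j)" if "i \<noteq> j" for i j :: 4 and k
      using that unfolding grad_agree_def by simp
    then show "\<forall>j k i. i \<noteq> (j::4) \<longrightarrow> partial k (p (Some i)) (X j) = 0" using pN by simp
  qed
  finally show ?thesis .
qed

text \<open>\<open>N = range Some\<close> describes \<open>Z1\<close> and \<open>N = UNIV\<close>
  describes \<open>Z1_0\<close>, always for families with zero exterior entry.\<close>

definition ZN :: "4 option set \<Rightarrow> nat \<Rightarrow> (4 option \<Rightarrow> real^3 \<Rightarrow> real^3) \<Rightarrow> bool" where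
  "ZN N n p \<longleftrightarrow> vpoly n p \<and> C0 N p \<and> C0 N (\<lambda>m. curl (p m)) \<and> grad_agree N (\<lambda>m. curl (p m))"

text \<open>Membership in \<open>L1\<close> already supplies a continuous family of polynomials. Its
  cellwise curls represent the weak curl, so the remaining conditions can be read off from the
  family.\<close>

lemma Z_iff:
  "w \<in> Z1 n X z \<longleftrightarrow> (\<exists>p. rep p w \<and> ZN (range Some) n p)"
  "w \<in> Z1_0 n X z \<longleftrightarrow> (\<exists>p. rep p w \<and> ZN UNIV n p)"
proof -
  have main: "(w \<in> Z1 n X z \<longleftrightarrow> ZN (range Some) n p) \<and> (w \<in> Z1_0 n X z \<longleftrightarrow> ZN UNIV n p)"
    if w: "rep p w" and p: "vpoly n p" and C: "C0 (range Some) p" for p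
  proof -
    have wc: "rep (\<lambda>m. curl (p m)) (wcurl (tet X) w)"
      by (rule wcurl_rep[OF Hcurl_C0[OF w p C] w p])
    note c = vpoly_curl[OF p]
    show ?thesis
      unfolding Z1_def S1_def Z1_0_def S1_0_def ZN_def mem_Collect_eq
        L1_rep_iff[OF w p] L1_rep_iff[OF wc c] grad_vanishes_iff[OF wc vpoly_smooth[OF c] c[THEN conjunct2, THEN spec]]
      using Ck_at_1_iff[OF wc vpoly_smooth[OF c]] p by blast
  qed
  have L1p: "\<exists>p. rep p w \<and> vpoly n p \<and> C0 (range Some) p" if "w \<in> L1 n X z"
  proof -
    have "\<And>k. (\<lambda>x. w x $ k) \<in> PA n X z" using that unfolding L1_def W0_def by blast
    then obtain p where "vpoly n p" "rep p w" by (rule ex_vpoly_rep)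
    then show ?thesis using L1_rep_iff(1)[of p w n] that by blast
  qed
  have sub: "L1_0 n X z \<subseteq> L1 n X z" unfolding L1_0_def L1_def W0_0_def by blast
  have res: "C0 UNIV p \<Longrightarrow> C0 (range Some) p" for p :: "4 option \<Rightarrow> real^3 \<Rightarrow> real^3" unfolding C0_def by blast
  show "w \<in> Z1 n X z \<longleftrightarrow> (\<exists>p. rep p w \<and> ZN (range Some) n p)"
  proof
    assume a: "w \<in> Z1 n X z"
    then have "w \<in> L1 n X z" by (simp add: Z1_def S1_def)
    then show "\<exists>p. rep p w \<and> ZN (range Some) n p" using L1p main a by blast
  next
    assume "\<exists>p. rep p w \<and> ZN (range Some) n p"
    then show "w \<in> Z1 n X z" using main ZN_def by blast
  qed
  show "w \<in> Z1_0 n X z \<longleftrightarrow> (\<exists>p. rep p w \<and> ZN UNIV n p)"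
  proof
    assume a: "w \<in> Z1_0 n X z"
    then have "w \<in> L1 n X z" using sub by (auto simp: Z1_0_def S1_0_def)
    then show "\<exists>p. rep p w \<and> ZN UNIV n p" using L1p main a by blast
  next
    assume "\<exists>p. rep p w \<and> ZN UNIV n p"
    then show "w \<in> Z1_0 n X z" using main res ZN_def by blast
  qed
qed

end

section \<open>Symmetric parts and potentials\<close>

lemma curl_add:
  assumes "smooth p" "smooth q" shows "curl (\<lambda>x. p x + q x) x = curl p x + curl q x"
  by (simp add: curl_def vec_eq_iff forall_3 partial_add smooth_differentiable assms)

lemma symm_nth: "symm M $ a $ b = (M $ a $ b + M $ b $ a) / 2"
  by (simp add: symm_def transpose_def)

context alfeld_split
begin

text \<open>At most three of the four cell indices are excluded. The index found is the third piece
  at \<open>X j\<close> that the comparison of two gradients requires.\<close>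

lemma third_node:
  fixes N :: "4 option set" and j :: 4
  assumes "range Some \<subseteq> N" obtains c where "c \<in> N - {Some j}" "c \<noteq> m" "c \<noteq> l"
proof -
  have "\<not> range (Some :: 4 \<Rightarrow> 4 option) \<subseteq> {Some j, m, l}"
  proof
    assume "range (Some :: 4 \<Rightarrow> 4 option) \<subseteq> {Some j, m, l}"
    then have "card (range (Some :: 4 \<Rightarrow> 4 option)) \<le> card {Some j, m, l}" by (intro card_mono) auto
    also have "\<dots> \<le> 3" by (simp add: card_insert_if)
    finally show False by (simp add: card_image)
  qed
  then obtain c where "c \<in> range (Some :: 4 \<Rightarrow> 4 option)" "c \<notin> {Some j, m, l}" by blast
  then show ?thesis using assms by (intro that[of c]) auto
qed

text \<open>All \<open>L m\<close> with \<open>m \<noteq> Some j\<close> vanish at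
  \<open>X j\<close>, so two pieces there can be completed by a third one to a configuration of
  three planes through the vertex.\<close>

lemma grad_agreeI:
  assumes N: "range Some \<subseteq> N" and p: "vpoly n p" and C: "C0 N p" and c: "curl_agree N p"
  shows "grad_agree N p"
  unfolding grad_agree_def
proof (intro allI ballI)
  fix j :: 4 and k m l assume m: "m \<in> N - {Some j}" and l: "l \<in> N - {Some j}"
  show "partial k (p m) (X j) = partial k (p l) (X j)"
  proof (cases "m = l")
    case False
    obtain c' where c': "c' \<in> N - {Some j}" "c' \<noteq> m" "c' \<noteq> l" using third_node[OF N] by metis
    have S: "{m, l, c'} \<subseteq> N - {Some j}" using m l c' by blast
    show ?thesis
    proof (rule gradients_agree[where c=c'])
      show "smooth (p a)" for a by (rule vpoly_smooth[OF p])
      show "L m (X j) = L l (X j)" "L l (X j) = L c' (X j)" using m l c' by (simp_all add: L_vertex)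
      show "p a x = p b x" if "a \<in> {m, l, c'}" "b \<in> {m, l, c'}" "L a x = L b x" for a b x
        using C0_D[OF C] S that by blast
      show "curl (p a) (X j) = curl (p b) (X j)" if "a \<in> {m, l, c'}" "b \<in> {m, l, c'}" for a b
        using c S that unfolding curl_agree_def by blast
    qed (use False c' in auto)
  qed simp
qed

section \<open>Symmetric fields and their potentials\<close>

text \<open>\<open>Q a\<close> is row \<open>a\<close> of a symmetric field. Symmetry is imposed on
  the polynomials at every point, whereas the class itself is symmetric only almost
  everywhere.\<close>

definition good :: "4 option set \<Rightarrow> nat \<Rightarrow> (3 \<Rightarrow> 4 option \<Rightarrow> real^3 \<Rightarrow> real^3) \<Rightarrow> bool" where
  "good N n Q \<longleftrightarrow> (\<forall>a. vpoly n (Q a)) \<and> (\<forall>a b m x. Q a m x $ b = Q b m x $ a) \<and> (\<forall>a. C0 N (Q a))"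

text \<open>Row \<open>d\<close> of \<open>(curl u)'\<close>, for the field \<open>u\<close> with
  rows \<open>Q a\<close>.\<close>

definition curlT :: "(3 \<Rightarrow> 4 option \<Rightarrow> real^3 \<Rightarrow> real^3) \<Rightarrow> 3 \<Rightarrow> 4 option \<Rightarrow> real^3 \<Rightarrow> real^3" where
  "curlT Q d m x = (\<chi> a. curl (Q a m) x $ d)"

definition tangential :: "4 option set \<Rightarrow> (4 option \<Rightarrow> real^3 \<Rightarrow> real^3) \<Rightarrow> bool" where
  "tangential N p \<longleftrightarrow> (\<forall>m\<in>N. \<forall>l\<in>N. \<forall>x. L m x = L l x \<longrightarrow> (\<exists>s. p m x - p l x = s *\<^sub>R (av m - av l)))"

text \<open>Row \<open>a\<close> of \<open>u - mskw \<psi>\<close>, where row \<open>a\<close> of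
  \<open>mskw \<psi>\<close> is \<open>e_a x \<psi>\<close>.\<close>

definition skewed :: "(3 \<Rightarrow> 4 option \<Rightarrow> real^3 \<Rightarrow> real^3) \<Rightarrow> (3 \<Rightarrow> 4 option \<Rightarrow> real^3 \<Rightarrow> real) \<Rightarrow> 3 \<Rightarrow> 4 option \<Rightarrow> real^3 \<Rightarrow> real^3" where
  "skewed Q \<psi> a m x = Q a m x - cross3 (axis a 1) (\<chi> d. \<psi> d m x)"

lemma vpoly_curlT:
  assumes "\<And>a. vpoly n (Q a)" shows "vpoly (n - 1) (curlT Q d)"
  using vpoly_curl[OF assms] by (auto simp: curlT_def[abs_def] vec_eq_iff)

text \<open>With \<open>S d = curlT Q d + grad (\<psi> d)\<close>, this is \<open>curl (u - mskw \<psi>) = S' - (tr S) I\<close>, where the trace of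
  \<open>curlT Q\<close> drops out by symmetry of \<open>Q\<close>.\<close>
lemma curl_skewed:
  assumes Q: "\<And>a. vpoly n (Q a)" and sym: "\<And>a b m x. Q a m x $ b = Q b m x $ a"
    and \<psi>: "\<And>d m. smooth (\<psi> d m)"
  shows "curl (skewed Q \<psi> a m) x $ d = (curlT Q d m x $ a + partial a (\<psi> d m) x)
    - (if a = d then \<Sum>e\<in>UNIV. curlT Q e m x $ e + partial e (\<psi> e m) x else 0)"
proof -
  have s\<psi>: "smooth (\<lambda>x. \<chi> d. \<psi> d m x)" by (rule smooth_vec) (simp add: \<psi>)
  note sQ = vpoly_smooth[OF Q]
  have sc: "smooth (\<lambda>x. cross3 (axis a 1) (\<chi> d. \<psi> d m x))" for a
  proof (rule smooth_vec)
    fix k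
    have u: "smooth (\<lambda>x. - \<psi> j m x)" for j
      by (rule smooth_linear(1)[OF bounded_linear_minus[OF bounded_linear_ident] \<psi>])
    have c: "smooth (\<lambda>x. 0::real)" by (rule smooth_alg_smooth[OF smooth_alg.const])
    consider "a = 1" | "a = 2" | "a = 3" using exhaust_3[of a] by blast
    then have "\<forall>k. smooth (\<lambda>x. cross3 (axis a 1) (\<chi> d. \<psi> d m x) $ k)"
      by cases (simp_all add: forall_3 cross3_axis \<psi> u c)
    then show "smooth (\<lambda>x. cross3 (axis a 1) (\<chi> d. \<psi> d m x) $ k)" by blast
  qed
  have tr: "(\<Sum>e\<in>UNIV. curlT Q e m x $ e) = 0"
  proof -
    have "Q 2 m x $ 1 = Q 1 m x $ 2" "Q 3 m x $ 1 = Q 1 m x $ 3" "Q 3 m x $ 2 = Q 2 m x $ 3" for x by (rule sym)+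
    then show ?thesis by (simp add: curlT_def sum_3 curl_components smooth_differentiable sQ)
  qed
  have "curl (skewed Q \<psi> a m) x $ d = curl (Q a m) x $ d - curl (\<lambda>x. cross3 (axis a 1) (\<chi> d. \<psi> d m x)) x $ d"
    unfolding skewed_def[abs_def] using curl_diff[OF sQ sc] by simp
  also have "curl (\<lambda>x. cross3 (axis a 1) (\<chi> d. \<psi> d m x)) x $ d
      = (if a = d then (\<Sum>e\<in>UNIV. partial e (\<psi> e m) x) else 0) - partial a (\<psi> d m) x"
    by (simp add: curl_skew[OF s\<psi>])
  finally show ?thesis by (simp add: curlT_def sum.distrib tr[unfolded curlT_def vec_lambda_beta])
qed

lemma poly_fun_skewed:
  assumes Q: "\<And>a. vpoly n (Q a)" and \<psi>: "\<And>d m. poly_fun n (\<psi> d m)" and \<psi>0: "\<And>d x. \<psi> d None x = 0"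
  shows "vpoly n (skewed Q \<psi> a)"
proof (intro conjI allI)
  show "poly_fun n (\<lambda>x. skewed Q \<psi> a m x $ k)" for m k
    unfolding skewed_def vector_minus_component
    by (intro poly_fun_diff poly_fun_cross3_axis) (use Q \<psi> in auto)
  have "(\<chi> d. \<psi> d None x) = 0" for x by (simp add: vec_eq_iff \<psi>0)
  then show "skewed Q \<psi> a None x = 0" for x using Q[of a] by (simp add: skewed_def)
qed

text \<open>Each row of \<open>(curl u)'\<close> has its own lift \<open>\<psi> d\<close>, and the
  lifts are the components of the vector defining the skew part. Adding a gradient does not change
  the curl of a row, so agreement of curls at the vertices passes to the continuous
  \<open>S d\<close> and there upgrades to agreement of gradients.\<close>

lemma potential_exists:
  assumes N: "range Some \<subseteq> N" and n: "2 \<le> n" and Q: "good N n Q"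
    and T: "\<And>d. tangential N (curlT Q d)" and c: "\<And>d. curl_agree N (curlT Q d)"
  obtains P' where "\<And>a. ZN N n (P' a)" "\<And>m x. symm (\<chi> a. P' a m x) = (\<chi> a. Q a m x)"
proof -
  have Qp: "\<And>a. vpoly n (Q a)" and sym: "\<And>a b m x. Q a m x $ b = Q b m x $ a" and QC: "\<And>a. C0 N (Q a)"
    using Q unfolding good_def by blast+
  note Rp = vpoly_curlT[where Q=Q, OF Qp]
  \<comment> \<open>The rows of \<open>(curl u)'\<close> have degree \<open>n - 1\<close>, which the
    lift requires to be positive. The lift itself has degree \<open>n\<close>, so the potential
    keeps the degree of \<open>u\<close>.\<close>
  have n': "Suc (n - 1) = n" "1 \<le> n - 1" using n by auto
  have "\<exists>\<psi>. (\<forall>m. poly_fun n (\<psi> m)) \<and> (\<forall>m l x. L m x = L l x \<longrightarrow> \<psi> m x = \<psi> l x) \<and> (\<forall>x. \<psi> None x = 0) \<and>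
      (\<forall>m\<in>N. \<forall>l\<in>N. \<forall>x k. L m x = L l x \<longrightarrow>
        curlT Q d m x $ k + partial k (\<psi> m) x = curlT Q d l x $ k + partial k (\<psi> l) x)" for d
  proof -
    have R1: "poly_fun (n - 1) (\<lambda>x. curlT Q d m x $ k)" for m k using Rp[of d] by blast
    have R2: "\<exists>c. curlT Q d m x - curlT Q d l x = c *\<^sub>R (av m - av l)" if "m \<in> N" "l \<in> N" "L m x = L l x" for m l x
      using T[of d] that unfolding tangential_def by blast
    show ?thesis
      by (rule normal_jump_lift[OF n'(2) R1 R2], assumption+, unfold n'(1), intro exI conjI allI ballI impI, blast+)
  qed
  then have "\<exists>\<psi>. \<forall>d. (\<forall>m. poly_fun n (\<psi> d m)) \<and> (\<forall>m l x. L m x = L l x \<longrightarrow> \<psi> d m x = \<psi> d l x) \<and> (\<forall>x. \<psi> d None x = 0) \<and>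
      (\<forall>m\<in>N. \<forall>l\<in>N. \<forall>x k. L m x = L l x \<longrightarrow>
        curlT Q d m x $ k + partial k (\<psi> d m) x = curlT Q d l x $ k + partial k (\<psi> d l) x)" (is "\<exists>\<psi>. ?lift \<psi>")
    by (intro choice allI)
  then obtain \<psi> where lift: "?lift \<psi>" by (elim exE)
  note lift1 = lift[THEN spec]
  note lift2 = lift1[THEN conjunct2]
  note lift3 = lift2[THEN conjunct2, THEN conjunct2]
  have \<psi>: "poly_fun n (\<psi> d m)" for d m by (rule lift1[THEN conjunct1, THEN spec])
  have \<psi>0: "\<psi> d None x = 0" for d x by (rule lift2[THEN conjunct2, THEN conjunct1, THEN spec])
  have \<psi>C: "\<psi> d m x = \<psi> d l x" if "L m x = L l x" for d m l x
    by (rule lift2[THEN conjunct1, rule_format, OF that])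
  have jump: "curlT Q d m x $ k + partial k (\<psi> d m) x = curlT Q d l x $ k + partial k (\<psi> d l) x"
    if "m \<in> N" "l \<in> N" "L m x = L l x" for d m l x k
    by (rule lift3[rule_format, OF that])
  note \<psi>s = poly_fun_smooth[OF \<psi>]
  define S where "S d m x = curlT Q d m x + (\<chi> k. partial k (\<psi> d m) x)" for d m x
  have pN: "partial k (\<psi> d None) x = 0" for k d x
  proof -
    have "\<psi> d None = (\<lambda>x. 0)" using \<psi>0 by auto
    then show ?thesis by simp
  qed
  have Sp: "vpoly (n - 1) (S d)" for d
  proof (intro conjI allI)
    show "poly_fun (n - 1) (\<lambda>x. S d m x $ k)" for m k
      unfolding S_def vector_add_component vec_lambda_beta
      by (intro poly_fun_add poly_fun_partial \<psi>) (use Rp[of d] in blast)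
    show "S d None x = 0" for x using Rp[of d] by (simp add: S_def pN vec_eq_iff)
  qed
  have SC: "C0 N (S d)" for d
    unfolding C0_def vec_eq_iff S_def vector_add_component vec_lambda_beta by (intro ballI allI impI jump)
  have cS: "curl (S d m) x = curl (curlT Q d m) x" for d m x
  proof -
    have "smooth (\<lambda>x. (\<chi> k. partial k (\<psi> d m) x) :: real^3)"
      by (rule smooth_vec) (simp add: smooth_partial \<psi>s)
    then show ?thesis
      unfolding S_def[abs_def] by (simp add: curl_add vpoly_smooth[OF Rp] curl_gradient \<psi>s)
  qed
  have "curl_agree N (S d)" for d using c[of d] unfolding curl_agree_def cS .
  then have Sg: "grad_agree N (S d)" for d by (rule grad_agreeI[OF N Sp SC])
  have cP: "curl (skewed Q \<psi> a m) x $ d = S d m x $ a - (if a = d then \<Sum>e\<in>UNIV. S e m x $ e else 0)" for a m x d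
    by (simp add: curl_skewed[where Q=Q and \<psi>=\<psi>, OF Qp sym \<psi>s] S_def)
  note Pp = poly_fun_skewed[where Q=Q and \<psi>=\<psi>, OF Qp \<psi> \<psi>0]
  have "ZN N n (skewed Q \<psi> a)" for a
    unfolding ZN_def
  proof (intro conjI)
    show "\<forall>m k. poly_fun n (\<lambda>x. skewed Q \<psi> a m x $ k)" "\<forall>x. skewed Q \<psi> a None x = 0" using Pp[of a] by blast+
    show "C0 N (skewed Q \<psi> a)"
      unfolding C0_def
    proof (intro ballI allI impI)
      fix m l x assume ml: "m \<in> N" "l \<in> N" "L m x = L l x"
      show "skewed Q \<psi> a m x = skewed Q \<psi> a l x"
        unfolding skewed_def C0_D[OF QC ml] \<psi>C[OF ml(3)] ..
    qed
    show "C0 N (\<lambda>m. curl (skewed Q \<psi> a m))"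
      unfolding C0_def vec_eq_iff cP
    proof (intro ballI allI impI)
      fix m l x d assume ml: "m \<in> N" "l \<in> N" "L m x = L l x"
      show "S d m x $ a - (if a = d then \<Sum>e\<in>UNIV. S e m x $ e else 0)
          = S d l x $ a - (if a = d then \<Sum>e\<in>UNIV. S e l x $ e else 0)"
        unfolding C0_D[OF SC ml] ..
    qed
    show "grad_agree N (\<lambda>m. curl (skewed Q \<psi> a m))"
      unfolding grad_agree_def
    proof (intro allI ballI)
      fix j :: 4 and k m l assume ml: "m \<in> N - {Some j}" "l \<in> N - {Some j}"
      have g: "partial k (curl (skewed Q \<psi> a m)) x $ d = partial k (S d m) x $ a
          - (if a = d then \<Sum>e\<in>UNIV. partial k (S e m) x $ e else 0)" for m x d
      proof -
        note Sd = smooth_differentiable[OF vpoly_smooth[OF Sp]] smooth_differentiable[OF smooth_nth[OF vpoly_smooth[OF Sp]]]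
        have ds: "(\<lambda>x. \<Sum>e\<in>UNIV. S e m x $ e) differentiable at x" by (rule differentiable_sum) (auto intro: Sd)
        have "partial k (curl (skewed Q \<psi> a m)) x $ d = partial k (\<lambda>x. curl (skewed Q \<psi> a m) x $ d) x"
          by (rule partial_nth[symmetric], rule smooth_differentiable[OF vpoly_smooth[OF vpoly_curl[OF Pp]]])
        also have "\<dots> = partial k (S d m) x $ a - (if a = d then \<Sum>e\<in>UNIV. partial k (S e m) x $ e else 0)"
          unfolding cP by (cases "a = d") (simp_all add: partial_diff ds Sd partial_sum partial_nth)
        finally show ?thesis .
      qed
      have "partial k (S d m) (X j) = partial k (S d l) (X j)" for d
        using Sg[of d] ml unfolding grad_agree_def by blast
      then show "partial k (curl (skewed Q \<psi> a m)) (X j) = partial k (curl (skewed Q \<psi> a l)) (X j)"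
        unfolding vec_eq_iff g by simp
    qed
  qed
  moreover have "symm (\<chi> a. skewed Q \<psi> a m x) = (\<chi> a. Q a m x)" for m x
  proof -
    have "(skewed Q \<psi> a m x $ b + skewed Q \<psi> b m x $ a) / 2 = Q a m x $ b" for a b
      using cross3_axis_antisym[of a "\<chi> d. \<psi> d m x" b] sym[of a m x b] by (simp add: skewed_def)
    then show ?thesis by (simp add: vec_eq_iff symm_nth)
  qed
  ultimately show ?thesis by (rule that)
qed

text \<open>The skew part exhibits the given field as \<open>skewed Q \<psi>\<close>. Solving
  \<open>curl P = S' - (tr S) I\<close> for \<open>S\<close> shows that \<open>S\<close> is
  continuous, and \<open>curlT Q d\<close> differs from \<open>S d\<close> by the gradient of a
  continuous function, whose jumps are normal.\<close>

lemma symmetric_part_properties: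
  assumes N: "range Some \<subseteq> N" and P': "\<And>a. ZN N n (P' a)"
  obtains Q where "good N n Q" "\<And>m x. symm (\<chi> a. P' a m x) = (\<chi> a. Q a m x)"
    "\<And>d. tangential N (curlT Q d)" "\<And>d. curl_agree N (curlT Q d)" "\<And>a. grad_agree N (Q a)"
    "\<And>d f. rep (curlT Q d) f \<Longrightarrow> f \<in> Hcurl (tet X)"
proof -
  have Pp: "\<And>a. vpoly n (P' a)" and PC: "\<And>a. C0 N (P' a)" and cC: "\<And>a. C0 N (\<lambda>m. curl (P' a m))"
    and cg: "\<And>a. grad_agree N (\<lambda>m. curl (P' a m))" using P' unfolding ZN_def by blast+
  define Q where "Q a m x = (\<chi> b. (P' a m x $ b + P' b m x $ a) / 2)" for a m x
  \<comment> \<open>The axial vector of the skew part, with the sign for which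
    \<open>skewed Q \<psi>\<close> gives back \<open>P'\<close>.\<close>
  define \<psi> :: "3 \<Rightarrow> 4 option \<Rightarrow> real^3 \<Rightarrow> real" where
    "\<psi> d m x = (if d = 1 then P' 2 m x $ 3 - P' 3 m x $ 2 else if d = 2 then P' 3 m x $ 1 - P' 1 m x $ 3
      else P' 1 m x $ 2 - P' 2 m x $ 1) / 2" for d m x
  have half: "poly_fun n (\<lambda>x. f x / 2)" if "poly_fun n f" for f
    using poly_fun_cmult[OF that, of "1/2"] by simp
  have Pk: "poly_fun n (\<lambda>x. P' a m x $ b)" for a m b using Pp by blast
  have P0: "P' a None x = 0" for a x using Pp by blast
  have Qp: "vpoly n (Q a)" for a
    by (auto simp: Q_def P0 vec_eq_iff intro!: half poly_fun_add Pk)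
  have \<psi>p: "poly_fun n (\<psi> d m)" for d m
    unfolding \<psi>_def[abs_def] by (cases "d = 1"; cases "d = 2") (simp_all, (intro half poly_fun_diff Pk)+)
  have sym: "Q a m x $ b = Q b m x $ a" for a b m x by (simp add: Q_def add.commute)
  have PQ: "P' a = skewed Q \<psi> a" for a
  proof -
    consider "a = 1" | "a = 2" | "a = 3" using exhaust_3[of a] by blast
    then have "P' a m x = skewed Q \<psi> a m x" for m x
      by cases (simp_all add: skewed_def cross3_axis vec_eq_iff forall_3 Q_def \<psi>_def field_simps)
    then show ?thesis by blast
  qed
  have QC: "C0 N (Q a)" for a
    unfolding C0_def
  proof (intro ballI allI impI)
    fix m l x assume ml: "m \<in> N" "l \<in> N" "L m x = L l x"
    show "Q a m x = Q a l x" unfolding Q_def C0_D[OF PC ml] ..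
  qed
  have \<psi>C: "\<psi> d m x = \<psi> d l x" if ml: "m \<in> N" "l \<in> N" "L m x = L l x" for d m l x
    unfolding \<psi>_def C0_D[OF PC ml] ..
  note \<psi>s = poly_fun_smooth[OF \<psi>p]
  define tr where "tr m x = (\<Sum>e\<in>UNIV. curl (P' e m) x $ e)" for m x
  \<comment> \<open>Taking traces in \<open>curl P = S' - (tr S) I\<close> gives
    \<open>tr (curl P) = - 2 tr S\<close>; this explains the half of the trace subtracted on the
    diagonal.\<close>
  define S where "S d m x = (\<chi> a. curl (P' a m) x $ d - (if a = d then tr m x / 2 else 0))" for d m x
  have trS: "tr m x = - 2 * (\<Sum>e\<in>UNIV. curlT Q e m x $ e + partial e (\<psi> e m) x)" for m x
    unfolding tr_def PQ curl_skewed[where Q=Q and \<psi>=\<psi>, OF Qp sym \<psi>s] by (simp add: sum_subtractf)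
  have SQ: "S d m x $ a = curlT Q d m x $ a + partial a (\<psi> d m) x" for d m x a
    unfolding S_def vec_lambda_beta trS by (simp add: PQ[of a] curl_skewed[where Q=Q and \<psi>=\<psi>, OF Qp sym \<psi>s])
  note cPp = vpoly_curl[OF Pp]
  have cPk: "poly_fun (n - 1) (\<lambda>x. curl (P' a m) x $ d)" and cP0: "curl (P' a None) x = 0" for a m d x
    using cPp[of a] by blast+
  have trp: "poly_fun (n - 1) (tr m)" for m unfolding tr_def[abs_def] by (intro poly_fun_sum cPk)
  have Sp: "vpoly (n - 1) (S d)" for d
  proof (intro conjI allI)
    show "poly_fun (n - 1) (\<lambda>x. S d m x $ a)" for m a
      unfolding S_def vec_lambda_beta using cPk poly_fun_cmult[OF trp, of "1/2"]
      by (cases "a = d") (auto intro!: poly_fun_diff)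
    show "S d None x = 0" for x by (simp add: S_def tr_def cP0 vec_eq_iff)
  qed
  have SC: "C0 N (S d)" for d
    unfolding C0_def
  proof (intro ballI allI impI)
    fix m l x assume ml: "m \<in> N" "l \<in> N" "L m x = L l x"
    show "S d m x = S d l x" unfolding S_def tr_def C0_D[OF cC ml] ..
  qed
  have Sgrad: "partial k (S d m) (X j) = partial k (S d l) (X j)"
    if ml: "m \<in> N - {Some j}" "l \<in> N - {Some j}" for d k m l j
  proof -
    note cd = smooth_differentiable[OF vpoly_smooth[OF cPp]] smooth_differentiable[OF poly_fun_smooth[OF cPk]]
      smooth_differentiable[OF poly_fun_smooth[OF trp]]
    have trg: "partial k (tr m) x = (\<Sum>e\<in>UNIV. partial k (curl (P' e m)) x $ e)" for m x
      unfolding tr_def[abs_def] by (subst partial_sum) (simp_all add: cd partial_nth)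
    have g: "partial k (S d m) x $ a = partial k (curl (P' a m)) x $ d - (if a = d then partial k (tr m) x / 2 else 0)" for m x a
    proof -
      have h: "partial k (\<lambda>x. tr m x / 2) x = partial k (tr m) x / 2" "(\<lambda>x. tr m x / 2) differentiable at x"
        using partial_linear[OF bounded_linear_divide cd(3)] smooth_differentiable[OF smooth_linear(1)[OF bounded_linear_divide poly_fun_smooth[OF trp]]]
        by auto
      have "partial k (S d m) x $ a = partial k (\<lambda>x. S d m x $ a) x"
        by (rule partial_nth[symmetric], rule smooth_differentiable[OF vpoly_smooth[OF Sp]])
      also have "\<dots> = partial k (curl (P' a m)) x $ d - (if a = d then partial k (tr m) x / 2 else 0)"
        unfolding S_def vec_lambda_beta
        by (cases "a = d") (simp_all add: partial_diff cd h partial_nth)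
      finally show ?thesis .
    qed
    have "partial k (curl (P' a m)) (X j) = partial k (curl (P' a l)) (X j)" for a
      using cg[of a] ml unfolding grad_agree_def by blast
    then show ?thesis unfolding vec_eq_iff g trg by simp
  qed
  have grad_smooth: "smooth (\<lambda>x. (\<chi> k. partial k (\<psi> d m) x) :: real^3)" for d m
    by (rule smooth_vec) (simp add: smooth_partial \<psi>s)
  have RS: "curlT Q d m = (\<lambda>x. S d m x - (\<chi> k. partial k (\<psi> d m) x))" for d m
    by (rule ext) (simp add: vec_eq_iff SQ)
  have cR: "curl (curlT Q d m) x = curl (S d m) x" for d m x
    unfolding RS by (simp add: curl_diff vpoly_smooth[OF Sp] grad_smooth curl_gradient \<psi>s)
  have "good N n Q" unfolding good_def using Qp sym QC by blast
  moreover have "symm (\<chi> a. P' a m x) = (\<chi> a. Q a m x)" for m x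
    by (simp add: vec_eq_iff symm_nth Q_def)
  moreover have "tangential N (curlT Q d)" for d
    unfolding tangential_def
  proof (intro ballI allI impI)
    fix m l x0 assume ml: "m \<in> N" "l \<in> N" "L m x0 = L l x0"
    show "\<exists>s. curlT Q d m x0 - curlT Q d l x0 = s *\<^sub>R (av m - av l)"
    proof (cases "m = l")
      case False
      then have \<nu>: "av m - av l \<noteq> 0" using av_neq by simp
      have "(\<lambda>x. \<psi> d m x - \<psi> d l x) differentiable at x0"
        by (intro differentiable_diff smooth_differentiable \<psi>s)
      then obtain c where c: "\<And>j. partial j (\<lambda>x. \<psi> d m x - \<psi> d l x) x0 = c * (av m - av l) $ j"
      proof (rule partial_parallel_normal[OF _ \<nu>])
        fix x assume "(av m - av l) \<bullet> (x - x0) = 0"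
        then have "L m x = L l x" using L_eq_iff[OF ml(3)] by blast
        then show "\<psi> d m x - \<psi> d l x = 0" using \<psi>C[OF ml(1,2)] by simp
      qed blast
      have "partial j (\<psi> d m) x0 - partial j (\<psi> d l) x0 = c * (av m - av l) $ j" for j
        using c[of j] by (simp add: partial_diff smooth_differentiable \<psi>s)
      then have "curlT Q d m x0 - curlT Q d l x0 = (- c) *\<^sub>R (av m - av l)"
        unfolding RS C0_D[OF SC ml] vec_eq_iff by (simp add: algebra_simps)
      then show ?thesis ..
    qed simp
  qed
  moreover have "curl_agree N (curlT Q d)" for d
    unfolding curl_agree_def cR
  proof (intro allI ballI)
    fix j m l assume "m \<in> N - {Some j}" "l \<in> N - {Some j}"
    from Sgrad[OF this] show "curl (S d m) (X j) = curl (S d l) (X j)" by (simp add: curl_def)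
  qed
  moreover have "grad_agree N (Q a)" for a
  proof -
    have "curl_agree N (P' a)" for a
      unfolding curl_agree_def
    proof (intro allI ballI)
      fix j m l assume "m \<in> N - {Some j}" "l \<in> N - {Some j}"
      then show "curl (P' a m) (X j) = curl (P' a l) (X j)"
        by (intro C0_D[OF cC, of m l "X j" a]) (auto simp: L_vertex)
    qed
    then have Pg: "grad_agree N (P' a)" for a by (rule grad_agreeI[OF N Pp PC])
    have g: "partial k (Q a m) x $ b = (partial k (P' a m) x $ b + partial k (P' b m) x $ a) / 2" for k m x b
    proof -
      note Pd = smooth_differentiable[OF vpoly_smooth[OF Pp]] smooth_differentiable[OF poly_fun_smooth[OF Pk]]
      have ds: "(\<lambda>x. P' a m x $ b + P' b m x $ a) differentiable at x" by (intro differentiable_add Pd)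
      have "partial k (Q a m) x $ b = partial k (\<lambda>x. Q a m x $ b) x"
        by (rule partial_nth[symmetric], rule smooth_differentiable[OF vpoly_smooth[OF Qp]])
      also have "\<dots> = partial k (\<lambda>x. P' a m x $ b + P' b m x $ a) x / 2"
        unfolding Q_def vec_lambda_beta by (rule partial_linear[OF bounded_linear_divide ds])
      also have "\<dots> = (partial k (P' a m) x $ b + partial k (P' b m) x $ a) / 2"
        by (simp add: partial_add Pd partial_nth)
      finally show ?thesis .
    qed
    show ?thesis
      unfolding grad_agree_def
    proof (intro allI ballI)
      fix j k m l assume ml: "m \<in> N - {Some j}" "l \<in> N - {Some j}"
      have "partial k (P' a m) (X j) = partial k (P' a l) (X j)" for a
        using Pg[of a] ml unfolding grad_agree_def by blast
      then show "partial k (Q a m) (X j) = partial k (Q a l) (X j)" unfolding vec_eq_iff g by simp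
    qed
  qed
  moreover have "f \<in> Hcurl (tet X)" if f: "rep (curlT Q d) f" for d f
  proof -
    have m\<psi>: "poly_fun n (\<lambda>x. - \<psi> d m x)" for m by (rule poly_fun_uminus[OF \<psi>p])
    have pm: "partial k (\<lambda>x. - \<psi> d m x) x = - partial k (\<psi> d m) x" for k m x
      by (rule partial_uminus) (intro smooth_differentiable \<psi>s)
    \<comment> \<open>\<open>curlT Q d\<close> is the continuous field \<open>S d\<close> plus the
      gradient of the continuous function \<open>- \<psi> d\<close>, so its weak curl is the
      cellwise curl of \<open>S d\<close>.\<close>
    have "has_wcurl (tet X) f (pw (\<lambda>m. curl (S d m)))"
    proof (rule has_wcurl_C0_grad[where \<psi>="\<lambda>m x. - \<psi> d m x", OF _ Sp _ m\<psi> _ rep_pw])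
      show "rep (\<lambda>m x. S d m x + (\<chi> k. partial k (\<lambda>x. - \<psi> d m x) x)) f"
        by (rule rep_cong[OF f]) (simp add: vec_eq_iff pm SQ)
      show "C0 (range Some) (S d)" using SC N unfolding C0_def by blast
      show "C0 (range Some) (\<lambda>m x. - \<psi> d m x)"
        unfolding C0_def
      proof (intro ballI allI impI)
        fix m l x assume "m \<in> range Some" "l \<in> range Some" "L m x = L l x"
        then have "\<psi> d m x = \<psi> d l x" using \<psi>C N by blast
        then show "- \<psi> d m x = - \<psi> d l x" by simp
      qed
    qed
    then show ?thesis unfolding Hcurl_def by blast
  qed
  ultimately show ?thesis by (rule that)
qed

section \<open>From polynomial families back to function spaces\<close>

lemma symm_tensor_iff:
  assumes Z: "\<And>w. w \<in> Z \<longleftrightarrow> (\<exists>p. rep p w \<and> ZN N n p)"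
  shows "(\<exists>v\<in>tensorV Z. AE x in lebesgue_on (tet X). u x = symm (v x)) \<longleftrightarrow>
    (\<exists>P'. (\<forall>a. ZN N n (P' a)) \<and> rep (\<lambda>m x. symm (\<chi> a. P' a m x)) u)" (is "?l \<longleftrightarrow> ?r")
proof
  assume ?l
  then obtain v where "v \<in> tensorV Z" and uv: "AE x in tetM. u x = symm (v x)"
    unfolding tetM_def by blast
  then have "\<exists>P'. \<forall>a. rep (P' a) (\<lambda>x. v x $ a) \<and> ZN N n (P' a)" using Z unfolding tensorV_def by (intro choice) blast
  then obtain P' where P': "\<And>a. rep (P' a) (\<lambda>x. v x $ a)" "\<And>a. ZN N n (P' a)" by blast
  have "rep (\<lambda>m x. \<chi> a. P' a m x) v" unfolding rep_nth[of "\<lambda>m x. \<chi> a. P' a m x"] using P'(1) by simp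
  from rep_map[OF this, of "\<lambda>_. symm"] have "rep (\<lambda>m x. symm (\<chi> a. P' a m x)) (\<lambda>x. symm (v x))" .
  from rep_AE_iff[OF this] have "rep (\<lambda>m x. symm (\<chi> a. P' a m x)) u" using uv by (simp add: eq_commute)
  then show ?r using P'(2) by blast
next
  assume ?r
  then obtain P' where P': "\<And>a. ZN N n (P' a)" and u: "rep (\<lambda>m x. symm (\<chi> a. P' a m x)) u" by blast
  define v where "v = pw (\<lambda>m x. \<chi> a. P' a m x)"
  have v: "rep (\<lambda>m x. \<chi> a. P' a m x) v" unfolding v_def by (rule rep_pw)
  have "rep (P' a) (\<lambda>x. v x $ a)" for a using rep_map[OF v, of "\<lambda>_ y. y $ a"] by simp
  then have "v \<in> tensorV Z" unfolding tensorV_def using Z P' by blast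
  moreover have "AE x in tetM. u x = symm (v x)"
    unfolding rep_AE_iff[OF u, symmetric] by (rule rep_map[OF v])
  ultimately show ?l unfolding tetM_def by blast
qed

lemma symm_fields_iff:
  assumes H: "\<And>p f. rep p f \<Longrightarrow> (\<And>m. poly_fun n (p m)) \<Longrightarrow> (\<And>x. p None x = 0) \<Longrightarrow> f \<in> H \<longleftrightarrow> C0 N p"
  shows "u \<in> symm_fields (tet X) H \<and> u \<in> symm_fields (tet X) (PA n X z) \<longleftrightarrow>
    (\<exists>Q. good N n Q \<and> rep (\<lambda>m x. \<chi> a. Q a m x) u)" (is "?l \<longleftrightarrow> ?r")
proof
  assume l: ?l
  then have sym: "AE x in tetM. transpose (u x) = u x" and uH: "\<And>a b. (\<lambda>x. u x $ a $ b) \<in> H"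
    and uP: "\<And>a b. (\<lambda>x. u x $ a $ b) \<in> PA n X z" unfolding symm_fields_def tetM_def by blast+
  have "\<forall>a. \<exists>q. \<forall>b. (\<forall>m. poly_fun n (q b m)) \<and> (\<forall>x. q b None x = 0) \<and> rep (q b) (\<lambda>x. u x $ a $ b)"
    using uP unfolding PA_iff by (intro allI choice) blast
  then have "\<exists>q. \<forall>a b. (\<forall>m. poly_fun n (q a b m)) \<and> (\<forall>x. q a b None x = 0) \<and> rep (q a b) (\<lambda>x. u x $ a $ b)"
    by (rule choice)
  then obtain q where q: "\<And>a b m. poly_fun n (q a b m)" and q0: "\<And>a b x. q a b None x = 0"
    and qr: "\<And>a b. rep (q a b) (\<lambda>x. u x $ a $ b)" by blast
  \<comment> \<open>\<open>u\<close> is symmetric only almost everywhere, while \<open>good\<close>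
    asks for identical polynomials off the diagonal; averaging \<open>q a b\<close> and
    \<open>q b a\<close> achieves this without changing the class.\<close>
  define Q where "Q a m x = (\<chi> b. (q a b m x + q b a m x) / 2)" for a m x
  have Qp: "poly_fun n (\<lambda>x. Q a m x $ b)" for a m b
    using poly_fun_cmult[OF poly_fun_add[OF q q], of "1/2" a b m b a m] by (simp add: Q_def)
  have Q0: "Q a None x = 0" for a x by (simp add: Q_def q0 vec_eq_iff)
  have Qr: "rep (\<lambda>m x. Q a m x $ b) (\<lambda>x. u x $ a $ b)" for a b
  proof -
    have 1: "rep (\<lambda>m x. Q a m x $ b) (\<lambda>x. (u x $ a $ b + u x $ b $ a) / 2)"
      using rep_map2[OF qr[of a b] qr[of b a], of "\<lambda>_ s t. (s + t) / 2"] by (simp add: Q_def)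
    have "AE x in tetM. (u x $ a $ b + u x $ b $ a) / 2 = u x $ a $ b"
      using sym
    proof eventually_elim
      case (elim x)
      then have "transpose (u x) $ a $ b = u x $ a $ b" by simp
      then show ?case by (simp add: transpose_def)
    qed
    then show ?thesis using rep_AE_iff[OF 1] by blast
  qed
  have "C0 N (\<lambda>m x. Q a m x $ b)" for a b using H[OF Qr Qp] uH Q0 by simp
  then have "C0 N (Q a)" for a unfolding C0_nth[of N "Q a"] by blast
  moreover have "Q a m x $ b = Q b m x $ a" for a b m x by (simp add: Q_def add.commute)
  ultimately have "good N n Q" using Qp Q0 unfolding good_def by blast
  moreover have "rep (\<lambda>m x. \<chi> a. Q a m x) u" using Qr by (simp add: rep_nth)
  ultimately show ?r by blast
next
  assume ?r
  then obtain Q where Q: "good N n Q" and r: "rep (\<lambda>m x. \<chi> a. Q a m x) u" by blast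
  have Qp: "poly_fun n (\<lambda>x. Q a m x $ b)" and Q0: "Q a None x $ b = 0" and sym: "Q a m x $ b = Q b m x $ a"
    for a b m x using Q unfolding good_def by auto
  have QC: "C0 N (\<lambda>m x. Q a m x $ b)" for a b using Q C0_nth[of N "Q a"] unfolding good_def by blast
  have e: "rep (\<lambda>m x. Q a m x $ b) (\<lambda>x. u x $ a $ b)" for a b
    using rep_map[OF r, of "\<lambda>_ M. M $ a $ b"] by simp
  have "rep (\<lambda>m x. \<chi> a. Q a m x) (\<lambda>x. transpose (u x))"
    using rep_map[OF r, of "\<lambda>_. transpose"] by (rule rep_cong) (simp add: transpose_def vec_eq_iff sym)
  then have "AE x in tetM. transpose (u x) = u x" using rep_AE_iff r by blast
  then show ?l
    unfolding symm_fields_def tetM_def using H[OF e Qp Q0] QC PA_rep[OF e Qp Q0] by blast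
qed

lemma rep_curlT:
  assumes N: "range Some \<subseteq> N" and Q: "good N n Q" and r: "rep (\<lambda>m x. \<chi> a. Q a m x) u"
  shows "rep (curlT Q d) (\<lambda>x. transpose (mcurl (tet X) u x) $ d)"
proof -
  have Qp: "vpoly n (Q a)" and QC: "C0 (range Some) (Q a)" for a
    using Q N unfolding good_def C0_def by blast+
  have ra: "rep (Q a) (\<lambda>x. u x $ a)" for a using rep_map[OF r, of "\<lambda>_ M. M $ a"] by simp
  have "rep (\<lambda>m. curl (Q a m)) (wcurl (tet X) (\<lambda>x. u x $ a))" for a
    by (rule wcurl_rep[OF Hcurl_C0[OF ra Qp QC] ra Qp])
  then have "rep (\<lambda>m x. \<chi> a. curl (Q a m) x) (mcurl (tet X) u)" by (simp add: rep_nth mcurl_def)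
  from rep_map[OF this, of "\<lambda>_ M. transpose M $ d"] show ?thesis
    by (rule rep_cong) (simp add: curlT_def transpose_def)
qed

text \<open>The hypothesis \<open>H\<close> makes the outer weak curls exist, so that the functions
  chosen by \<open>wcurl\<close> are weak curls and are represented by the cellwise curls.\<close>

lemma rep_inc:
  assumes r: "\<And>d. rep (R d) (\<lambda>x. transpose (mcurl (tet X) u x) $ d)" and R: "\<And>d. vpoly n (R d)"
    and H: "\<And>d. (\<lambda>x. transpose (mcurl (tet X) u x) $ d) \<in> Hcurl (tet X)"
  shows "rep (\<lambda>m x. \<chi> d. curl (R d m) x) (inc (tet X) u)"
  using wcurl_rep[OF H r R] by (simp add: rep_nth inc_def mcurl_def[of _ "\<lambda>x. transpose (mcurl (tet X) u x)"])

lemma tangential_Some: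
  assumes H: "w \<in> Hcurl (tet X)" and r: "rep p w" and p: "vpoly n p"
  shows "tangential (range Some) p"
  unfolding tangential_def
proof clarify
  fix i j x assume e: "L (Some i) x = L (Some j) x"
  obtain c where c: "has_wcurl (tet X) w c" using H unfolding Hcurl_def by blast
  show "\<exists>s. p (Some i) x - p (Some j) x = s *\<^sub>R (av (Some i) - av (Some j))"
    using has_wcurl_rep(2)[OF c r p _ e] by (cases "i = j") auto
qed

lemma W1_rep_iff:
  assumes r: "rep p w" and p: "vpoly n p"
  shows "w \<in> W1 n X z \<longleftrightarrow> w \<in> Hcurl (tet X)"
proof -
  have "(\<lambda>x. w x $ k) \<in> PA n X z" for k
    by (rule PA_rep[OF r[unfolded rep_nth, rule_format, of k]]) (use p in auto)
  then show ?thesis by (simp add: W1_def)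
qed

text \<open>The boundary condition says that \<open>p (Some i)\<close> is parallel to the gradient
  of \<open>L (Some i)\<close> on a face, hence on its plane. This is the tangential condition
  between \<open>Some i\<close> and the exterior \<open>None\<close>; between two cells it follows
  from membership in H(curl).\<close>

lemma W1_0_rep_iff:
  assumes r: "rep p w" and p: "vpoly n p"
  shows "w \<in> W1_0 n X z \<longleftrightarrow> w \<in> Hcurl (tet X) \<and> tangential UNIV p"
proof -
  have sc: "poly_fun n (\<lambda>x. cross3 (p m x) v $ k)" for m v k
  proof -
    have pk: "poly_fun n (\<lambda>x. p m x $ j * c)" for j c using poly_fun_cmult p by (simp add: mult.commute)
    have "\<forall>k. poly_fun n (\<lambda>x. cross3 (p m x) v $ k)"
      unfolding forall_3 cross3_def by (simp add: poly_fun_diff pk)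
    then show ?thesis by blast
  qed
  have face: "(\<forall>x\<in>face X i. limiting_value (subtet X z i) [] (\<lambda>y. cross3 (w y) (outward_normal X i)) x 0)
      \<longleftrightarrow> (\<forall>x. L (Some i) x = 0 \<longrightarrow> (\<exists>s. p (Some i) x = s *\<^sub>R av (Some i)))" for i
  proof -
    obtain t where t: "t \<noteq> 0" "outward_normal X i = t *\<^sub>R av (Some i)" by (rule outward_normal_parallel)
    have rc: "rep (\<lambda>m x. cross3 (p m x) (outward_normal X i)) (\<lambda>y. cross3 (w y) (outward_normal X i))"
      using rep_map[OF r, of "\<lambda>_ y. cross3 y (outward_normal X i)"] .
    have sub: "face X i \<subseteq> subtet X z i" unfolding face_def subtet_def by (rule hull_mono) blast
    have "(\<forall>x\<in>face X i. limiting_value (subtet X z i) [] (\<lambda>y. cross3 (w y) (outward_normal X i)) x 0)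
      \<longleftrightarrow> (\<forall>x\<in>face X i. cross3 (p (Some i) x) (outward_normal X i) = 0)"
      using limiting_value_iff[OF rc smooth_vec[OF poly_fun_smooth[OF sc]], of _ i "[]" 0] sub
      by (auto simp: partials_def)
    also have "\<dots> \<longleftrightarrow> (\<forall>x\<in>face X i. cross3 (p (Some i) x) (av (Some i)) = 0)"
      using t by (simp add: cross_mult_right)
    also have "\<dots> \<longleftrightarrow> (\<forall>x. L (Some i) x = 0 \<longrightarrow> (\<exists>s. p (Some i) x = s *\<^sub>R av (Some i)))"
    proof
      assume z: "\<forall>x\<in>face X i. cross3 (p (Some i) x) (av (Some i)) = 0"
      show "\<forall>x. L (Some i) x = 0 \<longrightarrow> (\<exists>s. p (Some i) x = s *\<^sub>R av (Some i))"
      proof (intro allI impI)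
        fix x assume x: "L (Some i) x = 0"
        have "cross3 (p (Some i) x) (av (Some i)) $ k = 0" for k
          by (rule poly_zero_face_plane[OF sc _ x]) (use z in simp)
        then have "cross3 (p (Some i) x) (av (Some i)) = 0" by (simp add: vec_eq_iff)
        then show "\<exists>s. p (Some i) x = s *\<^sub>R av (Some i)"
          using parallel_of_cross3 av_neq[of "Some i" None] by simp
      qed
    next
      assume z: "\<forall>x. L (Some i) x = 0 \<longrightarrow> (\<exists>s. p (Some i) x = s *\<^sub>R av (Some i))"
      show "\<forall>x\<in>face X i. cross3 (p (Some i) x) (av (Some i)) = 0"
      proof
        fix x assume "x \<in> face X i"
        then have "L (Some i) x = 0" unfolding face_eq by blast
        then obtain s where "p (Some i) x = s *\<^sub>R av (Some i)" using z by blast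
        then show "cross3 (p (Some i) x) (av (Some i)) = 0" by (simp add: cross_mult_left)
      qed
    qed
    finally show ?thesis .
  qed
  have p0: "p None x = 0" and a0: "av None = 0" for x using p by (auto simp: av_def)
  have neg: "(\<exists>s. - v = - (s *\<^sub>R a)) \<longleftrightarrow> (\<exists>s. v = s *\<^sub>R a)" for v a :: "real^3" by auto
  have "tangential UNIV p \<longleftrightarrow> tangential (range Some) p \<and>
      (\<forall>i x. L (Some i) x = 0 \<longrightarrow> (\<exists>s. p (Some i) x = s *\<^sub>R av (Some i)))"
    unfolding tangential_def UNIV_option_conv ball_simps by (auto simp: p0 a0 neg eq_commute[of 0])
  then show ?thesis
    unfolding W1_0_def mem_Collect_eq W1_rep_iff[OF assms] face using tangential_Some[OF _ assms] by blast
qed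

lemma Ck_at_0_iff:
  fixes f :: "real^3 \<Rightarrow> 'b::real_normed_vector"
  assumes f: "rep p f" and p: "\<And>m. smooth (p m)"
  shows "(\<forall>x\<in>range X. Ck_at 0 X z f x) \<longleftrightarrow>
    (\<forall>j. \<forall>m\<in>range Some - {Some j}. \<forall>l\<in>range Some - {Some j}. p m (X j) = p l (X j))"
  by (auto simp: Ck_at_iff[OF assms] vertex_in_subtet partials_def)

lemma vanishes_vertices_iff:
  fixes f :: "real^3 \<Rightarrow> 'b::real_normed_vector"
  assumes f: "rep p f" and p: "\<And>m. smooth (p m)" and p0: "\<And>x. p None x = 0"
  shows "(\<forall>x\<in>range X. vanishes_at X z f x) \<longleftrightarrow>
    (\<forall>j. \<forall>m\<in>UNIV - {Some j}. \<forall>l\<in>UNIV - {Some j}. p m (X j) = p l (X j))"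
proof
  assume "\<forall>x\<in>range X. vanishes_at X z f x"
  then have "p m (X j) = 0" if "m \<noteq> Some j" for m j
    using that by (cases m) (auto simp: vanishes_at_iff[OF f p] vertex_in_subtet p0)
  then show "\<forall>j. \<forall>m\<in>UNIV - {Some j}. \<forall>l\<in>UNIV - {Some j}. p m (X j) = p l (X j)" by (metis DiffD2 singletonI)
next
  assume a: "\<forall>j. \<forall>m\<in>UNIV - {Some j}. \<forall>l\<in>UNIV - {Some j}. p m (X j) = p l (X j)"
  have "p (Some i) (X j) = 0" if "i \<noteq> j" for i j
  proof -
    have "p (Some i) (X j) = p None (X j)" by (rule a[rule_format]) (use that in auto)
    then show ?thesis unfolding p0 .
  qed
  then show "\<forall>x\<in>range X. vanishes_at X z f x" by (auto simp: vanishes_at_iff[OF f p] vertex_in_subtet)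
qed

text \<open>Both equalities in the language of polynomial families; what remains is to translate
  each condition into a space or a limiting value.\<close>

lemma symm_potential_iff:
  assumes N: "range Some \<subseteq> N" and n: "2 \<le> n"
  shows "(\<exists>P'. (\<forall>a. ZN N n (P' a)) \<and> rep (\<lambda>m x. symm (\<chi> a. P' a m x)) u) \<longleftrightarrow>
    (\<exists>Q. good N n Q \<and> rep (\<lambda>m x. \<chi> a. Q a m x) u \<and>
      (\<forall>d. (\<lambda>x. transpose (mcurl (tet X) u x) $ d) \<in> Hcurl (tet X)) \<and> (\<forall>d. tangential N (curlT Q d)) \<and>
      grad_agree N (\<lambda>m x. \<chi> a. Q a m x) \<and> (\<forall>d. curl_agree N (curlT Q d)))" (is "?l \<longleftrightarrow> ?r")
proof
  assume ?l
  then obtain P' where P': "\<And>a. ZN N n (P' a)" and u: "rep (\<lambda>m x. symm (\<chi> a. P' a m x)) u" by blast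
  obtain Q where Q: "good N n Q" and s: "\<And>m x. symm (\<chi> a. P' a m x) = (\<chi> a. Q a m x)"
    and T: "\<And>d. tangential N (curlT Q d)" and c: "\<And>d. curl_agree N (curlT Q d)" and g: "\<And>a. grad_agree N (Q a)"
    and H: "\<And>d f. rep (curlT Q d) f \<Longrightarrow> f \<in> Hcurl (tet X)"
  proof (rule symmetric_part_properties[where P'=P', OF N P'], goal_cases)
    case (1 Q)
    show thesis by (rule that[of Q]; fact 1)
  qed
  have r: "rep (\<lambda>m x. \<chi> a. Q a m x) u" using u unfolding s .
  have Qs: "smooth (Q a m)" for a m using Q unfolding good_def by (intro vpoly_smooth[of n]) blast
  have sQ: "smooth (\<lambda>x. \<chi> a. Q a m x)" for m by (rule smooth_vec) (simp add: Qs)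
  have "partial k (\<lambda>x. \<chi> a. Q a m x) x $ a = partial k (Q a m) x" for k m x a
    using partial_nth[OF smooth_differentiable[OF sQ], where i=k and k=a and x=x] by simp
  then have gQ: "partial k (\<lambda>x. \<chi> a. Q a m x) x = (\<chi> a. partial k (Q a m) x)" for k m x by (simp add: vec_eq_iff)
  have "grad_agree N (\<lambda>m x. \<chi> a. Q a m x)"
    unfolding grad_agree_def
  proof (intro allI ballI)
    fix j :: 4 and k m l assume "m \<in> N - {Some j}" "l \<in> N - {Some j}"
    then have "partial k (Q a m) (X j) = partial k (Q a l) (X j)" for a
      using g[of a, unfolded grad_agree_def] by blast
    then show "partial k (\<lambda>x. \<chi> a. Q a m x) (X j) = partial k (\<lambda>x. \<chi> a. Q a l x) (X j)"
      unfolding gQ by simp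
  qed
  then show ?r using Q r T c H[OF rep_curlT[OF N Q r]] by blast
next
  assume ?r
  then obtain Q where Q: "good N n Q" and r: "rep (\<lambda>m x. \<chi> a. Q a m x) u"
    and T: "\<And>d. tangential N (curlT Q d)" and c: "\<And>d. curl_agree N (curlT Q d)" by blast
  obtain P' where P': "\<And>a. ZN N n (P' a)" and s: "\<And>m x. symm (\<chi> a. P' a m x) = (\<chi> a. Q a m x)"
  proof (rule potential_exists[where Q=Q, OF N n Q T c], goal_cases)
    case (1 P')
    show thesis by (rule that[of P']; fact 1)
  qed
  have "rep (\<lambda>m x. symm (\<chi> a. P' a m x)) u" unfolding s by (rule r)
  then show ?l by (intro exI[of _ P'] conjI allI P')
qed

lemma curlT_facts:
  assumes Q: "good N n Q"
  shows "vpoly (n - 1) (curlT Q d)" "smooth (\<lambda>x. \<chi> d. curl (curlT Q d m) x)"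
    "(\<chi> d. curl (curlT Q d None) x) = 0" "smooth (\<lambda>x. \<chi> a. Q a m x)" "(\<chi> a. Q a None x) = 0"
proof -
  have Qp: "vpoly n (Q a)" for a using Q unfolding good_def by blast
  show R: "vpoly (n - 1) (curlT Q d)" for d by (rule vpoly_curlT[where Q=Q, OF Qp])
  show "smooth (\<lambda>x. \<chi> d. curl (curlT Q d m) x)"
    by (rule smooth_vec) (simp add: vpoly_smooth[OF vpoly_curl[OF R]])
  show "(\<chi> d. curl (curlT Q d None) x) = 0" using vpoly_curl[OF R] by (simp add: vec_eq_iff)
  show "smooth (\<lambda>x. \<chi> a. Q a m x)" by (rule smooth_vec) (simp add: vpoly_smooth[OF Qp])
  show "(\<chi> a. Q a None x) = 0" using Qp by (simp add: vec_eq_iff)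
qed

lemma C0_Some: "good N n Q \<Longrightarrow> range Some \<subseteq> N \<Longrightarrow> C0 (range Some) (\<lambda>m x. \<chi> a. Q a m x)"
  unfolding C0_nth[of _ "\<lambda>m x. \<chi> a. Q a m x"] vec_lambda_beta unfolding good_def C0_def by blast

section \<open>The two descriptions of the symmetric spaces\<close>

lemma U1_eq:
  assumes n: "2 \<le> n"
  shows "U1 n X z =
      {u. u \<in> symm_fields (tet X) (H1 (tet X)) \<and> u \<in> symm_fields (tet X) (PA n X z) \<and>
          (\<lambda>x. transpose (mcurl (tet X) u x)) \<in> tensorV (W1 (n - 1) X z) \<and>
          (\<forall>x\<in>range X. Ck_at 1 X z u x) \<and> (\<forall>x\<in>range X. Ck_at 0 X z (inc (tet X) u) x)}"
proof -
  have H: "f \<in> H1 (tet X) \<longleftrightarrow> C0 (range Some) p"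
    if "rep p f" "\<And>m. poly_fun n (p m)" "\<And>x. p None x = 0" for p f
    using that C0_imp_H1 H1_imp_C0 by blast
  have iff: "(\<lambda>x. transpose (mcurl (tet X) u x)) \<in> tensorV (W1 (n - 1) X z) \<and>
          (\<forall>x\<in>range X. Ck_at 1 X z u x) \<and> (\<forall>x\<in>range X. Ck_at 0 X z (inc (tet X) u) x) \<longleftrightarrow>
      (\<forall>d. (\<lambda>x. transpose (mcurl (tet X) u x) $ d) \<in> Hcurl (tet X)) \<and> (\<forall>d. tangential (range Some) (curlT Q d)) \<and>
      grad_agree (range Some) (\<lambda>m x. \<chi> a. Q a m x) \<and> (\<forall>d. curl_agree (range Some) (curlT Q d))"
    if Q: "good (range Some) n Q" and r: "rep (\<lambda>m x. \<chi> a. Q a m x) u" for u Q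
  proof -
    note f = curlT_facts[OF Q] and R = rep_curlT[OF order_refl Q r]
    have 1: "(\<lambda>x. transpose (mcurl (tet X) u x)) \<in> tensorV (W1 (n - 1) X z) \<longleftrightarrow>
      (\<forall>d. (\<lambda>x. transpose (mcurl (tet X) u x) $ d) \<in> Hcurl (tet X))"
      unfolding tensorV_def mem_Collect_eq W1_rep_iff[OF R f(1)] ..
    have 2: "(\<forall>x\<in>range X. Ck_at 1 X z u x) \<longleftrightarrow> grad_agree (range Some) (\<lambda>m x. \<chi> a. Q a m x)"
      by (rule Ck_at_1_iff[OF r f(4) C0_Some[OF Q order_refl]])
    \<comment> \<open>The outer curl in \<open>inc\<close> is meaningful only once the rows of
      \<open>(curl u)'\<close> lie in H(curl), so this equivalence is conditional on that
      membership.\<close>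
    have 3: "(\<forall>x\<in>range X. Ck_at 0 X z (inc (tet X) u) x) \<longleftrightarrow> (\<forall>d. curl_agree (range Some) (curlT Q d))"
      if h: "\<And>d. (\<lambda>x. transpose (mcurl (tet X) u x) $ d) \<in> Hcurl (tet X)"
      unfolding Ck_at_0_iff[OF rep_inc[where R="curlT Q", OF R f(1) h] f(2)]
        curl_agree_def vec_eq_iff[where 'a="real^3"] vec_lambda_beta by blast
    show ?thesis unfolding 1 2 using 3 tangential_Some[OF _ R f(1)] by blast
  qed
  show ?thesis
    unfolding U1_def symm_tensor_iff[OF Z_iff(1)] symm_potential_iff[OF order_refl n]
  proof (rule Collect_cong, goal_cases)
    case (1 u)
    show ?case using symm_fields_iff[OF H, of n u] iff[of _ u] by blast
  qed
qed

lemma U1_0_eq: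
  assumes n: "2 \<le> n"
  shows "U1_0 n X z =
      {u. u \<in> symm_fields (tet X) (H1_0 (tet X)) \<and> u \<in> symm_fields (tet X) (PA n X z) \<and>
          (\<lambda>x. transpose (mcurl (tet X) u x)) \<in> tensorV (W1_0 (n - 1) X z) \<and>
          (\<forall>x\<in>range X. grad_vanishes_at X z u x) \<and> (\<forall>x\<in>range X. vanishes_at X z (inc (tet X) u) x)}"
proof -
  have H: "f \<in> H1_0 (tet X) \<longleftrightarrow> C0 UNIV p"
    if "rep p f" "\<And>m. poly_fun n (p m)" "\<And>x. p None x = 0" for p f
    by (rule H1_0_rep_iff[OF that])
  have iff: "(\<lambda>x. transpose (mcurl (tet X) u x)) \<in> tensorV (W1_0 (n - 1) X z) \<and>
          (\<forall>x\<in>range X. grad_vanishes_at X z u x) \<and> (\<forall>x\<in>range X. vanishes_at X z (inc (tet X) u) x) \<longleftrightarrow>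
      (\<forall>d. (\<lambda>x. transpose (mcurl (tet X) u x) $ d) \<in> Hcurl (tet X)) \<and> (\<forall>d. tangential UNIV (curlT Q d)) \<and>
      grad_agree UNIV (\<lambda>m x. \<chi> a. Q a m x) \<and> (\<forall>d. curl_agree UNIV (curlT Q d))"
    if Q: "good UNIV n Q" and r: "rep (\<lambda>m x. \<chi> a. Q a m x) u" for u Q
  proof -
    note f = curlT_facts[OF Q] and R = rep_curlT[OF subset_UNIV Q r]
    have 1: "(\<lambda>x. transpose (mcurl (tet X) u x)) \<in> tensorV (W1_0 (n - 1) X z) \<longleftrightarrow>
      (\<forall>d. (\<lambda>x. transpose (mcurl (tet X) u x) $ d) \<in> Hcurl (tet X) \<and> tangential UNIV (curlT Q d))"
      unfolding tensorV_def mem_Collect_eq W1_0_rep_iff[OF R f(1)] ..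
    have 2: "(\<forall>x\<in>range X. grad_vanishes_at X z u x) \<longleftrightarrow> grad_agree UNIV (\<lambda>m x. \<chi> a. Q a m x)"
      by (rule grad_vanishes_iff[OF r f(4) f(5)])
    have 3: "(\<forall>x\<in>range X. vanishes_at X z (inc (tet X) u) x) \<longleftrightarrow> (\<forall>d. curl_agree UNIV (curlT Q d))"
      if h: "\<And>d. (\<lambda>x. transpose (mcurl (tet X) u x) $ d) \<in> Hcurl (tet X)"
      unfolding vanishes_vertices_iff[OF rep_inc[where R="curlT Q", OF R f(1) h] f(2,3)]
        curl_agree_def vec_eq_iff[where 'a="real^3"] vec_lambda_beta by blast
    show ?thesis unfolding 1 2 using 3 by blast
  qed
  show ?thesis
    unfolding U1_0_def symm_tensor_iff[OF Z_iff(2)] symm_potential_iff[OF subset_UNIV n]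
  proof (rule Collect_cong, goal_cases)
    case (1 u)
    show ?case using symm_fields_iff[where u=u and n=n, OF H] iff[of _ u] by blast
  qed
qed

end

theorem theorem5p6:
  fixes X :: "4 \<Rightarrow> real^3" and z :: "real^3" and r :: nat
  assumes "nondegenerate X"
    and "z \<in> interior (tet X)"
    and "r \<ge> 4"
  shows "U1 r X z =
      {u. u \<in> symm_fields (tet X) (H1 (tet X)) \<and>
          u \<in> symm_fields (tet X) (PA r X z) \<and>
          (\<lambda>x. transpose (mcurl (tet X) u x)) \<in> tensorV (W1 (r - 1) X z) \<and>
          (\<forall>x\<in>range X. Ck_at 1 X z u x) \<and>
          (\<forall>x\<in>range X. Ck_at 0 X z (inc (tet X) u) x)}
    \<and> U1_0 r X z =
      {u. u \<in> symm_fields (tet X) (H1_0 (tet X)) \<and>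
          u \<in> symm_fields (tet X) (PA r X z) \<and>
          (\<lambda>x. transpose (mcurl (tet X) u x)) \<in> tensorV (W1_0 (r - 1) X z) \<and>
          (\<forall>x\<in>range X. grad_vanishes_at X z u x) \<and>
          (\<forall>x\<in>range X. vanishes_at X z (inc (tet X) u) x)}"
proof -
  interpret alfeld_split X z using assms(1,2) by unfold_locales
  show ?thesis using U1_eq U1_0_eq assms(3) by simp
qed

end
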